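(* Let $\mathfrak C=(n,\Gamma,L,P)$ be a stabilizer code and $i\ge0$ an integer such that $Q^i(\mathfrak C)\ne0$. Then $\mathfrak C$ is not isomorphic to $\iota_*(n,\Lambda,L',P')$ for any stabilizer code $(n,\Lambda,L',P')$ with $\mathrm{rk}(\Lambda)<i+1$ and any injective homomorphism $\iota:\Lambda\to\Gamma$. If moreover $\mathfrak C$ is saturated, then $\mathfrak C$ is also not isomorphic to any such $\iota_*(n,\Lambda,L',P')$ with $\mathrm{rk}(\Lambda)=i+1$.
   Context: Let $n$ be a positive integer, $\mathbb Z_n=\mathbb Z/n\mathbb Z$, $\Lambda$ a finitely generated abelian group with free rank $\mathrm{rk}(\Lambda)$, $R=\mathbb Z_n[\Lambda]$, $x^\lambda\in R$ the element corresponding to $\lambda\in\Lambda$. The antipode is $\overline{\sum_\lambda r_\lambda x^\lambda}=\sum_\lambda r_\lambda x^{-\lambda}$; for an $R$-module $M$, $\overline M$ is the same abelian group with $R$-action twisted by the antipode. A stabilizer code $(n,\Lambda,L,P)$ consists of: $P=P_0[\Lambda]=P_0\otimes_{\mathbb Z_n}R$, where $P_0$ is a finitely generated $\mathbb Z_n$-module with an alternating ($\omega_0(a,a)=0$), nondegenerate ($\omega_0(\cdot,a)=0\Rightarrow a=0$) bilinear form $\omega_0:P_0\times P_0\to\mathbb Z_n$, equipped with $\omega:P\times P\to R$, $\omega(a x^\lambda,b x^\mu)=\omega_0(a,b)x^{\mu-\lambda}$ (extended $\mathbb Z_n$-bilinearly); and an $R$-submodule $L\subset P$ with $\omega|_{L\times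 L}=0$. For $N\subset P$, $N^\omega=\{p\in P:\omega(m,p)=0\ \forall m\in N\}$. The code is saturated if $L^{\omega\omega}=L$. Charge modules: $Q^i=\mathrm{Ext}^{i+1}_R(\overline{P/L},R)$, $i\ge0$. An isomorphism of codes $(L,P)\to(L',P')$ over the same group ring is an isomorphism of modules $P\to P'$ preserving the forms $\omega$ and taking $L$ onto $L'$. Stacking: for an injective homomorphism $\iota:\Lambda\to\Gamma$ of finitely generated abelian groups and a $\mathbb Z_n[\Lambda]$-module $M$, $\iota_*M=M\otimes_{\mathbb Z_n[\Lambda]}\mathbb Z_n[\Gamma]$ (an exact functor), and $\iota_*(n,\Lambda,L,P)=(n,\Gamma,\iota_*L,\iota_*P)$, where $\iota_*P=P_0[\Gamma]$ carries the form built from the same $\omega_0$. *)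

theory Defs
  imports "HOL-Algebra.Algebra"
begin

section \<open>Finitely generated abelian groups and modules\<close>

definition fin_gen_group :: "('g, 'x) monoid_scheme \<Rightarrow> bool" where
  "fin_gen_group G \<longleftrightarrow> (\<exists>S. finite S \<and> S \<subseteq> carrier G \<and> generate G S = carrier G)"

definition int_independent :: "('g, 'x) monoid_scheme \<Rightarrow> 'g set \<Rightarrow> bool" where
  "int_independent G S \<longleftrightarrow> finite S \<and> S \<subseteq> carrier G \<and>
     (\<forall>c :: 'g \<Rightarrow> int. finprod G (\<lambda>x. x [^]\<^bsub>G\<^esub> c x) S = \<one>\<^bsub>G\<^esub> \<longrightarrow> (\<forall>x\<in>S. c x = 0))"

text \<open>
  The maximum exists for every finitely generated abelian group; on those the definition gives the
  rank of the quotient by the torsion subgroup.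
\<close>

definition free_rank :: "('g, 'x) monoid_scheme \<Rightarrow> nat" where
  "free_rank G = Max (card ` {S. int_independent G S})"

definition fin_gen_module :: "('r, 'x) ring_scheme \<Rightarrow> ('r, 'm, 'y) module_scheme \<Rightarrow> bool" where
  "fin_gen_module R M \<longleftrightarrow>
     (\<exists>S. finite S \<and> S \<subseteq> carrier M \<and>
        (\<forall>H. submodule H R M \<and> S \<subseteq> H \<longrightarrow> H = carrier M))"


section \<open>Constructions with modules\<close>

text \<open>
  Module records extend ring records; in the modules built below the multiplicative fields
  \<^const>\<open>monoid.mult\<close> and \<^const>\<open>monoid.one\<close> carry no meaning.
\<close>

definition ring_module :: "('r, 'x) ring_scheme \<Rightarrow> ('r, 'r) module" where
  "ring_module R = \<lparr>carrier = carrier R, monoid.mult = monoid.mult R, one = \<one>\<^bsub>R\<^esub>, ring.zero = \<zero>\<^bsub>R\<^esub>, add = add R,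
     smult = monoid.mult R\<rparr>"

definition module_hom ::
  "('r, 'x) ring_scheme \<Rightarrow> ('r, 'm, 'y) module_scheme \<Rightarrow> ('r, 'n, 'z) module_scheme \<Rightarrow> ('m \<Rightarrow> 'n) set"
where
  "module_hom R M N = {f \<in> hom (add_monoid M) (add_monoid N).
     \<forall>r\<in>carrier R. \<forall>x\<in>carrier M. f (r \<odot>\<^bsub>M\<^esub> x) = r \<odot>\<^bsub>N\<^esub> f x}"

definition Hom_module ::
  "('r, 'x) ring_scheme \<Rightarrow> ('r, 'm, 'y) module_scheme \<Rightarrow> ('r, 'n, 'z) module_scheme
   \<Rightarrow> ('r, 'm \<Rightarrow> 'n) module"
where
  "Hom_module R M N = \<lparr>carrier = module_hom R M N \<inter> extensional (carrier M),
     monoid.mult = undefined, one = undefined,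
     ring.zero = (\<lambda>x\<in>carrier M. \<zero>\<^bsub>N\<^esub>),
     add = (\<lambda>f g. \<lambda>x\<in>carrier M. f x \<oplus>\<^bsub>N\<^esub> g x),
     smult = (\<lambda>r f. \<lambda>x\<in>carrier M. r \<odot>\<^bsub>N\<^esub> f x)\<rparr>"

text \<open>The scalar \<open>r\<close> sends the coset \<open>H + x\<close> to \<open>H + r x\<close>.\<close>

definition quotient_module ::
  "('r, 'm, 'y) module_scheme \<Rightarrow> 'm set \<Rightarrow> ('r, 'm set) module"
where
  "quotient_module M H = \<lparr>carrier = a_rcosets\<^bsub>M\<^esub> H, monoid.mult = undefined, one = undefined,
     ring.zero = H, add = set_add M,
     smult = (\<lambda>r U. \<Union>x\<in>U. H +>\<^bsub>M\<^esub> (r \<odot>\<^bsub>M\<^esub> x))\<rparr>"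

text \<open>
  Finitely supported functions \<open>A \<rightarrow> M\<close>, represented as total functions vanishing outside \<open>A\<close>.
\<close>

definition fin_supp :: "'a set \<Rightarrow> ('m, 'y) ring_scheme \<Rightarrow> ('a \<Rightarrow> 'm) set" where
  "fin_supp A M = {f. range f \<subseteq> carrier M \<and> finite {a. f a \<noteq> \<zero>\<^bsub>M\<^esub>} \<and> {a. f a \<noteq> \<zero>\<^bsub>M\<^esub>} \<subseteq> A}"

definition free_module :: "('r, 'x) ring_scheme \<Rightarrow> 'u set \<Rightarrow> ('r, 'u \<Rightarrow> 'r) module" where
  "free_module R B = \<lparr>carrier = fin_supp B R, monoid.mult = undefined, one = undefined,
     ring.zero = (\<lambda>_. \<zero>\<^bsub>R\<^esub>),
     add = (\<lambda>f g b. f b \<oplus>\<^bsub>R\<^esub> g b),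
     smult = (\<lambda>r f b. r \<otimes>\<^bsub>R\<^esub> f b)\<rparr>"

text \<open>
  The tensor product (as an abelian group): the free abelian group on pairs modulo the
  subgroup generated by the bilinearity relations.
\<close>

definition tensor_relators ::
  "('r, 'x) ring_scheme \<Rightarrow> ('r, 'm, 'y) module_scheme \<Rightarrow> ('r, 'n, 'z) module_scheme
   \<Rightarrow> ('m \<times> 'n \<Rightarrow>\<^sub>0 int) set"
where
  "tensor_relators R M N =
     {frag_of (x \<oplus>\<^bsub>M\<^esub> x', y) - frag_of (x, y) - frag_of (x', y) | x x' y.
        x \<in> carrier M \<and> x' \<in> carrier M \<and> y \<in> carrier N} \<union>
     {frag_of (x, y \<oplus>\<^bsub>N\<^esub> y') - frag_of (x, y) - frag_of (x, y') | x y y'.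
        x \<in> carrier M \<and> y \<in> carrier N \<and> y' \<in> carrier N} \<union>
     {frag_of (r \<odot>\<^bsub>M\<^esub> x, y) - frag_of (x, r \<odot>\<^bsub>N\<^esub> y) | r x y.
        r \<in> carrier R \<and> x \<in> carrier M \<and> y \<in> carrier N}"

definition tensor_product ::
  "('r, 'x) ring_scheme \<Rightarrow> ('r, 'm, 'y) module_scheme \<Rightarrow> ('r, 'n, 'z) module_scheme
   \<Rightarrow> ('m \<times> 'n \<Rightarrow>\<^sub>0 int) set monoid"
where
  "tensor_product R M N =
     (let F = free_Abelian_group (carrier M \<times> carrier N)
      in F Mod generate F (tensor_relators R M N))"


section \<open>Ext\<close>

text \<open>
  A free resolution \<open>\<dots> \<rightarrow> R\<^bsup>(B 1)\<^esup> \<rightarrow> R\<^bsup>(B 0)\<^esup> \<rightarrow> M \<rightarrow> 0\<close> with differentials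
  \<open>d k : R\<^bsup>(B (k + 1))\<^esup> \<rightarrow> R\<^bsup>(B k)\<^esup>\<close> and augmentation \<open>e\<close>.
\<close>

definition free_resolution ::
  "('r, 'x) ring_scheme \<Rightarrow> ('r, 'm, 'y) module_scheme \<Rightarrow>
   (nat \<Rightarrow> 'u set) \<times> (nat \<Rightarrow> ('u \<Rightarrow> 'r) \<Rightarrow> ('u \<Rightarrow> 'r)) \<times> (('u \<Rightarrow> 'r) \<Rightarrow> 'm) \<Rightarrow> bool"
where
  "free_resolution R M = (\<lambda>(B, d, e). let F = (\<lambda>k. free_module R (B k)) in
     e \<in> module_hom R (F 0) M \<and> e ` carrier (F 0) = carrier M \<and>
     (\<forall>k. d k \<in> module_hom R (F (Suc k)) (F k)) \<and>
     d 0 ` carrier (F 1) = a_kernel (F 0) M e \<and>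
     (\<forall>k. d (Suc k) ` carrier (F (Suc (Suc k))) = a_kernel (F (Suc k)) (F k) (d k)))"

definition cocycles ::
  "('r, 'x) ring_scheme \<Rightarrow> ('r, 'n, 'z) module_scheme \<Rightarrow> (nat \<Rightarrow> 'u set) \<Rightarrow>
   (nat \<Rightarrow> ('u \<Rightarrow> 'r) \<Rightarrow> ('u \<Rightarrow> 'r)) \<Rightarrow> nat \<Rightarrow> (('u \<Rightarrow> 'r) \<Rightarrow> 'n) set"
where
  "cocycles R N B d k = {f \<in> carrier (Hom_module R (free_module R (B k)) N).
     \<forall>x\<in>carrier (free_module R (B (Suc k))). f (d k x) = \<zero>\<^bsub>N\<^esub>}"

definition coboundaries ::
  "('r, 'x) ring_scheme \<Rightarrow> ('r, 'n, 'z) module_scheme \<Rightarrow> (nat \<Rightarrow> 'u set) \<Rightarrow>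
   (nat \<Rightarrow> ('u \<Rightarrow> 'r) \<Rightarrow> ('u \<Rightarrow> 'r)) \<Rightarrow> nat \<Rightarrow> (('u \<Rightarrow> 'r) \<Rightarrow> 'n) set"
where
  "coboundaries R N B d k = (case k of
     0 \<Rightarrow> {\<zero>\<^bsub>Hom_module R (free_module R (B 0)) N\<^esub>}
   | Suc j \<Rightarrow> (\<lambda>g. \<lambda>x\<in>carrier (free_module R (B (Suc j))). g (d j x)) `
              carrier (Hom_module R (free_module R (B j)) N))"

text \<open>
  \<open>Ext\<close> is the cohomology of \<open>Hom(F, N)\<close> for a chosen free resolution \<open>F\<close> of \<open>M\<close>; up to isomorphism
  it does not depend on the choice.  Bases are taken inside the type \<^typ>\<open>('r + 'm) list\<close>, which is
  infinite and at least as large as \<open>R\<close> and \<open>M\<close>, so that every module over a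
  commutative ring has such a resolution.
\<close>

definition Ext ::
  "('r, 'x) ring_scheme \<Rightarrow> nat \<Rightarrow> ('r, 'm, 'y) module_scheme \<Rightarrow> ('r, 'n, 'z) module_scheme
   \<Rightarrow> ('r, ((('r + 'm) list \<Rightarrow> 'r) \<Rightarrow> 'n) set) module"
where
  "Ext R k M N =
     (let (B, d, e) = (SOME F. free_resolution R M F)
      in quotient_module
           ((Hom_module R (free_module R (B k)) N)\<lparr>carrier := cocycles R N B d k\<rparr>)
           (coboundaries R N B d k))"


section \<open>Group rings\<close>

text \<open>
  Groups are written multiplicatively, and \<open>f g\<close> is the coefficient of \<open>x\<^sup>g\<close> in \<open>f\<close>.
\<close>

definition group_ring :: "('k, 'x) ring_scheme \<Rightarrow> ('g, 'y) monoid_scheme \<Rightarrow> ('g \<Rightarrow> 'k) ring" where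
  "group_ring K G = \<lparr>carrier = fin_supp (carrier G) K,
     monoid.mult = (\<lambda>r s g. if g \<in> carrier G
        then finsum K (\<lambda>h. r h \<otimes>\<^bsub>K\<^esub> s (inv\<^bsub>G\<^esub> h \<otimes>\<^bsub>G\<^esub> g)) {h \<in> carrier G. r h \<noteq> \<zero>\<^bsub>K\<^esub>}
        else \<zero>\<^bsub>K\<^esub>),
     one = (\<lambda>g. if g = \<one>\<^bsub>G\<^esub> then \<one>\<^bsub>K\<^esub> else \<zero>\<^bsub>K\<^esub>),
     ring.zero = (\<lambda>_. \<zero>\<^bsub>K\<^esub>),
     add = (\<lambda>r s g. r g \<oplus>\<^bsub>K\<^esub> s g)\<rparr>"

text \<open>\<open>M[G]\<close> as a module over the group ring \<open>K[G]\<close>, for a \<open>K\<close>-module \<open>M\<close>.\<close>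

definition group_module ::
  "('k, 'x) ring_scheme \<Rightarrow> ('k, 'm, 'z) module_scheme \<Rightarrow> ('g, 'y) monoid_scheme
   \<Rightarrow> ('g \<Rightarrow> 'k, 'g \<Rightarrow> 'm) module"
where
  "group_module K M G = \<lparr>carrier = fin_supp (carrier G) M, monoid.mult = undefined, one = undefined,
     ring.zero = (\<lambda>_. \<zero>\<^bsub>M\<^esub>),
     add = (\<lambda>p q g. p g \<oplus>\<^bsub>M\<^esub> q g),
     smult = (\<lambda>r p g. if g \<in> carrier G
        then finsum M (\<lambda>h. r h \<odot>\<^bsub>M\<^esub> p (inv\<^bsub>G\<^esub> h \<otimes>\<^bsub>G\<^esub> g)) {h \<in> carrier G. r h \<noteq> \<zero>\<^bsub>K\<^esub>}
        else \<zero>\<^bsub>M\<^esub>)\<rparr>"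

definition antipode ::
  "('k, 'x) ring_scheme \<Rightarrow> ('g, 'y) monoid_scheme \<Rightarrow> ('g \<Rightarrow> 'k) \<Rightarrow> ('g \<Rightarrow> 'k)"
where
  "antipode K G r = (\<lambda>g. if g \<in> carrier G then r (inv\<^bsub>G\<^esub> g) else \<zero>\<^bsub>K\<^esub>)"

definition antipode_twist ::
  "('k, 'x) ring_scheme \<Rightarrow> ('g, 'y) monoid_scheme \<Rightarrow> ('g \<Rightarrow> 'k, 'm) module \<Rightarrow> ('g \<Rightarrow> 'k, 'm) module"
where
  "antipode_twist K G M = M\<lparr>smult := (\<lambda>r. smult M (antipode K G r))\<rparr>"

text \<open>The additive map \<open>M[G] \<rightarrow> M[H]\<close>, \<open>a x\<^sup>g \<mapsto> a x\<^bsup>\<iota>(g)\<^esup>\<close>.\<close>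

definition push ::
  "('m, 'z) ring_scheme \<Rightarrow> ('g, 'y) monoid_scheme \<Rightarrow> ('g \<Rightarrow> 'h) \<Rightarrow> ('g \<Rightarrow> 'm) \<Rightarrow> ('h \<Rightarrow> 'm)"
where
  "push M G \<iota> f = (\<lambda>h. finsum M f {g \<in> carrier G. f g \<noteq> \<zero>\<^bsub>M\<^esub> \<and> \<iota> g = h})"


section \<open>Stabilizer codes\<close>

abbreviation Zmod :: "nat \<Rightarrow> int set ring" where
  "Zmod n \<equiv> ZFact (int n)"

text \<open>
  The data \<open>(n, \<Lambda>, L, P)\<close>, where \<open>P = P\<^sub>0[\<Lambda>]\<close> is given by \<open>P\<^sub>0\<close> and \<open>\<omega>\<^sub>0\<close>.
\<close>

record ('g, 'p) stab_code =
  modulus :: nat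
  site_group :: "'g monoid"
  local_module :: "(int set, 'p) module"
  local_form :: "'p \<Rightarrow> 'p \<Rightarrow> int set"
  stabilizers :: "('g \<Rightarrow> 'p) set"

definition stab_ring :: "('g, 'p) stab_code \<Rightarrow> ('g \<Rightarrow> int set) ring" where
  "stab_ring C = group_ring (Zmod (modulus C)) (site_group C)"

definition stab_module :: "('g, 'p) stab_code \<Rightarrow> ('g \<Rightarrow> int set, 'g \<Rightarrow> 'p) module" where
  "stab_module C = group_module (Zmod (modulus C)) (local_module C) (site_group C)"

text \<open>
  From \<open>\<omega>(a x\<^sup>\<lambda>, b x\<^sup>\<mu>) = \<omega>\<^sub>0(a, b) x\<^bsup>\<mu>-\<lambda>\<^esup>\<close>, the coefficient of \<open>x\<^sup>\<gamma>\<close> in \<open>\<omega>(p, q)\<close> collects the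
  pairs \<open>(\<lambda>, \<mu>)\<close> with \<open>\<mu> = \<lambda> + \<gamma>\<close>.
\<close>

definition stab_form :: "('g, 'p) stab_code \<Rightarrow> ('g \<Rightarrow> 'p) \<Rightarrow> ('g \<Rightarrow> 'p) \<Rightarrow> ('g \<Rightarrow> int set)" where
  "stab_form C p q = (\<lambda>\<gamma>. if \<gamma> \<in> carrier (site_group C)
     then finsum (Zmod (modulus C)) (\<lambda>l. local_form C (p l) (q (l \<otimes>\<^bsub>site_group C\<^esub> \<gamma>)))
            {l \<in> carrier (site_group C). p l \<noteq> \<zero>\<^bsub>local_module C\<^esub>}
     else \<zero>\<^bsub>Zmod (modulus C)\<^esub>)"

definition bilinear_form ::
  "('k, 'x) ring_scheme \<Rightarrow> ('k, 'm, 'z) module_scheme \<Rightarrow> ('m \<Rightarrow> 'm \<Rightarrow> 'k) \<Rightarrow> bool"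
where
  "bilinear_form K M w \<longleftrightarrow>
     (\<forall>a\<in>carrier M. (\<lambda>b. w a b) \<in> module_hom K M (ring_module K)) \<and>
     (\<forall>b\<in>carrier M. (\<lambda>a. w a b) \<in> module_hom K M (ring_module K))"

definition stabilizer_code :: "('g, 'p) stab_code \<Rightarrow> bool" where
  "stabilizer_code C \<longleftrightarrow>
     (let K = Zmod (modulus C); P\<^sub>0 = local_module C; \<omega>\<^sub>0 = local_form C in
      modulus C > 0 \<and>
      comm_group (site_group C) \<and> fin_gen_group (site_group C) \<and>
      Module.module K P\<^sub>0 \<and> fin_gen_module K P\<^sub>0 \<and>
      bilinear_form K P\<^sub>0 \<omega>\<^sub>0 \<and>
      (\<forall>a\<in>carrier P\<^sub>0. \<omega>\<^sub>0 a a = \<zero>\<^bsub>K\<^esub>) \<and>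
      (\<forall>a\<in>carrier P\<^sub>0. (\<forall>b\<in>carrier P\<^sub>0. \<omega>\<^sub>0 b a = \<zero>\<^bsub>K\<^esub>) \<longrightarrow> a = \<zero>\<^bsub>P\<^sub>0\<^esub>) \<and>
      submodule (stabilizers C) (stab_ring C) (stab_module C) \<and>
      (\<forall>p\<in>stabilizers C. \<forall>q\<in>stabilizers C. stab_form C p q = \<zero>\<^bsub>stab_ring C\<^esub>))"

definition form_orthogonal :: "('g, 'p) stab_code \<Rightarrow> ('g \<Rightarrow> 'p) set \<Rightarrow> ('g \<Rightarrow> 'p) set" where
  "form_orthogonal C N =
     {p \<in> carrier (stab_module C). \<forall>m\<in>N. stab_form C m p = \<zero>\<^bsub>stab_ring C\<^esub>}"

definition saturated :: "('g, 'p) stab_code \<Rightarrow> bool" where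
  "saturated C \<longleftrightarrow> form_orthogonal C (form_orthogonal C (stabilizers C)) = stabilizers C"

definition charge_module ::
  "nat \<Rightarrow> ('g, 'p) stab_code \<Rightarrow>
   ('g \<Rightarrow> int set, (((('g \<Rightarrow> int set) + ('g \<Rightarrow> 'p) set) list \<Rightarrow> ('g \<Rightarrow> int set)) \<Rightarrow> ('g \<Rightarrow> int set)) set)
    module"
where
  "charge_module i C = Ext (stab_ring C) (i + 1)
     (antipode_twist (Zmod (modulus C)) (site_group C)
        (quotient_module (stab_module C) (stabilizers C)))
     (ring_module (stab_ring C))"

definition stab_isomorphic :: "('g, 'p) stab_code \<Rightarrow> ('g, 'q) stab_code \<Rightarrow> bool" where
  "stab_isomorphic C D \<longleftrightarrow> modulus C = modulus D \<and> site_group C = site_group D \<and>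
     (\<exists>\<phi>\<in>module_hom (stab_ring C) (stab_module C) (stab_module D).
        bij_betw \<phi> (carrier (stab_module C)) (carrier (stab_module D)) \<and>
        (\<forall>p\<in>carrier (stab_module C). \<forall>q\<in>carrier (stab_module C).
           stab_form D (\<phi> p) (\<phi> q) = stab_form C p q) \<and>
        \<phi> ` stabilizers C = stabilizers D)"


section \<open>Stacking\<close>

text \<open>
  For an \<open>R\<close>-submodule \<open>N\<close> of \<open>P\<close>, with \<open>R = \<int>\<^sub>n[\<Lambda>]\<close>, the module \<open>\<iota>\<^sub>*N = N \<otimes>\<^sub>R \<int>\<^sub>n[\<Gamma>]\<close> is regarded
  as a submodule of \<open>\<iota>\<^sub>*P = P\<^sub>0[\<Gamma>]\<close>, namely as the image of the map \<open>l \<otimes> s \<mapsto> s \<cdot> push l\<close>, which is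
  induced by the inclusion of \<open>N\<close> and the identification \<open>P \<otimes>\<^sub>R \<int>\<^sub>n[\<Gamma>] = P\<^sub>0[\<Gamma>]\<close>.
  Here \<open>\<int>\<^sub>n[\<Gamma>]\<close> is an \<open>R\<close>-module via \<^const>\<open>push\<close>.
\<close>

definition stack_scalars ::
  "('l \<Rightarrow> 'g) \<Rightarrow> 'g monoid \<Rightarrow> ('l, 'p) stab_code \<Rightarrow> ('l \<Rightarrow> int set, 'g \<Rightarrow> int set) module"
where
  "stack_scalars \<iota> \<Gamma> C =
     (let K = Zmod (modulus C); S = group_ring K \<Gamma> in
      \<lparr>carrier = carrier S, monoid.mult = monoid.mult S, one = \<one>\<^bsub>S\<^esub>, ring.zero = \<zero>\<^bsub>S\<^esub>, add = add S,
       smult = (\<lambda>r s. push K (site_group C) \<iota> r \<otimes>\<^bsub>S\<^esub> s)\<rparr>)"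

definition stack_eval ::
  "('l \<Rightarrow> 'g) \<Rightarrow> 'g monoid \<Rightarrow> ('l, 'p) stab_code \<Rightarrow> (('l \<Rightarrow> 'p) \<times> ('g \<Rightarrow> int set) \<Rightarrow>\<^sub>0 int) \<Rightarrow> ('g \<Rightarrow> 'p)"
where
  "stack_eval \<iota> \<Gamma> C z =
     (let P' = group_module (Zmod (modulus C)) (local_module C) \<Gamma> in
      finsum P' (\<lambda>(l, s). [Poly_Mapping.lookup z (l, s)] \<cdot>\<^bsub>P'\<^esub>
                   (s \<odot>\<^bsub>P'\<^esub> push (local_module C) (site_group C) \<iota> l))
        (Poly_Mapping.keys z))"

definition stack_submodule ::
  "('l \<Rightarrow> 'g) \<Rightarrow> 'g monoid \<Rightarrow> ('l, 'p) stab_code \<Rightarrow> ('l \<Rightarrow> 'p) set \<Rightarrow> ('g \<Rightarrow> 'p) set"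
where
  "stack_submodule \<iota> \<Gamma> C N =
     (\<lambda>U. the_elem (stack_eval \<iota> \<Gamma> C ` U)) `
       carrier (tensor_product (stab_ring C) ((stab_module C)\<lparr>carrier := N\<rparr>) (stack_scalars \<iota> \<Gamma> C))"

definition stack :: "('l \<Rightarrow> 'g) \<Rightarrow> 'g monoid \<Rightarrow> ('l, 'p) stab_code \<Rightarrow> ('g, 'p) stab_code" where
  "stack \<iota> \<Gamma> C = \<lparr>modulus = modulus C, site_group = \<Gamma>, local_module = local_module C,
     local_form = local_form C, stabilizers = stack_submodule \<iota> \<Gamma> C (stabilizers C)\<rparr>"

end

theory Submission
  imports Defs
begin

text \<open>
  Choosing representatives of the cosets of \<open>\<iota>(\<Lambda>)\<close> in \<open>\<Gamma>\<close> gives, on a stacked module \<open>\<iota>\<^sub>*M\<close> and hence on its free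
  resolutions, a \<open>\<Lambda>\<close>-linear projection whose \<open>\<Gamma>\<close>-translates over the cosets add up to the identity. Averaging with it
  turns \<open>\<Lambda>\<close>-equivariant primitives of cocycles into \<open>\<Gamma>\<close>-equivariant ones, so it suffices to find the former.
  They exist above degree \<open>rk \<Lambda>\<close>: \<open>\<int>\<^sub>n\<close> is injective over itself by Baer's criterion, a generator of finite order
  modulo the previous ones costs no degree, and one of infinite order costs one degree, since a difference equation has to be
  solved along its orbits. If the code is saturated, then \<open>P/L = P/L\<^sup>\<omega>\<^sup>\<omega>\<close> embeds into a free module; the resolution,
  prolonged by this embedding, is still exact, which gains one more degree.
\<close>

text \<open>Flat base change would compare Ext over \<Gamma> with Ext over \<Lambda>, but
  \<open>Ext\<close> is evaluated on an arbitrarily chosen \<Gamma>-resolution, whose terms and maps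
  need not be induced from \<Lambda>. The ring is therefore never changed: all modules stay over the
  group ring of \<Gamma>, and only the group under which homomorphisms must be equivariant grows,
  from the trivial one through subgroups of \<open>\<iota>(\<Lambda>)\<close> to \<Gamma>. Two
  obstacles rule out an ordinary average over cosets. A finite index between subgroups of
  \<open>\<iota>(\<Lambda>)\<close> may be a zero divisor modulo \<open>n\<close>, so it cannot be
  divided by; instead the values of a primitive are cut down to a set of group elements with
  disjoint translates. The index of \<open>\<iota>(\<Lambda>)\<close> in \<Gamma> may be infinite,
  so each element must have only finitely many nonzero translates. On the stacked module this holds
  by finite support, but an abstract resolution knows nothing of such supports; the finiteness has
  to be lifted through it term by term, together with the projection.\<close>

definition amon :: "('a, 'm) ring_scheme \<Rightarrow> 'a monoid" where
  "amon R = \<lparr>carrier = carrier R, monoid.mult = add R, one = \<zero>\<^bsub>R\<^esub>\<rparr>"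

lemma amon_simps [simp]:
  "carrier (amon R) = carrier R" "monoid.mult (amon R) = add R" "\<one>\<^bsub>amon R\<^esub> = \<zero>\<^bsub>R\<^esub>"
  by (simp_all add: amon_def)

text \<open>\<open>add_monoid\<close> carries over the extension type of the ring record, filled
  with an undefined field, so the additive groups of structures of different record types cannot
  even be compared. In \<open>amon\<close> they can be literally equal, as for a ring and its
  regular module; this and the following lemmas move the basic notions there.\<close>

lemma hom_amon: "hom (add_monoid M) (add_monoid N) = hom (amon M) (amon N)"
  by (simp add: hom_def)

lemma finsum_amon: "finsum M f A = finprod (amon M) f A"
  by (simp add: finsum_def finprod_def)

lemma m_inv_amon: "m_inv (add_monoid M) = m_inv (amon M)"
  by (simp add: m_inv_def fun_eq_iff)

lemma pow_amon: "pow (add_monoid M) x (k::int) = pow (amon M) x k"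
  by (simp add: int_pow_def nat_pow_def m_inv_amon[unfolded fun_eq_iff] Let_def)

lemma add_pow_amon: "add_pow M (k::int) x = pow (amon M) x k"
  by (simp add: add_pow_def pow_amon)

lemma subgroup_amon: "subgroup H (add_monoid M) \<longleftrightarrow> subgroup H (amon M)"
  by (simp add: subgroup_def m_inv_amon)

lemma comm_group_amon: "abelian_group M \<longleftrightarrow> comm_group (amon M)"
proof
  assume "abelian_group M"
  then interpret abelian_group M .
  show "comm_group (amon M)"
    by (rule comm_groupI) (auto simp: a_ac intro: add.l_inv_ex)
next
  assume "comm_group (amon M)"
  then interpret comm_group "amon M" .
  show "abelian_group M"
    by (rule abelian_groupI)
      (use m_closed one_closed m_assoc m_comm l_one l_inv_ex in auto)
qed

lemma hom_finprod:
  assumes "comm_group A" "comm_group B" "f \<in> hom A B" "h \<in> S \<rightarrow> carrier A"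
  shows "f (finprod A h S) = finprod B (\<lambda>x. f (h x)) S"
proof -
  interpret A: comm_group A by fact
  interpret B: comm_group B by fact
  interpret group_hom A B f using assms(3) by unfold_locales
  show ?thesis
    using assms(4)
  proof (induction S rule: infinite_finite_induct)
    case (insert x S)
    then have "h x \<in> carrier A" "h \<in> S \<rightarrow> carrier A" by auto
    moreover have hc: "f (h y) \<in> carrier B" if "y \<in> insert x S" for y
      using insert.prems that hom_in_carrier[OF assms(3)] by blast
    moreover have "(\<lambda>x. f (h x)) \<in> S \<rightarrow> carrier B" using hc by blast
    ultimately show ?case using insert by simp
  qed auto
qed

section \<open>Integers modulo n\<close>

definition zc :: "nat \<Rightarrow> int \<Rightarrow> int set" where
  "zc n k = Idl\<^bsub>\<Z>\<^esub> {int n} +>\<^bsub>\<Z>\<^esub> k"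

text \<open>A representative lets a residue class serve as an exponent. On elements of exponent
  dividing \<open>n\<close> the power does not depend on the choice (\<open>torsion_zrep\<close>),
  so modules over the integers modulo \<open>n\<close> can be treated as plain abelian
  groups.\<close>

definition zrep :: "nat \<Rightarrow> int set \<Rightarrow> int" where
  "zrep n z = (SOME k. zc n k = z)"

lemma zc_hom: "zc n \<in> ring_hom \<Z> (Zmod n)"
proof -
  have "ideal (Idl\<^bsub>\<Z>\<^esub> {int n}) \<Z>"
    by (simp add: int.genideal_ideal)
  from ideal.rcos_ring_hom[OF this] show ?thesis
    by (simp add: zc_def[abs_def] ZFact_def)
qed

lemma carrier_Zmod: "carrier (Zmod n) = range (zc n)"
  by (auto simp: ZFact_defs A_RCOSETS_defs zc_def a_r_coset_def)

lemma zc_closed [simp]: "zc n k \<in> carrier (Zmod n)"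
  by (simp add: carrier_Zmod)

lemma zc_add: "zc n (a + b) = zc n a \<oplus>\<^bsub>Zmod n\<^esub> zc n b"
  using ring_hom_add[OF zc_hom, of a b n] by simp

lemma zc_one: "\<one>\<^bsub>Zmod n\<^esub> = zc n 1"
  using ring_hom_one[OF zc_hom, of n] by simp

lemma zc_zero: "\<zero>\<^bsub>Zmod n\<^esub> = zc n 0"
  using ring_hom_zero[OF zc_hom int.ring_axioms cring.axioms(1)[OF ZFact_is_cring], of n] by simp

lemma zc_eq_iff: "zc n a = zc n b \<longleftrightarrow> int n dvd a - b"
proof -
  have 1: "zc n a = {x * int n + a | x. True}" for a
    by (auto simp: zc_def a_r_coset_defs int_Idl)
  show ?thesis
  proof
    assume "zc n a = zc n b"
    moreover have "a \<in> zc n a" unfolding 1 by (auto intro!: exI[of _ 0])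
    ultimately have "a \<in> zc n b" by simp
    then show "int n dvd a - b" unfolding 1 by auto
  next
    assume "int n dvd a - b"
    then obtain c where c: "a = b + int n * c" by (metis add_diff_cancel_left' diff_add_cancel dvd_def add.commute)
    have "x * int n + a = (x + c) * int n + b" for x by (simp add: c algebra_simps)
    moreover have "x * int n + b = (x - c) * int n + a" for x by (simp add: c algebra_simps)
    ultimately show "zc n a = zc n b" unfolding 1 by blast
  qed
qed

lemma zc_zrep: "z \<in> carrier (Zmod n) \<Longrightarrow> zc n (zrep n z) = z"
  unfolding zrep_def carrier_Zmod by (rule someI_ex) auto

lemma comm_group_Zmod: "comm_group (amon (Zmod n))"
  using comm_group_amon ZFact_is_cring cring_def ring_def by blast

lemma zc_pow: "zc n a [^]\<^bsub>amon (Zmod n)\<^esub> (k::int) = zc n (k * a)"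
proof -
  interpret comm_group "amon (Zmod n)" by (rule comm_group_Zmod)
  have 1: "zc n a [^]\<^bsub>amon (Zmod n)\<^esub> (m::nat) = zc n (int m * a)" for m
    by (induction m) (auto simp: zc_zero zc_add[symmetric] algebra_simps)
  have "inv\<^bsub>amon (Zmod n)\<^esub> (zc n b) = zc n (-b)" for b
    by (rule inv_equality) (auto simp: zc_add[symmetric] zc_zero)
  then show ?thesis
    by (simp add: int_pow_def2 1)
qed

lemma Zmod_torsion: "x \<in> carrier (Zmod n) \<Longrightarrow> x [^]\<^bsub>amon (Zmod n)\<^esub> int n = \<zero>\<^bsub>Zmod n\<^esub>"
  using zc_zrep[of x n] zc_pow[of n "zrep n x" "int n"] zc_eq_iff[of n "int n * zrep n x" 0] by (simp add: zc_zero)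

lemma torsion_pow_eq:
  assumes "comm_group A" "x \<in> carrier A" "x [^]\<^bsub>A\<^esub> int n = \<one>\<^bsub>A\<^esub>" "int n dvd a - b"
  shows "x [^]\<^bsub>A\<^esub> a = x [^]\<^bsub>A\<^esub> b"
proof -
  interpret comm_group A by fact
  from assms(4) obtain c where "a = int n * c + b" by (metis diff_eq_eq dvd_def)
  then show ?thesis using assms
    by (simp add: int_pow_mult int_pow_pow[symmetric])
qed

lemma torsion_zrep:
  assumes "comm_group A" "x \<in> carrier A" "x [^]\<^bsub>A\<^esub> int n = \<one>\<^bsub>A\<^esub>"
  shows "x [^]\<^bsub>A\<^esub> zrep n (zc n k) = x [^]\<^bsub>A\<^esub> k"
  using assms torsion_pow_eq zc_eq_iff zc_zrep zc_closed by metis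

lemma zmod_ext:
  assumes "comm_group A" "x \<in> carrier A" "x [^]\<^bsub>A\<^esub> int n = \<one>\<^bsub>A\<^esub>"
  shows "(\<lambda>z. x [^]\<^bsub>A\<^esub> zrep n z) \<in> hom (amon (Zmod n)) A"
proof -
  interpret comm_group A by fact
  show ?thesis
    using assms
    by (auto simp: hom_def carrier_Zmod torsion_zrep zc_add[symmetric] int_pow_mult)
qed

section \<open>Finitely supported functions\<close>

text \<open>One model for three objects: with \<open>A\<close> the integers modulo \<open>n\<close>
  it is the group ring, with \<open>A\<close> the local module it is \<open>P_0[G]\<close>, and with
  \<open>A\<close> the group ring itself it is a free module.\<close>

definition fsg :: "'x set \<Rightarrow> 'a monoid \<Rightarrow> ('x \<Rightarrow> 'a) monoid" where
  "fsg J A = \<lparr>carrier = {f. range f \<subseteq> carrier A \<and> finite {x. f x \<noteq> \<one>\<^bsub>A\<^esub>} \<and> {x. f x \<noteq> \<one>\<^bsub>A\<^esub>} \<subseteq> J},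
     monoid.mult = (\<lambda>f g x. f x \<otimes>\<^bsub>A\<^esub> g x), monoid.one = (\<lambda>_. \<one>\<^bsub>A\<^esub>)\<rparr>"

definition sng :: "'a monoid \<Rightarrow> 'x \<Rightarrow> 'a \<Rightarrow> ('x \<Rightarrow> 'a)" where
  "sng A x a = (\<lambda>y. if y = x then a else \<one>\<^bsub>A\<^esub>)"

lemma fsg_one: "\<one>\<^bsub>fsg J A\<^esub> = (\<lambda>_. \<one>\<^bsub>A\<^esub>)"
  by (simp add: fsg_def)

lemma fsg_mult: "f \<otimes>\<^bsub>fsg J A\<^esub> g = (\<lambda>x. f x \<otimes>\<^bsub>A\<^esub> g x)"
  by (simp add: fsg_def)

lemma fsg_app: "f \<in> carrier (fsg J A) \<Longrightarrow> f x \<in> carrier A"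
  by (auto simp: fsg_def)

lemma fsg_out: "f \<in> carrier (fsg J A) \<Longrightarrow> x \<notin> J \<Longrightarrow> f x = \<one>\<^bsub>A\<^esub>"
  by (auto simp: fsg_def)

lemma fsg_fin: "f \<in> carrier (fsg J A) \<Longrightarrow> finite {x. f x \<noteq> \<one>\<^bsub>A\<^esub>}"
  by (auto simp: fsg_def)

lemma fsgI:
  assumes "\<And>x. f x \<in> carrier A" "finite S" "\<And>x. f x \<noteq> \<one>\<^bsub>A\<^esub> \<Longrightarrow> x \<in> S" "\<And>x. f x \<noteq> \<one>\<^bsub>A\<^esub> \<Longrightarrow> x \<in> J"
  shows "f \<in> carrier (fsg J A)"
proof -
  have "{x. f x \<noteq> \<one>\<^bsub>A\<^esub>} \<subseteq> S" using assms by auto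
  then have "finite {x. f x \<noteq> \<one>\<^bsub>A\<^esub>}" using assms finite_subset by blast
  then show ?thesis using assms by (auto simp: fsg_def)
qed

lemma fsg_comm_group:
  assumes "comm_group A"
  shows "comm_group (fsg J A)"
proof -
  interpret comm_group A by fact
  show ?thesis
  proof (rule comm_groupI)
    fix f g assume fg: "f \<in> carrier (fsg J A)" "g \<in> carrier (fsg J A)"
    show "f \<otimes>\<^bsub>fsg J A\<^esub> g \<in> carrier (fsg J A)"
      unfolding fsg_mult
    proof (rule fsgI[where S="{x. f x \<noteq> \<one>\<^bsub>A\<^esub>} \<union> {x. g x \<noteq> \<one>\<^bsub>A\<^esub>}"])
      fix x
      have c: "f x \<in> carrier A" "g x \<in> carrier A" using fg fsg_app by metis+
      then show "f x \<otimes>\<^bsub>A\<^esub> g x \<in> carrier A" by simp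
      assume *: "f x \<otimes>\<^bsub>A\<^esub> g x \<noteq> \<one>\<^bsub>A\<^esub>"
      then show "x \<in> {x. f x \<noteq> \<one>\<^bsub>A\<^esub>} \<union> {x. g x \<noteq> \<one>\<^bsub>A\<^esub>}" by auto
      show "x \<in> J" using * c fg fsg_out[of f J A x] fsg_out[of g J A x] by (cases "x \<in> J") auto
    qed (use fg fsg_fin in auto)
    show "f \<otimes>\<^bsub>fsg J A\<^esub> g = g \<otimes>\<^bsub>fsg J A\<^esub> f"
      using fsg_app[OF fg(1)] fsg_app[OF fg(2)] by (auto simp: fsg_mult fun_eq_iff intro: m_comm)
  next
    show "\<one>\<^bsub>fsg J A\<^esub> \<in> carrier (fsg J A)" by (auto simp: fsg_def)
  next
    fix f g h assume fgh: "f \<in> carrier (fsg J A)" "g \<in> carrier (fsg J A)" "h \<in> carrier (fsg J A)"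
    show "f \<otimes>\<^bsub>fsg J A\<^esub> g \<otimes>\<^bsub>fsg J A\<^esub> h = f \<otimes>\<^bsub>fsg J A\<^esub> (g \<otimes>\<^bsub>fsg J A\<^esub> h)"
      using fsg_app[OF fgh(1)] fsg_app[OF fgh(2)] fsg_app[OF fgh(3)] by (auto simp: fsg_mult fun_eq_iff intro: m_assoc)
  next
    fix f assume f: "f \<in> carrier (fsg J A)"
    then show "\<one>\<^bsub>fsg J A\<^esub> \<otimes>\<^bsub>fsg J A\<^esub> f = f"
      using fsg_app[OF f] by (auto simp: fsg_mult fsg_one fun_eq_iff)
    show "\<exists>g\<in>carrier (fsg J A). g \<otimes>\<^bsub>fsg J A\<^esub> f = \<one>\<^bsub>fsg J A\<^esub>"
    proof
      show "(\<lambda>x. inv\<^bsub>A\<^esub> (f x)) \<in> carrier (fsg J A)"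
        using fsg_app[OF f] fsg_fin[OF f] fsg_out[OF f] by (intro fsgI[where S="{x. f x \<noteq> \<one>\<^bsub>A\<^esub>}"]) auto
      show "(\<lambda>x. inv\<^bsub>A\<^esub> (f x)) \<otimes>\<^bsub>fsg J A\<^esub> f = \<one>\<^bsub>fsg J A\<^esub>"
        using fsg_app[OF f] by (auto simp: fsg_mult fsg_one fun_eq_iff)
    qed
  qed
qed

lemma fsg_eval_hom: "(\<lambda>f. f x) \<in> hom (fsg J A) A"
  by (auto simp: hom_def fsg_mult fsg_app)

lemma fsg_eval_group_hom: "comm_group A \<Longrightarrow> group_hom (fsg J A) A (\<lambda>f. f x)"
  by (simp add: fsg_eval_hom group_hom_def group_hom_axioms_def fsg_comm_group comm_group.axioms(2))

lemma fsg_int_pow: "comm_group A \<Longrightarrow> f \<in> carrier (fsg J A) \<Longrightarrow> (f [^]\<^bsub>fsg J A\<^esub> (k::int)) x = f x [^]\<^bsub>A\<^esub> k"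
  using group_hom.hom_int_pow[OF fsg_eval_group_hom] .

lemma fsg_finprod:
  "comm_group A \<Longrightarrow> h \<in> S \<rightarrow> carrier (fsg J A) \<Longrightarrow> finprod (fsg J A) h S x = finprod A (\<lambda>s. h s x) S"
  using hom_finprod[OF fsg_comm_group _ fsg_eval_hom] by fast

lemma sng_closed [simp]: "comm_group A \<Longrightarrow> x \<in> J \<Longrightarrow> a \<in> carrier A \<Longrightarrow> sng A x a \<in> carrier (fsg J A)"
  by (rule fsgI[where S="{x}"]) (auto simp: sng_def comm_groupE split: if_splits)

lemma sng_hom: "comm_group A \<Longrightarrow> x \<in> J \<Longrightarrow> sng A x \<in> hom A (fsg J A)"
  by (rule homI) (simp, auto simp: fsg_mult sng_def comm_groupE)

lemma fsg_induct:
  assumes A: "comm_group A" and U: "subgroup U (fsg J A)"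
    and sing: "\<And>x a. x \<in> J \<Longrightarrow> a \<in> carrier A \<Longrightarrow> sng A x a \<in> U"
    and v: "v \<in> carrier (fsg J A)"
  shows "v \<in> U"
proof -
  interpret A: comm_group A by fact
  interpret F: comm_group "fsg J A" using A by (rule fsg_comm_group)
  have "\<forall>v\<in>carrier (fsg J A). {x. v x \<noteq> \<one>\<^bsub>A\<^esub>} \<subseteq> S \<longrightarrow> v \<in> U" if "finite S" for S
    using that
  proof (induction S)
    case empty
    have "v = \<one>\<^bsub>fsg J A\<^esub>" if "v \<in> carrier (fsg J A)" "{x. v x \<noteq> \<one>\<^bsub>A\<^esub>} \<subseteq> {}" for v
      using that by (auto simp: fsg_one fun_eq_iff)
    then show ?case using subgroup.one_closed[OF U] by blast
  next
    case (insert s S)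
    show ?case
    proof (intro ballI impI)
      fix v assume v: "v \<in> carrier (fsg J A)" and sub: "{x. v x \<noteq> \<one>\<^bsub>A\<^esub>} \<subseteq> insert s S"
      define w where "w = (\<lambda>x. if x = s then \<one>\<^bsub>A\<^esub> else v x)"
      have w: "w \<in> carrier (fsg J A)"
        using fsg_app[OF v] fsg_fin[OF v] fsg_out[OF v]
        by (intro fsgI[where S="{x. v x \<noteq> \<one>\<^bsub>A\<^esub>}"]) (auto simp: w_def split: if_splits)
      moreover have "{x. w x \<noteq> \<one>\<^bsub>A\<^esub>} \<subseteq> S" using sub by (auto simp: w_def)
      ultimately have "w \<in> U" using insert.IH by blast
      show "v \<in> U"
      proof (cases "s \<in> J")
        case True
        then have "v = sng A s (v s) \<otimes>\<^bsub>fsg J A\<^esub> w"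
          using fsg_app[OF v] by (auto simp: fsg_mult w_def sng_def fun_eq_iff)
        then show ?thesis using \<open>w \<in> U\<close> sing[OF True fsg_app[OF v]] subgroup.m_closed[OF U]
          by metis
      next
        case False
        then have "w = v" using fsg_out[OF v] by (auto simp: w_def)
        then show ?thesis using \<open>w \<in> U\<close> by simp
      qed
    qed
  qed
  then show ?thesis using v fsg_fin by blast
qed

text \<open>The universal property of a direct sum. The formula is kept, and not only existence,
  because scalar multiplication in \<open>gmodule\<close> and the form \<open>stab_form\<close> are
  sums of exactly this shape; their additivity is read off from here.\<close>

lemma fsg_ext_explicit:
  assumes A: "comm_group A" and B: "comm_group B" and \<phi>: "\<And>x. x \<in> J \<Longrightarrow> \<phi> x \<in> hom A B"
  defines "f \<equiv> \<lambda>v. finprod B (\<lambda>x. \<phi> x (v x)) {x. v x \<noteq> \<one>\<^bsub>A\<^esub>}"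
  shows "f \<in> hom (fsg J A) B" and "\<And>x a. x \<in> J \<Longrightarrow> a \<in> carrier A \<Longrightarrow> f (sng A x a) = \<phi> x a"
proof -
  interpret A: comm_group A by fact
  interpret B: comm_group B by fact
  have \<phi>1: "\<phi> x \<one>\<^bsub>A\<^esub> = \<one>\<^bsub>B\<^esub>" if "x \<in> J" for x
    using \<phi>[OF that] by (simp add: A.group_axioms B.group_axioms hom_one)
  have fS: "f v = finprod B (\<lambda>x. \<phi> x (v x)) S"
    if "v \<in> carrier (fsg J A)" "finite S" "{x. v x \<noteq> \<one>\<^bsub>A\<^esub>} \<subseteq> S" "S \<subseteq> J" for v S
    unfolding f_def
    by (rule B.finprod_mono_neutral_cong_left)
      (use that \<phi>1 \<phi> fsg_app[OF that(1)] in \<open>auto intro!: hom_in_carrier[OF \<phi>]\<close>)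
  show "f \<in> hom (fsg J A) B"
  proof (rule homI)
    fix v assume v: "v \<in> carrier (fsg J A)"
    show "f v \<in> carrier B" unfolding f_def
      by (rule B.finprod_closed)
        (use v fsg_app[OF v] fsg_out[OF v] in \<open>auto intro!: hom_in_carrier[OF \<phi>]\<close>)
    fix w assume w: "w \<in> carrier (fsg J A)"
    let ?S = "{x. v x \<noteq> \<one>\<^bsub>A\<^esub>} \<union> {x. w x \<noteq> \<one>\<^bsub>A\<^esub>}"
    have S: "finite ?S" "?S \<subseteq> J" using fsg_fin[OF v] fsg_fin[OF w] fsg_out[OF v] fsg_out[OF w] by auto
    have vw: "v \<otimes>\<^bsub>fsg J A\<^esub> w \<in> carrier (fsg J A)"
      using v w comm_groupE(1)[OF fsg_comm_group[OF A]] by blast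
    have c: "(\<lambda>x. \<phi> x (v x)) \<in> ?S \<rightarrow> carrier B" "(\<lambda>x. \<phi> x (w x)) \<in> ?S \<rightarrow> carrier B"
      using S fsg_app[OF v] fsg_app[OF w] by (auto intro!: hom_in_carrier[OF \<phi>])
    have "f (v \<otimes>\<^bsub>fsg J A\<^esub> w) = finprod B (\<lambda>x. \<phi> x (v x \<otimes>\<^bsub>A\<^esub> w x)) ?S"
    proof -
      have "{x. (v \<otimes>\<^bsub>fsg J A\<^esub> w) x \<noteq> \<one>\<^bsub>A\<^esub>} \<subseteq> ?S" by (auto simp: fsg_mult)
      from fS[OF vw S(1) this S(2)] show ?thesis by (simp add: fsg_mult)
    qed
    also have "\<dots> = finprod B (\<lambda>x. \<phi> x (v x) \<otimes>\<^bsub>B\<^esub> \<phi> x (w x)) ?S"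
    proof (rule B.finprod_cong')
      show "(\<lambda>x. \<phi> x (v x) \<otimes>\<^bsub>B\<^esub> \<phi> x (w x)) \<in> ?S \<rightarrow> carrier B" using c by (auto simp: Pi_iff)
      fix x assume "x \<in> ?S"
      then show "\<phi> x (v x \<otimes>\<^bsub>A\<^esub> w x) = \<phi> x (v x) \<otimes>\<^bsub>B\<^esub> \<phi> x (w x)"
        using S(2) by (intro hom_mult[OF \<phi>]) (auto simp: fsg_app[OF v] fsg_app[OF w])
    qed simp
    also have "\<dots> = f v \<otimes>\<^bsub>B\<^esub> f w"
      using B.finprod_multf[OF c] fS[OF v S(1) _ S(2)] fS[OF w S(1) _ S(2)] by simp
    finally show "f (v \<otimes>\<^bsub>fsg J A\<^esub> w) = f v \<otimes>\<^bsub>B\<^esub> f w" .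
  qed
  show "f (sng A x a) = \<phi> x a" if "x \<in> J" "a \<in> carrier A" for x a
  proof -
    have "f (sng A x a) = finprod B (\<lambda>y. \<phi> y (sng A x a y)) {x}"
      by (rule fS) (use that in \<open>auto simp: A.comm_group_axioms, auto simp: sng_def split: if_splits\<close>)
    also have "\<dots> = \<phi> x a" using that hom_in_carrier[OF \<phi>] by (simp add: sng_def)
    finally show ?thesis .
  qed
qed

lemma fsg_ext:
  assumes "comm_group A" "comm_group B" "\<And>x. x \<in> J \<Longrightarrow> \<phi> x \<in> hom A B"
  shows "\<exists>f\<in>hom (fsg J A) B. \<forall>x\<in>J. \<forall>a\<in>carrier A. f (sng A x a) = \<phi> x a"
proof (rule bexI)
  show "\<forall>x\<in>J. \<forall>a\<in>carrier A. finprod B (\<lambda>y. \<phi> y (sng A x a y)) {y. sng A x a y \<noteq> \<one>\<^bsub>A\<^esub>} = \<phi> x a"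
    using fsg_ext_explicit(2)[OF assms(1,2), of J \<phi>] assms(3) by simp
qed (rule fsg_ext_explicit(1)[OF assms(1,2), of J \<phi>], rule assms(3))

section \<open>Abelian groups with a group action\<close>

text \<open>What remains of a module over the group ring when only monomials act;
  \<open>torsion\<close> is the trace left by the coefficients.\<close>

locale gact = A: comm_group A + G: comm_group G
  for G :: "'g monoid" and n :: nat and A :: "'a monoid" and \<alpha> :: "'g \<Rightarrow> 'a \<Rightarrow> 'a" +
  assumes act_hom: "g \<in> carrier G \<Longrightarrow> \<alpha> g \<in> hom A A"
    and act_one [simp]: "x \<in> carrier A \<Longrightarrow> \<alpha> \<one>\<^bsub>G\<^esub> x = x"
    and act_mult: "g \<in> carrier G \<Longrightarrow> h \<in> carrier G \<Longrightarrow> x \<in> carrier A \<Longrightarrow> \<alpha> (g \<otimes>\<^bsub>G\<^esub> h) x = \<alpha> g (\<alpha> h x)"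
    and torsion: "x \<in> carrier A \<Longrightarrow> x [^]\<^bsub>A\<^esub> int n = \<one>\<^bsub>A\<^esub>"
begin

lemma act_group_hom: "g \<in> carrier G \<Longrightarrow> group_hom A A (\<alpha> g)"
  by (simp add: act_hom group_hom_axioms_def group_hom_def)

lemma act_closed [simp, intro]: "g \<in> carrier G \<Longrightarrow> x \<in> carrier A \<Longrightarrow> \<alpha> g x \<in> carrier A"
  using act_hom hom_in_carrier by metis

lemma act_unit [simp]: "g \<in> carrier G \<Longrightarrow> \<alpha> g \<one>\<^bsub>A\<^esub> = \<one>\<^bsub>A\<^esub>"
  using group_hom.hom_one[OF act_group_hom] .

lemma act_m: "g \<in> carrier G \<Longrightarrow> x \<in> carrier A \<Longrightarrow> y \<in> carrier A \<Longrightarrow> \<alpha> g (x \<otimes>\<^bsub>A\<^esub> y) = \<alpha> g x \<otimes>\<^bsub>A\<^esub> \<alpha> g y"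
  using act_hom hom_mult by metis

lemma act_inv: "g \<in> carrier G \<Longrightarrow> x \<in> carrier A \<Longrightarrow> \<alpha> g (inv\<^bsub>A\<^esub> x) = inv\<^bsub>A\<^esub> (\<alpha> g x)"
  using group_hom.hom_inv[OF act_group_hom] .

lemma act_finprod:
  "g \<in> carrier G \<Longrightarrow> h \<in> S \<rightarrow> carrier A \<Longrightarrow> \<alpha> g (finprod A h S) = finprod A (\<lambda>x. \<alpha> g (h x)) S"
  using hom_finprod[OF A.comm_group_axioms A.comm_group_axioms act_hom] .

lemma act_l_inv [simp]: "g \<in> carrier G \<Longrightarrow> x \<in> carrier A \<Longrightarrow> \<alpha> (inv\<^bsub>G\<^esub> g) (\<alpha> g x) = x"
  by (simp add: act_mult[symmetric])

lemma act_r_inv [simp]: "g \<in> carrier G \<Longrightarrow> x \<in> carrier A \<Longrightarrow> \<alpha> g (\<alpha> (inv\<^bsub>G\<^esub> g) x) = x"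
  by (simp add: act_mult[symmetric])

lemma act_eq_unit: "g \<in> carrier G \<Longrightarrow> x \<in> carrier A \<Longrightarrow> \<alpha> g x = \<one>\<^bsub>A\<^esub> \<longleftrightarrow> x = \<one>\<^bsub>A\<^esub>"
  by (metis act_l_inv act_unit G.inv_closed)

end

text \<open>\<open>H\<close> is kept apart from the acting group, so that the cohomology of one and
  the same resolution can be taken with respect to smaller and larger subgroups.\<close>

definition ehom ::
  "'g set \<Rightarrow> 'a monoid \<Rightarrow> ('g \<Rightarrow> 'a \<Rightarrow> 'a) \<Rightarrow> 'b monoid \<Rightarrow> ('g \<Rightarrow> 'b \<Rightarrow> 'b) \<Rightarrow> ('a \<Rightarrow> 'b) set" where
  "ehom H A \<alpha> B \<beta> = {f \<in> hom A B. \<forall>h\<in>H. \<forall>x\<in>carrier A. f (\<alpha> h x) = \<beta> h (f x)}"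

lemma ehom_hom: "f \<in> ehom H A \<alpha> B \<beta> \<Longrightarrow> f \<in> hom A B"
  by (simp add: ehom_def)

lemma ehom_eq: "f \<in> ehom H A \<alpha> B \<beta> \<Longrightarrow> h \<in> H \<Longrightarrow> x \<in> carrier A \<Longrightarrow> f (\<alpha> h x) = \<beta> h (f x)"
  by (simp add: ehom_def)

lemma ehom_closed: "f \<in> ehom H A \<alpha> B \<beta> \<Longrightarrow> x \<in> carrier A \<Longrightarrow> f x \<in> carrier B"
  by (auto simp: ehom_def intro: hom_in_carrier)

lemma ehom_mono: "f \<in> ehom H A \<alpha> B \<beta> \<Longrightarrow> H' \<subseteq> H \<Longrightarrow> f \<in> ehom H' A \<alpha> B \<beta>"
  by (auto simp: ehom_def)

lemma hom_mult_fun: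
  assumes "comm_group B" "f \<in> hom A B" "g \<in> hom A B"
  shows "(\<lambda>x. f x \<otimes>\<^bsub>B\<^esub> g x) \<in> hom A B"
proof -
  interpret comm_group B by fact
  show ?thesis using assms(2,3)
    by (auto simp: hom_def Pi_iff m_ac)
qed

lemma hom_inv_fun:
  assumes "comm_group B" "f \<in> hom A B"
  shows "(\<lambda>x. inv\<^bsub>B\<^esub> (f x)) \<in> hom A B"
proof -
  interpret comm_group B by fact
  show ?thesis using assms(2)
    by (auto simp: hom_def Pi_iff inv_mult)
qed

lemma hom_comp_fun: "f \<in> hom A B \<Longrightarrow> g \<in> hom B C \<Longrightarrow> (\<lambda>x. g (f x)) \<in> hom A C"
  by (auto simp: hom_def Pi_iff)

lemma ehom_comp: "f \<in> ehom H A \<alpha> B \<beta> \<Longrightarrow> g \<in> ehom H B \<beta> C \<gamma> \<Longrightarrow> (\<lambda>x. g (f x)) \<in> ehom H A \<alpha> C \<gamma>"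
  unfolding ehom_def using hom_comp_fun[of f A B g C] hom_in_carrier[of f A B] by simp

lemma hom_equalizer:
  assumes "comm_group A" "comm_group B" "f \<in> hom A B" "g \<in> hom A B"
  shows "subgroup {x \<in> carrier A. f x = g x} A"
proof -
  interpret A: comm_group A by fact
  interpret B: comm_group B by fact
  interpret f: group_hom A B f using assms(3) by unfold_locales
  interpret g: group_hom A B g using assms(4) by unfold_locales
  show ?thesis by (rule A.subgroupI) (auto intro!: exI[of _ "\<one>\<^bsub>A\<^esub>"])
qed

section \<open>Free modules over the group ring\<close>

definition shift :: "'g monoid \<Rightarrow> 'a monoid \<Rightarrow> 'g \<Rightarrow> ('g \<Rightarrow> 'a) \<Rightarrow> ('g \<Rightarrow> 'a)" where
  "shift G A g f = (\<lambda>h. if h \<in> carrier G then f (inv\<^bsub>G\<^esub> g \<otimes>\<^bsub>G\<^esub> h) else \<one>\<^bsub>A\<^esub>)"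

lemma gact_shift:
  assumes "comm_group G" "comm_group A" and tors: "\<And>x. x \<in> carrier A \<Longrightarrow> x [^]\<^bsub>A\<^esub> int n = \<one>\<^bsub>A\<^esub>"
  shows "gact G n (fsg (carrier G) A) (shift G A)"
proof -
  interpret G: comm_group G by fact
  interpret A: comm_group A by fact
  interpret F: comm_group "fsg (carrier G) A" by (rule fsg_comm_group) fact
  show ?thesis
  proof
    fix g assume g: "g \<in> carrier G"
    show "shift G A g \<in> hom (fsg (carrier G) A) (fsg (carrier G) A)"
    proof (rule homI)
      fix x assume x: "x \<in> carrier (fsg (carrier G) A)"
      show "shift G A g x \<in> carrier (fsg (carrier G) A)"
      proof (rule fsgI[where S="(\<lambda>h. g \<otimes>\<^bsub>G\<^esub> h) ` {h. x h \<noteq> \<one>\<^bsub>A\<^esub>}"])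
        fix h assume "shift G A g x h \<noteq> \<one>\<^bsub>A\<^esub>"
        then have h: "h \<in> carrier G" "x (inv\<^bsub>G\<^esub> g \<otimes>\<^bsub>G\<^esub> h) \<noteq> \<one>\<^bsub>A\<^esub>" by (auto simp: shift_def split: if_splits)
        then have "h = g \<otimes>\<^bsub>G\<^esub> (inv\<^bsub>G\<^esub> g \<otimes>\<^bsub>G\<^esub> h)" using g by (simp add: G.m_assoc[symmetric])
        then show "h \<in> (\<lambda>h. g \<otimes>\<^bsub>G\<^esub> h) ` {h. x h \<noteq> \<one>\<^bsub>A\<^esub>}" using h by blast
        show "h \<in> carrier G" by fact
      qed (use x fsg_app[OF x] fsg_fin[OF x] in \<open>auto simp: shift_def\<close>)
      fix y assume "y \<in> carrier (fsg (carrier G) A)"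
      show "shift G A g (x \<otimes>\<^bsub>fsg (carrier G) A\<^esub> y) = shift G A g x \<otimes>\<^bsub>fsg (carrier G) A\<^esub> shift G A g y"
        by (auto simp: fsg_mult shift_def)
    qed
    fix h x assume h: "h \<in> carrier G" and x: "x \<in> carrier (fsg (carrier G) A)"
    show "shift G A (g \<otimes>\<^bsub>G\<^esub> h) x = shift G A g (shift G A h x)"
      using g h by (auto simp: shift_def fun_eq_iff G.inv_mult G.m_ac)
  next
    fix x assume x: "x \<in> carrier (fsg (carrier G) A)"
    then show "shift G A \<one>\<^bsub>G\<^esub> x = x" using fsg_out[OF x] by (auto simp: shift_def fun_eq_iff)
    show "x [^]\<^bsub>fsg (carrier G) A\<^esub> int n = \<one>\<^bsub>fsg (carrier G) A\<^esub>"
      using assms fsg_app[OF x] x by (auto simp: fun_eq_iff fsg_int_pow fsg_one)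
  qed
qed

lemma gact_fsg:
  assumes "gact G n A \<alpha>"
  shows "gact G n (fsg B A) (\<lambda>g f b. \<alpha> g (f b))"
proof -
  interpret A: gact G n A \<alpha> by fact
  interpret F: comm_group "fsg B A" by (rule fsg_comm_group) (rule A.A.comm_group_axioms)
  show ?thesis
  proof
    fix g assume g: "g \<in> carrier G"
    show "(\<lambda>f b. \<alpha> g (f b)) \<in> hom (fsg B A) (fsg B A)"
    proof (rule homI)
      fix x assume x: "x \<in> carrier (fsg B A)"
      show "(\<lambda>b. \<alpha> g (x b)) \<in> carrier (fsg B A)"
        using fsg_app[OF x] fsg_fin[OF x] fsg_out[OF x] g
        by (intro fsgI[where S="{b. x b \<noteq> \<one>\<^bsub>A\<^esub>}"]) (auto simp: A.act_eq_unit)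
      fix y assume y: "y \<in> carrier (fsg B A)"
      show "(\<lambda>b. \<alpha> g ((x \<otimes>\<^bsub>fsg B A\<^esub> y) b)) = (\<lambda>b. \<alpha> g (x b)) \<otimes>\<^bsub>fsg B A\<^esub> (\<lambda>b. \<alpha> g (y b))"
        using fsg_app[OF x] fsg_app[OF y] g by (auto simp: fsg_mult A.act_m)
    qed
    fix h x assume "h \<in> carrier G" and x: "x \<in> carrier (fsg B A)"
    then show "(\<lambda>b. \<alpha> (g \<otimes>\<^bsub>G\<^esub> h) (x b)) = (\<lambda>b. \<alpha> g (\<alpha> h (x b)))"
      using g fsg_app[OF x] by (auto simp: A.act_mult)
  next
    fix x assume x: "x \<in> carrier (fsg B A)"
    then show "(\<lambda>b. \<alpha> \<one>\<^bsub>G\<^esub> (x b)) = x" using fsg_app[OF x] by auto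
    show "x [^]\<^bsub>fsg B A\<^esub> int n = \<one>\<^bsub>fsg B A\<^esub>"
      using fsg_app[OF x] x by (auto simp: fun_eq_iff fsg_int_pow fsg_one A.torsion A.A.comm_group_axioms)
  qed
qed

lemma shift_sng:
  assumes "comm_group G" "g \<in> carrier G" "h \<in> carrier G"
  shows "shift G A g (sng A h a) = sng A (g \<otimes>\<^bsub>G\<^esub> h) a"
proof -
  interpret comm_group G by fact
  have "inv\<^bsub>G\<^esub> g \<otimes>\<^bsub>G\<^esub> x = h \<longleftrightarrow> x = g \<otimes>\<^bsub>G\<^esub> h" if "x \<in> carrier G" for x
    using assms that by (metis inv_solve_left)
  then show ?thesis using assms by (auto simp: shift_def sng_def fun_eq_iff)
qed

definition RG :: "'g monoid \<Rightarrow> nat \<Rightarrow> ('g \<Rightarrow> int set) monoid" where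
  "RG G n = fsg (carrier G) (amon (Zmod n))"

definition rsh :: "'g monoid \<Rightarrow> nat \<Rightarrow> 'g \<Rightarrow> ('g \<Rightarrow> int set) \<Rightarrow> ('g \<Rightarrow> int set)" where
  "rsh G n = shift G (amon (Zmod n))"

definition FR :: "'g monoid \<Rightarrow> nat \<Rightarrow> 'u set \<Rightarrow> ('u \<Rightarrow> 'g \<Rightarrow> int set) monoid" where
  "FR G n B = fsg B (RG G n)"

definition fsh :: "'g monoid \<Rightarrow> nat \<Rightarrow> 'g \<Rightarrow> ('u \<Rightarrow> 'g \<Rightarrow> int set) \<Rightarrow> ('u \<Rightarrow> 'g \<Rightarrow> int set)" where
  "fsh G n g f = (\<lambda>b. rsh G n g (f b))"

text \<open>The monomial of \<open>g\<close> times the basis vector \<open>b\<close>. Over the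
  integers modulo \<open>n\<close> alone, \<open>FR G n B\<close> is free on these elements, which
  is the content of \<open>FR_induct\<close> and \<open>FR_ext\<close>.\<close>

definition bas :: "'g monoid \<Rightarrow> nat \<Rightarrow> 'u \<Rightarrow> 'g \<Rightarrow> ('u \<Rightarrow> 'g \<Rightarrow> int set)" where
  "bas G n b g = sng (RG G n) b (sng (amon (Zmod n)) g (zc n 1))"

lemma gact_RG: "comm_group G \<Longrightarrow> gact G n (RG G n) (rsh G n)"
  unfolding RG_def rsh_def by (rule gact_shift) (auto simp: comm_group_Zmod Zmod_torsion)

lemma gact_FR: "comm_group G \<Longrightarrow> gact G n (FR G n B) (fsh G n)"
  unfolding FR_def fsh_def[abs_def] by (rule gact_fsg) (rule gact_RG)

lemma comm_group_RG: "comm_group (RG G n)"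
  unfolding RG_def by (intro fsg_comm_group comm_group_Zmod)

lemma comm_group_FR: "comm_group (FR G n B)"
  unfolding FR_def by (intro fsg_comm_group comm_group_RG)

lemma bas_closed [simp]: "b \<in> B \<Longrightarrow> g \<in> carrier G \<Longrightarrow> bas G n b g \<in> carrier (FR G n B)"
  unfolding bas_def FR_def RG_def by (intro sng_closed fsg_comm_group comm_group_Zmod) auto

lemma fsh_bas:
  assumes "comm_group G" "g \<in> carrier G" "h \<in> carrier G"
  shows "fsh G n g (bas G n b h) = bas G n b (g \<otimes>\<^bsub>G\<^esub> h)"
proof -
  interpret gact G n "RG G n" "rsh G n" using assms gact_RG by blast
  have "rsh G n g (sng (RG G n) b a b') = sng (RG G n) b (rsh G n g a) b'" for a b'
    using assms by (auto simp: sng_def)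
  then show ?thesis
    using assms by (simp add: fsh_def bas_def rsh_def shift_sng)
qed

lemma FR_induct:
  assumes U: "subgroup U (FR G n B)" and bU: "\<And>b g. b \<in> B \<Longrightarrow> g \<in> carrier G \<Longrightarrow> bas G n b g \<in> U"
    and v: "v \<in> carrier (FR G n B)"
  shows "v \<in> U"
proof -
  interpret F: comm_group "FR G n B" by (rule comm_group_FR)
  interpret R: comm_group "RG G n" by (rule comm_group_RG)
  show ?thesis
  proof (rule fsg_induct[of "RG G n" U B])
    show "comm_group (RG G n)" by (rule comm_group_RG)
    show "subgroup U (fsg B (RG G n))" "v \<in> carrier (fsg B (RG G n))" using U v by (auto simp: FR_def)
    fix b a assume b: "b \<in> B" and a: "a \<in> carrier (RG G n)"
    have hom: "sng (RG G n) b \<in> hom (RG G n) (FR G n B)"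
      unfolding FR_def by (rule sng_hom) (auto simp: b comm_group_RG)
    interpret s: group_hom "RG G n" "FR G n B" "sng (RG G n) b" using hom by unfold_locales
    let ?V = "{a \<in> carrier (RG G n). sng (RG G n) b a \<in> U}"
    have V: "subgroup ?V (RG G n)"
      by (rule R.subgroupI)
        (auto intro: exI[of _ "\<one>\<^bsub>RG G n\<^esub>"] simp: subgroup.one_closed[OF U] subgroup.m_inv_closed[OF U] subgroup.m_closed[OF U])
    have "a \<in> ?V"
    proof (rule fsg_induct[of "amon (Zmod n)" _ "carrier G"])
      show "subgroup ?V (fsg (carrier G) (amon (Zmod n)))" "a \<in> carrier (fsg (carrier G) (amon (Zmod n)))"
        using V a by (auto simp: RG_def)
      fix g z assume g: "g \<in> carrier G" and z: "z \<in> carrier (amon (Zmod n))"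
      have "sng (amon (Zmod n)) g \<in> hom (amon (Zmod n)) (RG G n)"
        unfolding RG_def by (rule sng_hom) (auto simp: g comm_group_Zmod)
      then interpret t: group_hom "amon (Zmod n)" "RG G n" "sng (amon (Zmod n)) g"
        using comm_group_Zmod by (simp add: group_hom_def group_hom_axioms_def comm_group.axioms)
      have "sng (amon (Zmod n)) g (zc n 1) \<in> ?V" using bU[OF b g] by (auto simp: bas_def)
      then have "sng (amon (Zmod n)) g (zc n 1) [^]\<^bsub>RG G n\<^esub> zrep n z \<in> ?V"
        using R.subgroup_int_pow_closed[OF V] by blast
      also have "sng (amon (Zmod n)) g (zc n 1) [^]\<^bsub>RG G n\<^esub> zrep n z = sng (amon (Zmod n)) g z"
        using z by (simp add: t.hom_int_pow[symmetric] zc_pow zc_zrep)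
      finally show "sng (amon (Zmod n)) g z \<in> ?V" .
    qed (rule comm_group_Zmod)
    then show "sng (RG G n) b a \<in> U" by blast
  qed
qed

lemma FR_hom_eq:
  assumes "comm_group A" "f \<in> hom (FR G n B) A" "f' \<in> hom (FR G n B) A"
    "\<And>b g. b \<in> B \<Longrightarrow> g \<in> carrier G \<Longrightarrow> f (bas G n b g) = f' (bas G n b g)"
    and "v \<in> carrier (FR G n B)"
  shows "f v = f' v"
  using FR_induct[OF hom_equalizer[OF comm_group_FR assms(1-3)], of v] assms by auto

lemma FR_ext:
  assumes A: "comm_group A" and tors: "\<And>x. x \<in> carrier A \<Longrightarrow> x [^]\<^bsub>A\<^esub> int n = \<one>\<^bsub>A\<^esub>"
    and val: "\<And>b g. b \<in> B \<Longrightarrow> g \<in> carrier G \<Longrightarrow> val b g \<in> carrier A"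
  shows "\<exists>f\<in>hom (FR G n B) A. \<forall>b\<in>B. \<forall>g\<in>carrier G. f (bas G n b g) = val b g"
proof -
  interpret A: comm_group A by fact
  have "\<forall>b\<in>B. \<exists>\<phi>\<in>hom (RG G n) A. \<forall>g\<in>carrier G. \<forall>z\<in>carrier (amon (Zmod n)).
      \<phi> (sng (amon (Zmod n)) g z) = val b g [^]\<^bsub>A\<^esub> zrep n z"
    unfolding RG_def
    by (intro ballI fsg_ext[OF comm_group_Zmod A] zmod_ext[OF A] val tors)
  then obtain \<phi> where \<phi>: "\<And>b. b \<in> B \<Longrightarrow> \<phi> b \<in> hom (RG G n) A"
    "\<And>b g z. b \<in> B \<Longrightarrow> g \<in> carrier G \<Longrightarrow> z \<in> carrier (amon (Zmod n)) \<Longrightarrow>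
      \<phi> b (sng (amon (Zmod n)) g z) = val b g [^]\<^bsub>A\<^esub> zrep n z"
    by metis
  obtain f where f: "f \<in> hom (FR G n B) A" "\<And>b a. b \<in> B \<Longrightarrow> a \<in> carrier (RG G n) \<Longrightarrow> f (sng (RG G n) b a) = \<phi> b a"
    using fsg_ext[OF comm_group_RG A, of B \<phi> G n] \<phi>(1) unfolding FR_def by blast
  have "f (bas G n b g) = val b g" if "b \<in> B" "g \<in> carrier G" for b g
  proof -
    have "sng (amon (Zmod n)) g (zc n 1) \<in> carrier (RG G n)"
      unfolding RG_def by (rule sng_closed) (auto simp: that comm_group_Zmod)
    then show ?thesis
      using that val torsion_zrep[OF A val[OF that] tors, of 1]
      by (simp add: bas_def f \<phi> that tors)
  qed
  then show ?thesis using f by blast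
qed

lemma FR_ehomI:
  assumes "gact G n A \<alpha>" "H \<subseteq> carrier G" "f \<in> hom (FR G n B) A"
    and eq: "\<And>b g h. b \<in> B \<Longrightarrow> g \<in> carrier G \<Longrightarrow> h \<in> H \<Longrightarrow> f (bas G n b (h \<otimes>\<^bsub>G\<^esub> g)) = \<alpha> h (f (bas G n b g))"
  shows "f \<in> ehom H (FR G n B) (fsh G n) A \<alpha>"
proof -
  interpret gact G n A \<alpha> by fact
  interpret F: gact G n "FR G n B" "fsh G n" by (rule gact_FR) (rule G.comm_group_axioms)
  have "f (fsh G n h v) = \<alpha> h (f v)" if h: "h \<in> H" and v: "v \<in> carrier (FR G n B)" for h v
  proof (rule FR_hom_eq[OF A.comm_group_axioms _ _ _ v])
    have hG: "h \<in> carrier G" using h assms by auto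
    show "(\<lambda>v. f (fsh G n h v)) \<in> hom (FR G n B) A"
      by (rule hom_comp_fun[OF F.act_hom assms(3)]) (rule hG)
    show "(\<lambda>v. \<alpha> h (f v)) \<in> hom (FR G n B) A"
      by (rule hom_comp_fun[OF assms(3) act_hom]) (rule hG)
    show "f (fsh G n h (bas G n b g)) = \<alpha> h (f (bas G n b g))" if "b \<in> B" "g \<in> carrier G" for b g
      using that eq h hG by (simp add: fsh_bas G.comm_group_axioms)
  qed
  then show ?thesis using assms by (simp add: ehom_def)
qed

text \<open>The normalisation \<open>\<alpha> g (w b g)\<close> turns equivariance of the values
  under \<open>H\<close> into invariance of \<open>w\<close> under translation by \<open>H\<close>.
  Prescribing an equivariant map then amounts to prescribing, for each \<open>b\<close>, a function
  on the cosets of \<open>H\<close>.\<close>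

lemma FR_ehom_ext:
  assumes A: "gact G n A \<alpha>" and H: "H \<subseteq> carrier G"
    and w: "\<And>b g. b \<in> B \<Longrightarrow> g \<in> carrier G \<Longrightarrow> w b g \<in> carrier A"
    and wH: "\<And>b g h. b \<in> B \<Longrightarrow> g \<in> carrier G \<Longrightarrow> h \<in> H \<Longrightarrow> w b (h \<otimes>\<^bsub>G\<^esub> g) = w b g"
  shows "\<exists>u\<in>ehom H (FR G n B) (fsh G n) A \<alpha>. \<forall>b\<in>B. \<forall>g\<in>carrier G. u (bas G n b g) = \<alpha> g (w b g)"
proof -
  interpret gact G n A \<alpha> by fact
  obtain u where u: "u \<in> hom (FR G n B) A" "\<And>b g. b \<in> B \<Longrightarrow> g \<in> carrier G \<Longrightarrow> u (bas G n b g) = \<alpha> g (w b g)"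
    using FR_ext[OF A.comm_group_axioms torsion, where val="\<lambda>b g. \<alpha> g (w b g)" and B=B and G=G] w by auto
  have "u \<in> ehom H (FR G n B) (fsh G n) A \<alpha>"
    by (rule FR_ehomI[OF A H u(1)])
      (use H w wH in \<open>auto simp: u(2) subset_iff act_mult\<close>)
  then show ?thesis using u by blast
qed

section \<open>Extending homomorphisms\<close>

text \<open>The domain is cut down to the image because \<open>q\<close> need not be surjective;
  going beyond the image is the task of \<open>hom_extend\<close>.\<close>

lemma hom_factor:
  assumes "comm_group A" "comm_group B" "comm_group C" "q \<in> hom A B" "f \<in> hom A C"
    and ker: "\<And>x. x \<in> carrier A \<Longrightarrow> q x = \<one>\<^bsub>B\<^esub> \<Longrightarrow> f x = \<one>\<^bsub>C\<^esub>"
  shows "\<exists>f'. f' \<in> hom (B\<lparr>carrier := q ` carrier A\<rparr>) C \<and> (\<forall>x\<in>carrier A. f' (q x) = f x)"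
proof -
  interpret A: comm_group A by fact
  interpret B: comm_group B by fact
  interpret C: comm_group C by fact
  interpret q: group_hom A B q using assms(4) by unfold_locales
  interpret f: group_hom A C f using assms(5) by unfold_locales
  define f' where "f' = (\<lambda>y. f (inv_into (carrier A) q y))"
  have f': "f' (q x) = f x" if x: "x \<in> carrier A" for x
  proof -
    let ?y = "inv_into (carrier A) q (q x)"
    have y: "?y \<in> carrier A" "q ?y = q x" using x by (auto intro: inv_into_into f_inv_into_f)
    then have "q (x \<otimes>\<^bsub>A\<^esub> inv\<^bsub>A\<^esub> ?y) = \<one>\<^bsub>B\<^esub>" using x by simp
    then have "f (x \<otimes>\<^bsub>A\<^esub> inv\<^bsub>A\<^esub> ?y) = \<one>\<^bsub>C\<^esub>" using x y by (intro ker) auto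
    then have "f x \<otimes>\<^bsub>C\<^esub> inv\<^bsub>C\<^esub> (f ?y) = \<one>\<^bsub>C\<^esub>" using x y by simp
    then have "f x = f ?y" using x y by (metis C.inv_equality C.inv_inv f.hom_closed C.inv_closed)
    then show ?thesis by (simp add: f'_def)
  qed
  have "f' \<in> hom (B\<lparr>carrier := q ` carrier A\<rparr>) C"
  proof (rule homI)
    fix y assume "y \<in> carrier (B\<lparr>carrier := q ` carrier A\<rparr>)"
    then obtain x where x: "x \<in> carrier A" "y = q x" by auto
    then show "f' y \<in> carrier C" by (simp add: f')
    fix y' assume "y' \<in> carrier (B\<lparr>carrier := q ` carrier A\<rparr>)"
    then obtain x' where x': "x' \<in> carrier A" "y' = q x'" by auto
    have "q x \<otimes>\<^bsub>B\<^esub> q x' = q (x \<otimes>\<^bsub>A\<^esub> x')" using x x' by simp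
    then show "f' (y \<otimes>\<^bsub>B\<lparr>carrier := q ` carrier A\<rparr>\<^esub> y') = f' y \<otimes>\<^bsub>C\<^esub> f' y'"
      using x x' f'[of "x \<otimes>\<^bsub>A\<^esub> x'"] by (simp add: f')
  qed
  then show ?thesis using f' by blast
qed

text \<open>Baer's criterion for groups of exponent \<open>n\<close>; partial homomorphisms are represented by their graphs.\<close>

lemma hom_extend:
  assumes V: "comm_group V" and N: "comm_group N" and n: "n > 0"
    and tors: "\<And>x. x \<in> carrier V \<Longrightarrow> x [^]\<^bsub>V\<^esub> int n = \<one>\<^bsub>V\<^esub>"
    and div: "\<And>z d. z \<in> carrier N \<Longrightarrow> int d dvd int n \<Longrightarrow> z [^]\<^bsub>N\<^esub> (int n div int d) = \<one>\<^bsub>N\<^esub> \<Longrightarrow>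
      \<exists>y\<in>carrier N. y [^]\<^bsub>N\<^esub> int d = z"
    and W: "subgroup W V" and f: "f \<in> hom (V\<lparr>carrier := W\<rparr>) N"
  shows "\<exists>g\<in>hom V N. \<forall>x\<in>W. g x = f x"
proof -
  interpret V: comm_group V by fact
  interpret N: comm_group N by fact
  interpret W: subgroup W V by fact
  interpret VN: group "V \<times>\<times> N" by (intro DirProd_group) unfold_locales
  have fW: "group_hom (V\<lparr>carrier := W\<rparr>) N f"
    using f V.subgroup_imp_group[OF W] by (simp add: group_hom_def group_hom_axioms_def)
  have f1: "f \<one>\<^bsub>V\<^esub> = \<one>\<^bsub>N\<^esub>" using group_hom.hom_one[OF fW] by simp
  have finv: "f (inv\<^bsub>V\<^esub> x) = inv\<^bsub>N\<^esub> (f x)" if "x \<in> W" for x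
    using group_hom.hom_inv[OF fW, of x] that V.m_inv_consistent[OF W that] by simp
  have fc: "f x \<in> carrier N" if "x \<in> W" for x using f that by (auto simp: hom_def)
  have fm: "f (x \<otimes>\<^bsub>V\<^esub> y) = f x \<otimes>\<^bsub>N\<^esub> f y" if "x \<in> W" "y \<in> W" for x y
    using f that by (auto simp: hom_def)
  let ?gr = "(\<lambda>x. (x, f x)) ` W"
  define \<A> where "\<A> = {r. ?gr \<subseteq> r \<and> subgroup r (V \<times>\<times> N) \<and> (\<forall>w. (\<one>\<^bsub>V\<^esub>, w) \<in> r \<longrightarrow> w = \<one>\<^bsub>N\<^esub>)}"
  have "?gr \<in> \<A>"
  proof -
    have "subgroup ?gr (V \<times>\<times> N)"
    proof (rule VN.subgroupI)
      fix p assume "p \<in> ?gr"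
      then obtain x where "x \<in> W" "p = (x, f x)" by auto
      then show "inv\<^bsub>V \<times>\<times> N\<^esub> p \<in> ?gr"
        using fc[of x] finv[of x] by (auto simp: inv_DirProd V.group_axioms N.group_axioms W.mem_carrier)
    next
      fix p p' assume "p \<in> ?gr" "p' \<in> ?gr"
      then obtain x y where xy: "x \<in> W" "y \<in> W" "p = (x, f x)" "p' = (y, f y)" by auto
      then have "p \<otimes>\<^bsub>V \<times>\<times> N\<^esub> p' = (\<lambda>x. (x, f x)) (x \<otimes>\<^bsub>V\<^esub> y)" using fm by simp
      then show "p \<otimes>\<^bsub>V \<times>\<times> N\<^esub> p' \<in> ?gr" using xy by blast
    next
      show "?gr \<noteq> {}" using W.one_closed by blast
    qed (use fc W.mem_carrier in auto)
    then show ?thesis using f1 by (auto simp: \<A>_def)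
  qed
  have "\<exists>M\<in>\<A>. \<forall>r\<in>\<A>. M \<subseteq> r \<longrightarrow> r = M"
  proof (rule subset_Zorn_nonempty)
    show "\<A> \<noteq> {}" using \<open>?gr \<in> \<A>\<close> by blast
    fix \<C> assume C: "\<C> \<noteq> {}" "subset.chain \<A> \<C>"
    then have sub: "subgroup r (V \<times>\<times> N)" if "r \<in> \<C>" for r
      using that by (auto simp: subset.chain_def \<A>_def)
    have "subgroup (\<Union>\<C>) (V \<times>\<times> N)"
    proof (rule VN.subgroupI)
      show "\<Union>\<C> \<subseteq> carrier (V \<times>\<times> N)" using sub subgroup.subset by blast
      show "\<Union>\<C> \<noteq> {}" using C sub subgroup.one_closed by blast
      fix p assume "p \<in> \<Union>\<C>"
      then show "inv\<^bsub>V \<times>\<times> N\<^esub> p \<in> \<Union>\<C>" using sub subgroup.m_inv_closed by (metis UnionE UnionI)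
    next
      fix p q assume "p \<in> \<Union>\<C>" "q \<in> \<Union>\<C>"
      then obtain r s where rs: "r \<in> \<C>" "s \<in> \<C>" "p \<in> r" "q \<in> s" by auto
      then have "r \<subseteq> s \<or> s \<subseteq> r" using C(2) unfolding subset.chain_def by blast
      then show "p \<otimes>\<^bsub>V \<times>\<times> N\<^esub> q \<in> \<Union>\<C>"
        using rs sub[OF rs(1)] sub[OF rs(2)] by (metis UnionI subgroup.m_closed subsetD)
    qed
    moreover have "?gr \<subseteq> \<Union>\<C>" using C unfolding subset.chain_def \<A>_def by blast
    moreover have "\<forall>w. (\<one>\<^bsub>V\<^esub>, w) \<in> \<Union>\<C> \<longrightarrow> w = \<one>\<^bsub>N\<^esub>" using C unfolding subset.chain_def \<A>_def by blast
    ultimately show "\<Union>\<C> \<in> \<A>" by (simp add: \<A>_def)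
  qed
  then obtain M where M: "M \<in> \<A>" and max: "\<And>r. r \<in> \<A> \<Longrightarrow> M \<subseteq> r \<Longrightarrow> r = M" by blast
  have Msub: "subgroup M (V \<times>\<times> N)" and Mgr: "?gr \<subseteq> M" and M1: "\<And>w. (\<one>\<^bsub>V\<^esub>, w) \<in> M \<Longrightarrow> w = \<one>\<^bsub>N\<^esub>"
    using M by (auto simp: \<A>_def)
  have Mc: "x \<in> carrier V" "w \<in> carrier N" if "(x, w) \<in> M" for x w
    using subgroup.subset[OF Msub] that by auto
  have Mm: "(x \<otimes>\<^bsub>V\<^esub> x', w \<otimes>\<^bsub>N\<^esub> w') \<in> M" if "(x, w) \<in> M" "(x', w') \<in> M" for x x' w w'
    using subgroup.m_closed[OF Msub that] by simp
  have Minv: "(inv\<^bsub>V\<^esub> x, inv\<^bsub>N\<^esub> w) \<in> M" if "(x, w) \<in> M" for x w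
    using subgroup.m_inv_closed[OF Msub that] Mc[OF that] by (simp add: inv_DirProd V.group_axioms N.group_axioms)
  have Mone: "(\<one>\<^bsub>V\<^esub>, \<one>\<^bsub>N\<^esub>) \<in> M" using subgroup.one_closed[OF Msub] by simp
  have Mnp: "(x [^]\<^bsub>V\<^esub> k, w [^]\<^bsub>N\<^esub> k) \<in> M" if "(x, w) \<in> M" for x w and k :: nat
    using that by (induction k) (auto simp: Mone Mm)
  have Mp: "(x [^]\<^bsub>V\<^esub> k, w [^]\<^bsub>N\<^esub> k) \<in> M" if "(x, w) \<in> M" for x w and k :: int
    unfolding int_pow_def2 using Mnp[OF that] Minv[OF Mnp[OF that]] by presburger
  have Muniq: "w = w'" if "(x, w) \<in> M" "(x, w') \<in> M" for x w w'
  proof -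
    have "(x \<otimes>\<^bsub>V\<^esub> inv\<^bsub>V\<^esub> x, w \<otimes>\<^bsub>N\<^esub> inv\<^bsub>N\<^esub> w') \<in> M" using that by (intro Mm Minv)
    then have "w \<otimes>\<^bsub>N\<^esub> inv\<^bsub>N\<^esub> w' = \<one>\<^bsub>N\<^esub>" using that Mc by (intro M1) auto
    then show ?thesis using that Mc by (metis N.inv_equality N.inv_inv N.inv_closed)
  qed
  have dom: "Domain M = carrier V"
  proof (rule ccontr)
    assume "Domain M \<noteq> carrier V"
    then obtain v where v: "v \<in> carrier V" "v \<notin> Domain M" using Mc by blast
    \<comment> \<open>The order of \<open>v\<close> modulo the domain. An extension has to send
      \<open>v\<close> to a \<open>d\<close>-th root of \<open>z\<close>, the value at
      \<open>v^d\<close>; the torsion of \<open>V\<close> forces \<open>z^(n/d) = 1\<close>, which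
      is exactly the condition under which \<open>div\<close> provides a root.\<close>
    define d where "d = (LEAST d::nat. d > 0 \<and> v [^]\<^bsub>V\<^esub> int d \<in> Domain M)"
    have ex: "n > 0 \<and> v [^]\<^bsub>V\<^esub> int n \<in> Domain M" using n v tors Mone by auto
    have d: "d > 0" "v [^]\<^bsub>V\<^esub> int d \<in> Domain M" using LeastI[of "\<lambda>d. d > 0 \<and> v [^]\<^bsub>V\<^esub> int d \<in> Domain M" n] ex unfolding d_def by blast+
    have dmin: "\<not> (e > 0 \<and> v [^]\<^bsub>V\<^esub> int e \<in> Domain M)" if "e < d" for e
      using not_less_Least that unfolding d_def by blast
    obtain z where z: "(v [^]\<^bsub>V\<^esub> int d, z) \<in> M" using d by auto
    have ddvd: "int d dvd a" if a: "v [^]\<^bsub>V\<^esub> a \<in> Domain M" for a :: int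
    proof -
      obtain y where y: "(v [^]\<^bsub>V\<^esub> a, y) \<in> M" using a by auto
      have "v [^]\<^bsub>V\<^esub> (a mod int d) = v [^]\<^bsub>V\<^esub> a \<otimes>\<^bsub>V\<^esub> (v [^]\<^bsub>V\<^esub> int d) [^]\<^bsub>V\<^esub> (- (a div int d))"
      proof -
        have "a mod int d = a + int d * (- (a div int d))"
          using mult_div_mod_eq[of "int d" a] by linarith
        then show ?thesis using v by (simp only: V.int_pow_mult V.int_pow_pow V.int_pow_closed)
      qed
      then have vD: "v [^]\<^bsub>V\<^esub> (a mod int d) \<in> Domain M"
        using Mm[OF y Mp[OF z]] by (metis DomainI)
      have nn: "int (nat (a mod int d)) = a mod int d" using d by simp
      have "nat (a mod int d) < d" using d by (simp add: nat_less_iff)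
      from dmin[OF this] have "nat (a mod int d) = 0" unfolding nn using vD by simp
      with nn have "a mod int d = 0" by simp
      then show ?thesis by (simp only: dvd_eq_mod_eq_0)
    qed
    have dn: "int d dvd int n" using ex by (intro ddvd) auto
    have "(v [^]\<^bsub>V\<^esub> int d) [^]\<^bsub>V\<^esub> (int n div int d) = \<one>\<^bsub>V\<^esub>"
      using v dn tors by (simp add: V.int_pow_pow del: of_nat_dvd_iff)
    then have "z [^]\<^bsub>N\<^esub> (int n div int d) = \<one>\<^bsub>N\<^esub>" using Mp[OF z, of "int n div int d"] M1 by simp
    then obtain y where y: "y \<in> carrier N" "y [^]\<^bsub>N\<^esub> int d = z" using div[OF Mc(2)[OF z] dn] by auto
    define M' where "M' = {(x \<otimes>\<^bsub>V\<^esub> v [^]\<^bsub>V\<^esub> k, w \<otimes>\<^bsub>N\<^esub> y [^]\<^bsub>N\<^esub> k) | x w (k::int). (x, w) \<in> M}"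
    have MM': "M \<subseteq> M'"
    proof
      fix p assume "p \<in> M"
      then show "p \<in> M'" unfolding M'_def
        using Mc by (cases p) (auto intro!: exI[of _ 0] exI[of _ "fst p"] exI[of _ "snd p"])
    qed
    have "subgroup M' (V \<times>\<times> N)"
    proof (rule VN.subgroupI)
      show "M' \<subseteq> carrier (V \<times>\<times> N)" using Mc v y by (auto simp: M'_def)
      show "M' \<noteq> {}" using Mone MM' by blast
      fix p assume "p \<in> M'"
      then obtain x w k where p: "p = (x \<otimes>\<^bsub>V\<^esub> v [^]\<^bsub>V\<^esub> k, w \<otimes>\<^bsub>N\<^esub> y [^]\<^bsub>N\<^esub> (k::int))" "(x, w) \<in> M"
        by (auto simp: M'_def)
      then have "inv\<^bsub>V \<times>\<times> N\<^esub> p = (inv\<^bsub>V\<^esub> x \<otimes>\<^bsub>V\<^esub> v [^]\<^bsub>V\<^esub> (-k), inv\<^bsub>N\<^esub> w \<otimes>\<^bsub>N\<^esub> y [^]\<^bsub>N\<^esub> (-k))"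
        using Mc[OF p(2)] v y
        by (simp add: inv_DirProd V.group_axioms N.group_axioms V.inv_mult N.inv_mult V.int_pow_neg N.int_pow_neg)
      then show "inv\<^bsub>V \<times>\<times> N\<^esub> p \<in> M'" using Minv[OF p(2)] by (auto simp: M'_def)
      fix p' assume "p' \<in> M'"
      then obtain x' w' k' where p': "p' = (x' \<otimes>\<^bsub>V\<^esub> v [^]\<^bsub>V\<^esub> k', w' \<otimes>\<^bsub>N\<^esub> y [^]\<^bsub>N\<^esub> (k'::int))" "(x', w') \<in> M"
        by (auto simp: M'_def)
      have "p \<otimes>\<^bsub>V \<times>\<times> N\<^esub> p' = ((x \<otimes>\<^bsub>V\<^esub> x') \<otimes>\<^bsub>V\<^esub> v [^]\<^bsub>V\<^esub> (k + k'), (w \<otimes>\<^bsub>N\<^esub> w') \<otimes>\<^bsub>N\<^esub> y [^]\<^bsub>N\<^esub> (k + k'))"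
        using p p' Mc[OF p(2)] Mc[OF p'(2)] v y by (simp add: V.int_pow_mult N.int_pow_mult V.m_ac N.m_ac)
      then show "p \<otimes>\<^bsub>V \<times>\<times> N\<^esub> p' \<in> M'" using Mm[OF p(2) p'(2)] by (auto simp: M'_def)
    qed
    \<comment> \<open>Single-valuedness of the enlarged graph: a power of \<open>v\<close> lies in
      the domain only if its exponent is divisible by \<open>d\<close>, and there the root
      \<open>y\<close> agrees with the old values.\<close>
    moreover have "w = \<one>\<^bsub>N\<^esub>" if w: "(\<one>\<^bsub>V\<^esub>, w) \<in> M'" for w
    proof -
      obtain x u k where x: "\<one>\<^bsub>V\<^esub> = x \<otimes>\<^bsub>V\<^esub> v [^]\<^bsub>V\<^esub> k" "w = u \<otimes>\<^bsub>N\<^esub> y [^]\<^bsub>N\<^esub> (k::int)" "(x, u) \<in> M"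
        using w unfolding M'_def by blast
      then have xv: "x = v [^]\<^bsub>V\<^esub> (-k)" using Mc[OF x(3)] v
        by (metis V.int_pow_closed V.int_pow_neg V.inv_equality V.inv_inv)
      then obtain q where q: "-k = int d * q" using ddvd[of "-k"] x(3) by (metis DomainI dvd_def)
      then have "x = (v [^]\<^bsub>V\<^esub> int d) [^]\<^bsub>V\<^esub> q" using v xv by (simp add: V.int_pow_pow)
      then have "u = z [^]\<^bsub>N\<^esub> q" using Muniq[OF x(3)] Mp[OF z, of q] by blast
      also have "\<dots> = y [^]\<^bsub>N\<^esub> (-k)" using y q by (simp add: N.int_pow_pow[symmetric])
      finally show ?thesis using x y by (simp add: N.int_pow_neg)
    qed
    ultimately have "M' \<in> \<A>" using Mgr MM' by (auto simp: \<A>_def)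
    then have "M' = M" using max MM' by blast
    moreover have "(v, y) \<in> M'" unfolding M'_def using Mone v y
      by (auto intro!: exI[of _ 1] exI[of _ "\<one>\<^bsub>V\<^esub>"] exI[of _ "\<one>\<^bsub>N\<^esub>"])
    ultimately show False using v by auto
  qed
  define g where "g = (\<lambda>x. THE w. (x, w) \<in> M)"
  have g: "(x, g x) \<in> M" if "x \<in> carrier V" for x
  proof -
    have "\<exists>!w. (x, w) \<in> M" using that dom Muniq by blast
    then show ?thesis unfolding g_def by (rule theI')
  qed
  have "g \<in> hom V N"
  proof (rule homI)
    fix x y assume x: "x \<in> carrier V" and y: "y \<in> carrier V"
    show "g (x \<otimes>\<^bsub>V\<^esub> y) = g x \<otimes>\<^bsub>N\<^esub> g y"
      using Muniq[OF g Mm[OF g[OF x] g[OF y]]] x y by simp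
  qed (use g Mc in blast)
  moreover have "g x = f x" if "x \<in> W" for x
    using Muniq[OF g[OF W.mem_carrier[OF that]], of "f x"] Mgr that by blast
  ultimately show ?thesis by blast
qed

text \<open>Supplies the hypothesis \<open>div\<close> of \<open>hom_extend\<close> for the group
  ring. Coefficientwise it is the self-injectivity of the integers modulo \<open>n\<close>: if
  \<open>n\<close> divides \<open>(n/d) k\<close>, then \<open>d\<close> divides
  \<open>k\<close>.\<close>

lemma RG_divisible:
  assumes n: "n > 0" and z: "z \<in> carrier (RG G n)" and d: "int d dvd int n"
    and 1: "z [^]\<^bsub>RG G n\<^esub> (int n div int d) = \<one>\<^bsub>RG G n\<^esub>"
  shows "\<exists>y\<in>carrier (RG G n). y [^]\<^bsub>RG G n\<^esub> int d = z"
proof -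
  have z': "z \<in> carrier (fsg (carrier G) (amon (Zmod n)))" using z by (simp add: RG_def)
  \<comment> \<open>The case distinction keeps the support finite: the chosen representative of the
    zero class may be a nonzero multiple of \<open>n\<close>, and its quotient by \<open>d\<close>
    need not vanish modulo \<open>n\<close>.\<close>
  define y where "y = (\<lambda>g. if z g = zc n 0 then zc n 0 else zc n (zrep n (z g) div int d))"
  have y: "y \<in> carrier (RG G n)"
    unfolding RG_def using fsg_fin[OF z'] fsg_out[OF z']
    by (intro fsgI[where S="{g. z g \<noteq> zc n 0}"]) (auto simp: y_def zc_zero split: if_splits)
  have "(y [^]\<^bsub>RG G n\<^esub> int d) g = z g" for g
  proof -
    have zg: "zc n (zrep n (z g)) = z g" using fsg_app[OF z'] by (simp add: zc_zrep)
    have "(z [^]\<^bsub>RG G n\<^esub> (int n div int d)) g = z g [^]\<^bsub>amon (Zmod n)\<^esub> (int n div int d)"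
      using z' by (simp add: RG_def fsg_int_pow comm_group_Zmod)
    then have "zc n ((int n div int d) * zrep n (z g)) = zc n 0"
      using 1 zg zc_pow[of n "zrep n (z g)" "int n div int d"] by (simp add: RG_def fsg_one zc_zero)
    then have "int n dvd (int n div int d) * zrep n (z g)" by (simp add: zc_eq_iff)
    moreover obtain e where e: "int n = int d * e" using d by (rule dvdE)
    moreover have "int n div int d = e" "e \<noteq> 0" using e n by auto
    ultimately have "e * int d dvd e * zrep n (z g)" by (simp add: mult.commute)
    then have "int d dvd zrep n (z g)" using \<open>e \<noteq> 0\<close> by simp
    then have "zc n (zrep n (z g) div int d) [^]\<^bsub>amon (Zmod n)\<^esub> int d = z g"
      by (simp add: zc_pow zg)
    moreover have "zc n 0 [^]\<^bsub>amon (Zmod n)\<^esub> int d = zc n 0" by (simp add: zc_pow)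
    ultimately show ?thesis
      using y by (simp add: RG_def fsg_int_pow comm_group_Zmod, simp add: y_def)
  qed
  then show ?thesis using y by blast
qed

section \<open>Cohomology vanishing above the rank\<close>

lemma comm_group_cancel:
  assumes "comm_group A" "a \<in> carrier A" "b \<in> carrier A" "c \<in> carrier A"
  shows "(a \<otimes>\<^bsub>A\<^esub> b) \<otimes>\<^bsub>A\<^esub> inv\<^bsub>A\<^esub> (c \<otimes>\<^bsub>A\<^esub> a) = b \<otimes>\<^bsub>A\<^esub> inv\<^bsub>A\<^esub> c"
proof -
  interpret comm_group A by fact
  have "a \<otimes>\<^bsub>A\<^esub> (inv\<^bsub>A\<^esub> a \<otimes>\<^bsub>A\<^esub> inv\<^bsub>A\<^esub> c) = inv\<^bsub>A\<^esub> c" using assms by (simp add: m_assoc[symmetric])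
  then show ?thesis using assms by (simp add: inv_mult_group m_comm[of a b] m_assoc)
qed

lemma generateI_subset:
  assumes "group G" "subgroup U G" "S \<subseteq> U" "x \<in> generate G S"
  shows "x \<in> U"
  using group.generate_subgroup_incl[OF assms(1,3,2)] assms(4) by blast

lemma ehom_generate:
  assumes A: "gact G n A \<alpha>" and B: "gact G n B \<beta>" and f: "f \<in> hom A B" and S: "S \<subseteq> carrier G"
    and eq: "\<And>s x. s \<in> S \<Longrightarrow> x \<in> carrier A \<Longrightarrow> f (\<alpha> s x) = \<beta> s (f x)"
  shows "f \<in> ehom (generate G S) A \<alpha> B \<beta>"
proof -
  interpret A: gact G n A \<alpha> by fact
  interpret B: gact G n B \<beta> by fact
  have fc: "f x \<in> carrier B" if "x \<in> carrier A" for x using f that by (rule hom_in_carrier)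
  let ?U = "{g \<in> carrier G. \<forall>x\<in>carrier A. f (\<alpha> g x) = \<beta> g (f x)}"
  have "subgroup ?U G"
  proof (rule A.G.subgroupI)
    show "?U \<noteq> {}" using fc by (auto intro!: exI[of _ "\<one>\<^bsub>G\<^esub>"])
    fix g assume g: "g \<in> ?U"
    have "f (\<alpha> (inv\<^bsub>G\<^esub> g) x) = \<beta> (inv\<^bsub>G\<^esub> g) (f x)" if x: "x \<in> carrier A" for x
    proof -
      have "f x = f (\<alpha> g (\<alpha> (inv\<^bsub>G\<^esub> g) x))" using g x by simp
      also have "\<dots> = \<beta> g (f (\<alpha> (inv\<^bsub>G\<^esub> g) x))" using g A.act_closed[OF A.G.inv_closed x] by blast
      finally show ?thesis using g x fc by simp
    qed
    then show "inv\<^bsub>G\<^esub> g \<in> ?U" using g by simp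
    fix h assume h: "h \<in> ?U"
    show "g \<otimes>\<^bsub>G\<^esub> h \<in> ?U" using g h fc by (simp add: A.act_mult B.act_mult)
  qed auto
  moreover have "S \<subseteq> ?U" using eq S by blast
  ultimately have "h \<in> ?U" if "h \<in> generate G S" for h
    using generateI_subset[OF A.G.group_axioms _ _ that] by blast
  then show ?thesis using f unfolding ehom_def by blast
qed

text \<open>\<open>Y\<close> is the union of one coset of \<open>H\<close> from each coset of the
  group generated by \<open>H\<close> and \<open>t\<close>. It meets every \<open>t\<close>-orbit,
  and the exponent leading into it is determined up to powers of \<open>t\<close> that lie in
  \<open>H\<close>. One construction thus serves generators of finite and of infinite order.\<close>

lemma ex_slice:
  assumes G: "comm_group G" and H: "subgroup H G" and t: "t \<in> carrier G"
  obtains Y where "Y \<subseteq> carrier G" "\<And>y h. y \<in> Y \<Longrightarrow> h \<in> H \<Longrightarrow> h \<otimes>\<^bsub>G\<^esub> y \<in> Y"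
    "\<And>g. g \<in> carrier G \<Longrightarrow> \<exists>a::int. t [^]\<^bsub>G\<^esub> a \<otimes>\<^bsub>G\<^esub> g \<in> Y"
    "\<And>y a. y \<in> Y \<Longrightarrow> t [^]\<^bsub>G\<^esub> (a::int) \<otimes>\<^bsub>G\<^esub> y \<in> Y \<Longrightarrow> t [^]\<^bsub>G\<^esub> a \<in> H"
proof -
  interpret comm_group G by fact
  interpret H: subgroup H G by fact
  define cls where "cls = (\<lambda>g. {h \<otimes>\<^bsub>G\<^esub> (t [^]\<^bsub>G\<^esub> a \<otimes>\<^bsub>G\<^esub> g) | h (a::int). h \<in> H})"
  \<comment> \<open>The choice depends on \<open>g\<close> only through the set
    \<open>cls g\<close>, hence it is constant on each coset of the larger group.\<close>
  define c where "c = (\<lambda>g. SOME x. x \<in> cls g)"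
  have clsI: "g \<in> cls g" if "g \<in> carrier G" for g
    using that H.one_closed by (auto simp: cls_def intro!: exI[of _ "\<one>\<^bsub>G\<^esub>"] exI[of _ "0::int"])
  have c: "c g \<in> cls g" if "g \<in> carrier G" for g unfolding c_def by (rule someI[of _ g]) (rule clsI[OF that])
  have clsG: "x \<in> carrier G" if "g \<in> carrier G" "x \<in> cls g" for x g
    using that t by (auto simp: cls_def)
  have sub: "cls (h \<otimes>\<^bsub>G\<^esub> (t [^]\<^bsub>G\<^esub> (a::int) \<otimes>\<^bsub>G\<^esub> g)) \<subseteq> cls g" if "g \<in> carrier G" "h \<in> H" for g h a
  proof
    fix x assume "x \<in> cls (h \<otimes>\<^bsub>G\<^esub> (t [^]\<^bsub>G\<^esub> (a::int) \<otimes>\<^bsub>G\<^esub> g))"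
    then obtain h' a' where "h' \<in> H" "x = h' \<otimes>\<^bsub>G\<^esub> (t [^]\<^bsub>G\<^esub> (a'::int) \<otimes>\<^bsub>G\<^esub> (h \<otimes>\<^bsub>G\<^esub> (t [^]\<^bsub>G\<^esub> (a::int) \<otimes>\<^bsub>G\<^esub> g)))"
      by (auto simp: cls_def)
    then have "x = (h' \<otimes>\<^bsub>G\<^esub> h) \<otimes>\<^bsub>G\<^esub> (t [^]\<^bsub>G\<^esub> (a' + a) \<otimes>\<^bsub>G\<^esub> g)" "h' \<otimes>\<^bsub>G\<^esub> h \<in> H"
      using that t by (auto simp: int_pow_mult m_ac)
    then show "x \<in> cls g" by (auto simp: cls_def)
  qed
  have cls_eq: "cls (h \<otimes>\<^bsub>G\<^esub> (t [^]\<^bsub>G\<^esub> (a::int) \<otimes>\<^bsub>G\<^esub> g)) = cls g" if g: "g \<in> carrier G" and h: "h \<in> H" for g h a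
  proof
    let ?x = "h \<otimes>\<^bsub>G\<^esub> (t [^]\<^bsub>G\<^esub> (a::int) \<otimes>\<^bsub>G\<^esub> g)"
    have hG: "h \<in> carrier G" using h by simp
    let ?u = "h \<otimes>\<^bsub>G\<^esub> t [^]\<^bsub>G\<^esub> a"
    have "inv\<^bsub>G\<^esub> h \<otimes>\<^bsub>G\<^esub> (t [^]\<^bsub>G\<^esub> (-a) \<otimes>\<^bsub>G\<^esub> ?x) = inv\<^bsub>G\<^esub> ?u \<otimes>\<^bsub>G\<^esub> (?u \<otimes>\<^bsub>G\<^esub> g)"
      using g hG t by (simp add: int_pow_neg inv_mult m_assoc)
    also have "\<dots> = g"
    proof -
      have "?u \<in> carrier G" using hG t by simp
      then show ?thesis using g by (metis inv_closed l_inv l_one m_assoc)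
    qed
    finally show "cls g \<subseteq> cls ?x" using sub[of ?x "inv\<^bsub>G\<^esub> h" "-a"] g h hG t by simp
  qed (rule sub[OF that])
  have c_eq: "c x = c g" if g: "g \<in> carrier G" and x: "x \<in> cls g" for g x
  proof -
    obtain h a where "h \<in> H" "x = h \<otimes>\<^bsub>G\<^esub> (t [^]\<^bsub>G\<^esub> (a::int) \<otimes>\<^bsub>G\<^esub> g)" using x by (auto simp: cls_def)
    then have "cls x = cls g" using cls_eq[OF g] by simp
    then show ?thesis by (simp add: c_def)
  qed
  define Y where "Y = {h \<otimes>\<^bsub>G\<^esub> c g | h g. h \<in> H \<and> g \<in> carrier G}"
  have cG: "c g \<in> carrier G" if "g \<in> carrier G" for g using clsG[OF that c[OF that]] .
  have cc: "c (h \<otimes>\<^bsub>G\<^esub> c g) = c g" if "g \<in> carrier G" "h \<in> H" for g h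
  proof -
    have "h \<otimes>\<^bsub>G\<^esub> c g = h \<otimes>\<^bsub>G\<^esub> (t [^]\<^bsub>G\<^esub> (0::int) \<otimes>\<^bsub>G\<^esub> c g)" using that cG by simp
    then have "h \<otimes>\<^bsub>G\<^esub> c g \<in> cls (c g)" using that(2) unfolding cls_def by blast
    then have "c (h \<otimes>\<^bsub>G\<^esub> c g) = c (c g)" by (rule c_eq[OF cG[OF that(1)]])
    then show ?thesis using c_eq[OF that(1) c[OF that(1)]] by simp
  qed
  show thesis
  proof (rule that[of Y])
    show "Y \<subseteq> carrier G"
    proof
      fix y assume "y \<in> Y"
      then obtain h g where "y = h \<otimes>\<^bsub>G\<^esub> c g" "h \<in> H" "g \<in> carrier G" unfolding Y_def by blast
      then show "y \<in> carrier G" using cG[of g] by simp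
    qed
  next
    fix y h' assume y: "y \<in> Y" and h': "h' \<in> H"
    then obtain h g where hg: "y = h \<otimes>\<^bsub>G\<^esub> c g" "h \<in> H" "g \<in> carrier G" unfolding Y_def by blast
    then have "h' \<otimes>\<^bsub>G\<^esub> y = (h' \<otimes>\<^bsub>G\<^esub> h) \<otimes>\<^bsub>G\<^esub> c g" using h' cG by (simp add: m_assoc)
    then show "h' \<otimes>\<^bsub>G\<^esub> y \<in> Y" using h' hg unfolding Y_def by blast
  next
    fix y and a :: int assume y: "y \<in> Y" and ty: "t [^]\<^bsub>G\<^esub> a \<otimes>\<^bsub>G\<^esub> y \<in> Y"
    from y obtain h g where hg: "y = h \<otimes>\<^bsub>G\<^esub> c g" "h \<in> H" "g \<in> carrier G" unfolding Y_def by blast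
    from ty obtain h' g' where hg': "t [^]\<^bsub>G\<^esub> a \<otimes>\<^bsub>G\<^esub> y = h' \<otimes>\<^bsub>G\<^esub> c g'" "h' \<in> H" "g' \<in> carrier G"
      unfolding Y_def by blast
    have yG: "y \<in> carrier G" using hg cG by simp
    have "t [^]\<^bsub>G\<^esub> a \<otimes>\<^bsub>G\<^esub> y \<in> cls y" using yG t H.one_closed
      by (auto simp: cls_def intro!: exI[of _ "\<one>\<^bsub>G\<^esub>"] exI[of _ a])
    then have "c g' = c g" using c_eq[OF yG] cc hg hg' by metis
    then have "(t [^]\<^bsub>G\<^esub> a \<otimes>\<^bsub>G\<^esub> h) \<otimes>\<^bsub>G\<^esub> c g = h' \<otimes>\<^bsub>G\<^esub> c g" using hg hg' t cG by (simp add: m_assoc)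
    then have "t [^]\<^bsub>G\<^esub> a \<otimes>\<^bsub>G\<^esub> h = h'" using hg hg' t cG by simp
    then have "t [^]\<^bsub>G\<^esub> a = h' \<otimes>\<^bsub>G\<^esub> inv\<^bsub>G\<^esub> h" using hg hg' t by (simp add: inv_solve_right)
    then show "t [^]\<^bsub>G\<^esub> a \<in> H" using hg hg' by simp
  next
    fix g assume g: "g \<in> carrier G"
    then obtain h a where ha: "c g = h \<otimes>\<^bsub>G\<^esub> (t [^]\<^bsub>G\<^esub> (a::int) \<otimes>\<^bsub>G\<^esub> g)" "h \<in> H" using c[OF g] unfolding cls_def by blast
    then have "t [^]\<^bsub>G\<^esub> a \<otimes>\<^bsub>G\<^esub> g = inv\<^bsub>G\<^esub> h \<otimes>\<^bsub>G\<^esub> c g" using g t H.mem_carrier by (metis inv_solve_left int_pow_closed m_closed cG)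
    then show "\<exists>a::int. t [^]\<^bsub>G\<^esub> a \<otimes>\<^bsub>G\<^esub> g \<in> Y" using ha g unfolding Y_def by blast
  qed
qed

text \<open>The product of \<open>e\<close> over the first \<open>k\<close> points of the forward
  orbit of \<open>x\<close> under \<open>s\<close>, closed off by \<open>u\<close>.\<close>

primrec orb :: "('a \<Rightarrow> 'a \<Rightarrow> 'a) \<Rightarrow> 'a \<Rightarrow> ('g \<Rightarrow> 'a) \<Rightarrow> ('g \<Rightarrow> 'g) \<Rightarrow> nat \<Rightarrow> 'g \<Rightarrow> 'a" where
  "orb m u e s 0 x = u"
| "orb m u e s (Suc k) x = m (e x) (orb m u e s k (s x))"

lemma orb_closed:
  assumes "comm_group A" "\<And>x. x \<in> J \<Longrightarrow> s x \<in> J" "\<And>x. x \<in> J \<Longrightarrow> e x \<in> carrier A" "x \<in> J"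
  shows "orb (monoid.mult A) \<one>\<^bsub>A\<^esub> e s k x \<in> carrier A"
proof -
  interpret comm_group A by fact
  show ?thesis using assms(4) by (induction k arbitrary: x) (auto simp: assms)
qed

lemma orb_invariant:
  assumes "\<And>x. x \<in> J \<Longrightarrow> s x \<in> J" "\<And>x. x \<in> J \<Longrightarrow> e (p x) = e x" "\<And>x. x \<in> J \<Longrightarrow> s (p x) = p (s x)" "x \<in> J"
  shows "orb m u e s k (p x) = orb m u e s k x"
  using assms(4) by (induction k arbitrary: x) (auto simp: assms)

text \<open>Solves the difference equation \<open>w (t\<inverse> g) = w g \<cdot> e g\<close> along the infinite \<open>t\<close>-orbits, starting from \<open>w = 1\<close> on a slice.\<close>

lemma ex_difference_solution:
  assumes G: "comm_group G" and A: "comm_group A" and H: "subgroup H G" and t: "t \<in> carrier G"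
    and inf: "\<And>a::int. a \<noteq> 0 \<Longrightarrow> t [^]\<^bsub>G\<^esub> a \<notin> H"
    and e: "\<And>g. g \<in> carrier G \<Longrightarrow> e g \<in> carrier A"
    and eH: "\<And>g h. g \<in> carrier G \<Longrightarrow> h \<in> H \<Longrightarrow> e (h \<otimes>\<^bsub>G\<^esub> g) = e g"
  shows "\<exists>w. (\<forall>g\<in>carrier G. w g \<in> carrier A) \<and> (\<forall>g\<in>carrier G. \<forall>h\<in>H. w (h \<otimes>\<^bsub>G\<^esub> g) = w g) \<and>
    (\<forall>g\<in>carrier G. w (inv\<^bsub>G\<^esub> t \<otimes>\<^bsub>G\<^esub> g) = w g \<otimes>\<^bsub>A\<^esub> e g)"
proof -
  interpret G: comm_group G by fact
  interpret A: comm_group A by fact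
  interpret H: subgroup H G by fact
  obtain Y where YG: "Y \<subseteq> carrier G" and YH: "\<And>y h. y \<in> Y \<Longrightarrow> h \<in> H \<Longrightarrow> h \<otimes>\<^bsub>G\<^esub> y \<in> Y"
    and Yex: "\<And>g. g \<in> carrier G \<Longrightarrow> \<exists>a::int. t [^]\<^bsub>G\<^esub> a \<otimes>\<^bsub>G\<^esub> g \<in> Y"
    and Yun: "\<And>y a. y \<in> Y \<Longrightarrow> t [^]\<^bsub>G\<^esub> (a::int) \<otimes>\<^bsub>G\<^esub> y \<in> Y \<Longrightarrow> t [^]\<^bsub>G\<^esub> a \<in> H"
    by (rule ex_slice[OF G H t]) (rule that; assumption)
  \<comment> \<open>The signed position of \<open>g\<close> on its \<open>t\<close>-orbit:
    \<open>g\<close> is \<open>t^(a g)\<close> times a point of the slice. Its uniqueness is where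
    the infinite order of \<open>t\<close> modulo \<open>H\<close> is used.\<close>
  define a where "a = (\<lambda>g. THE a::int. t [^]\<^bsub>G\<^esub> (-a) \<otimes>\<^bsub>G\<^esub> g \<in> Y)"
  have uniq: "b = c" if "g \<in> carrier G" "t [^]\<^bsub>G\<^esub> (-b) \<otimes>\<^bsub>G\<^esub> g \<in> Y" "t [^]\<^bsub>G\<^esub> (-c) \<otimes>\<^bsub>G\<^esub> g \<in> Y" for g and b c :: int
  proof -
    have "t [^]\<^bsub>G\<^esub> (b - c) \<otimes>\<^bsub>G\<^esub> (t [^]\<^bsub>G\<^esub> (-b) \<otimes>\<^bsub>G\<^esub> g) = t [^]\<^bsub>G\<^esub> (-c) \<otimes>\<^bsub>G\<^esub> g"
    proof -
      have "t [^]\<^bsub>G\<^esub> (b - c) \<otimes>\<^bsub>G\<^esub> t [^]\<^bsub>G\<^esub> (-b) = t [^]\<^bsub>G\<^esub> (-c)"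
        using G.int_pow_mult[OF t, of "b - c" "-b"] by simp
      then show ?thesis using t that(1) G.m_assoc by (metis G.int_pow_closed)
    qed
    then have "t [^]\<^bsub>G\<^esub> (b - c) \<in> H" using that Yun by metis
    then show ?thesis using inf[of "b - c"] by fastforce
  qed
  have a_eq: "a g = b" if "g \<in> carrier G" "t [^]\<^bsub>G\<^esub> (-b) \<otimes>\<^bsub>G\<^esub> g \<in> Y" for g b
    unfolding a_def by (rule the_equality[where P="\<lambda>a. t [^]\<^bsub>G\<^esub> (-a) \<otimes>\<^bsub>G\<^esub> g \<in> Y", OF that(2)]) (rule uniq[OF that(1) _ that(2)])
  have aY: "t [^]\<^bsub>G\<^esub> (- a g) \<otimes>\<^bsub>G\<^esub> g \<in> Y" if g: "g \<in> carrier G" for g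
  proof -
    obtain b :: int where "t [^]\<^bsub>G\<^esub> b \<otimes>\<^bsub>G\<^esub> g \<in> Y" using Yex[OF g] ..
    then have "t [^]\<^bsub>G\<^esub> (-(-b)) \<otimes>\<^bsub>G\<^esub> g \<in> Y" by simp
    from a_eq[OF g this] this show ?thesis by simp
  qed
  have aH: "a (h \<otimes>\<^bsub>G\<^esub> g) = a g" if "g \<in> carrier G" "h \<in> H" for g h
  proof (rule a_eq)
    have "t [^]\<^bsub>G\<^esub> (- a g) \<otimes>\<^bsub>G\<^esub> (h \<otimes>\<^bsub>G\<^esub> g) = h \<otimes>\<^bsub>G\<^esub> (t [^]\<^bsub>G\<^esub> (- a g) \<otimes>\<^bsub>G\<^esub> g)"
      using that t by (simp add: G.m_lcomm)
    then show "t [^]\<^bsub>G\<^esub> (- a g) \<otimes>\<^bsub>G\<^esub> (h \<otimes>\<^bsub>G\<^esub> g) \<in> Y" using YH aY that by simp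
  qed (use that in auto)
  have at: "a (inv\<^bsub>G\<^esub> t \<otimes>\<^bsub>G\<^esub> g) = a g - 1" if "g \<in> carrier G" for g
  proof (rule a_eq)
    have "t [^]\<^bsub>G\<^esub> (- (a g - 1)) = t [^]\<^bsub>G\<^esub> (- a g) \<otimes>\<^bsub>G\<^esub> t"
      using t G.int_pow_mult[of t "- a g" 1] by simp
    moreover have "t \<otimes>\<^bsub>G\<^esub> (inv\<^bsub>G\<^esub> t \<otimes>\<^bsub>G\<^esub> g) = g" using that t by (simp add: G.m_assoc[symmetric])
    ultimately show "t [^]\<^bsub>G\<^esub> (- (a g - 1)) \<otimes>\<^bsub>G\<^esub> (inv\<^bsub>G\<^esub> t \<otimes>\<^bsub>G\<^esub> g) \<in> Y" using aY[OF that] that t by (simp add: G.m_assoc)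
  qed (use that t in auto)
  let ?m = "monoid.mult A" and ?u = "\<one>\<^bsub>A\<^esub>"
  define P where "P = orb ?m ?u e (\<lambda>g. inv\<^bsub>G\<^esub> t \<otimes>\<^bsub>G\<^esub> g)"
  define Q where "Q = orb ?m ?u (\<lambda>g. e (t \<otimes>\<^bsub>G\<^esub> g)) (\<lambda>g. t \<otimes>\<^bsub>G\<^esub> g)"
  have Pc: "P k g \<in> carrier A" and Qc: "Q k g \<in> carrier A" if "g \<in> carrier G" for k g
    unfolding P_def Q_def using that e t by (auto intro!: orb_closed[where J="carrier G", OF A])
  have PH: "P k (h \<otimes>\<^bsub>G\<^esub> g) = P k g" if "g \<in> carrier G" "h \<in> H" for k g h
    unfolding P_def
    by (rule orb_invariant[where p="\<lambda>g. h \<otimes>\<^bsub>G\<^esub> g" and J="carrier G"]) (use that t eH in \<open>auto simp: G.m_lcomm\<close>)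
  have QH: "Q k (h \<otimes>\<^bsub>G\<^esub> g) = Q k g" if "g \<in> carrier G" "h \<in> H" for k g h
    unfolding Q_def
  proof (rule orb_invariant[where p="\<lambda>g. h \<otimes>\<^bsub>G\<^esub> g" and J="carrier G"])
    fix x assume x: "x \<in> carrier G"
    have *: "t \<otimes>\<^bsub>G\<^esub> (h \<otimes>\<^bsub>G\<^esub> x) = h \<otimes>\<^bsub>G\<^esub> (t \<otimes>\<^bsub>G\<^esub> x)" using x t that by (simp add: G.m_lcomm)
    then show "t \<otimes>\<^bsub>G\<^esub> (h \<otimes>\<^bsub>G\<^esub> x) = h \<otimes>\<^bsub>G\<^esub> (t \<otimes>\<^bsub>G\<^esub> x)" .
    show "e (t \<otimes>\<^bsub>G\<^esub> (h \<otimes>\<^bsub>G\<^esub> x)) = e (t \<otimes>\<^bsub>G\<^esub> x)" unfolding * using eH x t that by simp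
  qed (use that t in auto)
  \<comment> \<open>Forced by the equation once \<open>w\<close> is trivial on the slice: a point
    above the slice collects inverses of \<open>e\<close> on the way down, beginning with
    \<open>g\<close> itself; a point below collects \<open>e\<close> on the way up, beginning with
    \<open>t g\<close>.\<close>
  define w where "w = (\<lambda>g. if a g \<ge> 0 then inv\<^bsub>A\<^esub> (P (nat (a g)) g) else Q (nat (- a g)) g)"
  have "w (inv\<^bsub>G\<^esub> t \<otimes>\<^bsub>G\<^esub> g) = w g \<otimes>\<^bsub>A\<^esub> e g" if g: "g \<in> carrier G" for g
  \<comment> \<open>The split is at 1 rather than 0: from position 0 one step down leaves the range
    of \<open>P\<close> and enters that of \<open>Q\<close>.\<close>
  proof (cases "a g \<ge> 1")
    case True
    define k where "k = nat (a g - 1)"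
    then have k: "nat (a g) = Suc k" "nat (a g - 1) = k" using True by linarith+
    have gt: "inv\<^bsub>G\<^esub> t \<otimes>\<^bsub>G\<^esub> g \<in> carrier G" using g t by simp
    have "w g \<otimes>\<^bsub>A\<^esub> e g = inv\<^bsub>A\<^esub> (e g \<otimes>\<^bsub>A\<^esub> P k (inv\<^bsub>G\<^esub> t \<otimes>\<^bsub>G\<^esub> g)) \<otimes>\<^bsub>A\<^esub> e g"
      using True k by (simp add: w_def P_def)
    also have "\<dots> = (inv\<^bsub>A\<^esub> (P k (inv\<^bsub>G\<^esub> t \<otimes>\<^bsub>G\<^esub> g)) \<otimes>\<^bsub>A\<^esub> inv\<^bsub>A\<^esub> (e g)) \<otimes>\<^bsub>A\<^esub> e g"
      using e[OF g] Pc[OF gt] by (simp add: A.inv_mult A.m_comm)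
    also have "\<dots> = inv\<^bsub>A\<^esub> (P k (inv\<^bsub>G\<^esub> t \<otimes>\<^bsub>G\<^esub> g))"
      using e[OF g] Pc[OF gt] by (simp add: A.m_assoc)
    finally show ?thesis using True k g by (simp add: w_def at)
  next
    case False
    define k where "k = nat (- a g)"
    then have k: "nat (- a g) = k" "nat (1 - a g) = Suc k" using False by linarith+
    have "w g = Q k g" using False k Qc[OF g] by (auto simp: w_def P_def Q_def)
    moreover have "w (inv\<^bsub>G\<^esub> t \<otimes>\<^bsub>G\<^esub> g) = Q (Suc k) (inv\<^bsub>G\<^esub> t \<otimes>\<^bsub>G\<^esub> g)"
      using False k g by (simp add: w_def at)
    moreover have "t \<otimes>\<^bsub>G\<^esub> (inv\<^bsub>G\<^esub> t \<otimes>\<^bsub>G\<^esub> g) = g" using g t by (simp add: G.m_assoc[symmetric])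
    ultimately show ?thesis using Qc[OF g] e[OF g] by (simp add: Q_def A.m_comm)
  qed
  moreover have "w g \<in> carrier A" if "g \<in> carrier G" for g using Pc Qc that by (auto simp: w_def)
  moreover have "w (h \<otimes>\<^bsub>G\<^esub> g) = w g" if "g \<in> carrier G" "h \<in> H" for g h
    using that by (simp add: w_def aH PH QH)
  ultimately show ?thesis by blast
qed

text \<open>Used for two kinds of \<open>Y\<close>: a slice, where it replaces division by a finite
  index, and the image of \<Lambda>, where it projects \<open>P_0[\<Gamma>]\<close> onto the part
  living on one coset.\<close>

definition cut :: "'a monoid \<Rightarrow> 'g set \<Rightarrow> ('g \<Rightarrow> 'a) \<Rightarrow> ('g \<Rightarrow> 'a)" where
  "cut A Y f = (\<lambda>g. if g \<in> Y then f g else \<one>\<^bsub>A\<^esub>)"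

lemma cut_hom: 
  assumes "comm_group A" shows "cut A Y \<in> hom (fsg J A) (fsg J A)"
proof -
  interpret comm_group A by fact
  show ?thesis
  proof (rule homI)
    fix x assume x: "x \<in> carrier (fsg J A)"
    show "cut A Y x \<in> carrier (fsg J A)"
      using fsg_app[OF x] fsg_fin[OF x] fsg_out[OF x]
      by (intro fsgI[where S="{g. x g \<noteq> \<one>\<^bsub>A\<^esub>}"]) (auto simp: cut_def split: if_splits)
  qed (auto simp: cut_def fsg_mult)
qed

lemma shift_cut:
  assumes "group G" "h \<in> carrier G" "\<And>g. g \<in> carrier G \<Longrightarrow> inv\<^bsub>G\<^esub> h \<otimes>\<^bsub>G\<^esub> g \<in> Y \<longleftrightarrow> g \<in> Y" 
  shows "cut A Y (shift G A h f) = shift G A h (cut A Y f)"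
  using assms by (auto simp: cut_def shift_def fun_eq_iff)

text \<open>Exactness is asked at positive indices only; nothing is said about the cokernel of
  \<open>D 0\<close>. This lets the same locale cover a free resolution and its prolongation by an
  embedding of the resolved module into a free one.\<close>

locale exact_seq = G: comm_group G for G :: "'g monoid" +
  fixes n :: nat and B :: "nat \<Rightarrow> 'u set" and D :: "nat \<Rightarrow> ('u \<Rightarrow> 'g \<Rightarrow> int set) \<Rightarrow> ('u \<Rightarrow> 'g \<Rightarrow> int set)"
  assumes n: "n > 0"
    and D: "D k \<in> ehom (carrier G) (FR G n (B (Suc k))) (fsh G n) (FR G n (B k)) (fsh G n)"
    and exact: "{x \<in> carrier (FR G n (B (Suc k))). D k x = \<one>\<^bsub>FR G n (B k)\<^esub>} = D (Suc k) ` carrier (FR G n (B (Suc (Suc k))))"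
begin

abbreviation "F k \<equiv> FR G n (B k)"
abbreviation "N \<equiv> RG G n"

text \<open>The \<open>H\<close>-equivariant cohomology with values in the group ring vanishes in
  all degrees \<open>k + 1\<close> with \<open>k \<ge> m\<close>, that is in all degrees above
  \<open>m\<close>. A whole range of degrees is part of the statement because a generator of
  infinite order uses two adjacent ones.\<close>

definition vanish :: "'g set \<Rightarrow> nat \<Rightarrow> bool" where
  "vanish H m \<longleftrightarrow> (\<forall>k\<ge>m. \<forall>f\<in>ehom H (F (Suc k)) (fsh G n) N (rsh G n).
     (\<forall>x\<in>carrier (F (Suc (Suc k))). f (D (Suc k) x) = \<one>\<^bsub>N\<^esub>) \<longrightarrow>
     (\<exists>g\<in>ehom H (F k) (fsh G n) N (rsh G n). \<forall>x\<in>carrier (F (Suc k)). f x = g (D k x)))"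

lemma vanishD:
  assumes "vanish H m" "m \<le> k" "f \<in> ehom H (F (Suc k)) (fsh G n) N (rsh G n)"
    "\<And>x. x \<in> carrier (F (Suc (Suc k))) \<Longrightarrow> f (D (Suc k) x) = \<one>\<^bsub>N\<^esub>"
  obtains g where "g \<in> ehom H (F k) (fsh G n) N (rsh G n)" "\<And>x. x \<in> carrier (F (Suc k)) \<Longrightarrow> f x = g (D k x)"
proof -
  have "\<exists>g\<in>ehom H (F k) (fsh G n) N (rsh G n). \<forall>x\<in>carrier (F (Suc k)). f x = g (D k x)"
    using assms by (simp add: vanish_def)
  then show ?thesis using that by (elim bexE) simp
qed

lemma gF: "gact G n (F k) (fsh G n)" by (rule gact_FR) unfold_locales
lemma gN: "gact G n N (rsh G n)" by (rule gact_RG) unfold_locales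

lemma D_hom: "D k \<in> hom (F (Suc k)) (F k)" by (rule ehom_hom[OF D])
lemma D_closed [simp]: "x \<in> carrier (F (Suc k)) \<Longrightarrow> D k x \<in> carrier (F k)" by (rule ehom_closed[OF D])
lemma D_fsh: "x \<in> carrier (F (Suc k)) \<Longrightarrow> g \<in> carrier G \<Longrightarrow> D k (fsh G n g x) = fsh G n g (D k x)"
  using ehom_eq[OF D] .
lemma DD: "x \<in> carrier (F (Suc (Suc k))) \<Longrightarrow> D k (D (Suc k) x) = \<one>\<^bsub>F k\<^esub>" using exact by blast

text \<open>Without equivariance there is no obstruction in any positive degree: a cocycle descends
  to the image of \<open>D k\<close> and extends from there, because the group ring is injective
  over the integers modulo \<open>n\<close>.\<close>

lemma vanish_base: "vanish {\<one>\<^bsub>G\<^esub>} 0"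
  unfolding vanish_def
proof (intro allI ballI impI)
  fix k f assume f: "f \<in> ehom {\<one>\<^bsub>G\<^esub>} (F (Suc k)) (fsh G n) N (rsh G n)"
    and f0: "\<forall>x\<in>carrier (F (Suc (Suc k))). f (D (Suc k) x) = \<one>\<^bsub>N\<^esub>"
  interpret F: gact G n "F j" "fsh G n" for j by (rule gF)
  interpret N: gact G n N "rsh G n" by (rule gN)
  interpret D: group_hom "F (Suc j)" "F j" "D j" for j using D_hom by unfold_locales
  obtain f' where f': "f' \<in> hom (F k\<lparr>carrier := D k ` carrier (F (Suc k))\<rparr>) N" "\<And>x. x \<in> carrier (F (Suc k)) \<Longrightarrow> f' (D k x) = f x"
  proof -
    have "f x = \<one>\<^bsub>N\<^esub>" if "x \<in> carrier (F (Suc k))" "D k x = \<one>\<^bsub>F k\<^esub>" for x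
    proof -
      have "x \<in> D (Suc k) ` carrier (F (Suc (Suc k)))" unfolding exact[symmetric] using that by simp
      then show ?thesis using f0 by auto
    qed
    from hom_factor[OF comm_group_FR comm_group_FR comm_group_RG D_hom ehom_hom[OF f] this] show ?thesis
      using that by blast
  qed
  have "\<exists>g\<in>hom (F k) N. \<forall>x\<in>D k ` carrier (F (Suc k)). g x = f' x"
    by (rule hom_extend[OF comm_group_FR comm_group_RG n F.torsion RG_divisible[OF n] D.img_is_subgroup f'(1)])
  then obtain g where g: "g \<in> hom (F k) N" "\<And>x. x \<in> carrier (F (Suc k)) \<Longrightarrow> g (D k x) = f x" using f' by auto
  have "g \<in> ehom {\<one>\<^bsub>G\<^esub>} (F k) (fsh G n) N (rsh G n)"
    using g(1) by (auto simp: ehom_def hom_in_carrier)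
  then show "\<exists>g\<in>ehom {\<one>\<^bsub>G\<^esub>} (F k) (fsh G n) N (rsh G n). \<forall>x\<in>carrier (F (Suc k)). f x = g (D k x)"
    using g(2) by (metis (no_types))
qed

text \<open>On the \<open>H\<close>-equivariant maps from a free module to \<open>N\<close>,
  consider conjugation by \<open>t\<close> minus the identity. Its kernel consists of the maps
  equivariant under the larger group, and it is surjective because preimages can be found along the
  infinite \<open>t\<close>-orbits. The resulting short exact sequence of complexes places each new
  cohomology group between two old ones in adjacent degrees, hence the loss of one degree. The proof
  is the corresponding diagram chase.\<close>

lemma vanish_step_infinite:
  assumes V: "vanish H m" and HS: "H = generate G S" and S: "S \<subseteq> carrier G" and t: "t \<in> carrier G"
    and inf: "\<And>a::int. a \<noteq> 0 \<Longrightarrow> t [^]\<^bsub>G\<^esub> a \<notin> H"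
  shows "vanish (generate G (insert t S)) (Suc m)"
  unfolding vanish_def
proof (intro allI ballI impI)
  let ?H' = "generate G (insert t S)"
  fix k f assume k: "k \<ge> Suc m" and f: "f \<in> ehom ?H' (F (Suc k)) (fsh G n) N (rsh G n)"
    and f0: "\<forall>x\<in>carrier (F (Suc (Suc k))). f (D (Suc k) x) = \<one>\<^bsub>N\<^esub>"
  interpret F: gact G n "F j" "fsh G n" for j by (rule gF)
  interpret N: gact G n N "rsh G n" by (rule gN)
  have H: "subgroup H G" unfolding HS by (rule G.generate_is_subgroup) (rule S)
  interpret H: subgroup H G by (rule H)
  have HH': "H \<subseteq> ?H'" unfolding HS by (rule G.mono_generate) blast
  have tH': "t \<in> ?H'" by (simp add: generate.incl)
  \<comment> \<open>The preceding degree is still at least \<open>m\<close>; this is where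
    \<open>Suc m\<close> is spent.\<close>
  obtain l where l: "k = Suc l" "l \<ge> m" using k by (cases k) auto
  have "k \<ge> m" using k by simp
  then obtain g where g: "g \<in> ehom H (F k) (fsh G n) N (rsh G n)" and fg: "\<And>x. x \<in> carrier (F (Suc k)) \<Longrightarrow> f x = g (D k x)"
    using vanishD[OF V \<open>k \<ge> m\<close> ehom_mono[OF f HH']] f0 that by blast
  have gc: "g x \<in> carrier N" if "x \<in> carrier (F k)" for x using ehom_closed[OF g that] .
  have gm: "g (x \<otimes>\<^bsub>F k\<^esub> y) = g x \<otimes>\<^bsub>N\<^esub> g y" if "x \<in> carrier (F k)" "y \<in> carrier (F k)" for x y
    using hom_mult[OF ehom_hom[OF g]] that by simp
  \<comment> \<open>The failure of the primitive \<open>g\<close> to be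
    \<open>t\<close>-equivariant. It vanishes on the image of \<open>D k\<close> since
    \<open>f\<close> is equivariant, so it has a primitive \<open>h\<close> one degree
    lower.\<close>
  define d where "d = (\<lambda>x. rsh G n t (g (fsh G n (inv\<^bsub>G\<^esub> t) x)) \<otimes>\<^bsub>N\<^esub> inv\<^bsub>N\<^esub> (g x))"
  have "d \<in> hom (F k) N" unfolding d_def
  proof (intro hom_mult_fun hom_inv_fun)
    show "(\<lambda>x. rsh G n t (g (fsh G n (inv\<^bsub>G\<^esub> t) x))) \<in> hom (F k) N"
      using t by (intro hom_comp_fun[OF hom_comp_fun[OF F.act_hom ehom_hom[OF g]] N.act_hom]) auto
  qed (use ehom_hom[OF g] N.A.comm_group_axioms in auto)
  moreover have "d (fsh G n h x) = rsh G n h (d x)" if "h \<in> H" "x \<in> carrier (F k)" for h x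
  proof -
    have hG: "h \<in> carrier G" using that by simp
    have "fsh G n (inv\<^bsub>G\<^esub> t) (fsh G n h x) = fsh G n h (fsh G n (inv\<^bsub>G\<^esub> t) x)"
      using t hG that by (simp add: F.act_mult[symmetric] G.m_comm)
    then have "rsh G n t (g (fsh G n (inv\<^bsub>G\<^esub> t) (fsh G n h x))) = rsh G n h (rsh G n t (g (fsh G n (inv\<^bsub>G\<^esub> t) x)))"
      using t hG that gc by (simp add: ehom_eq[OF g] N.act_mult[symmetric] G.m_comm)
    then show ?thesis using t hG that gc by (simp add: d_def ehom_eq[OF g] N.act_m N.act_inv)
  qed
  ultimately have d: "d \<in> ehom H (F k) (fsh G n) N (rsh G n)" by (auto simp: ehom_def)
  have "d (D k x) = \<one>\<^bsub>N\<^esub>" if x: "x \<in> carrier (F (Suc k))" for x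
  proof -
    have *: "g (fsh G n (inv\<^bsub>G\<^esub> t) (D k x)) = f (fsh G n (inv\<^bsub>G\<^esub> t) x)"
      using x t by (simp add: fg D_fsh)
    have "rsh G n t (g (fsh G n (inv\<^bsub>G\<^esub> t) (D k x))) = f (fsh G n t (fsh G n (inv\<^bsub>G\<^esub> t) x))"
      unfolding * by (rule ehom_eq[OF f tH' F.act_closed[OF G.inv_closed[OF t] x], symmetric])
    also have "\<dots> = g (D k x)" using x t by (simp add: fg)
    finally show ?thesis using x gc by (simp add: d_def)
  qed
  then have dD: "d (D (Suc l) x) = \<one>\<^bsub>N\<^esub>" if "x \<in> carrier (F (Suc (Suc l)))" for x using l that by simp
  obtain h where h: "h \<in> ehom H (F l) (fsh G n) N (rsh G n)" and dh: "\<And>x. x \<in> carrier (F (Suc l)) \<Longrightarrow> d x = h (D l x)"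
    using vanishD[OF V l(2) d[unfolded l] dD] that by blast
  have hc: "h x \<in> carrier N" if "x \<in> carrier (F l)" for x using ehom_closed[OF h that] .
  \<comment> \<open>In the normalisation of \<open>FR_ehom_ext\<close>, finding \<open>u\<close>
    whose conjugate by \<open>t\<close> is \<open>u + h\<close> becomes a difference equation for
    each basis vector separately.\<close>
  have "\<exists>w. (\<forall>g\<in>carrier G. w g \<in> carrier N) \<and> (\<forall>g\<in>carrier G. \<forall>h\<in>H. w (h \<otimes>\<^bsub>G\<^esub> g) = w g) \<and>
    (\<forall>g\<in>carrier G. w (inv\<^bsub>G\<^esub> t \<otimes>\<^bsub>G\<^esub> g) = w g \<otimes>\<^bsub>N\<^esub> rsh G n (inv\<^bsub>G\<^esub> g) (h (bas G n b g)))" if b: "b \<in> B l" for b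
  proof (rule ex_difference_solution[OF G.comm_group_axioms N.A.comm_group_axioms H t inf])
    fix g assume g: "g \<in> carrier G"
    then show "rsh G n (inv\<^bsub>G\<^esub> g) (h (bas G n b g)) \<in> carrier N" using b hc by simp
    fix h' assume h': "h' \<in> H"
    have hG: "h' \<in> carrier G" using h' by simp
    have "h (bas G n b (h' \<otimes>\<^bsub>G\<^esub> g)) = rsh G n h' (h (bas G n b g))"
      using b g h' hG ehom_eq[OF h h'] by (simp add: fsh_bas[symmetric] G.comm_group_axioms)
    then show "rsh G n (inv\<^bsub>G\<^esub> (h' \<otimes>\<^bsub>G\<^esub> g)) (h (bas G n b (h' \<otimes>\<^bsub>G\<^esub> g))) = rsh G n (inv\<^bsub>G\<^esub> g) (h (bas G n b g))"
      using g hG hc b by (simp add: G.inv_mult_group N.act_mult)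
  qed
  then obtain w where w: "\<And>b g. b \<in> B l \<Longrightarrow> g \<in> carrier G \<Longrightarrow> w b g \<in> carrier N"
    "\<And>b g h. b \<in> B l \<Longrightarrow> g \<in> carrier G \<Longrightarrow> h \<in> H \<Longrightarrow> w b (h \<otimes>\<^bsub>G\<^esub> g) = w b g"
    "\<And>b g. b \<in> B l \<Longrightarrow> g \<in> carrier G \<Longrightarrow> w b (inv\<^bsub>G\<^esub> t \<otimes>\<^bsub>G\<^esub> g) = w b g \<otimes>\<^bsub>N\<^esub> rsh G n (inv\<^bsub>G\<^esub> g) (h (bas G n b g))"
    by metis
  obtain u where u: "u \<in> ehom H (F l) (fsh G n) N (rsh G n)"
    and ub: "\<And>b g. b \<in> B l \<Longrightarrow> g \<in> carrier G \<Longrightarrow> u (bas G n b g) = rsh G n g (w b g)"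
  proof -
    have "\<exists>u\<in>ehom H (F l) (fsh G n) N (rsh G n). \<forall>b\<in>B l. \<forall>g\<in>carrier G. u (bas G n b g) = rsh G n g (w b g)"
      by (rule FR_ehom_ext[OF gN H.subset]) (use w in simp_all)
    then show ?thesis using that by (elim bexE) simp
  qed
  have uc: "u x \<in> carrier N" if "x \<in> carrier (F l)" for x using ehom_closed[OF u that] .
  have ueq: "rsh G n t (u (fsh G n (inv\<^bsub>G\<^esub> t) x)) = u x \<otimes>\<^bsub>N\<^esub> h x" if "x \<in> carrier (F l)" for x
  proof (rule FR_hom_eq[OF N.A.comm_group_axioms _ _ _ that])
    show "(\<lambda>x. rsh G n t (u (fsh G n (inv\<^bsub>G\<^esub> t) x))) \<in> hom (F l) N"
      using t by (intro hom_comp_fun[OF hom_comp_fun[OF F.act_hom ehom_hom[OF u]] N.act_hom]) auto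
    show "(\<lambda>x. u x \<otimes>\<^bsub>N\<^esub> h x) \<in> hom (F l) N"
      using u h by (intro hom_mult_fun N.A.comm_group_axioms) (auto intro: ehom_hom)
    fix b g assume b: "b \<in> B l" and g: "g \<in> carrier G"
    have "rsh G n t (u (fsh G n (inv\<^bsub>G\<^esub> t) (bas G n b g))) = rsh G n t (rsh G n (inv\<^bsub>G\<^esub> t \<otimes>\<^bsub>G\<^esub> g) (w b g \<otimes>\<^bsub>N\<^esub> rsh G n (inv\<^bsub>G\<^esub> g) (h (bas G n b g))))"
      using b g t by (simp add: fsh_bas G.comm_group_axioms ub w)
    also have "\<dots> = rsh G n g (w b g \<otimes>\<^bsub>N\<^esub> rsh G n (inv\<^bsub>G\<^esub> g) (h (bas G n b g)))"
      using b g t w hc by (simp add: N.act_mult)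
    finally show "rsh G n t (u (fsh G n (inv\<^bsub>G\<^esub> t) (bas G n b g))) = u (bas G n b g) \<otimes>\<^bsub>N\<^esub> h (bas G n b g)"
      using b g w hc by (simp add: N.act_m ub)
  qed
  \<comment> \<open>Subtracting \<open>u \<circ> D l\<close> removes the defect
    \<open>d = h \<circ> D l\<close> and does not disturb \<open>f = g \<circ> D k\<close>, because
    \<open>D l \<circ> D k\<close> is trivial.\<close>
  define g' where "g' = (\<lambda>x. g x \<otimes>\<^bsub>N\<^esub> inv\<^bsub>N\<^esub> (u (D l x)))"
  have g'hom: "g' \<in> hom (F k) N" unfolding g'_def l
    using hom_comp_fun[OF D_hom ehom_hom[OF u]] ehom_hom[OF g] l
    by (intro hom_mult_fun hom_inv_fun N.A.comm_group_axioms) auto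
  have Dl: "D l x \<in> carrier (F l)" if "x \<in> carrier (F k)" for x using that l by simp
  have g'H: "g' (fsh G n h x) = rsh G n h (g' x)" if "h \<in> H" "x \<in> carrier (F k)" for h x
  proof -
    have hG: "h \<in> carrier G" using that by simp
    have "D l (fsh G n h x) = fsh G n h (D l x)" using that hG l by (simp add: D_fsh)
    then show ?thesis using that hG gc uc Dl
      by (simp add: g'_def ehom_eq[OF g] ehom_eq[OF u] N.act_m N.act_inv)
  qed
  have g't: "g' (fsh G n t x) = rsh G n t (g' x)" if x: "x \<in> carrier (F k)" for x
  proof -
    let ?y = "fsh G n t x"
    have y: "?y \<in> carrier (F k)" using x t by simp
    have yx: "fsh G n (inv\<^bsub>G\<^esub> t) ?y = x" using x t by simp
    have D1: "fsh G n (inv\<^bsub>G\<^esub> t) (D l ?y) = D l x" using D_fsh[of ?y l "inv\<^bsub>G\<^esub> t"] y t l yx by simp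
    have 1: "rsh G n t (u (D l x)) = u (D l ?y) \<otimes>\<^bsub>N\<^esub> h (D l ?y)" using ueq[OF Dl[OF y]] D1 by simp
    have 2: "rsh G n t (g x) \<otimes>\<^bsub>N\<^esub> inv\<^bsub>N\<^esub> (g ?y) = h (D l ?y)" using dh[of ?y] y l yx by (simp add: d_def)
    have c: "g x \<in> carrier N" "g ?y \<in> carrier N" "rsh G n t (g x) \<in> carrier N" "h (D l ?y) \<in> carrier N" "u (D l x) \<in> carrier N" "u (D l ?y) \<in> carrier N"
      using gc x y t hc uc Dl by auto
    have "rsh G n t (g x) = h (D l ?y) \<otimes>\<^bsub>N\<^esub> g ?y" using 2 c by (metis N.A.inv_solve_right' )
    then have "rsh G n t (g' x) = (h (D l ?y) \<otimes>\<^bsub>N\<^esub> g ?y) \<otimes>\<^bsub>N\<^esub> inv\<^bsub>N\<^esub> (u (D l ?y) \<otimes>\<^bsub>N\<^esub> h (D l ?y))"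
      using c t 1 by (simp add: g'_def N.act_m N.act_inv)
    also have "\<dots> = g ?y \<otimes>\<^bsub>N\<^esub> inv\<^bsub>N\<^esub> (u (D l ?y))"
      by (rule comm_group_cancel) (use c N.A.comm_group_axioms in auto)
    finally show ?thesis using c by (simp add: g'_def)
  qed
  have "g' \<in> ehom ?H' (F k) (fsh G n) N (rsh G n)"
  proof (rule ehom_generate[OF gF gN g'hom])
    fix s x assume "s \<in> insert t S" "x \<in> carrier (F k)"
    then show "g' (fsh G n s x) = rsh G n s (g' x)"
      using g't g'H by (auto simp: HS generate.incl)
  qed (use S t in auto)
  moreover have "f x = g' (D k x)" if x: "x \<in> carrier (F (Suc k))" for x
  proof -
    interpret U: group_hom "F l" N u using ehom_hom[OF u] by unfold_locales
    have "D l (D k x) = \<one>\<^bsub>F l\<^esub>" using DD[of x l] x l by simp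
    then show ?thesis using x gc by (simp add: g'_def fg)
  qed
  ultimately show "\<exists>g\<in>ehom ?H' (F k) (fsh G n) N (rsh G n). \<forall>x\<in>carrier (F (Suc k)). f x = g (D k x)" by blast
qed

lemma finprod_cyclic:
  assumes "comm_group A" "\<And>a. T a \<in> carrier A" "T q = T (0::nat)"
  shows "finprod A (\<lambda>a. T (Suc a)) {..<q} = finprod A T {..<q}"
proof -
  interpret comm_group A by fact
  have "finprod A (\<lambda>a. T (Suc a)) {..<k} \<otimes>\<^bsub>A\<^esub> T 0 = finprod A T {..<k} \<otimes>\<^bsub>A\<^esub> T k" for k
  proof (induction k)
    case (Suc k)
    let ?P = "finprod A (\<lambda>a. T (Suc a)) {..<k}" and ?Q = "finprod A T {..<k}"
    have c: "?P \<in> carrier A" "?Q \<in> carrier A" using assms(2) by (auto intro!: finprod_closed)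
    have "finprod A (\<lambda>a. T (Suc a)) {..<Suc k} \<otimes>\<^bsub>A\<^esub> T 0 = T (Suc k) \<otimes>\<^bsub>A\<^esub> (?P \<otimes>\<^bsub>A\<^esub> T 0)"
      using c assms(2) by (simp add: lessThan_Suc Pi_def m_assoc)
    also have "\<dots> = (T k \<otimes>\<^bsub>A\<^esub> ?Q) \<otimes>\<^bsub>A\<^esub> T (Suc k)"
      unfolding Suc using c assms(2) by (simp add: m_comm)
    finally show ?case using assms(2) by (simp add: lessThan_Suc Pi_def)
  qed (use assms(2) in simp)
  from this[of q] show ?thesis using assms by (simp add: Pi_def)
qed

text \<open>Summing the conjugates of \<open>g\<close> over the cosets of \<open>H\<close> would
  give a primitive of \<open>q\<close> times \<open>f\<close>, and \<open>q\<close> need not be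
  invertible modulo \<open>n\<close>. If \<open>g\<close> is first cut to a slice, the
  \<open>q\<close> translates of the slice partition the group, so the conjugated cuts give a
  primitive of \<open>f\<close> itself, and no degree is lost.\<close>

lemma vanish_step_finite:
  assumes V: "vanish H m" and HS: "H = generate G S" and S: "S \<subseteq> carrier G" and t: "t \<in> carrier G"
    and fin: "(a::int) \<noteq> 0" "t [^]\<^bsub>G\<^esub> a \<in> H"
  shows "vanish (generate G (insert t S)) m"
  unfolding vanish_def
proof (intro allI ballI impI)
  let ?H' = "generate G (insert t S)"
  fix k f assume k: "k \<ge> m" and f: "f \<in> ehom ?H' (F (Suc k)) (fsh G n) N (rsh G n)"
    and f0: "\<forall>x\<in>carrier (F (Suc (Suc k))). f (D (Suc k) x) = \<one>\<^bsub>N\<^esub>"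
  interpret F: gact G n "F j" "fsh G n" for j by (rule gF)
  interpret N: gact G n N "rsh G n" by (rule gN)
  have H: "subgroup H G" unfolding HS by (rule G.generate_is_subgroup) (rule S)
  interpret H: subgroup H G by (rule H)
  have HH': "H \<subseteq> ?H'" unfolding HS by (rule G.mono_generate) blast
  have tH': "t [^]\<^bsub>G\<^esub> b \<in> ?H'" for b :: int
    using G.subgroup_int_pow_closed[OF G.generate_is_subgroup[of "insert t S"]] S t by (simp add: generate.incl)
  have f0': "f (D (Suc k) x) = \<one>\<^bsub>N\<^esub>" if "x \<in> carrier (F (Suc (Suc k)))" for x using f0 that by simp
  obtain g where g: "g \<in> ehom H (F k) (fsh G n) N (rsh G n)" and fg: "\<And>x. x \<in> carrier (F (Suc k)) \<Longrightarrow> f x = g (D k x)"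
    using vanishD[OF V k ehom_mono[OF f HH'] f0'] that by blast
  have gc: "g x \<in> carrier N" if "x \<in> carrier (F k)" for x using ehom_closed[OF g that] .
  \<comment> \<open>The order of \<open>t\<close> modulo \<open>H\<close>, hence the number of
    translates of the slice.\<close>
  define q where "q = (LEAST q. q > 0 \<and> t [^]\<^bsub>G\<^esub> int q \<in> H)"
  have "t [^]\<^bsub>G\<^esub> \<bar>a\<bar> \<in> H" using fin(2) H.m_inv_closed[OF fin(2)] t by (simp add: abs_if G.int_pow_neg)
  then have "nat \<bar>a\<bar> > 0 \<and> t [^]\<^bsub>G\<^esub> int (nat \<bar>a\<bar>) \<in> H" using fin(1) by simp
  from LeastI[of "\<lambda>q. q > 0 \<and> t [^]\<^bsub>G\<^esub> int q \<in> H", OF this]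
  have q: "q > 0" "t [^]\<^bsub>G\<^esub> int q \<in> H" by (auto simp: q_def)
  have qmin: "b = 0" if "b < q" "t [^]\<^bsub>G\<^esub> int b \<in> H" for b
    using not_less_Least[of b "\<lambda>q. q > 0 \<and> t [^]\<^bsub>G\<^esub> int q \<in> H"] that by (auto simp: q_def)
  obtain Y where YG: "Y \<subseteq> carrier G" and YH: "\<And>y h. y \<in> Y \<Longrightarrow> h \<in> H \<Longrightarrow> h \<otimes>\<^bsub>G\<^esub> y \<in> Y"
    and Yex: "\<And>g. g \<in> carrier G \<Longrightarrow> \<exists>a::int. t [^]\<^bsub>G\<^esub> a \<otimes>\<^bsub>G\<^esub> g \<in> Y"
    and Yun: "\<And>y a. y \<in> Y \<Longrightarrow> t [^]\<^bsub>G\<^esub> (a::int) \<otimes>\<^bsub>G\<^esub> y \<in> Y \<Longrightarrow> t [^]\<^bsub>G\<^esub> a \<in> H"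
    by (rule ex_slice[OF G.comm_group_axioms H t]) (rule that; assumption)
  let ?K = "amon (Zmod n)"
  let ?t = "\<lambda>a. t [^]\<^bsub>G\<^esub> int a"
  define \<rho> where "\<rho> = cut ?K Y"
  have \<rho>_hom: "\<rho> \<in> hom N N" unfolding \<rho>_def RG_def by (rule cut_hom) (rule comm_group_Zmod)
  have \<rho>c: "\<rho> z \<in> carrier N" if "z \<in> carrier N" for z using \<rho>_hom that by (rule hom_in_carrier)
  have \<rho>H: "\<rho> (rsh G n h z) = rsh G n h (\<rho> z)" if "h \<in> H" for h z
    unfolding \<rho>_def rsh_def
  proof (rule shift_cut)
    fix y assume y: "y \<in> carrier G"
    have "h \<otimes>\<^bsub>G\<^esub> (inv\<^bsub>G\<^esub> h \<otimes>\<^bsub>G\<^esub> y) = y" using y that by (simp add: G.m_assoc[symmetric])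
    then show "inv\<^bsub>G\<^esub> h \<otimes>\<^bsub>G\<^esub> y \<in> Y \<longleftrightarrow> y \<in> Y"
      using YH[of y "inv\<^bsub>G\<^esub> h"] YH[of "inv\<^bsub>G\<^esub> h \<otimes>\<^bsub>G\<^esub> y" h] that by auto
  qed (use that in auto)
  \<comment> \<open>The conjugate by \<open>t^a\<close> of the cut primitive. It is
    \<open>q\<close>-periodic in \<open>a\<close> because \<open>t^q\<close> lies in
    \<open>H\<close>, under which both \<open>g\<close> and \<open>\<rho>\<close> are equivariant;
    periodicity makes the sum over one period compatible with \<open>t\<close>.\<close>
  define T where "T = (\<lambda>a x. rsh G n (?t a) (\<rho> (g (fsh G n (inv\<^bsub>G\<^esub> (?t a)) x))))"
  have Thom: "T a \<in> hom (F k) N" for a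
    unfolding T_def using t
    by (intro hom_comp_fun[OF hom_comp_fun[OF hom_comp_fun[OF F.act_hom ehom_hom[OF g]] \<rho>_hom] N.act_hom]) auto
  have Tc: "T a x \<in> carrier N" if "x \<in> carrier (F k)" for a x using Thom that by (rule hom_in_carrier)
  have TH: "T a (fsh G n h x) = rsh G n h (T a x)" if h: "h \<in> H" and x: "x \<in> carrier (F k)" for a h x
  proof -
    have hG: "h \<in> carrier G" using h by simp
    have "fsh G n (inv\<^bsub>G\<^esub> (?t a)) (fsh G n h x) = fsh G n h (fsh G n (inv\<^bsub>G\<^esub> (?t a)) x)"
      using t hG x by (simp add: F.act_mult[symmetric] G.m_comm)
    then show ?thesis using t hG h x gc \<rho>c
      by (simp add: T_def ehom_eq[OF g] \<rho>H N.act_mult[symmetric] G.m_comm)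
  qed
  have Tq: "T q x = T 0 x" if x: "x \<in> carrier (F k)" for x
  proof -
    have "g (fsh G n (inv\<^bsub>G\<^esub> (?t q)) x) = rsh G n (inv\<^bsub>G\<^esub> (?t q)) (g x)"
      by (rule ehom_eq[OF g]) (use q x in auto)
    then show ?thesis using x t gc \<rho>c q by (simp add: T_def \<rho>H)
  qed
  have Tt: "rsh G n t (T a x) = T (Suc a) (fsh G n t x)" if x: "x \<in> carrier (F k)" for a x
  proof -
    have tS: "?t (Suc a) = t \<otimes>\<^bsub>G\<^esub> ?t a" using t G.int_pow_mult[of t 1 "int a"] by simp
    have "inv\<^bsub>G\<^esub> (?t (Suc a)) \<otimes>\<^bsub>G\<^esub> t = inv\<^bsub>G\<^esub> (?t a)"
      unfolding tS using t by (simp add: G.inv_mult_group G.m_assoc)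
    then have "fsh G n (inv\<^bsub>G\<^esub> (?t (Suc a))) (fsh G n t x) = fsh G n (inv\<^bsub>G\<^esub> (?t a)) x"
      using x t F.act_mult[of "inv\<^bsub>G\<^esub> (?t (Suc a))" t x k] by (metis G.int_pow_closed G.inv_closed)
    then show ?thesis using x t gc \<rho>c unfolding T_def tS by (simp add: N.act_mult)
  qed
  define g' where "g' = (\<lambda>x. finprod N (\<lambda>a. T a x) {..<q})"
  have g'hom: "g' \<in> hom (F k) N"
  proof (rule homI)
    fix x assume x: "x \<in> carrier (F k)"
    show "g' x \<in> carrier N" unfolding g'_def using Tc[OF x] by (intro N.A.finprod_closed) blast
    fix y assume y: "y \<in> carrier (F k)"
    have "g' (x \<otimes>\<^bsub>F k\<^esub> y) = finprod N (\<lambda>a. T a x \<otimes>\<^bsub>N\<^esub> T a y) {..<q}"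
      unfolding g'_def using hom_mult[OF Thom x y] by simp
    also have "\<dots> = g' x \<otimes>\<^bsub>N\<^esub> g' y"
      unfolding g'_def by (rule N.A.finprod_multf) (use Tc[OF x] Tc[OF y] in blast)+
    finally show "g' (x \<otimes>\<^bsub>F k\<^esub> y) = g' x \<otimes>\<^bsub>N\<^esub> g' y" .
  qed
  have g'H: "g' (fsh G n h x) = rsh G n h (g' x)" if h: "h \<in> H" and x: "x \<in> carrier (F k)" for h x
  proof -
    have hG: "h \<in> carrier G" using h by simp
    have "rsh G n h (g' x) = finprod N (\<lambda>a. rsh G n h (T a x)) {..<q}"
      unfolding g'_def by (rule N.act_finprod[OF hG]) (use Tc[OF x] in blast)
    then show ?thesis using TH[OF h x] by (simp add: g'_def)
  qed
  have g't: "g' (fsh G n t x) = rsh G n t (g' x)" if x: "x \<in> carrier (F k)" for x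
  proof -
    have tx: "fsh G n t x \<in> carrier (F k)" using x t by simp
    have "rsh G n t (g' x) = finprod N (\<lambda>a. rsh G n t (T a x)) {..<q}"
      unfolding g'_def by (rule N.act_finprod[OF t]) (use Tc[OF x] in blast)
    also have "\<dots> = finprod N (\<lambda>a. T (Suc a) (fsh G n t x)) {..<q}" using Tt[OF x] by simp
    also have "\<dots> = finprod N (\<lambda>a. T a (fsh G n t x)) {..<q}"
      by (rule finprod_cyclic[OF N.A.comm_group_axioms, where T="\<lambda>a. T a (fsh G n t x)"]) (use Tc[OF tx] Tq[OF tx] in auto)
    finally show ?thesis by (simp add: g'_def)
  qed
  have "g' \<in> ehom ?H' (F k) (fsh G n) N (rsh G n)"
  proof (rule ehom_generate[OF gF gN g'hom])
    fix s x assume "s \<in> insert t S" "x \<in> carrier (F k)"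
    then show "g' (fsh G n s x) = rsh G n s (g' x)"
      using g't g'H by (auto simp: HS generate.incl)
  qed (use S t in auto)
  moreover have "f x = g' (D k x)" if x: "x \<in> carrier (F (Suc k))" for x
  proof -
    let ?z = "f x"
    have z: "?z \<in> carrier N" using f x by (rule ehom_closed)
    have zF: "?z \<in> carrier (fsg (carrier G) ?K)" using z by (simp add: RG_def)
    have TD: "T a (D k x) = rsh G n (?t a) (\<rho> (rsh G n (inv\<^bsub>G\<^esub> (?t a)) ?z))" for a
    proof -
      have "inv\<^bsub>G\<^esub> (?t a) = t [^]\<^bsub>G\<^esub> (- int a)" using t by (simp add: G.int_pow_neg)
      then have i: "inv\<^bsub>G\<^esub> (?t a) \<in> ?H'" using tH' by metis
      have "g (fsh G n (inv\<^bsub>G\<^esub> (?t a)) (D k x)) = f (fsh G n (inv\<^bsub>G\<^esub> (?t a)) x)"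
        using x t by (simp add: fg D_fsh)
      also have "\<dots> = rsh G n (inv\<^bsub>G\<^esub> (?t a)) ?z" by (rule ehom_eq[OF f i x])
      finally show ?thesis by (simp add: T_def)
    qed
    have "g' (D k x) y = ?z y" for y
    proof (cases "y \<in> carrier G")
      case False
      have "g' (D k x) \<in> carrier (fsg (carrier G) ?K)"
        using hom_in_carrier[OF g'hom D_closed[OF x]] by (simp add: RG_def)
      then show ?thesis using fsg_out[OF _ False] zF by metis
    next
      case y: True
      have ev: "T a (D k x) y = (if inv\<^bsub>G\<^esub> (?t a) \<otimes>\<^bsub>G\<^esub> y \<in> Y then ?z y else \<one>\<^bsub>?K\<^esub>)" for a
      proof -
        have "?t a \<otimes>\<^bsub>G\<^esub> (inv\<^bsub>G\<^esub> (?t a) \<otimes>\<^bsub>G\<^esub> y) = y" using y t by (simp add: G.m_assoc[symmetric])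
        then show ?thesis using y t by (simp add: TD rsh_def shift_def \<rho>_def cut_def)
      qed
      obtain b :: int where b: "t [^]\<^bsub>G\<^esub> b \<otimes>\<^bsub>G\<^esub> y \<in> Y" using Yex[OF y] ..
      \<comment> \<open>The unique translate containing \<open>y\<close>: if \<open>t^b y\<close>
        lies in the slice, then so does \<open>t^(-c) y\<close> for every \<open>c\<close> congruent
        to \<open>-b\<close> modulo \<open>q\<close>.\<close>
      define c where "c = nat ((-b) mod int q)"
      have cq: "c < q" using q by (simp add: c_def nat_less_iff)
      have cY: "inv\<^bsub>G\<^esub> (?t c) \<otimes>\<^bsub>G\<^esub> y \<in> Y"
      proof -
        define d where "d = (-b) div int q"
        have "- int c = int q * d + b" using q minus_mod_eq_mult_div[of "-b" "int q"] by (simp add: c_def d_def)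
        then have "inv\<^bsub>G\<^esub> (?t c) = (?t q) [^]\<^bsub>G\<^esub> d \<otimes>\<^bsub>G\<^esub> t [^]\<^bsub>G\<^esub> b"
          using t by (simp add: G.int_pow_pow G.int_pow_mult[symmetric] G.int_pow_neg[symmetric])
        then have "inv\<^bsub>G\<^esub> (?t c) \<otimes>\<^bsub>G\<^esub> y = (?t q) [^]\<^bsub>G\<^esub> d \<otimes>\<^bsub>G\<^esub> (t [^]\<^bsub>G\<^esub> b \<otimes>\<^bsub>G\<^esub> y)"
          using t y by (simp add: G.m_assoc)
        then show ?thesis using YH[OF b] G.subgroup_int_pow_closed[OF H q(2)] by simp
      qed
      have uniq: "a = c" if a: "a < q" "inv\<^bsub>G\<^esub> (?t a) \<otimes>\<^bsub>G\<^esub> y \<in> Y" for a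
      proof -
        have key: "e = 0" if "inv\<^bsub>G\<^esub> (?t i) \<otimes>\<^bsub>G\<^esub> y \<in> Y" "inv\<^bsub>G\<^esub> (?t (i + e)) \<otimes>\<^bsub>G\<^esub> y \<in> Y" "i + e < q" for i e
        proof (rule qmin)
          have "inv\<^bsub>G\<^esub> (?t i) = ?t e \<otimes>\<^bsub>G\<^esub> inv\<^bsub>G\<^esub> (?t (i + e))"
            using t G.int_pow_mult[OF t, of "int e" "- int (i + e)"] by (simp add: G.int_pow_neg[symmetric])
          then have "?t e \<otimes>\<^bsub>G\<^esub> (inv\<^bsub>G\<^esub> (?t (i + e)) \<otimes>\<^bsub>G\<^esub> y) = inv\<^bsub>G\<^esub> (?t i) \<otimes>\<^bsub>G\<^esub> y"
            using t y by (simp add: G.m_assoc)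
          then show "?t e \<in> H" using Yun[OF that(2), of "int e"] that(1) by simp
        qed (use that in simp)
        show ?thesis
          using key[of a "c - a"] key[of c "a - c"] a cY cq by (cases a c rule: linorder_cases) auto
      qed
      have "g' (D k x) y = finprod ?K (\<lambda>a. T a (D k x) y) {..<q}"
        unfolding g'_def RG_def
        by (rule fsg_finprod[OF comm_group_Zmod]) (use Tc[OF D_closed[OF x]] in \<open>auto simp: RG_def\<close>)
      also have "\<dots> = finprod ?K (\<lambda>a. if c = a then ?z y else \<one>\<^bsub>?K\<^esub>) {..<q}"
        by (rule comm_monoid.finprod_cong'[OF comm_group.axioms(1)[OF comm_group_Zmod]])
          (use uniq cY fsg_app[OF zF] in \<open>auto simp: ev comm_group.axioms(1)[OF comm_group_Zmod] comm_groupE(2)[OF comm_group_Zmod, simplified]\<close>)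
      also have "\<dots> = ?z y"
        using comm_monoid.finprod_singleton[OF comm_group.axioms(1)[OF comm_group_Zmod], of c "{..<q}" "\<lambda>_. ?z y"] cq fsg_app[OF zF]
        by simp
      finally show ?thesis .
    qed
    then show ?thesis by (auto simp: fun_eq_iff)
  qed
  ultimately show "\<exists>g\<in>ehom ?H' (F k) (fsh G n) N (rsh G n). \<forall>x\<in>carrier (F (Suc k)). f x = g (D k x)" by blast
qed

text \<open>Generators are adjoined one at a time. Those of infinite order modulo the group
  generated before them are collected in \<open>I\<close>, and in a relation among them the last one
  with a nonzero exponent would contradict this. The loss of degrees is thus the size of an
  independent set, and no torsion subgroup has to be split off.\<close>

theorem vanish_rank:
  assumes "finite S" "S \<subseteq> carrier G"
  shows "\<exists>I\<subseteq>S. int_independent G I \<and> vanish (generate G S) (card I)"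
  using assms
proof (induction S)
  case empty
  have "generate G {} = {\<one>\<^bsub>G\<^esub>}" by (rule G.generate_empty)
  then show ?case using vanish_base by (auto simp: int_independent_def)
next
  case (insert t S)
  then obtain I where I: "I \<subseteq> S" "int_independent G I" "vanish (generate G S) (card I)" by auto
  have S: "S \<subseteq> carrier G" and t: "t \<in> carrier G" using insert by auto
  have finI: "finite I" using I insert finite_subset by blast
  show ?case
  proof (cases "\<exists>a::int. a \<noteq> 0 \<and> t [^]\<^bsub>G\<^esub> a \<in> generate G S")
    case True
    then obtain a :: int where "a \<noteq> 0" "t [^]\<^bsub>G\<^esub> a \<in> generate G S" by blast
    from vanish_step_finite[OF I(3) refl S t this] show ?thesis using I by blast
  next
    case False
    then have inf: "t [^]\<^bsub>G\<^esub> a \<notin> generate G S" if "a \<noteq> 0" for a :: int using that by blast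
    have "t \<notin> I" using I insert by blast
    have "int_independent G (insert t I)"
      unfolding int_independent_def
    proof (intro conjI allI impI)
      fix c :: "'g \<Rightarrow> int"
      have IG: "I \<subseteq> carrier G" using I S by blast
      assume 1: "finprod G (\<lambda>x. x [^]\<^bsub>G\<^esub> c x) (insert t I) = \<one>\<^bsub>G\<^esub>"
      let ?p = "finprod G (\<lambda>x. x [^]\<^bsub>G\<^esub> c x) I"
      have gS: "subgroup (generate G S) G" by (rule G.generate_is_subgroup[OF S])
      have pS: "?p \<in> generate G S" using finI I(1)
      proof (induction I)
        case empty
        then show ?case by (simp add: generate.one)
      next
        case (insert x I)
        have "x [^]\<^bsub>G\<^esub> c x \<in> generate G S" using insert by (intro G.subgroup_int_pow_closed[OF gS]) (auto intro: generate.incl)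
        moreover have "I \<subseteq> carrier G" "x \<in> carrier G" using insert S by auto
        ultimately show ?case using insert subgroup.m_closed[OF gS] by (simp add: Pi_def subset_iff)
      qed
      have pG: "?p \<in> carrier G" using IG by (intro G.finprod_closed) auto
      have "t [^]\<^bsub>G\<^esub> c t \<otimes>\<^bsub>G\<^esub> ?p = \<one>\<^bsub>G\<^esub>"
        using 1 finI \<open>t \<notin> I\<close> IG t by (simp add: Pi_def subset_iff)
      then have "t [^]\<^bsub>G\<^esub> c t = inv\<^bsub>G\<^esub> ?p" using t pG by (metis G.int_pow_closed G.inv_equality)
      then have "t [^]\<^bsub>G\<^esub> c t \<in> generate G S" using subgroup.m_inv_closed[OF gS pS] by simp
      then have ct: "c t = 0" using inf by blast
      then have "?p = \<one>\<^bsub>G\<^esub>" using \<open>t [^]\<^bsub>G\<^esub> c t \<otimes>\<^bsub>G\<^esub> ?p = \<one>\<^bsub>G\<^esub>\<close> pG by simp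
      then show "\<forall>x\<in>insert t I. c x = 0" using I(2) ct by (simp add: int_independent_def)
    qed (use I S t finI in auto)
    moreover have "vanish (generate G (insert t S)) (card (insert t I))"
      using vanish_step_infinite[OF I(3) refl S t inf] \<open>t \<notin> I\<close> finI by simp
    ultimately show ?thesis using I by blast
  qed
qed

end

section \<open>Splittings indexed by the cosets of a subgroup\<close>

text \<open>Representatives are given by a map that is constant on cosets rather than by a set:
  translation by \<open>g\<close> then permutes them as multiplication by \<open>g\<close> followed
  by \<open>\<rho>\<close>.\<close>

locale transversal = G: comm_group G for G :: "'g monoid" +
  fixes \<Lambda> :: "'g set" and \<rho> :: "'g \<Rightarrow> 'g"
  assumes sub: "subgroup \<Lambda> G"
    and rho_closed [simp]: "g \<in> carrier G \<Longrightarrow> \<rho> g \<in> carrier G"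
    and rho_mem: "g \<in> carrier G \<Longrightarrow> inv\<^bsub>G\<^esub> g \<otimes>\<^bsub>G\<^esub> \<rho> g \<in> \<Lambda>"
    and rho_right: "g \<in> carrier G \<Longrightarrow> h \<in> \<Lambda> \<Longrightarrow> \<rho> (g \<otimes>\<^bsub>G\<^esub> h) = \<rho> g"

lemma ex_transversal:
  assumes "comm_group G" "subgroup \<Lambda> G"
  shows "\<exists>\<rho>. transversal G \<Lambda> \<rho>"
proof -
  interpret comm_group G by fact
  interpret L: subgroup \<Lambda> G by fact
  define \<rho> where "\<rho> = (\<lambda>g. SOME x. x \<in> \<Lambda> #>\<^bsub>G\<^esub> g)"
  have r: "\<rho> g \<in> \<Lambda> #>\<^bsub>G\<^esub> g" if "g \<in> carrier G" for g
    unfolding \<rho>_def by (rule someI[of _ g]) (rule rcos_self[OF that assms(2)])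
  have "transversal G \<Lambda> \<rho>"
  proof
    fix g assume g: "g \<in> carrier G"
    then obtain h where h: "h \<in> \<Lambda>" "\<rho> g = h \<otimes>\<^bsub>G\<^esub> g" using r unfolding r_coset_def by blast
    then show "\<rho> g \<in> carrier G" using g by simp
    have "inv\<^bsub>G\<^esub> g \<otimes>\<^bsub>G\<^esub> \<rho> g = h" using g h by (simp add: m_comm[of h g] m_assoc[symmetric])
    then show "inv\<^bsub>G\<^esub> g \<otimes>\<^bsub>G\<^esub> \<rho> g \<in> \<Lambda>" using h by simp
    fix k assume k: "k \<in> \<Lambda>"
    have "g \<otimes>\<^bsub>G\<^esub> k \<in> \<Lambda> #>\<^bsub>G\<^esub> g" using m_comm[OF g L.mem_carrier[OF k]] k unfolding r_coset_def by blast
    then have "\<Lambda> #>\<^bsub>G\<^esub> (g \<otimes>\<^bsub>G\<^esub> k) = \<Lambda> #>\<^bsub>G\<^esub> g" using repr_independence[OF _ g assms(2)] by metis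
    then show "\<rho> (g \<otimes>\<^bsub>G\<^esub> k) = \<rho> g" by (simp add: \<rho>_def)
  qed
  then show ?thesis by blast
qed

section \<open>Conjugates of an equivariant map indexed by cosets, and their sum\<close>

context transversal
begin

lemma L_sub: "h \<in> \<Lambda> \<Longrightarrow> h \<in> carrier G" using subgroup.mem_carrier[OF sub] .

abbreviation "T \<equiv> \<rho> ` carrier G"

lemma rho_eqI:
  assumes "g \<in> carrier G" "g' \<in> carrier G" "inv\<^bsub>G\<^esub> g \<otimes>\<^bsub>G\<^esub> g' \<in> \<Lambda>"
  shows "\<rho> g' = \<rho> g"
proof -
  have "g \<otimes>\<^bsub>G\<^esub> (inv\<^bsub>G\<^esub> g \<otimes>\<^bsub>G\<^esub> g') = g'" using assms by (simp add: G.m_assoc[symmetric])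
  then show ?thesis using rho_right[OF assms(1,3)] by simp
qed

lemma rho_rho: "g \<in> carrier G \<Longrightarrow> \<rho> (\<rho> g) = \<rho> g"
  by (rule rho_eqI) (auto intro: rho_mem)

lemma T_closed: "x \<in> T \<Longrightarrow> x \<in> carrier G" by auto

lemma rho_T: "x \<in> T \<Longrightarrow> \<rho> x = x" using rho_rho by auto

lemma rho_mult: "g \<in> carrier G \<Longrightarrow> h \<in> carrier G \<Longrightarrow> \<rho> (g \<otimes>\<^bsub>G\<^esub> \<rho> h) = \<rho> (g \<otimes>\<^bsub>G\<^esub> h)"
proof (rule rho_eqI)
  assume g: "g \<in> carrier G" and h: "h \<in> carrier G"
  have "inv\<^bsub>G\<^esub> g \<otimes>\<^bsub>G\<^esub> (g \<otimes>\<^bsub>G\<^esub> \<rho> h) = \<rho> h" using g h by (simp add: G.m_assoc[symmetric])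
  then have "inv\<^bsub>G\<^esub> (g \<otimes>\<^bsub>G\<^esub> h) \<otimes>\<^bsub>G\<^esub> (g \<otimes>\<^bsub>G\<^esub> \<rho> h) = inv\<^bsub>G\<^esub> h \<otimes>\<^bsub>G\<^esub> \<rho> h"
    using g h by (simp add: G.inv_mult_group G.m_assoc)
  then show "inv\<^bsub>G\<^esub> (g \<otimes>\<^bsub>G\<^esub> h) \<otimes>\<^bsub>G\<^esub> (g \<otimes>\<^bsub>G\<^esub> \<rho> h) \<in> \<Lambda>" using rho_mem[OF h] by simp
qed auto

text \<open>The conjugate of \<open>\<theta>\<close> by \<open>x\<close>. For a
  \<Lambda>-equivariant \<open>\<theta>\<close> it depends only on the coset of \<open>x\<close>
  (\<open>trm_rho\<close>), so representatives suffice as indices.\<close>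

definition trm where "trm \<alpha> \<beta> \<theta> x v = \<beta> x (\<theta> (\<alpha> (inv\<^bsub>G\<^esub> x) v))"

definition supp where "supp B \<alpha> \<beta> \<theta> v = {x \<in> T. trm \<alpha> \<beta> \<theta> x v \<noteq> \<one>\<^bsub>B\<^esub>}"

text \<open>The trace of \<open>\<theta>\<close> from \<Lambda> to the full group for an index that
  may be infinite: the sum is finite for each \<open>v\<close> separately. On an infinite support
  the product would default to the unit, hence the finiteness hypothesis of
  \<open>avg_ehom\<close>.\<close>

definition avg where "avg B \<alpha> \<beta> \<theta> v = finprod B (\<lambda>x. trm \<alpha> \<beta> \<theta> x v) (supp B \<alpha> \<beta> \<theta> v)"

lemma trm_closed:
  assumes "gact G n A \<alpha>" "gact G n B \<beta>" "\<theta> \<in> ehom \<Lambda> A \<alpha> B \<beta>" "x \<in> carrier G" "v \<in> carrier A"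
  shows "trm \<alpha> \<beta> \<theta> x v \<in> carrier B"
proof -
  interpret A: gact G n A \<alpha> by fact
  interpret B: gact G n B \<beta> by fact
  show ?thesis using assms(4,5) ehom_closed[OF assms(3)] by (simp add: trm_def)
qed

lemma trm_hom:
  assumes "gact G n A \<alpha>" "gact G n B \<beta>" "\<theta> \<in> ehom \<Lambda> A \<alpha> B \<beta>" "x \<in> carrier G"
  shows "trm \<alpha> \<beta> \<theta> x \<in> hom A B"
proof -
  interpret A: gact G n A \<alpha> by fact
  interpret B: gact G n B \<beta> by fact
  show ?thesis unfolding trm_def[abs_def] using assms(4)
    by (intro hom_comp_fun[OF hom_comp_fun[OF A.act_hom ehom_hom[OF assms(3)]] B.act_hom]) auto
qed

lemma trm_rho:
  assumes "gact G n A \<alpha>" "gact G n B \<beta>" "\<theta> \<in> ehom \<Lambda> A \<alpha> B \<beta>" "g \<in> carrier G" "v \<in> carrier A"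
  shows "trm \<alpha> \<beta> \<theta> (\<rho> g) v = trm \<alpha> \<beta> \<theta> g v"
proof -
  interpret A: gact G n A \<alpha> by fact
  interpret B: gact G n B \<beta> by fact
  define h where "h = inv\<^bsub>G\<^esub> g \<otimes>\<^bsub>G\<^esub> \<rho> g"
  have h: "h \<in> \<Lambda>" "h \<in> carrier G" using rho_mem[OF assms(4)] L_sub by (auto simp: h_def)
  have r: "\<rho> g = g \<otimes>\<^bsub>G\<^esub> h" using assms(4) by (simp add: h_def G.m_assoc[symmetric])
  have "inv\<^bsub>G\<^esub> (\<rho> g) = inv\<^bsub>G\<^esub> h \<otimes>\<^bsub>G\<^esub> inv\<^bsub>G\<^esub> g" unfolding r using assms(4) h by (simp add: G.inv_mult_group)
  then have "\<theta> (\<alpha> (inv\<^bsub>G\<^esub> (\<rho> g)) v) = \<beta> (inv\<^bsub>G\<^esub> h) (\<theta> (\<alpha> (inv\<^bsub>G\<^esub> g) v))"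
    using assms(4,5) h subgroup.m_inv_closed[OF sub h(1)] by (simp add: A.act_mult ehom_eq[OF assms(3)])
  then show ?thesis
    using assms(4,5) h ehom_closed[OF assms(3)] by (simp add: trm_def r B.act_mult)
qed

lemma trm_act:
  assumes "gact G n A \<alpha>" "gact G n B \<beta>" "\<theta> \<in> ehom \<Lambda> A \<alpha> B \<beta>" "g \<in> carrier G" "x \<in> carrier G" "v \<in> carrier A"
  shows "trm \<alpha> \<beta> \<theta> (\<rho> (g \<otimes>\<^bsub>G\<^esub> x)) (\<alpha> g v) = \<beta> g (trm \<alpha> \<beta> \<theta> x v)"
proof -
  interpret A: gact G n A \<alpha> by fact
  interpret B: gact G n B \<beta> by fact
  have "\<alpha> (inv\<^bsub>G\<^esub> (g \<otimes>\<^bsub>G\<^esub> x)) (\<alpha> g v) = \<alpha> (inv\<^bsub>G\<^esub> x) v"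
    using assms(4-6) by (simp add: G.inv_mult_group A.act_mult)
  then have "trm \<alpha> \<beta> \<theta> (g \<otimes>\<^bsub>G\<^esub> x) (\<alpha> g v) = \<beta> g (trm \<alpha> \<beta> \<theta> x v)"
    using assms(4-6) ehom_closed[OF assms(3)] by (simp add: trm_def B.act_mult)
  then show ?thesis using trm_rho[OF assms(1-3), of "g \<otimes>\<^bsub>G\<^esub> x" "\<alpha> g v"] assms(4-6) by simp
qed

lemma avg_eq:
  assumes "gact G n A \<alpha>" "gact G n B \<beta>" "\<theta> \<in> ehom \<Lambda> A \<alpha> B \<beta>" "v \<in> carrier A"
    and "finite S" "S \<subseteq> T" "supp B \<alpha> \<beta> \<theta> v \<subseteq> S"
  shows "avg B \<alpha> \<beta> \<theta> v = finprod B (\<lambda>x. trm \<alpha> \<beta> \<theta> x v) S"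
proof -
  interpret B: gact G n B \<beta> by fact
  have c: "trm \<alpha> \<beta> \<theta> x v \<in> carrier B" if "x \<in> S" for x
    using trm_closed[OF assms(1-3) T_closed assms(4)] that assms(6) by blast
  show ?thesis unfolding avg_def
  proof (rule B.A.finprod_mono_neutral_cong_left)
    fix i assume "i \<in> S - supp B \<alpha> \<beta> \<theta> v"
    then show "trm \<alpha> \<beta> \<theta> i v = \<one>\<^bsub>B\<^esub>" using assms(6) unfolding supp_def by blast
  qed (use assms c in auto)
qed

lemma avg_ehom:
  assumes A: "gact G n A \<alpha>" and B: "gact G n B \<beta>" and \<theta>: "\<theta> \<in> ehom \<Lambda> A \<alpha> B \<beta>"
    and fin: "\<And>v. v \<in> carrier A \<Longrightarrow> finite (supp B \<alpha> \<beta> \<theta> v)"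
  shows "avg B \<alpha> \<beta> \<theta> \<in> ehom (carrier G) A \<alpha> B \<beta>"
proof -
  interpret A: gact G n A \<alpha> by fact
  interpret B: gact G n B \<beta> by fact
  note c = trm_closed[OF A B \<theta> T_closed]
  have sT: "supp B \<alpha> \<beta> \<theta> v \<subseteq> T" for v by (auto simp: supp_def)
  have "avg B \<alpha> \<beta> \<theta> \<in> hom A B"
  proof (rule homI)
    fix v assume v: "v \<in> carrier A"
    show "avg B \<alpha> \<beta> \<theta> v \<in> carrier B"
      unfolding avg_def using c[OF _ v] sT by (intro B.A.finprod_closed) blast
    fix w assume w: "w \<in> carrier A"
    let ?S = "supp B \<alpha> \<beta> \<theta> v \<union> supp B \<alpha> \<beta> \<theta> w"
    have S: "finite ?S" "?S \<subseteq> T" using fin[OF v] fin[OF w] sT[of v] sT[of w] by auto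
    have m: "trm \<alpha> \<beta> \<theta> x (v \<otimes>\<^bsub>A\<^esub> w) = trm \<alpha> \<beta> \<theta> x v \<otimes>\<^bsub>B\<^esub> trm \<alpha> \<beta> \<theta> x w" if "x \<in> T" for x
      using hom_mult[OF trm_hom[OF A B \<theta> T_closed[OF that]] v w] .
    have "supp B \<alpha> \<beta> \<theta> (v \<otimes>\<^bsub>A\<^esub> w) \<subseteq> ?S"
      using m by (auto simp: supp_def)
    then have "avg B \<alpha> \<beta> \<theta> (v \<otimes>\<^bsub>A\<^esub> w) = finprod B (\<lambda>x. trm \<alpha> \<beta> \<theta> x (v \<otimes>\<^bsub>A\<^esub> w)) ?S"
      using avg_eq[OF A B \<theta> _ S] v w by simp
    also have "\<dots> = finprod B (\<lambda>x. trm \<alpha> \<beta> \<theta> x v \<otimes>\<^bsub>B\<^esub> trm \<alpha> \<beta> \<theta> x w) ?S"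
    proof (rule B.A.finprod_cong')
      show "(\<lambda>x. trm \<alpha> \<beta> \<theta> x v \<otimes>\<^bsub>B\<^esub> trm \<alpha> \<beta> \<theta> x w) \<in> ?S \<rightarrow> carrier B"
        using c[OF _ v] c[OF _ w] S(2) by (intro Pi_I B.A.m_closed) blast+
      show "\<And>i. i \<in> ?S \<Longrightarrow> trm \<alpha> \<beta> \<theta> i (v \<otimes>\<^bsub>A\<^esub> w) = trm \<alpha> \<beta> \<theta> i v \<otimes>\<^bsub>B\<^esub> trm \<alpha> \<beta> \<theta> i w"
        using m S(2) by blast
    qed simp
    also have "\<dots> = finprod B (\<lambda>x. trm \<alpha> \<beta> \<theta> x v) ?S \<otimes>\<^bsub>B\<^esub> finprod B (\<lambda>x. trm \<alpha> \<beta> \<theta> x w) ?S"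
      by (rule B.A.finprod_multf) (use c[OF _ v] c[OF _ w] S(2) in blast)+
    also have "\<dots> = avg B \<alpha> \<beta> \<theta> v \<otimes>\<^bsub>B\<^esub> avg B \<alpha> \<beta> \<theta> w"
      using avg_eq[OF A B \<theta> v S] avg_eq[OF A B \<theta> w S] by simp
    finally show "avg B \<alpha> \<beta> \<theta> (v \<otimes>\<^bsub>A\<^esub> w) = avg B \<alpha> \<beta> \<theta> v \<otimes>\<^bsub>B\<^esub> avg B \<alpha> \<beta> \<theta> w" .
  qed
  moreover have "avg B \<alpha> \<beta> \<theta> (\<alpha> g v) = \<beta> g (avg B \<alpha> \<beta> \<theta> v)" if g: "g \<in> carrier G" and v: "v \<in> carrier A" for g v
  proof -
    \<comment> \<open>Translation by \<open>g\<close> permutes the cosets; on representatives it is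
      \<open>\<tau>\<close>, with inverse \<open>\<sigma>\<close>, and it carries the terms for
      \<open>v\<close> to those for \<open>\<alpha> g v\<close>.\<close>
    define \<tau> where "\<tau> = (\<lambda>x. \<rho> (g \<otimes>\<^bsub>G\<^esub> x))"
    define \<sigma> where "\<sigma> = (\<lambda>x. \<rho> (inv\<^bsub>G\<^esub> g \<otimes>\<^bsub>G\<^esub> x))"
    have st: "\<sigma> (\<tau> x) = x" if "x \<in> T" for x
    proof -
      have "inv\<^bsub>G\<^esub> g \<otimes>\<^bsub>G\<^esub> (g \<otimes>\<^bsub>G\<^esub> x) = x" using g T_closed[OF that] by (simp add: G.m_assoc[symmetric])
      then show ?thesis using g T_closed[OF that] rho_T[OF that] by (simp add: \<sigma>_def \<tau>_def rho_mult)
    qed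
    have ts: "\<tau> (\<sigma> x) = x" if "x \<in> T" for x
    proof -
      have "g \<otimes>\<^bsub>G\<^esub> (inv\<^bsub>G\<^esub> g \<otimes>\<^bsub>G\<^esub> x) = x" using g T_closed[OF that] by (simp add: G.m_assoc[symmetric])
      then show ?thesis using g T_closed[OF that] rho_T[OF that] by (simp add: \<sigma>_def \<tau>_def rho_mult)
    qed
    have sT': "\<sigma> x \<in> T" "\<tau> x \<in> T" if "x \<in> T" for x
      using g T_closed[OF that] unfolding \<sigma>_def \<tau>_def by (intro imageI; simp)+
    have tr: "trm \<alpha> \<beta> \<theta> (\<tau> x) (\<alpha> g v) = \<beta> g (trm \<alpha> \<beta> \<theta> x v)" if "x \<in> T" for x
      unfolding \<tau>_def by (rule trm_act[OF A B \<theta> g T_closed[OF that] v])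
    have iff: "\<tau> x \<in> supp B \<alpha> \<beta> \<theta> (\<alpha> g v) \<longleftrightarrow> x \<in> supp B \<alpha> \<beta> \<theta> v" if "x \<in> T" for x
      using that sT'[OF that] tr[OF that] B.act_eq_unit[OF g c[OF that v]] unfolding supp_def by simp
    have img: "\<tau> ` supp B \<alpha> \<beta> \<theta> v = supp B \<alpha> \<beta> \<theta> (\<alpha> g v)"
    proof
      show "\<tau> ` supp B \<alpha> \<beta> \<theta> v \<subseteq> supp B \<alpha> \<beta> \<theta> (\<alpha> g v)" using iff sT by blast
      show "supp B \<alpha> \<beta> \<theta> (\<alpha> g v) \<subseteq> \<tau> ` supp B \<alpha> \<beta> \<theta> v"
      proof
        fix y assume y: "y \<in> supp B \<alpha> \<beta> \<theta> (\<alpha> g v)"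
        then have yT: "y \<in> T" using sT by blast
        then have "\<sigma> y \<in> supp B \<alpha> \<beta> \<theta> v" using iff[OF sT'(1)[OF yT]] ts[OF yT] y by simp
        then show "y \<in> \<tau> ` supp B \<alpha> \<beta> \<theta> v" using ts[OF yT] by (metis imageI)
      qed
    qed
    have inj: "inj_on \<tau> (supp B \<alpha> \<beta> \<theta> v)"
      by (rule inj_on_inverseI[where g=\<sigma>]) (use st sT in blast)
    have gv: "\<alpha> g v \<in> carrier A" using g v by simp
    have "avg B \<alpha> \<beta> \<theta> (\<alpha> g v) = finprod B (\<lambda>x. trm \<alpha> \<beta> \<theta> (\<tau> x) (\<alpha> g v)) (supp B \<alpha> \<beta> \<theta> v)"
      unfolding avg_def img[symmetric]
      by (rule B.A.finprod_reindex[OF _ inj]) (use c[OF _ gv] sT img in blast)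
    also have "\<dots> = finprod B (\<lambda>x. \<beta> g (trm \<alpha> \<beta> \<theta> x v)) (supp B \<alpha> \<beta> \<theta> v)"
    proof (rule B.A.finprod_cong')
      show "(\<lambda>x. \<beta> g (trm \<alpha> \<beta> \<theta> x v)) \<in> supp B \<alpha> \<beta> \<theta> v \<rightarrow> carrier B"
        using c[OF _ v] sT g by (intro Pi_I B.act_closed) blast+
    qed (use tr sT in blast)+
    also have "\<dots> = \<beta> g (avg B \<alpha> \<beta> \<theta> v)"
      unfolding avg_def by (rule B.act_finprod[OF g, symmetric]) (use c[OF _ v] sT in blast)
    finally show ?thesis .
  qed
  ultimately show ?thesis by (simp add: ehom_def)
qed

text \<open>The analogue, for a possibly infinite index, of Higman's criterion for relative
  projectivity: the identity is a trace from \<Lambda>. On an induced module \<open>\<pi>\<close>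
  can be the projection onto the summand of the trivial coset. Idempotence is left out because lifts
  along a resolution do not have it in general.\<close>

definition splitting :: "nat \<Rightarrow> 'a monoid \<Rightarrow> ('g \<Rightarrow> 'a \<Rightarrow> 'a) \<Rightarrow> ('a \<Rightarrow> 'a) \<Rightarrow> bool" where
  "splitting n A \<alpha> \<pi> \<longleftrightarrow> \<pi> \<in> ehom \<Lambda> A \<alpha> A \<alpha> \<and> (\<forall>v\<in>carrier A. finite (supp A \<alpha> \<alpha> \<pi> v) \<and> avg A \<alpha> \<alpha> \<pi> v = v)"

text \<open>The values of \<open>\<pi>\<close> on translates of each \<open>d (e b)\<close> are
  lifted separately. The translated lifts add up to the basis vector only modulo the kernel of
  \<open>d\<close>, so the lift at one fixed representative \<open>x0\<close> is replaced by
  whatever is missing from the sum. The replacement is still a lift because the conjugates of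
  \<open>\<pi>\<close> themselves add up to the identity.\<close>

lemma splitting_lift:
  assumes A: "gact G n A \<alpha>" and sp: "splitting n A \<alpha> \<pi>"
    and d: "d \<in> ehom (carrier G) (FR G n B) (fsh G n) A \<alpha>"
    and im: "\<And>v. v \<in> carrier (FR G n B) \<Longrightarrow> \<pi> (d v) \<in> d ` carrier (FR G n B)"
  obtains \<pi>' where "splitting n (FR G n B) (fsh G n) \<pi>'" "\<And>v. v \<in> carrier (FR G n B) \<Longrightarrow> d (\<pi>' v) = \<pi> (d v)"
proof -
  let ?F = "FR G n B"
  interpret A: gact G n A \<alpha> by fact
  have F: "gact G n ?F (fsh G n)" by (rule gact_FR) (rule G.comm_group_axioms)
  interpret F: gact G n ?F "fsh G n" by (rule F)
  interpret d: group_hom ?F A d using ehom_hom[OF d] by unfold_locales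
  have \<pi>: "\<pi> \<in> ehom \<Lambda> A \<alpha> A \<alpha>" and fin: "\<And>v. v \<in> carrier A \<Longrightarrow> finite (supp A \<alpha> \<alpha> \<pi> v)"
    and av: "\<And>v. v \<in> carrier A \<Longrightarrow> avg A \<alpha> \<alpha> \<pi> v = v" using sp by (auto simp: splitting_def)
  interpret p: group_hom A A \<pi> using ehom_hom[OF \<pi>] by unfold_locales
  define e where "e b = bas G n b \<one>\<^bsub>G\<^esub>" for b :: 'b
  define S where "S b = supp A \<alpha> \<alpha> \<pi> (d (e b))" for b
  have e: "e b \<in> carrier ?F" if "b \<in> B" for b using that by (simp add: e_def)
  have bas_e: "bas G n b g = fsh G n g (e b)" if "g \<in> carrier G" for b g
    using that by (simp add: e_def fsh_bas G.comm_group_axioms)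
  have S: "finite (S b)" if "b \<in> B" for b using fin e that by (simp add: S_def)
  have ST: "S b \<subseteq> T" for b unfolding S_def supp_def by blast
  \<comment> \<open>Outside the finite set \<open>S b\<close> the unit is a legitimate lift, and it
    has to be the one taken so that only finitely many lifted terms are nontrivial.\<close>
  have "\<exists>y. y \<in> carrier ?F \<and> d y = \<pi> (\<alpha> (inv\<^bsub>G\<^esub> x) (d (e b))) \<and> (x \<notin> S b \<longrightarrow> y = \<one>\<^bsub>?F\<^esub>)"
    if b: "b \<in> B" and x: "x \<in> T" for b x
  proof (cases "x \<in> S b")
    case True
    have "\<pi> (\<alpha> (inv\<^bsub>G\<^esub> x) (d (e b))) = \<pi> (d (fsh G n (inv\<^bsub>G\<^esub> x) (e b)))"
      using ehom_eq[OF d _ e[OF b], of "inv\<^bsub>G\<^esub> x"] T_closed[OF x] by simp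
    also have "\<dots> \<in> d ` carrier ?F" using im F.act_closed[OF G.inv_closed[OF T_closed[OF x]] e[OF b]] by blast
    finally show ?thesis using True by (metis (no_types, lifting) imageE)
  next
    case False
    then have "\<alpha> x (\<pi> (\<alpha> (inv\<^bsub>G\<^esub> x) (d (e b)))) = \<one>\<^bsub>A\<^esub>" using x by (simp add: S_def supp_def trm_def)
    then have "\<pi> (\<alpha> (inv\<^bsub>G\<^esub> x) (d (e b))) = \<one>\<^bsub>A\<^esub>"
      using A.act_eq_unit[OF T_closed[OF x]] T_closed[OF x] e[OF b] by simp
    then show ?thesis by (intro exI[of _ "\<one>\<^bsub>?F\<^esub>"]) simp
  qed
  then obtain y where y: "\<And>b x. b \<in> B \<Longrightarrow> x \<in> T \<Longrightarrow> y b x \<in> carrier ?F"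
    "\<And>b x. b \<in> B \<Longrightarrow> x \<in> T \<Longrightarrow> d (y b x) = \<pi> (\<alpha> (inv\<^bsub>G\<^esub> x) (d (e b)))"
    "\<And>b x. b \<in> B \<Longrightarrow> x \<in> T \<Longrightarrow> x \<notin> S b \<Longrightarrow> y b x = \<one>\<^bsub>?F\<^esub>"
    by metis
  define x0 where "x0 = \<rho> \<one>\<^bsub>G\<^esub>"
  have x0: "x0 \<in> T" unfolding x0_def by (rule imageI) simp
  have x0G: "x0 \<in> carrier G" using T_closed[OF x0] .
  define Q where "Q b = finprod ?F (\<lambda>x. fsh G n x (y b x)) (S b - {x0})" for b
  \<comment> \<open>\<open>Q b\<close> collects the terms at all other representatives; the term at
    \<open>x0\<close> becomes exactly \<open>e b\<close> minus \<open>Q b\<close>.\<close>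
  define y' where "y' b x = (if x = x0 then fsh G n (inv\<^bsub>G\<^esub> x0) (e b \<otimes>\<^bsub>?F\<^esub> inv\<^bsub>?F\<^esub> (Q b)) else y b x)" for b x
  have Qf: "(\<lambda>x. fsh G n x (y b x)) \<in> S b - {x0} \<rightarrow> carrier ?F" if "b \<in> B" for b
    using y(1)[OF that] ST[of b] T_closed by blast
  have Q: "Q b \<in> carrier ?F" if "b \<in> B" for b
    unfolding Q_def by (rule F.A.finprod_closed) (rule Qf[OF that])
  have y'c: "y' b x \<in> carrier ?F" if "b \<in> B" "x \<in> T" for b x
    using y(1)[OF that] x0G e[OF that(1)] Q[OF that(1)] by (simp add: y'_def)
  have y'1: "y' b x = \<one>\<^bsub>?F\<^esub>" if "b \<in> B" "x \<in> T" "x \<notin> insert x0 (S b)" for b x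
    using that y(3) by (simp add: y'_def)
  have y'd: "d (y' b x) = \<pi> (\<alpha> (inv\<^bsub>G\<^esub> x) (d (e b)))" if b: "b \<in> B" and x: "x \<in> T" for b x
  proof (cases "x = x0")
    case False
    then show ?thesis using y(2)[OF b x] by (simp add: y'_def)
  next
    case True
    let ?v = "d (e b)"
    have v: "?v \<in> carrier A" using e[OF b] by simp
    have tc: "trm \<alpha> \<alpha> \<pi> x ?v \<in> carrier A" if "x \<in> T" for x by (rule trm_closed[OF A A \<pi> T_closed[OF that] v])
    let ?P = "finprod A (\<lambda>x. trm \<alpha> \<alpha> \<pi> x ?v) (S b - {x0})"
    have tcP: "(\<lambda>x. trm \<alpha> \<alpha> \<pi> x ?v) \<in> S b - {x0} \<rightarrow> carrier A" using tc ST[of b] by blast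
    have P: "?P \<in> carrier A" by (rule A.A.finprod_closed) (rule tcP)
    have "?v = finprod A (\<lambda>x. trm \<alpha> \<alpha> \<pi> x ?v) (insert x0 (S b - {x0}))"
      using av[OF v] avg_eq[OF A A \<pi> v, of "insert x0 (S b - {x0})"] S[OF b] ST[of b] x0
      unfolding S_def[symmetric] by auto
    also have "\<dots> = trm \<alpha> \<alpha> \<pi> x0 ?v \<otimes>\<^bsub>A\<^esub> ?P"
      by (rule A.A.finprod_insert) (use S[OF b] tcP tc[OF x0] in auto)
    finally have vP: "?v \<otimes>\<^bsub>A\<^esub> inv\<^bsub>A\<^esub> ?P = trm \<alpha> \<alpha> \<pi> x0 ?v"
      using P tc[OF x0] v by (metis A.A.inv_solve_right A.A.inv_closed A.A.m_closed)
    have "d (Q b) = finprod A (\<lambda>x. d (fsh G n x (y b x))) (S b - {x0})"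
      unfolding Q_def by (rule hom_finprod[OF F.A.comm_group_axioms A.A.comm_group_axioms ehom_hom[OF d] Qf[OF b]])
    also have "\<dots> = ?P"
    proof (rule A.A.finprod_cong'[OF refl tcP])
      fix x assume "x \<in> S b - {x0}"
      then have xT: "x \<in> T" using ST by blast
      then show "d (fsh G n x (y b x)) = trm \<alpha> \<alpha> \<pi> x ?v"
        using ehom_eq[OF d T_closed[OF xT] y(1)[OF b xT]] y(2)[OF b xT] by (simp add: trm_def)
    qed
    finally have dQ: "d (Q b) = ?P" .
    have "d (y' b x0) = \<alpha> (inv\<^bsub>G\<^esub> x0) (?v \<otimes>\<^bsub>A\<^esub> inv\<^bsub>A\<^esub> ?P)"
      using ehom_eq[OF d, of "inv\<^bsub>G\<^esub> x0" "e b \<otimes>\<^bsub>?F\<^esub> inv\<^bsub>?F\<^esub> (Q b)"] x0G e[OF b] Q[OF b] dQ by (simp add: y'_def)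
    also have "\<dots> = \<pi> (\<alpha> (inv\<^bsub>G\<^esub> x0) ?v)"
      unfolding vP using x0G v by (simp add: trm_def)
    finally show ?thesis using True by simp
  qed
  \<comment> \<open>With \<open>x\<close> the representative of \<open>g^(-1)\<close>, the product
    \<open>g x\<close> lies in \<Lambda>. Thus \<open>bas G n b g\<close> is the \<Lambda>-translate
    by \<open>g x\<close> of the element at \<open>x^(-1)\<close>, whose image is prescribed to be
    \<open>y' b x\<close>; equivariance leaves no other choice.\<close>
  define w where "w b g = fsh G n (\<rho> (inv\<^bsub>G\<^esub> g)) (y' b (\<rho> (inv\<^bsub>G\<^esub> g)))" for b g
  have rT: "\<rho> (inv\<^bsub>G\<^esub> g) \<in> T" if "g \<in> carrier G" for g using that by (intro imageI) simp
  have rG: "\<rho> (inv\<^bsub>G\<^esub> g) \<in> carrier G" if "g \<in> carrier G" for g using that by simp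
  have "\<exists>u\<in>ehom \<Lambda> ?F (fsh G n) ?F (fsh G n). \<forall>b\<in>B. \<forall>g\<in>carrier G. u (bas G n b g) = fsh G n g (w b g)"
  proof (rule FR_ehom_ext[OF F subgroup.subset[OF sub]])
    fix b g assume b: "b \<in> B" and g: "g \<in> carrier G"
    show "w b g \<in> carrier ?F" unfolding w_def by (rule F.act_closed[OF rG[OF g] y'c[OF b rT[OF g]]])
    fix h assume h: "h \<in> \<Lambda>"
    have "\<rho> (inv\<^bsub>G\<^esub> (h \<otimes>\<^bsub>G\<^esub> g)) = \<rho> (inv\<^bsub>G\<^esub> g)"
      using rho_right[of "inv\<^bsub>G\<^esub> g" "inv\<^bsub>G\<^esub> h"] g L_sub[OF h] subgroup.m_inv_closed[OF sub h] by (simp add: G.inv_mult_group)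
    then show "w b (h \<otimes>\<^bsub>G\<^esub> g) = w b g" by (simp add: w_def)
  qed
  then obtain \<pi>' where \<pi>': "\<pi>' \<in> ehom \<Lambda> ?F (fsh G n) ?F (fsh G n)"
    and \<pi>'b: "\<And>b g. b \<in> B \<Longrightarrow> g \<in> carrier G \<Longrightarrow> \<pi>' (bas G n b g) = fsh G n g (w b g)" by blast
  have comm: "d (\<pi>' v) = \<pi> (d v)" if v: "v \<in> carrier ?F" for v
  proof (rule FR_hom_eq[OF A.A.comm_group_axioms _ _ _ v])
    show "(\<lambda>v. d (\<pi>' v)) \<in> hom ?F A" by (rule hom_comp_fun[OF ehom_hom[OF \<pi>'] ehom_hom[OF d]])
    show "(\<lambda>v. \<pi> (d v)) \<in> hom ?F A" by (rule hom_comp_fun[OF ehom_hom[OF d] ehom_hom[OF \<pi>]])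
    fix b g assume b: "b \<in> B" and g: "g \<in> carrier G"
    let ?x = "\<rho> (inv\<^bsub>G\<^esub> g)" and ?v = "d (e b)"
    have v: "?v \<in> carrier A" using e[OF b] by simp
    have gx: "g \<otimes>\<^bsub>G\<^esub> ?x \<in> \<Lambda>" using rho_mem[of "inv\<^bsub>G\<^esub> g"] g by simp
    have "\<pi>' (bas G n b g) = fsh G n (g \<otimes>\<^bsub>G\<^esub> ?x) (y' b ?x)"
      using b g y'c[OF b rT[OF g]] by (simp add: \<pi>'b w_def F.act_mult)
    then have "d (\<pi>' (bas G n b g)) = \<alpha> (g \<otimes>\<^bsub>G\<^esub> ?x) (\<pi> (\<alpha> (inv\<^bsub>G\<^esub> ?x) ?v))"
      using ehom_eq[OF d L_sub[OF gx] y'c[OF b rT[OF g]]] y'd[OF b rT[OF g]] by simp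
    also have "\<dots> = \<pi> (\<alpha> (g \<otimes>\<^bsub>G\<^esub> ?x) (\<alpha> (inv\<^bsub>G\<^esub> ?x) ?v))"
      using ehom_eq[OF \<pi> gx, of "\<alpha> (inv\<^bsub>G\<^esub> ?x) ?v"] g v by simp
    also have "\<alpha> (g \<otimes>\<^bsub>G\<^esub> ?x) (\<alpha> (inv\<^bsub>G\<^esub> ?x) ?v) = \<alpha> g ?v" using g v by (simp add: A.act_mult)
    also have "\<dots> = d (bas G n b g)" using ehom_eq[OF d g e[OF b]] by (simp add: bas_e[OF g])
    finally show "d (\<pi>' (bas G n b g)) = \<pi> (d (bas G n b g))" .
  qed
  have tr: "trm (fsh G n) (fsh G n) \<pi>' x (e b) = fsh G n x (y' b x)" if b: "b \<in> B" and x: "x \<in> T" for b x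
  proof -
    have xG: "x \<in> carrier G" using T_closed[OF x] .
    have "\<pi>' (fsh G n (inv\<^bsub>G\<^esub> x) (e b)) = fsh G n (inv\<^bsub>G\<^esub> x) (fsh G n x (y' b x))"
      using \<pi>'b[OF b, of "inv\<^bsub>G\<^esub> x"] xG rho_T[OF x] by (simp add: bas_e w_def)
    then show ?thesis using xG y'c[OF b x] by (simp add: trm_def)
  qed
  have supp_e: "supp ?F (fsh G n) (fsh G n) \<pi>' (e b) \<subseteq> insert x0 (S b)" if b: "b \<in> B" for b
  proof
    fix x assume "x \<in> supp ?F (fsh G n) (fsh G n) \<pi>' (e b)"
    then have x: "x \<in> T" "fsh G n x (y' b x) \<noteq> \<one>\<^bsub>?F\<^esub>" using tr[OF b] by (auto simp: supp_def)
    show "x \<in> insert x0 (S b)"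
    proof (rule ccontr)
      assume "x \<notin> insert x0 (S b)"
      then show False using y'1[OF b x(1)] x(2) F.act_unit[OF T_closed[OF x(1)]] by simp
    qed
  qed
  note trhom = trm_hom[OF F F \<pi>' T_closed]
  \<comment> \<open>Finiteness passes from basis vectors to all elements: translating a basis vector
    translates the set of contributing cosets, and the elements with finitely many of them form a
    subgroup.\<close>
  have fin': "finite (supp ?F (fsh G n) (fsh G n) \<pi>' v)" if v: "v \<in> carrier ?F" for v
  proof -
    let ?s = "supp ?F (fsh G n) (fsh G n) \<pi>'"
    let ?U = "{v \<in> carrier ?F. finite (?s v)}"
    have tm: "trm (fsh G n) (fsh G n) \<pi>' x (v \<otimes>\<^bsub>?F\<^esub> w) = trm (fsh G n) (fsh G n) \<pi>' x v \<otimes>\<^bsub>?F\<^esub> trm (fsh G n) (fsh G n) \<pi>' x w"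
      if "x \<in> T" "v \<in> carrier ?F" "w \<in> carrier ?F" for x v w using hom_mult[OF trhom[OF that(1)]] that by blast
    have ti: "trm (fsh G n) (fsh G n) \<pi>' x (inv\<^bsub>?F\<^esub> v) = inv\<^bsub>?F\<^esub> (trm (fsh G n) (fsh G n) \<pi>' x v)"
      if "x \<in> T" "v \<in> carrier ?F" for x v
      using group_hom.hom_inv[of ?F ?F "trm (fsh G n) (fsh G n) \<pi>' x" v] trhom[OF that(1)] that(2) F.A.group_axioms
      by (simp add: group_hom_def group_hom_axioms_def)
    have t1: "trm (fsh G n) (fsh G n) \<pi>' x \<one>\<^bsub>?F\<^esub> = \<one>\<^bsub>?F\<^esub>" if "x \<in> T" for x
      using hom_one[OF trhom[OF that]] F.A.group_axioms by blast
    have tcl: "trm (fsh G n) (fsh G n) \<pi>' x v \<in> carrier ?F" if "x \<in> T" "v \<in> carrier ?F" for x v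
      using trm_closed[OF F F \<pi>' T_closed[OF that(1)] that(2)] .
    have "subgroup ?U ?F"
    proof (rule F.A.subgroupI)
      have "?s \<one>\<^bsub>?F\<^esub> = {}" using t1 by (auto simp: supp_def)
      then have "\<one>\<^bsub>?F\<^esub> \<in> ?U" by simp
      then show "?U \<noteq> {}" by blast
      fix v assume v: "v \<in> ?U"
      have "?s (inv\<^bsub>?F\<^esub> v) \<subseteq> ?s v"
      proof
        fix x assume "x \<in> ?s (inv\<^bsub>?F\<^esub> v)"
        then show "x \<in> ?s v" using ti[of x v] v by (auto simp: supp_def)
      qed
      then show "inv\<^bsub>?F\<^esub> v \<in> ?U" using v finite_subset by auto
      fix w assume w: "w \<in> ?U"
      have "?s (v \<otimes>\<^bsub>?F\<^esub> w) \<subseteq> ?s v \<union> ?s w"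
      proof
        fix x assume "x \<in> ?s (v \<otimes>\<^bsub>?F\<^esub> w)"
        then show "x \<in> ?s v \<union> ?s w" using tm[of x v w] v w by (auto simp: supp_def)
      qed
      then show "v \<otimes>\<^bsub>?F\<^esub> w \<in> ?U" using v w finite_subset by auto
    qed blast
    then have "v \<in> ?U"
    proof (rule FR_induct[OF _ _ v])
      fix b g assume b: "b \<in> B" and g: "g \<in> carrier G"
      have "?s (bas G n b g) \<subseteq> (\<lambda>x. \<rho> (g \<otimes>\<^bsub>G\<^esub> x)) ` insert x0 (S b)"
      proof
        fix x assume x: "x \<in> ?s (bas G n b g)"
        then have xT: "x \<in> T" by (simp add: supp_def)
        define z where "z = \<rho> (inv\<^bsub>G\<^esub> g \<otimes>\<^bsub>G\<^esub> x)"
        have zT: "z \<in> T" unfolding z_def using g T_closed[OF xT] by (intro imageI) simp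
        have "g \<otimes>\<^bsub>G\<^esub> (inv\<^bsub>G\<^esub> g \<otimes>\<^bsub>G\<^esub> x) = x" using g T_closed[OF xT] by (simp add: G.m_assoc[symmetric])
        then have gz: "\<rho> (g \<otimes>\<^bsub>G\<^esub> z) = x" using g T_closed[OF xT] rho_T[OF xT] by (simp add: z_def rho_mult)
        have "trm (fsh G n) (fsh G n) \<pi>' x (bas G n b g) = fsh G n g (trm (fsh G n) (fsh G n) \<pi>' z (e b))"
          using trm_act[OF F F \<pi>' g T_closed[OF zT] e[OF b]] by (simp add: gz bas_e[OF g])
        moreover have "trm (fsh G n) (fsh G n) \<pi>' x (bas G n b g) \<noteq> \<one>\<^bsub>?F\<^esub>" using x by (simp add: supp_def)
        ultimately have "trm (fsh G n) (fsh G n) \<pi>' z (e b) \<noteq> \<one>\<^bsub>?F\<^esub>" using F.act_unit[OF g] by metis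
        then have "z \<in> insert x0 (S b)" using supp_e[OF b] zT by (auto simp: supp_def)
        then show "x \<in> (\<lambda>x. \<rho> (g \<otimes>\<^bsub>G\<^esub> x)) ` insert x0 (S b)" using gz by blast
      qed
      then show "bas G n b g \<in> ?U" using S[OF b] b g by (simp add: finite_subset)
    qed
    then show ?thesis by blast
  qed
  have av_ehom: "avg ?F (fsh G n) (fsh G n) \<pi>' \<in> ehom (carrier G) ?F (fsh G n) ?F (fsh G n)"
    by (rule avg_ehom[OF F F \<pi>' fin'])
  have ave: "avg ?F (fsh G n) (fsh G n) \<pi>' (e b) = e b" if b: "b \<in> B" for b
  proof -
    have Sx: "insert x0 (S b - {x0}) = insert x0 (S b)" by blast
    have "avg ?F (fsh G n) (fsh G n) \<pi>' (e b) = finprod ?F (\<lambda>x. trm (fsh G n) (fsh G n) \<pi>' x (e b)) (insert x0 (S b - {x0}))"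
      by (rule avg_eq[OF F F \<pi>' e[OF b]]) (use S[OF b] ST[of b] x0 supp_e[OF b] in auto)
    also have "\<dots> = finprod ?F (\<lambda>x. fsh G n x (y' b x)) (insert x0 (S b - {x0}))"
    proof (rule F.A.finprod_cong'[OF refl])
      show "(\<lambda>x. fsh G n x (y' b x)) \<in> insert x0 (S b - {x0}) \<rightarrow> carrier ?F"
        using y'c[OF b] ST[of b] x0 T_closed by (intro Pi_I F.act_closed) blast+
      show "\<And>x. x \<in> insert x0 (S b - {x0}) \<Longrightarrow> trm (fsh G n) (fsh G n) \<pi>' x (e b) = fsh G n x (y' b x)"
        using tr[OF b] ST[of b] x0 by blast
    qed
    also have "\<dots> = fsh G n x0 (y' b x0) \<otimes>\<^bsub>?F\<^esub> finprod ?F (\<lambda>x. fsh G n x (y' b x)) (S b - {x0})"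
      by (rule F.A.finprod_insert) (use S[OF b] y'c[OF b] ST[of b] x0 x0G T_closed in \<open>auto simp: subset_iff\<close>)
    also have "finprod ?F (\<lambda>x. fsh G n x (y' b x)) (S b - {x0}) = Q b"
      unfolding Q_def by (rule F.A.finprod_cong'[OF refl Qf[OF b]]) (simp add: y'_def)
    also have "fsh G n x0 (y' b x0) \<otimes>\<^bsub>?F\<^esub> Q b = e b"
      using e[OF b] Q[OF b] x0G by (simp add: y'_def F.A.m_assoc)
    finally show ?thesis .
  qed
  have "avg ?F (fsh G n) (fsh G n) \<pi>' v = v" if v: "v \<in> carrier ?F" for v
  proof (rule FR_hom_eq[OF F.A.comm_group_axioms ehom_hom[OF av_ehom] _ _ v])
    show "(\<lambda>v. v) \<in> hom ?F ?F" by (simp add: hom_def)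
    fix b g assume b: "b \<in> B" and g: "g \<in> carrier G"
    show "avg ?F (fsh G n) (fsh G n) \<pi>' (bas G n b g) = bas G n b g"
      using ehom_eq[OF av_ehom g e[OF b]] ave[OF b] by (simp add: bas_e[OF g])
  qed
  then have "splitting n ?F (fsh G n) \<pi>'" using \<pi>' fin' by (simp add: splitting_def)
  then show thesis using comm by (rule that)
qed

text \<open>If \<open>\<pi>\<close> preserves the kernel of \<open>q\<close>, it descends along with
  its conjugates. In this way the quotient by the stabilizers receives a splitting from the stacked
  module.\<close>

lemma splitting_transfer:
  assumes A: "gact G n A \<alpha>" and B: "gact G n B \<beta>" and sp: "splitting n A \<alpha> \<pi>"
    and q: "q \<in> ehom (carrier G) A \<alpha> B \<beta>" and surj: "q ` carrier A = carrier B"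
    and ker: "\<And>v. v \<in> carrier A \<Longrightarrow> q v = \<one>\<^bsub>B\<^esub> \<Longrightarrow> q (\<pi> v) = \<one>\<^bsub>B\<^esub>"
  shows "\<exists>\<pi>'. splitting n B \<beta> \<pi>'"
proof -
  interpret A: gact G n A \<alpha> by fact
  interpret B: gact G n B \<beta> by fact
  interpret q: group_hom A B q using ehom_hom[OF q] by unfold_locales
  have \<pi>: "\<pi> \<in> ehom \<Lambda> A \<alpha> A \<alpha>" and fin: "\<And>v. v \<in> carrier A \<Longrightarrow> finite (supp A \<alpha> \<alpha> \<pi> v)"
    and av: "\<And>v. v \<in> carrier A \<Longrightarrow> avg A \<alpha> \<alpha> \<pi> v = v" using sp by (auto simp: splitting_def)
  note \<pi>c = ehom_closed[OF \<pi>]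
  obtain \<pi>' where \<pi>': "\<pi>' \<in> hom (B\<lparr>carrier := q ` carrier A\<rparr>) B" and \<pi>'q: "\<And>v. v \<in> carrier A \<Longrightarrow> \<pi>' (q v) = q (\<pi> v)"
    using hom_factor[OF A.A.comm_group_axioms B.A.comm_group_axioms B.A.comm_group_axioms ehom_hom[OF q]
        hom_comp_fun[OF ehom_hom[OF \<pi>] ehom_hom[OF q]] ker] by blast
  have "\<pi>' \<in> hom B B" using \<pi>' by (simp add: surj)
  moreover have "\<pi>' (\<beta> h u) = \<beta> h (\<pi>' u)" if h: "h \<in> \<Lambda>" and u: "u \<in> carrier B" for h u
  proof -
    obtain v where v: "v \<in> carrier A" "u = q v" using surj u by blast
    have "\<beta> h u = q (\<alpha> h v)" using ehom_eq[OF q L_sub[OF h] v(1)] v by simp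
    then have "\<pi>' (\<beta> h u) = q (\<pi> (\<alpha> h v))" using \<pi>'q L_sub[OF h] v by simp
    also have "\<dots> = \<beta> h (\<pi>' u)"
      using ehom_eq[OF \<pi> h v(1)] ehom_eq[OF q L_sub[OF h] \<pi>c[OF v(1)]] v \<pi>'q by simp
    finally show ?thesis .
  qed
  ultimately have \<pi>'e: "\<pi>' \<in> ehom \<Lambda> B \<beta> B \<beta>" by (simp add: ehom_def)
  have tr: "trm \<beta> \<beta> \<pi>' x (q v) = q (trm \<alpha> \<alpha> \<pi> x v)" if x: "x \<in> T" and v: "v \<in> carrier A" for x v
  proof -
    have xG: "x \<in> carrier G" using T_closed[OF x] .
    have "\<beta> (inv\<^bsub>G\<^esub> x) (q v) = q (\<alpha> (inv\<^bsub>G\<^esub> x) v)" using ehom_eq[OF q _ v, of "inv\<^bsub>G\<^esub> x"] xG by simp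
    then have "\<pi>' (\<beta> (inv\<^bsub>G\<^esub> x) (q v)) = q (\<pi> (\<alpha> (inv\<^bsub>G\<^esub> x) v))" using \<pi>'q xG v by simp
    then show ?thesis using ehom_eq[OF q xG \<pi>c, of "\<alpha> (inv\<^bsub>G\<^esub> x) v"] xG v by (simp add: trm_def)
  qed
  have "finite (supp B \<beta> \<beta> \<pi>' u) \<and> avg B \<beta> \<beta> \<pi>' u = u" if u: "u \<in> carrier B" for u
  proof -
    obtain v where v: "v \<in> carrier A" "u = q v" using surj u by blast
    let ?S = "supp A \<alpha> \<alpha> \<pi> v"
    have ST: "?S \<subseteq> T" by (auto simp: supp_def)
    have sub': "supp B \<beta> \<beta> \<pi>' u \<subseteq> ?S"
    proof
      fix x assume x: "x \<in> supp B \<beta> \<beta> \<pi>' u"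
      then have "x \<in> T" "q (trm \<alpha> \<alpha> \<pi> x v) \<noteq> \<one>\<^bsub>B\<^esub>" using tr[OF _ v(1)] v(2) by (auto simp: supp_def)
      then show "x \<in> ?S" by (auto simp: supp_def)
    qed
    have "avg B \<beta> \<beta> \<pi>' u = finprod B (\<lambda>x. trm \<beta> \<beta> \<pi>' x u) ?S"
      by (rule avg_eq[OF B B \<pi>'e u fin[OF v(1)] ST sub'])
    also have "\<dots> = finprod B (\<lambda>x. q (trm \<alpha> \<alpha> \<pi> x v)) ?S"
      using tr[OF _ v(1)] ST v(2) trm_closed[OF A A \<pi> T_closed v(1)]
      by (intro B.A.finprod_cong'[OF refl]) (auto simp: subset_iff)
    also have "\<dots> = q (avg A \<alpha> \<alpha> \<pi> v)"
      unfolding avg_def using ST trm_closed[OF A A \<pi> T_closed v(1)]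
      by (intro hom_finprod[OF A.A.comm_group_axioms B.A.comm_group_axioms ehom_hom[OF q], symmetric]) blast
    finally show ?thesis using av[OF v(1)] v(2) finite_subset[OF sub' fin[OF v(1)]] by simp
  qed
  then show ?thesis using \<pi>'e by (auto simp: splitting_def)
qed

text \<open>A \<open>\<Lambda>\<close>-equivariant primitive of a \<open>G\<close>-equivariant cocycle is averaged into a \<open>G\<close>-equivariant one.\<close>

lemma equivariant_primitive:
  assumes A: "gact G n A \<alpha>" and B: "gact G n B \<beta>" and C: "gact G n C \<gamma>"
    and d: "d \<in> ehom (carrier G) A \<alpha> B \<beta>"
    and sA: "splitting n A \<alpha> \<pi>" and sB: "splitting n B \<beta> \<pi>'" and comm: "\<And>v. v \<in> carrier A \<Longrightarrow> d (\<pi> v) = \<pi>' (d v)"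
    and f: "f \<in> ehom (carrier G) A \<alpha> C \<gamma>" and g: "g \<in> ehom \<Lambda> B \<beta> C \<gamma>"
    and fg: "\<And>v. v \<in> carrier A \<Longrightarrow> f v = g (d v)"
  shows "\<exists>g'\<in>ehom (carrier G) B \<beta> C \<gamma>. \<forall>v\<in>carrier A. f v = g' (d v)"
proof -
  interpret A: gact G n A \<alpha> by fact
  interpret B: gact G n B \<beta> by fact
  interpret C: gact G n C \<gamma> by fact
  have \<pi>: "\<pi> \<in> ehom \<Lambda> A \<alpha> A \<alpha>" and fin: "\<And>v. v \<in> carrier A \<Longrightarrow> finite (supp A \<alpha> \<alpha> \<pi> v)"
    and av: "\<And>v. v \<in> carrier A \<Longrightarrow> avg A \<alpha> \<alpha> \<pi> v = v" using sA by (auto simp: splitting_def)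
  have \<pi>': "\<pi>' \<in> ehom \<Lambda> B \<beta> B \<beta>" and fin': "\<And>v. v \<in> carrier B \<Longrightarrow> finite (supp B \<beta> \<beta> \<pi>' v)"
    using sB by (auto simp: splitting_def)
  note \<pi>c = ehom_closed[OF \<pi>] and \<pi>'c = ehom_closed[OF \<pi>'] and dc = ehom_closed[OF d]
  interpret g: group_hom B C g using ehom_hom[OF g] by unfold_locales
  \<comment> \<open>The sum of conjugates of \<open>g\<close> itself need not be finite.
    Precomposing with \<open>\<pi>'\<close> makes it so; and since \<open>\<pi>'\<close> corresponds
    to \<open>\<pi>\<close> under \<open>d\<close>, the average of \<open>\<theta>\<close> evaluated
    on \<open>d v\<close> is \<open>f\<close> applied to the average of \<open>\<pi>\<close> at
    \<open>v\<close>, which is \<open>v\<close>.\<close>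
  define \<theta> where "\<theta> = (\<lambda>v. g (\<pi>' v))"
  have \<theta>: "\<theta> \<in> ehom \<Lambda> B \<beta> C \<gamma>" unfolding \<theta>_def by (rule ehom_comp[OF \<pi>' g])
  have finT: "finite (supp C \<beta> \<gamma> \<theta> v)" if v: "v \<in> carrier B" for v
  proof (rule finite_subset[OF _ fin'[OF v]])
    show "supp C \<beta> \<gamma> \<theta> v \<subseteq> supp B \<beta> \<beta> \<pi>' v"
    proof
      fix x assume x: "x \<in> supp C \<beta> \<gamma> \<theta> v"
      then have xT: "x \<in> T" by (simp add: supp_def)
      have xG: "x \<in> carrier G" using T_closed[OF xT] .
      have "\<pi>' (\<beta> (inv\<^bsub>G\<^esub> x) v) \<noteq> \<one>\<^bsub>B\<^esub>"
        using x C.act_unit[OF xG] by (auto simp: supp_def trm_def \<theta>_def)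
      then have "\<beta> x (\<pi>' (\<beta> (inv\<^bsub>G\<^esub> x) v)) \<noteq> \<one>\<^bsub>B\<^esub>"
        using B.act_eq_unit[OF xG \<pi>'c] xG v by simp
      then show "x \<in> supp B \<beta> \<beta> \<pi>' v" using xT by (simp add: supp_def trm_def)
    qed
  qed
  have "f v = avg C \<beta> \<gamma> \<theta> (d v)" if v: "v \<in> carrier A" for v
  proof -
    let ?S = "supp A \<alpha> \<alpha> \<pi> v"
    have ST: "?S \<subseteq> T" by (auto simp: supp_def)
    have tr: "f (trm \<alpha> \<alpha> \<pi> x v) = trm \<beta> \<gamma> \<theta> x (d v)" if x: "x \<in> T" for x
    proof -
      have xG: "x \<in> carrier G" using T_closed[OF x] .
      have ixv: "\<alpha> (inv\<^bsub>G\<^esub> x) v \<in> carrier A" using xG v by simp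
      have "f (trm \<alpha> \<alpha> \<pi> x v) = \<gamma> x (g (d (\<pi> (\<alpha> (inv\<^bsub>G\<^esub> x) v))))"
        using ehom_eq[OF f xG \<pi>c[OF ixv]] fg[OF \<pi>c[OF ixv]] by (simp add: trm_def)
      also have "\<dots> = \<gamma> x (g (\<pi>' (\<beta> (inv\<^bsub>G\<^esub> x) (d v))))"
        using comm[OF ixv] ehom_eq[OF d _ v, of "inv\<^bsub>G\<^esub> x"] xG by simp
      finally show ?thesis by (simp add: trm_def \<theta>_def)
    qed
    have fc: "f (trm \<alpha> \<alpha> \<pi> x v) \<in> carrier C" if "x \<in> T" for x
      using ehom_closed[OF f trm_closed[OF A A \<pi> T_closed[OF that] v]] .
    have sub': "supp C \<beta> \<gamma> \<theta> (d v) \<subseteq> ?S"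
    proof
      fix x assume x: "x \<in> supp C \<beta> \<gamma> \<theta> (d v)"
      then have "x \<in> T" "f (trm \<alpha> \<alpha> \<pi> x v) \<noteq> \<one>\<^bsub>C\<^esub>" using tr by (auto simp: supp_def)
      then show "x \<in> ?S" using hom_one[OF ehom_hom[OF f] A.A.group_axioms C.A.group_axioms] by (auto simp: supp_def)
    qed
    have "f v = f (avg A \<alpha> \<alpha> \<pi> v)" using av[OF v] by simp
    also have "\<dots> = finprod C (\<lambda>x. f (trm \<alpha> \<alpha> \<pi> x v)) ?S"
      unfolding avg_def using ST trm_closed[OF A A \<pi> T_closed v]
      by (intro hom_finprod[OF A.A.comm_group_axioms C.A.comm_group_axioms ehom_hom[OF f]]) blast
    also have "\<dots> = finprod C (\<lambda>x. trm \<beta> \<gamma> \<theta> x (d v)) ?S"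
      using tr fc ST by (intro C.A.finprod_cong'[OF refl]) (auto simp: subset_iff)
    also have "\<dots> = avg C \<beta> \<gamma> \<theta> (d v)"
      by (rule avg_eq[OF B C \<theta> dc[OF v] fin[OF v] ST sub', symmetric])
    finally show ?thesis .
  qed
  then show ?thesis using avg_ehom[OF B C \<theta> finT] by blast
qed

end

section \<open>Bounding the rank\<close>

text \<open>More unknowns than equations. To stay within the integers, an equation with nonzero
  pivot \<open>a j s\<close> is eliminated by cross multiplication instead of division.\<close>

lemma ex_int_relation:
  fixes a :: "'i \<Rightarrow> 's \<Rightarrow> int"
  assumes "finite S" "finite I" "card S < card I"
  shows "\<exists>c. (\<exists>i\<in>I. c i \<noteq> 0) \<and> (\<forall>s\<in>S. (\<Sum>i\<in>I. c i * a i s) = 0)"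
  using assms
proof (induction S arbitrary: I a rule: finite_induct)
  case empty
  then obtain i where "i \<in> I" by fastforce
  then show ?case by (intro exI[of _ "\<lambda>_. 1"]) auto
next
  case (insert s S)
  show ?case
  proof (cases "\<forall>i\<in>I. a i s = 0")
    case True
    obtain c where "\<exists>i\<in>I. c i \<noteq> 0" "\<forall>t\<in>S. (\<Sum>i\<in>I. c i * a i t) = 0"
      using insert.IH[of I a] insert.prems insert.hyps by auto
    then show ?thesis using True by (intro exI[of _ c]) auto
  next
    case False
    then obtain j where j: "j \<in> I" "a j s \<noteq> 0" by blast
    let ?I = "I - {j}"
    define a' where "a' i t = a j s * a i t - a i s * a j t" for i t
    have "card S < card ?I" using insert.prems insert.hyps j by simp
    then obtain c where c: "\<exists>i\<in>?I. c i \<noteq> 0" "\<And>t. t \<in> S \<Longrightarrow> (\<Sum>i\<in>?I. c i * a' i t) = 0"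
      using insert.IH[of ?I a'] insert.prems by auto
    \<comment> \<open>The factor \<open>a j s\<close> on the remaining unknowns makes the value of
      the eliminated one an integer.\<close>
    define c' where "c' i = (if i = j then - (\<Sum>i\<in>?I. c i * a i s) else c i * a j s)" for i
    have "(\<Sum>i\<in>I. c' i * a i t) = (\<Sum>i\<in>?I. c i * a' i t)" for t
    proof -
      have "(\<Sum>i\<in>I. c' i * a i t) = c' j * a j t + (\<Sum>i\<in>?I. c' i * a i t)"
        using insert.prems j by (simp add: sum.remove)
      also have "(\<Sum>i\<in>?I. c' i * a i t) = (\<Sum>i\<in>?I. c i * a j s * a i t)"
        by (rule sum.cong) (auto simp: c'_def)
      also have "c' j * a j t = (\<Sum>i\<in>?I. - (c i * a i s * a j t))"
        by (simp add: c'_def sum_distrib_right sum_negf)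
      also have "\<dots> + (\<Sum>i\<in>?I. c i * a j s * a i t) = (\<Sum>i\<in>?I. c i * a' i t)"
        unfolding sum.distrib[symmetric] by (rule sum.cong) (auto simp: a'_def algebra_simps)
      finally show ?thesis .
    qed
    moreover have "a' i s = 0" for i by (simp add: a'_def)
    ultimately have "\<forall>t\<in>insert s S. (\<Sum>i\<in>I. c' i * a i t) = 0" using c(2) by simp
    moreover have "\<exists>i\<in>I. c' i \<noteq> 0" using c(1) j by (auto simp: c'_def)
    ultimately show ?thesis by blast
  qed
qed

lemma generate_finprod:
  assumes "comm_group G" "finite S" "S \<subseteq> carrier G" "x \<in> generate G S"
  shows "\<exists>a. x = finprod G (\<lambda>s. s [^]\<^bsub>G\<^esub> (a s :: int)) S"
proof -
  interpret comm_group G by fact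
  have c: "(\<lambda>s. s [^]\<^bsub>G\<^esub> (a s :: int)) \<in> S \<rightarrow> carrier G" for a using assms(3) by auto
  let ?U = "{finprod G (\<lambda>s. s [^]\<^bsub>G\<^esub> (a s :: int)) S | a. True}"
  have "subgroup ?U G"
  proof (rule subgroupI)
    fix x assume "x \<in> ?U"
    then obtain a where a: "x = finprod G (\<lambda>s. s [^]\<^bsub>G\<^esub> (a s :: int)) S" by blast
    have "(\<lambda>x. inv\<^bsub>G\<^esub> x) \<in> hom G G" by (simp add: hom_def inv_mult)
    from hom_finprod[OF comm_group_axioms comm_group_axioms this c]
    have "inv\<^bsub>G\<^esub> x = finprod G (\<lambda>s. inv\<^bsub>G\<^esub> (s [^]\<^bsub>G\<^esub> a s)) S" unfolding a .
    also have "\<dots> = finprod G (\<lambda>s. s [^]\<^bsub>G\<^esub> (- a s)) S"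
      using assms(3) by (intro finprod_cong'[OF refl]) (auto simp: int_pow_neg subset_iff)
    finally show "inv\<^bsub>G\<^esub> x \<in> ?U" by (auto intro!: exI[of _ "\<lambda>s. - a s"])
    fix y assume "y \<in> ?U"
    then obtain b where b: "y = finprod G (\<lambda>s. s [^]\<^bsub>G\<^esub> (b s :: int)) S" by blast
    have "x \<otimes>\<^bsub>G\<^esub> y = finprod G (\<lambda>s. s [^]\<^bsub>G\<^esub> a s \<otimes>\<^bsub>G\<^esub> s [^]\<^bsub>G\<^esub> b s) S"
      unfolding a b by (rule finprod_multf[OF c c, symmetric])
    also have "\<dots> = finprod G (\<lambda>s. s [^]\<^bsub>G\<^esub> (a s + b s)) S"
      using assms(3) by (intro finprod_cong'[OF refl]) (auto simp: int_pow_mult subset_iff)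
    finally show "x \<otimes>\<^bsub>G\<^esub> y \<in> ?U" by (auto intro!: exI[of _ "\<lambda>s. a s + b s"])
  qed (use finprod_closed[OF c] in auto)
  moreover have "S \<subseteq> ?U"
  proof
    fix t assume t: "t \<in> S"
    then have tG: "t \<in> carrier G" using assms by blast
    have "finprod G (\<lambda>s. s [^]\<^bsub>G\<^esub> (if s = t then 1 else 0 :: int)) S = finprod G (\<lambda>s. if t = s then s else \<one>\<^bsub>G\<^esub>) S"
      using assms(3) by (intro finprod_cong'[OF refl]) (auto simp: subset_iff)
    also have "\<dots> = t" using finprod_singleton[OF t assms(2), of "\<lambda>s. s"] assms(3) by auto
    finally show "t \<in> ?U" by (auto intro!: exI[of _ "\<lambda>s. if s = t then 1 else 0"])
  qed
  ultimately show ?thesis using generateI_subset[OF is_group _ _ assms(4)] by blast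
qed

lemma int_independent_card:
  assumes "comm_group G" "finite S" "S \<subseteq> carrier G" "generate G S = carrier G" "int_independent G I"
  shows "card I \<le> card S"
proof (rule ccontr)
  assume "\<not> card I \<le> card S"
  then have lt: "card S < card I" by simp
  interpret comm_group G by fact
  have I: "finite I" "I \<subseteq> carrier G"
    and ind: "\<And>c :: 'a \<Rightarrow> int. finprod G (\<lambda>x. x [^]\<^bsub>G\<^esub> c x) I = \<one>\<^bsub>G\<^esub> \<Longrightarrow> \<forall>x\<in>I. c x = 0"
    using assms(5) by (auto simp: int_independent_def)
  have "\<forall>x\<in>I. \<exists>a. x = finprod G (\<lambda>s. s [^]\<^bsub>G\<^esub> (a s :: int)) S"
    using generate_finprod[OF assms(1-3)] I(2) assms(4) by blast
  then obtain a where a: "\<And>x. x \<in> I \<Longrightarrow> x = finprod G (\<lambda>s. s [^]\<^bsub>G\<^esub> (a x s :: int)) S" by metis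
  obtain c where c: "\<exists>i\<in>I. c i \<noteq> 0" "\<forall>s\<in>S. (\<Sum>i\<in>I. c i * a i s) = 0"
    using ex_int_relation[OF assms(2) I(1) lt, of a] by blast
  have cl: "(\<lambda>s. s [^]\<^bsub>G\<^esub> (e s :: int)) \<in> S \<rightarrow> carrier G" for e using assms(3) by auto
  have pw: "finprod G (\<lambda>s. s [^]\<^bsub>G\<^esub> (e s :: int)) S [^]\<^bsub>G\<^esub> (k::int) = finprod G (\<lambda>s. s [^]\<^bsub>G\<^esub> (k * e s)) S" for e k
  proof -
    have "(\<lambda>x. x [^]\<^bsub>G\<^esub> k) \<in> hom G G" by (simp add: hom_def int_pow_distrib)
    from hom_finprod[OF comm_group_axioms comm_group_axioms this cl]
    have "finprod G (\<lambda>s. s [^]\<^bsub>G\<^esub> e s) S [^]\<^bsub>G\<^esub> k = finprod G (\<lambda>s. (s [^]\<^bsub>G\<^esub> e s) [^]\<^bsub>G\<^esub> k) S" .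
    also have "\<dots> = finprod G (\<lambda>s. s [^]\<^bsub>G\<^esub> (k * e s)) S"
      using assms(3) by (intro finprod_cong'[OF refl]) (auto simp: int_pow_pow mult.commute subset_iff)
    finally show ?thesis .
  qed
  have "finprod G (\<lambda>x. x [^]\<^bsub>G\<^esub> c x) I' = finprod G (\<lambda>s. s [^]\<^bsub>G\<^esub> (\<Sum>i\<in>I'. c i * a i s)) S" if "finite I'" "I' \<subseteq> I" for I'
    using that
  proof (induction I' rule: finite_induct)
    case empty
    then show ?case by simp
  next
    case (insert x J)
    have x: "x \<in> I" "x \<in> carrier G" "J \<subseteq> carrier G" using insert I by auto
    have "finprod G (\<lambda>x. x [^]\<^bsub>G\<^esub> c x) (insert x J) = x [^]\<^bsub>G\<^esub> c x \<otimes>\<^bsub>G\<^esub> finprod G (\<lambda>x. x [^]\<^bsub>G\<^esub> c x) J"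
      using insert.hyps x by (intro finprod_insert) auto
    also have "x [^]\<^bsub>G\<^esub> c x = finprod G (\<lambda>s. s [^]\<^bsub>G\<^esub> (c x * a x s)) S"
      using pw[of "a x" "c x"] a[OF x(1)] by simp
    also have "finprod G (\<lambda>x. x [^]\<^bsub>G\<^esub> c x) J = finprod G (\<lambda>s. s [^]\<^bsub>G\<^esub> (\<Sum>i\<in>J. c i * a i s)) S"
      using insert by simp
    also have "finprod G (\<lambda>s. s [^]\<^bsub>G\<^esub> (c x * a x s)) S \<otimes>\<^bsub>G\<^esub> \<dots> =
        finprod G (\<lambda>s. s [^]\<^bsub>G\<^esub> (c x * a x s) \<otimes>\<^bsub>G\<^esub> s [^]\<^bsub>G\<^esub> (\<Sum>i\<in>J. c i * a i s)) S"
      by (rule finprod_multf[OF cl cl, symmetric])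
    also have "\<dots> = finprod G (\<lambda>s. s [^]\<^bsub>G\<^esub> (\<Sum>i\<in>insert x J. c i * a i s)) S"
      using assms(3) insert.hyps by (intro finprod_cong'[OF refl]) (auto simp: int_pow_mult subset_iff)
    finally show ?case .
  qed
  from this[OF I(1) subset_refl] have "finprod G (\<lambda>x. x [^]\<^bsub>G\<^esub> c x) I = finprod G (\<lambda>s. s [^]\<^bsub>G\<^esub> (0::int)) S"
  proof -
    assume 1: "finprod G (\<lambda>x. x [^]\<^bsub>G\<^esub> c x) I = finprod G (\<lambda>s. s [^]\<^bsub>G\<^esub> (\<Sum>i\<in>I. c i * a i s)) S"
    have "finprod G (\<lambda>s. s [^]\<^bsub>G\<^esub> (\<Sum>i\<in>I. c i * a i s)) S = finprod G (\<lambda>s. s [^]\<^bsub>G\<^esub> (0::int)) S"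
      using c(2) by (intro finprod_cong'[OF refl]) auto
    with 1 show ?thesis by simp
  qed
  then show False using ind[of c] c(1) by simp
qed

text \<open>\<open>Max\<close> is informative only on a finite set;
  \<open>int_independent_card\<close> bounds the sizes of independent sets by the number of
  generators and so makes it finite.\<close>

lemma card_le_free_rank:
  assumes "comm_group G" "fin_gen_group G" "int_independent G I"
  shows "card I \<le> free_rank G"
proof -
  obtain S where S: "finite S" "S \<subseteq> carrier G" "generate G S = carrier G"
    using assms(2) by (auto simp: fin_gen_group_def)
  have "card ` {S. int_independent G S} \<subseteq> {..card S}"
    using int_independent_card[OF assms(1) S] by auto
  then have "finite (card ` {S. int_independent G S})" using finite_subset by blast
  then show ?thesis unfolding free_rank_def using assms(3) by (intro Max_ge) auto
qed

text \<open>\<open>vanish_rank\<close> finds its independent set inside \<Gamma>, whereas the rank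
  to be compared with is that of \<Lambda>.\<close>

lemma int_independent_image:
  assumes G: "comm_group G" and H: "comm_group H" and \<iota>: "\<iota> \<in> hom G H" "inj_on \<iota> (carrier G)"
    and I: "I \<subseteq> carrier G" "int_independent H (\<iota> ` I)"
  shows "int_independent G I"
proof -
  interpret G: comm_group G by fact
  interpret H: comm_group H by fact
  interpret \<iota>: group_hom G H \<iota> using \<iota> by unfold_locales
  have inj: "inj_on \<iota> I" using \<iota>(2) I(1) inj_on_subset by blast
  have fin: "finite I" using I(2) finite_imageD[OF _ inj] by (simp add: int_independent_def)
  show ?thesis
    unfolding int_independent_def
  proof (intro conjI allI impI fin I(1))
    fix c :: "'a \<Rightarrow> int" assume 1: "finprod G (\<lambda>x. x [^]\<^bsub>G\<^esub> c x) I = \<one>\<^bsub>G\<^esub>"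
    define c' where "c' y = c (inv_into I \<iota> y)" for y
    have c': "c' (\<iota> x) = c x" if "x \<in> I" for x using inj that by (simp add: c'_def)
    have cl: "(\<lambda>y. y [^]\<^bsub>H\<^esub> c' y) \<in> \<iota> ` I \<rightarrow> carrier H" using I(1) by auto
    have "finprod H (\<lambda>y. y [^]\<^bsub>H\<^esub> c' y) (\<iota> ` I) = finprod H (\<lambda>x. \<iota> x [^]\<^bsub>H\<^esub> c' (\<iota> x)) I"
      by (rule H.finprod_reindex[OF cl inj])
    also have "\<dots> = finprod H (\<lambda>x. \<iota> (x [^]\<^bsub>G\<^esub> c x)) I"
      using I(1) c' by (intro H.finprod_cong'[OF refl]) (auto simp: \<iota>.hom_int_pow subset_iff)
    also have "\<dots> = \<iota> (finprod G (\<lambda>x. x [^]\<^bsub>G\<^esub> c x) I)"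
      using I(1) by (intro hom_finprod[OF G H \<iota>(1), symmetric]) auto
    finally have "\<forall>y\<in>\<iota> ` I. c' y = 0" using I(2) 1 by (simp add: int_independent_def)
    then show "\<forall>x\<in>I. c x = 0" using c' by simp
  qed
qed

section \<open>Noetherianity\<close>

text \<open>Submodules are described by groups with operators: adjoining a variable to the ring
  becomes adding one commuting endomorphism to \<open>\<Omega>\<close>, and no polynomial ring has
  to be formed. The carrier of \<open>A\<close> is in general larger than the part reached so far,
  so \<open>noetherian\<close> is relative to a set \<open>J\<close>.\<close>

definition osub :: "'a monoid \<Rightarrow> ('a \<Rightarrow> 'a) set \<Rightarrow> 'a set \<Rightarrow> bool" where
  "osub A \<Omega> W \<longleftrightarrow> subgroup W A \<and> (\<forall>f\<in>\<Omega>. f ` W \<subseteq> W)"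

definition noetherian :: "'a monoid \<Rightarrow> ('a \<Rightarrow> 'a) set \<Rightarrow> 'a set \<Rightarrow> bool" where
  "noetherian A \<Omega> J \<longleftrightarrow> (\<forall>W. osub A \<Omega> W \<and> W \<subseteq> J \<longrightarrow>
     (\<exists>S. finite S \<and> S \<subseteq> W \<and> (\<forall>U. osub A \<Omega> U \<and> S \<subseteq> U \<longrightarrow> W \<subseteq> U)))"

lemma noetherianD:
  assumes "noetherian A \<Omega> J" "osub A \<Omega> W" "W \<subseteq> J"
  obtains S where "finite S" "S \<subseteq> W" "\<And>U. osub A \<Omega> U \<Longrightarrow> S \<subseteq> U \<Longrightarrow> W \<subseteq> U"
  using assms unfolding noetherian_def by metis

lemma osub_chain_Union:
  fixes C :: "nat \<Rightarrow> 'a set"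
  assumes "group A" "\<And>d. osub A \<Omega> (C d)" "\<And>d. C d \<subseteq> C (Suc d)"
  shows "osub A \<Omega> (\<Union>d. C d)"
proof -
  interpret group A by fact
  have mono: "C d \<subseteq> C e" if "d \<le> e" for d e using lift_Suc_mono_le[of C, OF assms(3) that] .
  have sg: "subgroup (C d) A" for d using assms(2) by (simp add: osub_def)
  have "subgroup (\<Union>d. C d) A"
  proof (rule subgroupI)
    show "(\<Union>d. C d) \<subseteq> carrier A" using subgroup.subset[OF sg] by blast
    show "(\<Union>d. C d) \<noteq> {}" using subgroup.one_closed[OF sg] by blast
    fix x assume "x \<in> (\<Union>d. C d)"
    then obtain d where d: "x \<in> C d" by blast
    then show "inv\<^bsub>A\<^esub> x \<in> (\<Union>d. C d)" using subgroup.m_inv_closed[OF sg] by blast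
    fix y assume "y \<in> (\<Union>d. C d)"
    then obtain e where e: "y \<in> C e" by blast
    have "x \<in> C (max d e)" "y \<in> C (max d e)" using d e mono[of d "max d e"] mono[of e "max d e"] by auto
    then show "x \<otimes>\<^bsub>A\<^esub> y \<in> (\<Union>d. C d)" using subgroup.m_closed[OF sg] by blast
  qed
  then show ?thesis using assms(2) unfolding osub_def by blast
qed

text \<open>Hilbert's basis theorem: \<open>W\<close> is controlled by its modules \<open>LC W d\<close> of leading coefficients in degree \<open>d\<close>.
  The sum \<open>\<Sum>d. t\<^sup>d J\<close> need not be direct.\<close>

lemma hilbert_basis:
  assumes A: "comm_group A" and \<Omega>: "\<Omega> \<subseteq> hom A A" and t: "t \<in> hom A A"
    and comm: "\<And>f x. f \<in> \<Omega> \<Longrightarrow> x \<in> carrier A \<Longrightarrow> f (t x) = t (f x)"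
    and J: "osub A \<Omega> J" and N: "noetherian A \<Omega> J"
  shows "\<exists>J'. J \<subseteq> J' \<and> osub A (insert t \<Omega>) J' \<and> noetherian A (insert t \<Omega>) J'"
proof -
  interpret comm_group A by fact
  have Jsg: "subgroup J A" and J\<Omega>: "\<And>f x. f \<in> \<Omega> \<Longrightarrow> x \<in> J \<Longrightarrow> f x \<in> J" using J by (auto simp: osub_def)
  interpret J: subgroup J A by (rule Jsg)
  have fh: "group_hom A A f" if "f \<in> \<Omega>" for f using \<Omega> that by (auto simp: group_hom_def group_hom_axioms_def)
  interpret t: group_hom A A t using t by unfold_locales
  have td: "(t ^^ d) \<in> hom A A" for d
  proof (induction d)
    case (Suc d) then show ?case using hom_comp_fun[OF Suc t] by (simp add: comp_def)
  qed (simp add: hom_def)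
  interpret td: group_hom A A "t ^^ d" for d using td by unfold_locales
  have fc: "f x \<in> carrier A" if "f \<in> \<Omega>" "x \<in> carrier A" for f x by (rule hom_in_carrier[OF subsetD[OF \<Omega> that(1)] that(2)])
  have comm_d: "f ((t ^^ d) x) = (t ^^ d) (f x)" if "f \<in> \<Omega>" "x \<in> carrier A" for f x d
  proof (induction d)
    case (Suc d)
    have "f ((t ^^ Suc d) x) = t (f ((t ^^ d) x))" using comm[OF that(1), of "(t ^^ d) x"] that by simp
    then show ?case using Suc by simp
  qed simp
  \<comment> \<open>The elements of degree below \<open>d\<close>, that is
    \<open>J + t J + ... + t^(d-1) J\<close>.\<close>
  define L where "L = rec_nat {\<one>\<^bsub>A\<^esub>} (\<lambda>d S. {y \<otimes>\<^bsub>A\<^esub> (t ^^ d) x | y x. y \<in> S \<and> x \<in> J})"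
  have L0: "L 0 = {\<one>\<^bsub>A\<^esub>}" and LS: "L (Suc d) = {y \<otimes>\<^bsub>A\<^esub> (t ^^ d) x | y x. y \<in> L d \<and> x \<in> J}" for d
    by (simp_all add: L_def)
  have Lsub: "osub A \<Omega> (L d)" for d
  proof (induction d)
    case 0
    show ?case using group_hom.hom_one[OF fh] by (auto simp: osub_def L0 triv_subgroup)
  next
    case (Suc d)
    then have sg: "subgroup (L d) A" and o: "\<And>f x. f \<in> \<Omega> \<Longrightarrow> x \<in> L d \<Longrightarrow> f x \<in> L d" by (auto simp: osub_def)
    interpret L: subgroup "L d" A by (rule sg)
    have "subgroup (L (Suc d)) A"
    proof (rule subgroupI)
      show "L (Suc d) \<subseteq> carrier A" by (auto simp: LS)
      show "L (Suc d) \<noteq> {}" unfolding LS using L.one_closed J.one_closed by blast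
      fix a assume "a \<in> L (Suc d)"
      then obtain y x where yx: "a = y \<otimes>\<^bsub>A\<^esub> (t ^^ d) x" "y \<in> L d" "x \<in> J" unfolding LS by blast
      then have "inv\<^bsub>A\<^esub> a = inv\<^bsub>A\<^esub> y \<otimes>\<^bsub>A\<^esub> (t ^^ d) (inv\<^bsub>A\<^esub> x)" by (simp add: inv_mult)
      then show "inv\<^bsub>A\<^esub> a \<in> L (Suc d)" unfolding LS using yx L.m_inv_closed J.m_inv_closed by blast
      fix b assume "b \<in> L (Suc d)"
      then obtain y' x' where yx': "b = y' \<otimes>\<^bsub>A\<^esub> (t ^^ d) x'" "y' \<in> L d" "x' \<in> J" unfolding LS by blast
      have "a \<otimes>\<^bsub>A\<^esub> b = (y \<otimes>\<^bsub>A\<^esub> y') \<otimes>\<^bsub>A\<^esub> (t ^^ d) (x \<otimes>\<^bsub>A\<^esub> x')" using yx yx' by (simp add: m_ac)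
      then show "a \<otimes>\<^bsub>A\<^esub> b \<in> L (Suc d)" unfolding LS using yx yx' L.m_closed J.m_closed by blast
    qed
    moreover have "f a \<in> L (Suc d)" if f: "f \<in> \<Omega>" and a: "a \<in> L (Suc d)" for f a
    proof -
      obtain y x where yx: "a = y \<otimes>\<^bsub>A\<^esub> (t ^^ d) x" "y \<in> L d" "x \<in> J" using a unfolding LS by blast
      then have "f a = f y \<otimes>\<^bsub>A\<^esub> (t ^^ d) (f x)" using f by (simp add: group_hom.hom_mult[OF fh[OF f]] comm_d)
      then show ?thesis unfolding LS using yx o[OF f] J\<Omega>[OF f] by blast
    qed
    ultimately show ?case unfolding osub_def by blast
  qed
  have Lsg: "subgroup (L d) A" for d using Lsub by (simp add: osub_def)
  have Lc: "y \<in> carrier A" if "y \<in> L d" for y d using subgroup.mem_carrier[OF Lsg that] .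
  have Lmono: "L d \<subseteq> L (Suc d)" for d
  proof
    fix y assume "y \<in> L d"
    moreover from this have "y = y \<otimes>\<^bsub>A\<^esub> (t ^^ d) \<one>\<^bsub>A\<^esub>" using Lc by simp
    ultimately show "y \<in> L (Suc d)" unfolding LS using J.one_closed by blast
  qed
  have tL: "t y \<in> L (Suc d)" if "y \<in> L d" for y d
    using that
  proof (induction d arbitrary: y)
    case 0
    then show ?case using subgroup.one_closed[OF Lsg] by (simp add: L0)
  next
    case (Suc d)
    then obtain z x where zx: "y = z \<otimes>\<^bsub>A\<^esub> (t ^^ d) x" "z \<in> L d" "x \<in> J" unfolding LS by blast
    then have "t y = t z \<otimes>\<^bsub>A\<^esub> (t ^^ Suc d) x" using Lc by simp
    then show ?case unfolding LS[of "Suc d"] using Suc.IH[OF zx(2)] zx(3) by blast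
  qed
  define J' where "J' = (\<Union>d. L d)"
  have J'sub: "osub A (insert t \<Omega>) J'"
  proof -
    have "osub A \<Omega> J'" unfolding J'_def by (rule osub_chain_Union[where C=L, OF is_group Lsub Lmono])
    moreover have "t ` J' \<subseteq> J'" unfolding J'_def using tL by blast
    ultimately show ?thesis by (simp add: osub_def)
  qed
  have JJ': "J \<subseteq> J'"
  proof
    fix x assume "x \<in> J"
    moreover from this have "x = \<one>\<^bsub>A\<^esub> \<otimes>\<^bsub>A\<^esub> (t ^^ 0) x" by simp
    ultimately have "x \<in> L (Suc 0)" unfolding LS L0 by blast
    then show "x \<in> J'" by (auto simp: J'_def)
  qed
  define LC where "LC W d = {x \<in> J. \<exists>y\<in>L d. y \<otimes>\<^bsub>A\<^esub> (t ^^ d) x \<in> W}" for W d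
  have LCsub: "osub A \<Omega> (LC W d)" if W: "osub A (insert t \<Omega>) W" for W d
  proof -
    interpret L: subgroup "L d" A by (rule Lsg)
    interpret W: subgroup W A using W by (simp add: osub_def)
    have "subgroup (LC W d) A"
    proof (rule subgroupI)
      show "LC W d \<subseteq> carrier A" by (auto simp: LC_def)
      have "\<one>\<^bsub>A\<^esub> \<otimes>\<^bsub>A\<^esub> (t ^^ d) \<one>\<^bsub>A\<^esub> \<in> W" by simp
      then have "\<one>\<^bsub>A\<^esub> \<in> LC W d" unfolding LC_def using L.one_closed J.one_closed by blast
      then show "LC W d \<noteq> {}" by blast
      fix x assume "x \<in> LC W d"
      then obtain y where xy: "x \<in> J" "y \<in> L d" "y \<otimes>\<^bsub>A\<^esub> (t ^^ d) x \<in> W" by (auto simp: LC_def)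
      have "inv\<^bsub>A\<^esub> (y \<otimes>\<^bsub>A\<^esub> (t ^^ d) x) = inv\<^bsub>A\<^esub> y \<otimes>\<^bsub>A\<^esub> (t ^^ d) (inv\<^bsub>A\<^esub> x)" using xy by (simp add: inv_mult)
      then have "inv\<^bsub>A\<^esub> y \<otimes>\<^bsub>A\<^esub> (t ^^ d) (inv\<^bsub>A\<^esub> x) \<in> W" using W.m_inv_closed[OF xy(3)] by simp
      then show "inv\<^bsub>A\<^esub> x \<in> LC W d" unfolding LC_def using xy L.m_inv_closed J.m_inv_closed by blast
      fix x' assume "x' \<in> LC W d"
      then obtain y' where xy': "x' \<in> J" "y' \<in> L d" "y' \<otimes>\<^bsub>A\<^esub> (t ^^ d) x' \<in> W" by (auto simp: LC_def)
      have "(y \<otimes>\<^bsub>A\<^esub> (t ^^ d) x) \<otimes>\<^bsub>A\<^esub> (y' \<otimes>\<^bsub>A\<^esub> (t ^^ d) x') = (y \<otimes>\<^bsub>A\<^esub> y') \<otimes>\<^bsub>A\<^esub> (t ^^ d) (x \<otimes>\<^bsub>A\<^esub> x')"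
        using xy xy' by (simp add: m_ac)
      then have "(y \<otimes>\<^bsub>A\<^esub> y') \<otimes>\<^bsub>A\<^esub> (t ^^ d) (x \<otimes>\<^bsub>A\<^esub> x') \<in> W" using W.m_closed[OF xy(3) xy'(3)] by simp
      then show "x \<otimes>\<^bsub>A\<^esub> x' \<in> LC W d" unfolding LC_def using xy xy' L.m_closed J.m_closed by blast
    qed
    moreover have "f x \<in> LC W d" if f: "f \<in> \<Omega>" and x: "x \<in> LC W d" for f x
    proof -
      obtain y where xy: "x \<in> J" "y \<in> L d" "y \<otimes>\<^bsub>A\<^esub> (t ^^ d) x \<in> W" using x by (auto simp: LC_def)
      have "f (y \<otimes>\<^bsub>A\<^esub> (t ^^ d) x) = f y \<otimes>\<^bsub>A\<^esub> (t ^^ d) (f x)"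
        using f xy by (simp add: group_hom.hom_mult[OF fh[OF f]] comm_d)
      moreover have "f (y \<otimes>\<^bsub>A\<^esub> (t ^^ d) x) \<in> W" using W f xy(3) by (auto simp: osub_def)
      moreover have "f y \<in> L d" using Lsub f xy(2) by (auto simp: osub_def)
      ultimately show ?thesis unfolding LC_def using J\<Omega>[OF f xy(1)] by auto
    qed
    ultimately show ?thesis unfolding osub_def by blast
  qed
  have LCmono: "LC W d \<subseteq> LC W (Suc d)" if W: "osub A (insert t \<Omega>) W" for W d
  proof
    fix x assume "x \<in> LC W d"
    then obtain y where xy: "x \<in> J" "y \<in> L d" "y \<otimes>\<^bsub>A\<^esub> (t ^^ d) x \<in> W" by (auto simp: LC_def)
    have "t (y \<otimes>\<^bsub>A\<^esub> (t ^^ d) x) = t y \<otimes>\<^bsub>A\<^esub> (t ^^ Suc d) x" using xy Lc by simp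
    moreover have "t (y \<otimes>\<^bsub>A\<^esub> (t ^^ d) x) \<in> W" using W xy(3) by (auto simp: osub_def)
    ultimately show "x \<in> LC W (Suc d)" unfolding LC_def using xy(1) tL[OF xy(2)] by auto
  qed
  have "noetherian A (insert t \<Omega>) J'"
    unfolding noetherian_def
  proof (intro allI impI)
    fix W assume "osub A (insert t \<Omega>) W \<and> W \<subseteq> J'"
    then have W: "osub A (insert t \<Omega>) W" and WJ': "W \<subseteq> J'" by auto
    have LCJ: "LC W d \<subseteq> J" for d by (auto simp: LC_def)
    obtain S where S: "finite S" "S \<subseteq> (\<Union>d. LC W d)" "\<And>U. osub A \<Omega> U \<Longrightarrow> S \<subseteq> U \<Longrightarrow> (\<Union>d. LC W d) \<subseteq> U"
    proof -
      have "osub A \<Omega> (\<Union>d. LC W d)"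
        by (rule osub_chain_Union[where C="LC W", OF is_group LCsub[OF W] LCmono[OF W]])
      moreover have "(\<Union>d. LC W d) \<subseteq> J" using LCJ by blast
      ultimately show ?thesis by (rule noetherianD[OF N]) (rule that; assumption)
    qed
    have LCle: "LC V d \<subseteq> LC V e" if "osub A (insert t \<Omega>) V" "d \<le> e" for V d e
      using lift_Suc_mono_le[of "LC V", OF LCmono[OF that(1)] that(2)] .
    have "\<exists>m. S' \<subseteq> LC W m" if "finite S'" "S' \<subseteq> (\<Union>d. LC W d)" for S' using that
    proof (induction S')
      case (insert x S')
      then obtain m d where md: "S' \<subseteq> LC W m" "x \<in> LC W d" by auto
      then have "insert x S' \<subseteq> LC W (max m d)" using LCle[OF W, of m "max m d"] LCle[OF W, of d "max m d"] by auto
      then show ?case by blast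
    qed simp
    then obtain m where m: "S \<subseteq> LC W m" using S(1,2) by blast
    have "\<exists>S. finite S \<and> S \<subseteq> LC W d \<and> (\<forall>U. osub A \<Omega> U \<and> S \<subseteq> U \<longrightarrow> LC W d \<subseteq> U)" for d
      using N LCsub[OF W] LCJ unfolding noetherian_def by simp
    then have "\<exists>R. \<forall>d. finite (R d) \<and> R d \<subseteq> LC W d \<and> (\<forall>U. osub A \<Omega> U \<and> R d \<subseteq> U \<longrightarrow> LC W d \<subseteq> U)"
      by (intro choice allI)
    then obtain R where R0: "\<forall>d. finite (R d) \<and> R d \<subseteq> LC W d \<and> (\<forall>U. osub A \<Omega> U \<and> R d \<subseteq> U \<longrightarrow> LC W d \<subseteq> U)" ..
    have R: "finite (R d)" "R d \<subseteq> LC W d" "osub A \<Omega> U \<Longrightarrow> R d \<subseteq> U \<Longrightarrow> LC W d \<subseteq> U" for d U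
      using R0 by simp_all
    \<comment> \<open>From degree \<open>m\<close> on the leading coefficients no longer grow, so
      the generators \<open>S\<close> of their union serve for all degrees from \<open>m\<close>
      upwards; each degree below \<open>m\<close> has its own.\<close>
    define Q where "Q d = (if d = m then S else R d)" for d
    have Q: "finite (Q d)" "Q d \<subseteq> LC W d" for d using S(1) m R by (auto simp: Q_def)
    have "\<forall>d. \<forall>x\<in>Q d. \<exists>y. y \<in> L d \<and> y \<otimes>\<^bsub>A\<^esub> (t ^^ d) x \<in> W"
      using Q(2) unfolding LC_def by blast
    then obtain y where y: "\<And>d x. x \<in> Q d \<Longrightarrow> y d x \<in> L d" "\<And>d x. x \<in> Q d \<Longrightarrow> y d x \<otimes>\<^bsub>A\<^esub> (t ^^ d) x \<in> W"
      by metis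
    define E where "E = (\<Union>d\<in>{..m}. (\<lambda>x. y d x \<otimes>\<^bsub>A\<^esub> (t ^^ d) x) ` Q d)"
    have "W \<subseteq> U" if U: "osub A (insert t \<Omega>) U" and EU: "E \<subseteq> U" for U
    proof -
      have WU: "osub A (insert t \<Omega>) (W \<inter> U)"
        using W U subgroups_Inter_pair unfolding osub_def by blast
      interpret U: subgroup U A using U by (simp add: osub_def)
      interpret W: subgroup W A using W by (simp add: osub_def)
      have QWU: "Q d \<subseteq> LC (W \<inter> U) d" if "d \<le> m" for d
      proof
        fix x assume x: "x \<in> Q d"
        then have "y d x \<otimes>\<^bsub>A\<^esub> (t ^^ d) x \<in> W \<inter> U" using y(2)[OF x] EU that by (auto simp: E_def)
        moreover have "x \<in> J" using x Q(2) LCJ by blast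
        ultimately show "x \<in> LC (W \<inter> U) d" unfolding LC_def using y(1)[OF x] by blast
      qed
      have LCU: "LC W d \<subseteq> LC (W \<inter> U) d" for d
      proof (cases "d < m")
        case True
        then show ?thesis using R(3)[OF LCsub[OF WU]] QWU[of d] by (auto simp: Q_def)
      next
        case False
        then have "S \<subseteq> LC (W \<inter> U) d" using QWU[of m] LCle[OF WU, of m d] by (auto simp: Q_def)
        then show ?thesis using S(3)[OF LCsub[OF WU]] by blast
      qed
      have "W \<inter> L d \<subseteq> U" for d
      proof (induction d)
        case 0
        then show ?case by (auto simp: L0)
      next
        case (Suc d)
        show ?case
        proof
          fix a assume a: "a \<in> W \<inter> L (Suc d)"
          then obtain z x where zx: "a = z \<otimes>\<^bsub>A\<^esub> (t ^^ d) x" "z \<in> L d" "x \<in> J" unfolding LS by blast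
          then have "x \<in> LC W d" using a by (auto simp: LC_def)
          then have "x \<in> LC (W \<inter> U) d" using LCU by blast
          then obtain z' where z': "z' \<in> L d" "z' \<otimes>\<^bsub>A\<^esub> (t ^^ d) x \<in> W \<inter> U" by (auto simp: LC_def)
          \<comment> \<open>An element of \<open>W\<close> already known to lie in \<open>U\<close>,
            with the same leading term as \<open>a\<close>; the difference has lower degree and lies
            in \<open>U\<close> by induction.\<close>
          let ?b = "z' \<otimes>\<^bsub>A\<^esub> (t ^^ d) x"
          have c: "z \<in> carrier A" "z' \<in> carrier A" "(t ^^ d) x \<in> carrier A" using Lc zx z' by auto
          have "a \<otimes>\<^bsub>A\<^esub> inv\<^bsub>A\<^esub> ?b = z \<otimes>\<^bsub>A\<^esub> inv\<^bsub>A\<^esub> z'"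
            unfolding zx(1) using comm_group_cancel[OF A c(3) c(1) c(2)] c by (simp add: m_comm)
          moreover have "a \<otimes>\<^bsub>A\<^esub> inv\<^bsub>A\<^esub> ?b \<in> W" using a z' by auto
          moreover have "z \<otimes>\<^bsub>A\<^esub> inv\<^bsub>A\<^esub> z' \<in> L d"
            using zx(2) z'(1) subgroup.m_closed[OF Lsg] subgroup.m_inv_closed[OF Lsg] by blast
          ultimately have "a \<otimes>\<^bsub>A\<^esub> inv\<^bsub>A\<^esub> ?b \<in> U" using Suc.IH by auto
          then have "(a \<otimes>\<^bsub>A\<^esub> inv\<^bsub>A\<^esub> ?b) \<otimes>\<^bsub>A\<^esub> ?b \<in> U" using z' by blast
          moreover have "(a \<otimes>\<^bsub>A\<^esub> inv\<^bsub>A\<^esub> ?b) \<otimes>\<^bsub>A\<^esub> ?b = a"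
          proof -
            have "a \<in> carrier A" "?b \<in> carrier A" using a W.mem_carrier c by auto
            then show ?thesis by (simp add: m_assoc del: inv_mult_group)
          qed
          ultimately show "a \<in> U" by simp
        qed
      qed
      then show ?thesis using WJ' unfolding J'_def by blast
    qed
    moreover have "finite E" unfolding E_def using Q(1) by blast
    moreover have "E \<subseteq> W" unfolding E_def using y(2) by blast
    ultimately show "\<exists>S. finite S \<and> S \<subseteq> W \<and> (\<forall>U. osub A (insert t \<Omega>) U \<and> S \<subseteq> U \<longrightarrow> W \<subseteq> U)" by blast
  qed
  then show ?thesis using JJ' J'sub by blast
qed

lemma ex_noetherian:
  assumes A: "comm_group A" and J: "finite J" "subgroup J A" and fin: "finite \<Omega>" and \<Omega>: "\<Omega> \<subseteq> hom A A"
    and comm: "\<And>f g x. f \<in> \<Omega> \<Longrightarrow> g \<in> \<Omega> \<Longrightarrow> x \<in> carrier A \<Longrightarrow> f (g x) = g (f x)"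
  shows "\<exists>J'. J \<subseteq> J' \<and> osub A \<Omega> J' \<and> noetherian A \<Omega> J'"
  using fin \<Omega> comm
proof (induction \<Omega>)
  case empty
  have "noetherian A {} J" unfolding noetherian_def using J(1) finite_subset by blast
  then show ?case using J(2) by (auto simp: osub_def)
next
  case (insert t \<Omega>)
  then obtain J1 where J1: "J \<subseteq> J1" "osub A \<Omega> J1" "noetherian A \<Omega> J1" by blast
  obtain J' where "J1 \<subseteq> J'" "osub A (insert t \<Omega>) J'" "noetherian A (insert t \<Omega>) J'"
    using hilbert_basis[OF A _ _ _ J1(2,3), of t] insert.prems by blast
  then show ?case using J1(1) by blast
qed

text \<open>The finite group \<open>A\<close>, placed at the neutral element, is noetherian without
  any operators. Each translation by a generator of \<open>G\<close> or by its inverse is then one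
  variable in Hilbert's theorem, and the translates of \<open>A\<close> generate all of
  \<open>A[G]\<close>.\<close>

lemma fsg_noetherian:
  assumes G: "comm_group G" "fin_gen_group G" and A: "comm_group A" "finite (carrier A)"
    and W: "subgroup W (fsg (carrier G) A)" "\<And>g. g \<in> carrier G \<Longrightarrow> shift G A g ` W \<subseteq> W"
  obtains S where "finite S" "S \<subseteq> W"
    "\<And>U. subgroup U (fsg (carrier G) A) \<Longrightarrow> (\<And>g. g \<in> carrier G \<Longrightarrow> shift G A g ` U \<subseteq> U) \<Longrightarrow> S \<subseteq> U \<Longrightarrow> W \<subseteq> U"
proof -
  interpret G: comm_group G by fact
  interpret A: comm_group A by fact
  let ?P = "fsg (carrier G) A"
  interpret P: comm_group ?P by (rule fsg_comm_group) fact
  obtain B where B: "finite B" "B \<subseteq> carrier G" "generate G B = carrier G" using G(2) by (auto simp: fin_gen_group_def)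
  \<comment> \<open>Inverses are listed as operators of their own because closure under an operator
    does not give closure under its inverse.\<close>
  define E where "E = B \<union> (\<lambda>g. inv\<^bsub>G\<^esub> g) ` B"
  have E: "finite E" "E \<subseteq> carrier G" using B by (auto simp: E_def)
  define \<Omega> where "\<Omega> = shift G A ` E"
  \<comment> \<open>Any exponent of \<open>A\<close> would do; it only serves to make translation an
    instance of \<open>gact\<close>.\<close>
  define n where "n = order A"
  have tors: "x [^]\<^bsub>A\<^esub> int n = \<one>\<^bsub>A\<^esub>" if "x \<in> carrier A" for x
    using A.pow_order_eq_1[OF that] by (simp add: int_pow_int n_def)
  interpret sh: gact G n ?P "shift G A" by (rule gact_shift[OF G(1) A(1) tors])
  have s: "sng A \<one>\<^bsub>G\<^esub> \<in> hom A ?P" by (rule sng_hom) (auto simp: A)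
  interpret s: group_hom A ?P "sng A \<one>\<^bsub>G\<^esub>" using s by unfold_locales
  obtain J where J: "sng A \<one>\<^bsub>G\<^esub> ` carrier A \<subseteq> J" "osub ?P \<Omega> J" "noetherian ?P \<Omega> J"
  proof -
    have "\<exists>J'. sng A \<one>\<^bsub>G\<^esub> ` carrier A \<subseteq> J' \<and> osub ?P \<Omega> J' \<and> noetherian ?P \<Omega> J'"
    proof (rule ex_noetherian[OF P.comm_group_axioms _ s.img_is_subgroup])
      show "finite (sng A \<one>\<^bsub>G\<^esub> ` carrier A)" using A(2) by simp
      show "finite \<Omega>" "\<Omega> \<subseteq> hom ?P ?P" using E sh.act_hom by (auto simp: \<Omega>_def)
      fix f g x assume "f \<in> \<Omega>" "g \<in> \<Omega>" and x: "x \<in> carrier ?P"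
      then obtain h k where hk: "h \<in> carrier G" "f = shift G A h" "k \<in> carrier G" "g = shift G A k" using E(2) by (auto simp: \<Omega>_def)
      then show "f (g x) = g (f x)" using x by (simp add: sh.act_mult[symmetric] G.m_comm)
    qed
    then show ?thesis using that by blast
  qed
  have Jsg: "subgroup J ?P" using J(2) by (simp add: osub_def)
  have JE: "shift G A g x \<in> J" if "g \<in> E" "x \<in> J" for g x using J(2) that by (auto simp: osub_def \<Omega>_def)
  have JG: "\<forall>x\<in>J. shift G A g x \<in> J" if "g \<in> generate G B" for g using that
  proof (induction rule: generate.induct)
    case one
    then show ?case using subgroup.mem_carrier[OF Jsg] by simp
  next
    case (incl h) then show ?case using JE by (auto simp: E_def)
  next
    case (inv h) then show ?case using JE by (auto simp: E_def)
  next
    case (eng h1 h2)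
    then have "h1 \<in> carrier G" "h2 \<in> carrier G" using B(3) by auto
    then show ?case using eng subgroup.mem_carrier[OF Jsg] by (simp add: sh.act_mult)
  qed
  have "x \<in> J" if "x \<in> carrier ?P" for x
  proof (rule fsg_induct[OF A(1) Jsg _ that])
    fix g a assume g: "g \<in> carrier G" and a: "a \<in> carrier A"
    have "sng A g a = shift G A g (sng A \<one>\<^bsub>G\<^esub> a)" using g by (simp add: shift_sng G)
    then show "sng A g a \<in> J" using JG[of g] g B(3) J(1) a by auto
  qed
  then have WJ: "W \<subseteq> J" using subgroup.subset[OF W(1)] by blast
  have Wo: "osub ?P \<Omega> W" unfolding osub_def \<Omega>_def using W E(2) by blast
  obtain S where S: "finite S" "S \<subseteq> W" "\<And>U. osub ?P \<Omega> U \<Longrightarrow> S \<subseteq> U \<Longrightarrow> W \<subseteq> U"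
    by (rule noetherianD[OF J(3) Wo WJ]) (rule that; assumption)
  show thesis
  proof (rule that[OF S(1,2)])
    fix U assume U: "subgroup U ?P" "\<And>g. g \<in> carrier G \<Longrightarrow> shift G A g ` U \<subseteq> U" "S \<subseteq> U"
    have "osub ?P \<Omega> U" unfolding osub_def \<Omega>_def using U(1,2) E(2) by blast
    then show "W \<subseteq> U" using S(3) U(3) by blast
  qed
qed

section \<open>Finiteness of finitely generated modules over a finite ring\<close>

lemma finite_Zmod: "n > 0 \<Longrightarrow> finite (carrier (Zmod n))"
proof -
  assume n: "n > 0"
  have "carrier (Zmod n) \<subseteq> zc n ` {0..<int n}"
  proof
    fix z assume "z \<in> carrier (Zmod n)"
    then obtain k where "z = zc n k" by (auto simp: carrier_Zmod)
    also have "\<dots> = zc n (k mod int n)" by (simp add: zc_eq_iff mod_eq_dvd_iff[symmetric])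
    finally show "z \<in> zc n ` {0..<int n}" using n by auto
  qed
  then show ?thesis using finite_subset by blast
qed

text \<open>\<open>fin_gen_module\<close> speaks of the submodules that contain the generators, so
  it suffices to exhibit a finite one. It is built by adding the multiples of one generator at a
  time.\<close>

lemma finite_fin_gen_module:
  assumes M: "Module.module R M" and fin: "finite (carrier R)" and gen: "fin_gen_module R M"
  shows "finite (carrier M)"
proof -
  interpret module R M by fact
  have ex: "\<exists>H. finite H \<and> S \<subseteq> H \<and> submodule H R M" if "finite S" "S \<subseteq> carrier M" for S
    using that
  proof (induction S)
    case empty
    have "submodule {\<zero>\<^bsub>M\<^esub>} R M" by (rule submoduleI) auto
    then show ?case by blast
  next
    case (insert s S)
    then obtain H where H: "finite H" "S \<subseteq> H" "submodule H R M" by blast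
    note HE = submoduleE[OF H(3)]
    have sM: "s \<in> carrier M" using insert by simp
    let ?H = "(\<lambda>(h, a). h \<oplus>\<^bsub>M\<^esub> a \<odot>\<^bsub>M\<^esub> s) ` (H \<times> carrier R)"
    have Hc: "h \<in> carrier M" if "h \<in> H" for h using HE(1) that by blast
    have z: "\<zero>\<^bsub>M\<^esub> \<in> H" using subgroup.one_closed[OF submodule.axioms(1)[OF H(3)]] by simp
    have I: "h \<oplus>\<^bsub>M\<^esub> a \<odot>\<^bsub>M\<^esub> s \<in> ?H" if "h \<in> H" "a \<in> carrier R" for h a using that by force
    have "submodule ?H R M"
    proof (rule submoduleI)
      show "?H \<subseteq> carrier M" using Hc sM by auto
      show "\<zero>\<^bsub>M\<^esub> \<in> ?H" using I[OF z R.zero_closed] sM by simp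
      fix p assume "p \<in> ?H"
      then obtain h a where p: "p = h \<oplus>\<^bsub>M\<^esub> a \<odot>\<^bsub>M\<^esub> s" "h \<in> H" "a \<in> carrier R" by auto
      have "\<ominus>\<^bsub>M\<^esub> p = (\<ominus>\<^bsub>M\<^esub> h) \<oplus>\<^bsub>M\<^esub> (\<ominus>\<^bsub>R\<^esub> a) \<odot>\<^bsub>M\<^esub> s"
        using p Hc sM by (simp add: M.minus_add smult_l_minus)
      then show "\<ominus>\<^bsub>M\<^esub> p \<in> ?H" using I[of "\<ominus>\<^bsub>M\<^esub> h" "\<ominus>\<^bsub>R\<^esub> a"] HE(3)[OF p(2)] p(3) by simp
      fix q assume "q \<in> ?H"
      then obtain k b where q: "q = k \<oplus>\<^bsub>M\<^esub> b \<odot>\<^bsub>M\<^esub> s" "k \<in> H" "b \<in> carrier R" by auto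
      have "p \<oplus>\<^bsub>M\<^esub> q = (h \<oplus>\<^bsub>M\<^esub> k) \<oplus>\<^bsub>M\<^esub> (a \<oplus>\<^bsub>R\<^esub> b) \<odot>\<^bsub>M\<^esub> s"
        using p q Hc sM by (simp add: smult_l_distr M.a_ac)
      then show "p \<oplus>\<^bsub>M\<^esub> q \<in> ?H" using I[of "h \<oplus>\<^bsub>M\<^esub> k" "a \<oplus>\<^bsub>R\<^esub> b"] HE(5)[OF p(2) q(2)] p(3) q(3) by simp
    next
      fix r p assume r: "r \<in> carrier R" and "p \<in> ?H"
      then obtain h a where p: "p = h \<oplus>\<^bsub>M\<^esub> a \<odot>\<^bsub>M\<^esub> s" "h \<in> H" "a \<in> carrier R" by auto
      have "r \<odot>\<^bsub>M\<^esub> p = (r \<odot>\<^bsub>M\<^esub> h) \<oplus>\<^bsub>M\<^esub> (r \<otimes>\<^bsub>R\<^esub> a) \<odot>\<^bsub>M\<^esub> s"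
        using p r Hc sM by (simp add: smult_r_distr smult_assoc1)
      then show "r \<odot>\<^bsub>M\<^esub> p \<in> ?H" using I[of "r \<odot>\<^bsub>M\<^esub> h" "r \<otimes>\<^bsub>R\<^esub> a"] HE(4)[OF r p(2)] p(3) r by simp
    qed
    moreover have "insert s S \<subseteq> ?H"
    proof -
      have "s \<in> ?H" using I[OF z R.one_closed] sM by simp
      moreover have "h \<in> ?H" if "h \<in> H" for h using I[OF that R.zero_closed] sM Hc[OF that] by simp
      ultimately show ?thesis using H(2) by blast
    qed
    moreover have "finite ?H" using H(1) fin by simp
    ultimately show ?case by blast
  qed
  obtain S where S: "finite S" "S \<subseteq> carrier M" "\<And>H. submodule H R M \<Longrightarrow> S \<subseteq> H \<Longrightarrow> H = carrier M"
    using gen unfolding fin_gen_module_def by blast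
  then show ?thesis using ex[OF S(1,2)] by metis
qed

section \<open>Modules over the group ring\<close>

text \<open>Connects module records with actions: multiplication by \<open>r\<close> is the sum of
  the translates weighted by the coefficients of \<open>r\<close>, which act as exponents through
  \<open>zrep\<close>. The module axioms needed later follow from this formula
  (\<open>gmodule_smult_hom\<close>).\<close>

definition gmodule :: "'g monoid \<Rightarrow> nat \<Rightarrow> ('g \<Rightarrow> int set, 'm, 'z) module_scheme \<Rightarrow> ('g \<Rightarrow> 'm \<Rightarrow> 'm) \<Rightarrow> bool" where
  "gmodule G n M \<alpha> \<longleftrightarrow> gact G n (amon M) \<alpha> \<and>
     (\<forall>r\<in>carrier (RG G n). \<forall>v\<in>carrier M. r \<odot>\<^bsub>M\<^esub> v =
        finprod (amon M) (\<lambda>h. \<alpha> h v [^]\<^bsub>amon M\<^esub> zrep n (r h)) {h \<in> carrier G. r h \<noteq> zc n 0})"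

lemma amon_group_ring: "amon (group_ring (Zmod n) G) = RG G n"
  by (auto simp: amon_def group_ring_def RG_def fsg_def fin_supp_def)

lemma carrier_group_ring: "carrier (group_ring (Zmod n) G) = carrier (RG G n)"
  using amon_group_ring by (metis amon_simps(1))

lemma amon_ring_module: "amon (ring_module R) = amon R"
  by (simp add: amon_def ring_module_def)

lemma ring_module_sel: "smult (ring_module R) = monoid.mult R" "\<zero>\<^bsub>ring_module R\<^esub> = \<zero>\<^bsub>R\<^esub>"
  by (simp_all add: ring_module_def)

lemma finsum_ring_module: "finsum (ring_module R) f S = finsum R f S"
  by (simp add: finsum_amon amon_ring_module)

lemma amon_group_module: "amon (group_module K M G) = fsg (carrier G) (amon M)"
  by (auto simp: amon_def group_module_def fsg_def fin_supp_def)

lemma amon_free_module: "amon (free_module (group_ring (Zmod n) G) B) = FR G n B"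
  by (auto simp: amon_def free_module_def group_ring_def FR_def RG_def fsg_def fin_supp_def)

lemma carrier_free_module: "carrier (free_module (group_ring (Zmod n) G) B) = carrier (FR G n B)"
  using amon_free_module by (metis amon_simps(1))

lemma zero_free_module: "\<zero>\<^bsub>free_module (group_ring (Zmod n) G) B\<^esub> = \<one>\<^bsub>FR G n B\<^esub>"
  using amon_free_module by (metis amon_simps(3))

lemma finprod_single:
  assumes "comm_monoid A" "f x \<in> carrier A"
  shows "finprod A f {x} = f x"
proof -
  interpret comm_monoid A by fact
  show ?thesis using assms(2) by simp
qed

lemma gmodule_monomial:
  assumes M: "gmodule G n M \<alpha>" and g: "g \<in> carrier G" and v: "v \<in> carrier M"
  shows "sng (amon (Zmod n)) g (zc n 1) \<in> carrier (RG G n)"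
    and "sng (amon (Zmod n)) g (zc n 1) \<odot>\<^bsub>M\<^esub> v = \<alpha> g v"
proof -
  interpret gact G n "amon M" \<alpha> using M by (simp add: gmodule_def)
  let ?r = "sng (amon (Zmod n)) g (zc n 1)"
  show r: "?r \<in> carrier (RG G n)" unfolding RG_def by (rule sng_closed) (auto simp: g comm_group_Zmod)
  have av: "\<alpha> g v \<in> carrier (amon M)" using g v act_closed by simp
  have eq: "?r \<odot>\<^bsub>M\<^esub> v = finprod (amon M) (\<lambda>h. \<alpha> h v [^]\<^bsub>amon M\<^esub> zrep n (?r h)) {h \<in> carrier G. ?r h \<noteq> zc n 0}"
    using M r v unfolding gmodule_def by blast
  show "?r \<odot>\<^bsub>M\<^esub> v = \<alpha> g v"
  \<comment> \<open>Over the zero ring, for \<open>n = 1\<close>, the monomial has empty support: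
    the formula gives an empty product, and the right-hand side is trivial by torsion.\<close>
  proof (cases "zc n 1 = zc n 0")
    case True
    then have "n = 1" by (simp add: zc_eq_iff)
    then have "\<alpha> g v = \<one>\<^bsub>amon M\<^esub>" using torsion[OF av] av A.int_pow_1 by simp
    moreover have S: "{h \<in> carrier G. ?r h \<noteq> zc n 0} = {}" using True by (auto simp: sng_def zc_zero)
    ultimately show ?thesis unfolding eq S by simp
  next
    case False
    then have "{h \<in> carrier G. ?r h \<noteq> zc n 0} = {g}" using g by (auto simp: sng_def zc_zero)
    then have "?r \<odot>\<^bsub>M\<^esub> v = finprod (amon M) (\<lambda>h. \<alpha> h v [^]\<^bsub>amon M\<^esub> zrep n (?r h)) {g}" using eq by simp
    also have "\<dots> = \<alpha> g v [^]\<^bsub>amon M\<^esub> zrep n (?r g)"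
      by (rule finprod_single[where f="\<lambda>h. \<alpha> h v [^]\<^bsub>amon M\<^esub> zrep n (?r h)"])
        (rule A.comm_monoid_axioms, rule A.int_pow_closed[OF av])
    also have "\<dots> = \<alpha> g v"
      using torsion_zrep[OF A.comm_group_axioms av torsion[OF av], of 1] A.int_pow_1[OF av] by (simp add: sng_def)
    finally show ?thesis .
  qed
qed

text \<open>Monomials yield equivariance from linearity, and the formula in \<open>gmodule\<close>
  yields the converse. Through this equality linear maps over the group ring are replaced by
  equivariant additive maps.\<close>

lemma module_hom_eq_ehom:
  assumes M: "gmodule G n M \<alpha>" and N: "gmodule G n N \<beta>"
  shows "module_hom (group_ring (Zmod n) G) M N = ehom (carrier G) (amon M) \<alpha> (amon N) \<beta>"
proof
  interpret M: gact G n "amon M" \<alpha> using M by (simp add: gmodule_def)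
  interpret N: gact G n "amon N" \<beta> using N by (simp add: gmodule_def)
  show "module_hom (group_ring (Zmod n) G) M N \<subseteq> ehom (carrier G) (amon M) \<alpha> (amon N) \<beta>"
  proof
    fix f assume f: "f \<in> module_hom (group_ring (Zmod n) G) M N"
    then have fh: "f \<in> hom (amon M) (amon N)" by (simp add: module_hom_def hom_amon)
    have "f (\<alpha> g v) = \<beta> g (f v)" if g: "g \<in> carrier G" and v: "v \<in> carrier M" for g v
    proof -
      have fv: "f v \<in> carrier N" using hom_in_carrier[OF fh] v by simp
      show ?thesis
        using f gmodule_monomial[OF M g v] gmodule_monomial[OF N g fv] v
        by (simp add: module_hom_def carrier_group_ring) metis
    qed
    then show "f \<in> ehom (carrier G) (amon M) \<alpha> (amon N) \<beta>" using fh by (simp add: ehom_def)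
  qed
  show "ehom (carrier G) (amon M) \<alpha> (amon N) \<beta> \<subseteq> module_hom (group_ring (Zmod n) G) M N"
  proof
    fix f assume f: "f \<in> ehom (carrier G) (amon M) \<alpha> (amon N) \<beta>"
    interpret f: group_hom "amon M" "amon N" f using ehom_hom[OF f] by unfold_locales
    have "f (r \<odot>\<^bsub>M\<^esub> v) = r \<odot>\<^bsub>N\<^esub> f v" if r: "r \<in> carrier (RG G n)" and v: "v \<in> carrier M" for r v
    proof -
      let ?S = "{h \<in> carrier G. r h \<noteq> zc n 0}"
      have v': "v \<in> carrier (amon M)" using v by simp
      have fv: "f v \<in> carrier N" using f.hom_closed[OF v'] by simp
      have c: "\<alpha> h v \<in> carrier (amon M)" if "h \<in> carrier G" for h using M.act_closed[OF that v'] .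
      have c': "\<beta> h (f v) \<in> carrier (amon N)" if "h \<in> carrier G" for h using N.act_closed[OF that f.hom_closed[OF v']] .
      have "f (r \<odot>\<^bsub>M\<^esub> v) = f (finprod (amon M) (\<lambda>h. \<alpha> h v [^]\<^bsub>amon M\<^esub> zrep n (r h)) ?S)"
        using M r v by (simp add: gmodule_def)
      also have "\<dots> = finprod (amon N) (\<lambda>h. f (\<alpha> h v [^]\<^bsub>amon M\<^esub> zrep n (r h))) ?S"
        by (rule hom_finprod[OF M.A.comm_group_axioms N.A.comm_group_axioms ehom_hom[OF f]])
          (use c M.A.int_pow_closed in blast)
      also have "\<dots> = finprod (amon N) (\<lambda>h. \<beta> h (f v) [^]\<^bsub>amon N\<^esub> zrep n (r h)) ?S"
      proof (rule N.A.finprod_cong'[OF refl])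
        show "(\<lambda>h. \<beta> h (f v) [^]\<^bsub>amon N\<^esub> zrep n (r h)) \<in> ?S \<rightarrow> carrier (amon N)"
          using c' N.A.int_pow_closed by blast
        fix h assume "h \<in> ?S"
        then have h: "h \<in> carrier G" by simp
        show "f (\<alpha> h v [^]\<^bsub>amon M\<^esub> zrep n (r h)) = \<beta> h (f v) [^]\<^bsub>amon N\<^esub> zrep n (r h)"
          using f.hom_int_pow[OF c[OF h]] ehom_eq[OF f h v'] by simp
      qed
      also have "\<dots> = r \<odot>\<^bsub>N\<^esub> f v" using N r fv by (simp add: gmodule_def)
      finally show ?thesis .
    qed
    then show "f \<in> module_hom (group_ring (Zmod n) G) M N"
      using ehom_hom[OF f] by (simp add: module_hom_def hom_amon carrier_group_ring)
  qed
qed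

lemma Zmod_smult:
  assumes M: "Module.module (Zmod n) M" and x: "x \<in> carrier M"
  shows "z \<in> carrier (Zmod n) \<Longrightarrow> z \<odot>\<^bsub>M\<^esub> x = x [^]\<^bsub>amon M\<^esub> zrep n z"
    and "x [^]\<^bsub>amon M\<^esub> int n = \<one>\<^bsub>amon M\<^esub>"
proof -
  interpret M: Module.module "Zmod n" M by fact
  have cM: "comm_group (amon M)" using comm_group_amon M.abelian_group_axioms by blast
  interpret h: group_hom "amon (Zmod n)" "amon M" "\<lambda>z. z \<odot>\<^bsub>M\<^esub> x"
    using cM comm_group_Zmod x
    by (auto simp: group_hom_def group_hom_axioms_def comm_group.axioms hom_def M.smult_l_distr)
  have *: "zc n k \<odot>\<^bsub>M\<^esub> x = x [^]\<^bsub>amon M\<^esub> k" for k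
    using h.hom_int_pow[of "zc n 1" k] M.smult_one[OF x] by (simp add: zc_pow zc_one)
  show "z \<in> carrier (Zmod n) \<Longrightarrow> z \<odot>\<^bsub>M\<^esub> x = x [^]\<^bsub>amon M\<^esub> zrep n z"
    using *[of "zrep n z"] by (simp add: zc_zrep)
  have "zc n (int n) = zc n 0" by (simp add: zc_eq_iff)
  then show "x [^]\<^bsub>amon M\<^esub> int n = \<one>\<^bsub>amon M\<^esub>"
    using *[of "int n"] *[of 0] by simp
qed

lemma gmodule_group_module:
  assumes G: "comm_group G" and M: "Module.module (Zmod n) M"
  shows "gmodule G n (group_module (Zmod n) M G) (shift G (amon M))"
proof -
  interpret M: Module.module "Zmod n" M by fact
  interpret G: comm_group G by fact
  have cM: "comm_group (amon M)" using comm_group_amon M.abelian_group_axioms by blast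
  interpret A: comm_group "amon M" by (rule cM)
  let ?P = "fsg (carrier G) (amon M)"
  have g: "gact G n ?P (shift G (amon M))"
    by (rule gact_shift[OF G cM]) (use Zmod_smult(2)[OF M] in simp)
  interpret sh: gact G n ?P "shift G (amon M)" by (rule g)
  have "r \<odot>\<^bsub>group_module (Zmod n) M G\<^esub> v = finprod ?P (\<lambda>h. shift G (amon M) h v [^]\<^bsub>?P\<^esub> zrep n (r h)) {h \<in> carrier G. r h \<noteq> zc n 0}"
    if r: "r \<in> carrier (RG G n)" and v: "v \<in> carrier ?P" for r v
  proof
    fix x
    let ?S = "{h \<in> carrier G. r h \<noteq> zc n 0}"
    have rh: "r h \<in> carrier (Zmod n)" for h using fsg_app[OF r[unfolded RG_def]] by simp
    have vh: "v h \<in> carrier (amon M)" for h using fsg_app[OF v] by simp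
    have ev: "(shift G (amon M) h v [^]\<^bsub>?P\<^esub> zrep n (r h)) x = shift G (amon M) h v x [^]\<^bsub>amon M\<^esub> zrep n (r h)"
      if "h \<in> carrier G" for h using fsg_int_pow[OF cM sh.act_closed[OF that v]] .
    have "finprod ?P (\<lambda>h. shift G (amon M) h v [^]\<^bsub>?P\<^esub> zrep n (r h)) ?S x =
        finprod (amon M) (\<lambda>h. (shift G (amon M) h v [^]\<^bsub>?P\<^esub> zrep n (r h)) x) ?S"
      by (rule fsg_finprod[OF cM]) (use v in auto)
    also have "\<dots> = (r \<odot>\<^bsub>group_module (Zmod n) M G\<^esub> v) x"
    proof (cases "x \<in> carrier G")
      case True
      have "(r \<odot>\<^bsub>group_module (Zmod n) M G\<^esub> v) x = finprod (amon M) (\<lambda>h. r h \<odot>\<^bsub>M\<^esub> v (inv\<^bsub>G\<^esub> h \<otimes>\<^bsub>G\<^esub> x)) ?S"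
        using True by (simp add: group_module_def finsum_amon zc_zero)
      also have "\<dots> = finprod (amon M) (\<lambda>h. (shift G (amon M) h v [^]\<^bsub>?P\<^esub> zrep n (r h)) x) ?S"
      proof (rule A.finprod_cong'[OF refl])
        show "(\<lambda>h. (shift G (amon M) h v [^]\<^bsub>?P\<^esub> zrep n (r h)) x) \<in> ?S \<rightarrow> carrier (amon M)"
        proof
          fix h assume "h \<in> ?S"
          then have "shift G (amon M) h v [^]\<^bsub>?P\<^esub> zrep n (r h) \<in> carrier ?P"
            using sh.A.int_pow_closed[OF sh.act_closed[OF _ v]] by simp
          then show "(shift G (amon M) h v [^]\<^bsub>?P\<^esub> zrep n (r h)) x \<in> carrier (amon M)" by (rule fsg_app)
        qed
        fix h assume "h \<in> ?S"
        then have h: "h \<in> carrier G" by simp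
        show "r h \<odot>\<^bsub>M\<^esub> v (inv\<^bsub>G\<^esub> h \<otimes>\<^bsub>G\<^esub> x) = (shift G (amon M) h v [^]\<^bsub>?P\<^esub> zrep n (r h)) x"
          unfolding ev[OF h] using Zmod_smult(1)[OF M _ rh] vh True by (simp add: shift_def)
      qed
      finally show ?thesis by simp
    next
      case False
      have "finprod (amon M) (\<lambda>h. (shift G (amon M) h v [^]\<^bsub>?P\<^esub> zrep n (r h)) x) ?S = \<one>\<^bsub>amon M\<^esub>"
        by (rule A.finprod_one_eqI) (use False ev in \<open>auto simp: shift_def A.int_pow_one[simplified]\<close>)
      then show ?thesis using False by (simp add: group_module_def)
    qed
    finally show "(r \<odot>\<^bsub>group_module (Zmod n) M G\<^esub> v) x = finprod ?P (\<lambda>h. shift G (amon M) h v [^]\<^bsub>?P\<^esub> zrep n (r h)) ?S x" by simp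
  qed
  moreover have "carrier (group_module (Zmod n) M G) = carrier ?P"
    using amon_group_module by (metis amon_simps(1))
  ultimately show ?thesis using g by (simp add: gmodule_def amon_group_module)
qed

lemma module_ring_module: 
  assumes "cring R" shows "Module.module R (ring_module R)"
proof -
  interpret cring R by fact
  show ?thesis
    by (rule moduleI) (auto simp: ring_module_def assms l_distr r_distr m_assoc intro!: abelian_groupI a_assoc a_comm add.l_inv_ex)
qed

text \<open>The regular module is \<open>P_0[G]\<close> for \<open>P_0\<close> the integers modulo
  \<open>n\<close>, so the result for group modules applies.\<close>

lemma gmodule_ring:
  assumes G: "comm_group G"
  shows "gmodule G n (ring_module (group_ring (Zmod n) G)) (rsh G n)"
proof -
  let ?N = "ring_module (group_ring (Zmod n) G)" and ?P = "group_module (Zmod n) (ring_module (Zmod n)) G"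
  have g: "gmodule G n ?P (shift G (amon (ring_module (Zmod n))))"
    by (rule gmodule_group_module[OF G module_ring_module[OF ZFact_is_cring]])
  have 1: "amon ?N = amon ?P"
    unfolding amon_ring_module amon_group_ring amon_group_module RG_def ..
  have "r \<odot>\<^bsub>?N\<^esub> v = r \<odot>\<^bsub>?P\<^esub> v" for r v
    by (simp add: ring_module_sel finsum_ring_module group_ring_def group_module_def cong: if_cong)
  moreover have "carrier ?N = carrier ?P" using 1 by (metis amon_simps(1))
  ultimately show ?thesis using g 1 by (simp add: gmodule_def amon_ring_module rsh_def)
qed

lemma gmodule_free:
  assumes G: "comm_group G"
  shows "gmodule G n (free_module (group_ring (Zmod n) G) B) (fsh G n)"
proof -
  let ?F = "free_module (group_ring (Zmod n) G) B"
  interpret N: gact G n "RG G n" "rsh G n" by (rule gact_RG[OF G])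
  interpret F: gact G n "FR G n B" "fsh G n" by (rule gact_FR[OF G])
  note cF = carrier_free_module
  have "r \<odot>\<^bsub>?F\<^esub> v = finprod (FR G n B) (\<lambda>h. fsh G n h v [^]\<^bsub>FR G n B\<^esub> zrep n (r h)) {h \<in> carrier G. r h \<noteq> zc n 0}"
    if r: "r \<in> carrier (RG G n)" and v: "v \<in> carrier (FR G n B)" for r v
  proof
    fix b
    let ?S = "{h \<in> carrier G. r h \<noteq> zc n 0}"
    have vb: "v b \<in> carrier (RG G n)" using fsg_app[OF v[unfolded FR_def]] .
    have "finprod (FR G n B) (\<lambda>h. fsh G n h v [^]\<^bsub>FR G n B\<^esub> zrep n (r h)) ?S b =
        finprod (RG G n) (\<lambda>h. (fsh G n h v [^]\<^bsub>FR G n B\<^esub> zrep n (r h)) b) ?S"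
      unfolding FR_def by (rule fsg_finprod[OF N.A.comm_group_axioms]) (use v in \<open>auto simp: FR_def[symmetric]\<close>)
    also have "\<dots> = finprod (RG G n) (\<lambda>h. rsh G n h (v b) [^]\<^bsub>RG G n\<^esub> zrep n (r h)) ?S"
    proof (rule N.A.finprod_cong'[OF refl])
      show "(\<lambda>h. rsh G n h (v b) [^]\<^bsub>RG G n\<^esub> zrep n (r h)) \<in> ?S \<rightarrow> carrier (RG G n)" using vb by auto
      fix h assume "h \<in> ?S"
      then have "fsh G n h v \<in> carrier (fsg B (RG G n))" using F.act_closed v by (simp add: FR_def)
      then show "(fsh G n h v [^]\<^bsub>FR G n B\<^esub> zrep n (r h)) b = rsh G n h (v b) [^]\<^bsub>RG G n\<^esub> zrep n (r h)"
        unfolding FR_def by (simp add: fsg_int_pow N.A.comm_group_axioms fsh_def)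
    qed
    also have "\<dots> = r \<odot>\<^bsub>ring_module (group_ring (Zmod n) G)\<^esub> v b"
      using gmodule_ring[OF G, of n] r vb
      by (simp add: gmodule_def amon_ring_module amon_group_ring) (simp add: ring_module_def carrier_group_ring)
    also have "\<dots> = (r \<odot>\<^bsub>?F\<^esub> v) b" by (simp add: ring_module_def free_module_def)
    finally show "(r \<odot>\<^bsub>?F\<^esub> v) b = finprod (FR G n B) (\<lambda>h. fsh G n h v [^]\<^bsub>FR G n B\<^esub> zrep n (r h)) ?S b" by simp
  qed
  then show ?thesis using gact_FR[OF G] by (simp add: gmodule_def amon_free_module cF)
qed

text \<open>The antipode as seen on actions. Inversion yields an action again because the group is
  commutative.\<close>

lemma gact_inverse:
  assumes "gact G n A \<beta>"
  shows "gact G n A (\<lambda>g. \<beta> (inv\<^bsub>G\<^esub> g))"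
proof -
  interpret gact G n A \<beta> by fact
  show ?thesis
  proof
    fix g h x assume *: "g \<in> carrier G" "h \<in> carrier G" "x \<in> carrier A"
    then have "inv\<^bsub>G\<^esub> (g \<otimes>\<^bsub>G\<^esub> h) = inv\<^bsub>G\<^esub> g \<otimes>\<^bsub>G\<^esub> inv\<^bsub>G\<^esub> h" by (simp add: G.inv_mult)
    then show "\<beta> (inv\<^bsub>G\<^esub> (g \<otimes>\<^bsub>G\<^esub> h)) x = \<beta> (inv\<^bsub>G\<^esub> g) (\<beta> (inv\<^bsub>G\<^esub> h) x)" using * by (simp add: act_mult)
  qed (auto simp: act_hom torsion)
qed

lemma gact_image:
  assumes A: "gact G n A \<alpha>" and q: "q \<in> hom A B" "q ` carrier A = carrier B" and B: "comm_group B"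
    and \<beta>: "\<And>g x. g \<in> carrier G \<Longrightarrow> x \<in> carrier A \<Longrightarrow> \<beta> g (q x) = q (\<alpha> g x)"
  shows "gact G n B \<beta>"
proof -
  interpret A: gact G n A \<alpha> by fact
  interpret B: comm_group B by fact
  interpret q: group_hom A B q using q by unfold_locales
  have ex: "\<exists>x\<in>carrier A. y = q x" if "y \<in> carrier B" for y using q(2) that by blast
  show ?thesis
  proof
    fix g assume g: "g \<in> carrier G"
    show "\<beta> g \<in> hom B B"
    proof (rule homI)
      fix y assume "y \<in> carrier B"
      then obtain x where x: "x \<in> carrier A" "y = q x" using ex by blast
      then show "\<beta> g y \<in> carrier B" using g \<beta> by simp
      fix y' assume "y' \<in> carrier B"
      then obtain x' where x': "x' \<in> carrier A" "y' = q x'" using ex by blast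
      have "\<beta> g (q (x \<otimes>\<^bsub>A\<^esub> x')) = q (\<alpha> g (x \<otimes>\<^bsub>A\<^esub> x'))"
        by (rule \<beta>[OF g A.A.m_closed[OF x(1) x'(1)]])
      then show "\<beta> g (y \<otimes>\<^bsub>B\<^esub> y') = \<beta> g y \<otimes>\<^bsub>B\<^esub> \<beta> g y'" using x x' g \<beta> by (simp add: A.act_m)
    qed
    fix h y assume h: "h \<in> carrier G" and "y \<in> carrier B"
    then obtain x where x: "x \<in> carrier A" "y = q x" using ex by blast
    then show "\<beta> (g \<otimes>\<^bsub>G\<^esub> h) y = \<beta> g (\<beta> h y)" using g h \<beta> by (simp add: A.act_mult)
  next
    fix y assume "y \<in> carrier B"
    then obtain x where x: "x \<in> carrier A" "y = q x" using ex by blast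
    then show "\<beta> \<one>\<^bsub>G\<^esub> y = y" using \<beta> by simp
    show "y [^]\<^bsub>B\<^esub> int n = \<one>\<^bsub>B\<^esub>" using x A.torsion by (simp add: q.hom_int_pow[symmetric])
  qed
qed

text \<open>The antipode is moved from the scalars to the acting group: \<open>M\<close> becomes an
  ordinary equivariant quotient of \<open>P\<close> with the inverted action, the form in which the
  twisted quotient is used afterwards.\<close>

lemma quotient_twist:
  assumes P: "gmodule G n P \<beta>" and L: "subgroup L (amon P)" and inv: "\<And>g. g \<in> carrier G \<Longrightarrow> \<beta> g ` L \<subseteq> L"
  defines "M \<equiv> antipode_twist (Zmod n) G (quotient_module P L)"
  obtains \<alpha> where "gmodule G n M \<alpha>"
    "(\<lambda>p. L +>\<^bsub>P\<^esub> p) \<in> ehom (carrier G) (amon P) (\<lambda>g. \<beta> (inv\<^bsub>G\<^esub> g)) (amon M) \<alpha>"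
    "(\<lambda>p. L +>\<^bsub>P\<^esub> p) ` carrier P = carrier M"
    "\<And>p. p \<in> carrier P \<Longrightarrow> L +>\<^bsub>P\<^esub> p = \<one>\<^bsub>amon M\<^esub> \<longleftrightarrow> p \<in> L"
proof -
  interpret P: gact G n "amon P" \<beta> using P by (simp add: gmodule_def)
  interpret PA: abelian_group P using comm_group_amon P.A.comm_group_axioms by blast
  interpret L: abelian_subgroup L P
    by (rule abelian_subgroupI3) (use L PA.abelian_group_axioms in \<open>auto simp: additive_subgroup_def subgroup_amon\<close>)
  define q where "q p = L +>\<^bsub>P\<^esub> p" for p
  have cM: "carrier M = a_rcosets\<^bsub>P\<^esub> L" and aM: "add M = set_add P" and zM: "\<zero>\<^bsub>M\<^esub> = L"
    and sM: "\<And>r U. r \<odot>\<^bsub>M\<^esub> U = (\<Union>x\<in>U. L +>\<^bsub>P\<^esub> (antipode (Zmod n) G r \<odot>\<^bsub>P\<^esub> x))"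
    by (simp_all add: M_def antipode_twist_def quotient_module_def)
  have q_img: "q ` carrier P = carrier M" by (auto simp: cM q_def A_RCOSETS_def')
  have q_hom: "q \<in> hom (amon P) (amon M)"
    using q_img L.a_rcos_sum by (auto simp: hom_def q_def aM)
  have qone: "q \<one>\<^bsub>amon P\<^esub> = \<one>\<^bsub>amon M\<^esub>" using L.a_subset by (simp add: q_def zM)
  have "comm_group ((amon M)\<lparr>carrier := q ` carrier (amon P), one := q \<one>\<^bsub>amon P\<^esub>\<rparr>)"
    by (rule P.A.hom_imp_img_comm_group[OF q_hom])
  also have "(amon M)\<lparr>carrier := q ` carrier (amon P), one := q \<one>\<^bsub>amon P\<^esub>\<rparr> = amon M"
    using q_img qone by (simp add: amon_def)
  finally have Mg: "comm_group (amon M)" .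
  interpret M: comm_group "amon M" by (rule Mg)
  interpret q: group_hom "amon P" "amon M" q using q_hom by unfold_locales
  have ker: "q p = \<one>\<^bsub>amon M\<^esub> \<longleftrightarrow> p \<in> L" if p: "p \<in> carrier P" for p
    using PA.a_coset_join1[of L p] PA.a_coset_join2[of p L] L.a_subgroup L.a_subset p by (auto simp: q_def zM)
  have qU: "q x = U" if U: "U \<in> carrier M" and x: "x \<in> U" for x U
  proof -
    have "U \<in> q ` carrier P" using U q_img by simp
    then obtain p where p: "p \<in> carrier P" "U = L +>\<^bsub>P\<^esub> p" unfolding q_def by blast
    then show ?thesis using L.a_repr_independence'[OF x[unfolded p(2)] p(1)] by (simp add: q_def)
  qed
  have Unempty: "\<exists>x. x \<in> U \<and> x \<in> carrier P" if U: "U \<in> carrier M" for U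
  proof -
    have "U \<in> q ` carrier P" using U q_img by simp
    then obtain p where p: "p \<in> carrier P" "U = L +>\<^bsub>P\<^esub> p" unfolding q_def by blast
    then show ?thesis using L.a_rcos_self by blast
  qed
  \<comment> \<open>Acts through a representative of the coset; the choice is harmless because two
    representatives differ by an element of the invariant subgroup \<open>L\<close>.\<close>
  define \<alpha> where "\<alpha> g U = q (\<beta> (inv\<^bsub>G\<^esub> g) (SOME x. x \<in> carrier P \<and> q x = U))" for g U
  have \<alpha>q: "\<alpha> g (q x) = q (\<beta> (inv\<^bsub>G\<^esub> g) x)" if g: "g \<in> carrier G" and x: "x \<in> carrier (amon P)" for g x
  proof -
    define y where "y = (SOME y. y \<in> carrier P \<and> q y = q x)"
    have y: "y \<in> carrier P \<and> q y = q x" unfolding y_def by (rule someI[of _ x]) (use x in simp)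
    let ?d = "x \<otimes>\<^bsub>amon P\<^esub> inv\<^bsub>amon P\<^esub> y"
    have yc: "y \<in> carrier (amon P)" using y by simp
    have dc: "?d \<in> carrier (amon P)" using x yc by (intro P.A.m_closed P.A.inv_closed)
    have "q ?d = q x \<otimes>\<^bsub>amon M\<^esub> inv\<^bsub>amon M\<^esub> (q y)"
      unfolding q.hom_mult[OF x P.A.inv_closed[OF yc]] q.hom_inv[OF yc] ..
    then have "q ?d = \<one>\<^bsub>amon M\<^esub>" using y M.r_inv[OF q.hom_closed[OF x]] by (simp del: amon_simps)
    then have "?d \<in> L" using ker dc by simp
    then have "\<beta> (inv\<^bsub>G\<^esub> g) ?d \<in> L" using inv[of "inv\<^bsub>G\<^esub> g"] g by auto
    moreover have "\<beta> (inv\<^bsub>G\<^esub> g) ?d \<in> carrier P" using P.act_closed[OF P.G.inv_closed[OF g] dc] by simp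
    ultimately have 1: "q (\<beta> (inv\<^bsub>G\<^esub> g) ?d) = \<one>\<^bsub>amon M\<^esub>" using ker by blast
    have dy: "?d \<otimes>\<^bsub>amon P\<^esub> y = x"
      unfolding P.A.m_assoc[OF x P.A.inv_closed[OF yc] yc] P.A.l_inv[OF yc] by (rule P.A.r_one[OF x])
    let ?i = "inv\<^bsub>G\<^esub> g"
    have i: "?i \<in> carrier G" using g by (rule P.G.inv_closed)
    have "\<beta> ?i x = \<beta> ?i ?d \<otimes>\<^bsub>amon P\<^esub> \<beta> ?i y" by (rule P.act_m[OF i dc yc, unfolded dy])
    then have "q (\<beta> ?i x) = q (\<beta> ?i ?d \<otimes>\<^bsub>amon P\<^esub> \<beta> ?i y)" by (rule arg_cong)
    also have "\<dots> = q (\<beta> ?i ?d) \<otimes>\<^bsub>amon M\<^esub> q (\<beta> ?i y)"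
      by (rule q.hom_mult[OF P.act_closed[OF i dc] P.act_closed[OF i yc]])
    also have "\<dots> = q (\<beta> ?i y)"
      unfolding 1 by (rule M.l_one[OF q.hom_closed[OF P.act_closed[OF i yc]]])
    finally have "q (\<beta> ?i x) = q (\<beta> ?i y)" .
    then show ?thesis unfolding \<alpha>_def y_def by (rule sym)
  qed
  have qs: "q ` carrier (amon P) = carrier (amon M)" using q_img by simp
  have gM: "gact G n (amon M) \<alpha>"
  proof (rule gact_image[where \<alpha>="\<lambda>g. \<beta> (inv\<^bsub>G\<^esub> g)" and q=q and A="amon P"])
    show "gact G n (amon P) (\<lambda>g. \<beta> (inv\<^bsub>G\<^esub> g))" by (rule gact_inverse[OF P.gact_axioms])
    show "\<alpha> g (q x) = q (\<beta> (inv\<^bsub>G\<^esub> g) x)" if "g \<in> carrier G" "x \<in> carrier (amon P)" for g x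
      using that by (rule \<alpha>q)
  qed (rule q_hom qs Mg)+
  interpret gM: gact G n "amon M" \<alpha> by (rule gM)
  have "r \<odot>\<^bsub>M\<^esub> U = finprod (amon M) (\<lambda>h. \<alpha> h U [^]\<^bsub>amon M\<^esub> zrep n (r h)) {h \<in> carrier G. r h \<noteq> zc n 0}" (is "_ = ?R")
    if r: "r \<in> carrier (RG G n)" and U: "U \<in> carrier M" for r U
  proof -
    let ?a = "antipode (Zmod n) G r"
    have r': "r \<in> carrier (fsg (carrier G) (amon (Zmod n)))" using r by (simp add: RG_def)
    have "?a \<in> carrier (RG G n)" unfolding RG_def
    proof (rule fsgI[where S="(\<lambda>h. inv\<^bsub>G\<^esub> h) ` {h. r h \<noteq> \<one>\<^bsub>amon (Zmod n)\<^esub>}"])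
      fix x assume x: "?a x \<noteq> \<one>\<^bsub>amon (Zmod n)\<^esub>"
      then show xG: "x \<in> carrier G" by (auto simp: antipode_def split: if_splits)
      have "r (inv\<^bsub>G\<^esub> x) \<noteq> \<one>\<^bsub>amon (Zmod n)\<^esub>" using x xG by (simp add: antipode_def)
      moreover have "x = inv\<^bsub>G\<^esub> (inv\<^bsub>G\<^esub> x)" using xG by simp
      ultimately show "x \<in> (\<lambda>h. inv\<^bsub>G\<^esub> h) ` {h. r h \<noteq> \<one>\<^bsub>amon (Zmod n)\<^esub>}" by blast
    qed (use fsg_app[OF r'] fsg_fin[OF r'] in \<open>auto simp: antipode_def zc_zero\<close>)
    note a = this
    \<comment> \<open>Scalar multiplication in the quotient is a union over all \<open>x\<close> in
      the coset \<open>U\<close>. Every \<open>x\<close> contributes the same coset, and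
      \<open>U\<close> is not empty.\<close>
    have "L +>\<^bsub>P\<^esub> (?a \<odot>\<^bsub>P\<^esub> x) = ?R" if xU: "x \<in> U" for x
    proof -
      have qx: "q x = U" by (rule qU[OF U xU])
      have x: "x \<in> carrier P" using L.a_rcosets_carrier U xU by (auto simp: cM)
      have x': "x \<in> carrier (amon P)" using x by simp
      let ?S = "{h \<in> carrier G. r h \<noteq> zc n 0}"
      have Sa: "{h \<in> carrier G. ?a h \<noteq> zc n 0} = (\<lambda>h. inv\<^bsub>G\<^esub> h) ` ?S"
      proof
        show "{h \<in> carrier G. ?a h \<noteq> zc n 0} \<subseteq> (\<lambda>h. inv\<^bsub>G\<^esub> h) ` ?S"
        proof
          fix h assume h: "h \<in> {h \<in> carrier G. ?a h \<noteq> zc n 0}"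
          then have hG: "h \<in> carrier G" and "?a h \<noteq> zc n 0" by simp_all
          then have r0: "r (inv\<^bsub>G\<^esub> h) \<noteq> zc n 0" by (simp only: antipode_def if_True simp_thms)
          show "h \<in> (\<lambda>h. inv\<^bsub>G\<^esub> h) ` ?S"
          proof (rule image_eqI)
            show "h = inv\<^bsub>G\<^esub> (inv\<^bsub>G\<^esub> h)" using hG by simp
            show "inv\<^bsub>G\<^esub> h \<in> ?S" using hG r0 by simp
          qed
        qed
        show "(\<lambda>h. inv\<^bsub>G\<^esub> h) ` ?S \<subseteq> {h \<in> carrier G. ?a h \<noteq> zc n 0}" by (auto simp: antipode_def)
      qed
      have inj: "inj_on (\<lambda>h. inv\<^bsub>G\<^esub> h) ?S" by (rule inj_on_subset[OF P.G.inv_inj]) blast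
      have pc: "\<beta> h x [^]\<^bsub>amon P\<^esub> (z::int) \<in> carrier (amon P)" if "h \<in> carrier G" for h z
        by (rule P.A.int_pow_closed[OF P.act_closed[OF that x']])
      have "q (?a \<odot>\<^bsub>P\<^esub> x) = q (finprod (amon P) (\<lambda>h. \<beta> h x [^]\<^bsub>amon P\<^esub> zrep n (?a h)) ((\<lambda>h. inv\<^bsub>G\<^esub> h) ` ?S))"
        using P a x by (simp add: gmodule_def Sa)
      also have "\<dots> = finprod (amon M) (\<lambda>h. q (\<beta> h x [^]\<^bsub>amon P\<^esub> zrep n (?a h))) ((\<lambda>h. inv\<^bsub>G\<^esub> h) ` ?S)"
        by (rule hom_finprod[OF P.A.comm_group_axioms Mg q_hom]) (use pc in \<open>auto simp del: amon_simps\<close>)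
      also have "\<dots> = finprod (amon M) (\<lambda>h. q (\<beta> (inv\<^bsub>G\<^esub> h) x [^]\<^bsub>amon P\<^esub> zrep n (?a (inv\<^bsub>G\<^esub> h)))) ?S"
        by (rule M.finprod_reindex[OF _ inj]) (use q.hom_closed[OF pc] in \<open>auto simp del: amon_simps\<close>)
      also have "\<dots> = ?R"
      proof (rule M.finprod_cong'[OF refl])
        have "\<alpha> h U [^]\<^bsub>amon M\<^esub> zrep n (r h) \<in> carrier (amon M)" if "h \<in> carrier G" for h
          using gM.act_closed[OF that] U by (intro M.int_pow_closed) simp
        then show "(\<lambda>h. \<alpha> h U [^]\<^bsub>amon M\<^esub> zrep n (r h)) \<in> ?S \<rightarrow> carrier (amon M)" by blast
        fix h assume "h \<in> ?S"
        then have h: "h \<in> carrier G" by simp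
        have "?a (inv\<^bsub>G\<^esub> h) = r h" using h by (simp add: antipode_def)
        then show "q (\<beta> (inv\<^bsub>G\<^esub> h) x [^]\<^bsub>amon P\<^esub> zrep n (?a (inv\<^bsub>G\<^esub> h))) = \<alpha> h U [^]\<^bsub>amon M\<^esub> zrep n (r h)"
          using q.hom_int_pow[OF P.act_closed[OF P.G.inv_closed[OF h] x']] \<alpha>q[OF h x'] by (simp add: qx)
      qed
      finally show ?thesis by (simp add: q_def)
    qed
    then show ?thesis unfolding sM using Unempty[OF U] by blast
  qed
  then have 1: "gmodule G n M \<alpha>" using gM by (simp add: gmodule_def)
  have 2: "q \<in> ehom (carrier G) (amon P) (\<lambda>g. \<beta> (inv\<^bsub>G\<^esub> g)) (amon M) \<alpha>" using q_hom \<alpha>q by (simp add: ehom_def)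
  show thesis
    using that[OF 1] 2 q_img ker unfolding q_def[abs_def] by blast
qed

section \<open>Existence of free resolutions\<close>

text \<open>A self-delimiting code: every letter of the word is preceded by \<open>a\<close>, and
  \<open>b\<close> marks its end, so that the continuation \<open>r\<close> can be
  recovered.\<close>

primrec code1 :: "'x \<Rightarrow> 'x \<Rightarrow> 'x list \<Rightarrow> 'x list \<Rightarrow> 'x list" where
  "code1 a b [] r = b # r"
| "code1 a b (x # xs) r = a # x # code1 a b xs r"

primrec code :: "'x \<Rightarrow> 'x \<Rightarrow> 'x list list \<Rightarrow> 'x list" where
  "code a b [] = []"
| "code a b (xs # xss) = code1 a b xs (code a b xss)"

lemma code1_inj: "a \<noteq> b \<Longrightarrow> code1 a b xs r = code1 a b ys s \<Longrightarrow> xs = ys \<and> r = s"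
proof (induction xs arbitrary: ys)
  case Nil then show ?case by (cases ys) auto
next
  case (Cons x xs) then show ?case by (cases ys) auto
qed

lemma code1_nonempty: "code1 a b ys r \<noteq> []"
  by (cases ys) auto

lemma code_inj: "a \<noteq> b \<Longrightarrow> code a b xss = code a b yss \<Longrightarrow> xss = yss"
proof (induction xss arbitrary: yss)
  case Nil
  then show ?case using code1_nonempty[of a b] by (cases yss) (simp, metis code.simps(1,2))
next
  case IH: (Cons xs xss)
  show ?case
  proof (cases yss)
    case Nil
    then show ?thesis using IH.prems(2) code1_nonempty[of a b xs "code a b xss"] by simp
  next
    case (Cons ys yss')
    then show ?thesis using code1_inj[OF IH.prems(1), of xs "code a b xss" ys "code a b yss'"] IH.prems IH.IH[of yss'] by auto
  qed
qed

text \<open>The elements of a kernel inside a free module index the basis of the next free module,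
  yet all bases have to live in the one list type fixed by \<open>Ext\<close>. Injecting the
  finitely supported functions on that type back into the type makes the iteration possible.\<close>

lemma ex_inj_fin_supp:
  fixes z :: 'r
  shows "\<exists>c :: (('r + 'm) list \<Rightarrow> 'r) \<Rightarrow> ('r + 'm) list. inj_on c {f. finite {x. f x \<noteq> z}}"
proof -
  define l where "l f = (SOME xs. set xs = {x. f x \<noteq> z})" for f :: "('r + 'm) list \<Rightarrow> 'r"
  \<comment> \<open>A point and its value form one list with the value in front, so the tails give
    back the listed support and the heads the values.\<close>
  define e where "e f = map (\<lambda>x. Inl (f x) # x) (l f)" for f :: "('r + 'm) list \<Rightarrow> 'r"
  define c where "c f = code (Inl undefined) (Inr undefined) (e f)" for f :: "('r + 'm) list \<Rightarrow> 'r"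
  have l: "set (l f) = {x. f x \<noteq> z}" if "finite {x. f x \<noteq> z}" for f
    unfolding l_def by (rule someI_ex) (use finite_list[OF that] in blast)
  have "inj_on c {f. finite {x. f x \<noteq> z}}"
  proof (rule inj_onI)
    fix f g assume f: "f \<in> {f. finite {x. f x \<noteq> z}}" and g: "g \<in> {f. finite {x. f x \<noteq> z}}" and "c f = c g"
    then have e: "e f = e g" unfolding c_def by (intro code_inj) auto
    then have "map tl (e f) = map tl (e g)" by simp
    then have lfg: "l f = l g" by (simp add: e_def comp_def)
    have "f x = g x" for x
    proof (cases "x \<in> set (l f)")
      case True
      then show ?thesis using e lfg by (simp add: e_def)
    next
      case False
      have "x \<notin> {x. f x \<noteq> z}" using False l[of f] f by blast
      moreover have "x \<notin> {x. g x \<noteq> z}" using False l[of g] g unfolding lfg by blast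
      ultimately show ?thesis by simp
    qed
    then show "f = g" by blast
  qed
  then show ?thesis by blast
qed

lemma ex_free_cover:
  assumes A: "gact G n A \<alpha>" and K: "subgroup K A" "\<And>g x. g \<in> carrier G \<Longrightarrow> x \<in> K \<Longrightarrow> \<alpha> g x \<in> K" and c: "inj_on c K"
  shows "\<exists>d\<in>ehom (carrier G) (FR G n (c ` K)) (fsh G n) A \<alpha>. d ` carrier (FR G n (c ` K)) = K"
proof -
  interpret gact G n A \<alpha> by fact
  interpret K: subgroup K A by (rule K(1))
  let ?F = "FR G n (c ` K)"
  have inv: "inv_into K c (c k) = k" if "k \<in> K" for k using c that by simp
  have "\<exists>u\<in>ehom (carrier G) ?F (fsh G n) A \<alpha>. \<forall>b\<in>c ` K. \<forall>g\<in>carrier G. u (bas G n b g) = \<alpha> g (inv_into K c b)"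
    by (rule FR_ehom_ext[OF A subset_refl]) (use inv in auto)
  then obtain d where d: "d \<in> ehom (carrier G) ?F (fsh G n) A \<alpha>"
    and db: "\<And>b g. b \<in> c ` K \<Longrightarrow> g \<in> carrier G \<Longrightarrow> d (bas G n b g) = \<alpha> g (inv_into K c b)" by blast
  interpret F: comm_group ?F by (rule comm_group_FR)
  interpret d: group_hom ?F A d using ehom_hom[OF d] by unfold_locales
  have "K \<subseteq> d ` carrier ?F"
  proof
    fix k assume k: "k \<in> K"
    then have "d (bas G n (c k) \<one>\<^bsub>G\<^esub>) = k" using db inv by simp
    then show "k \<in> d ` carrier ?F" using k by (metis G.one_closed bas_closed imageI)
  qed
  moreover have "d v \<in> K" if v: "v \<in> carrier ?F" for v
  proof -
    have "subgroup {v \<in> carrier ?F. d v \<in> K} ?F"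
      by (rule F.subgroupI) (auto intro: exI[of _ "\<one>\<^bsub>?F\<^esub>"])
    moreover have "bas G n b g \<in> {v \<in> carrier ?F. d v \<in> K}" if b: "b \<in> c ` K" and g: "g \<in> carrier G" for b g
    proof -
      obtain k where "k \<in> K" "b = c k" using b by blast
      then show ?thesis using db[OF b g] inv K(2)[OF g] b g by simp
    qed
    ultimately have "v \<in> {v \<in> carrier ?F. d v \<in> K}" by (rule FR_induct[OF _ _ v])
    then show ?thesis by simp
  qed
  ultimately show ?thesis using d by blast
qed

lemma ehom_kernel:
  assumes A: "gact G n A \<alpha>" and B: "gact G n B \<beta>" and d: "d \<in> ehom (carrier G) A \<alpha> B \<beta>"
  shows "subgroup {x \<in> carrier A. d x = \<one>\<^bsub>B\<^esub>} A"
    and "g \<in> carrier G \<Longrightarrow> x \<in> {x \<in> carrier A. d x = \<one>\<^bsub>B\<^esub>} \<Longrightarrow> \<alpha> g x \<in> {x \<in> carrier A. d x = \<one>\<^bsub>B\<^esub>}"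
proof -
  interpret A: gact G n A \<alpha> by fact
  interpret B: gact G n B \<beta> by fact
  interpret d: group_hom A B d using ehom_hom[OF d] by unfold_locales
  show "subgroup {x \<in> carrier A. d x = \<one>\<^bsub>B\<^esub>} A"
    by (rule A.A.subgroupI) (auto intro: exI[of _ "\<one>\<^bsub>A\<^esub>"])
  show "g \<in> carrier G \<Longrightarrow> x \<in> {x \<in> carrier A. d x = \<one>\<^bsub>B\<^esub>} \<Longrightarrow> \<alpha> g x \<in> {x \<in> carrier A. d x = \<one>\<^bsub>B\<^esub>}"
    using ehom_eq[OF d] by simp
qed

lemma free_resolution_iff:
  assumes G: "comm_group G" and M: "gmodule G n M \<alpha>"
  shows "free_resolution (group_ring (Zmod n) G) M (B, d, e) \<longleftrightarrow>
    e \<in> ehom (carrier G) (FR G n (B 0)) (fsh G n) (amon M) \<alpha> \<and> e ` carrier (FR G n (B 0)) = carrier M \<and>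
    (\<forall>k. d k \<in> ehom (carrier G) (FR G n (B (Suc k))) (fsh G n) (FR G n (B k)) (fsh G n)) \<and>
    d 0 ` carrier (FR G n (B 1)) = {x \<in> carrier (FR G n (B 0)). e x = \<one>\<^bsub>amon M\<^esub>} \<and>
    (\<forall>k. d (Suc k) ` carrier (FR G n (B (Suc (Suc k)))) = {x \<in> carrier (FR G n (B (Suc k))). d k x = \<one>\<^bsub>FR G n (B k)\<^esub>})"
proof -
  let ?R = "group_ring (Zmod n) G"
  have k: "a_kernel A C f = {x \<in> carrier A. f x = \<zero>\<^bsub>C\<^esub>}" for A C f
    by (simp add: a_kernel_def')
  show ?thesis
    by (simp add: free_resolution_def Let_def module_hom_eq_ehom[OF gmodule_free[OF G] M]
      module_hom_eq_ehom[OF gmodule_free[OF G] gmodule_free[OF G]] amon_free_module carrier_free_module k zero_free_module)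
qed

text \<open>\<open>Ext\<close> picks some resolution with bases in a prescribed type; only if one
  exists is the picked object known to be a resolution.\<close>

lemma ex_free_resolution:
  fixes M :: "('g \<Rightarrow> int set, 'm) module"
  assumes G: "comm_group G" and M: "gmodule G n M \<alpha>"
  shows "\<exists>F :: (nat \<Rightarrow> (('g \<Rightarrow> int set) + 'm) list set) \<times> _ \<times> _. free_resolution (group_ring (Zmod n) G) M F"
proof -
  interpret M: gact G n "amon M" \<alpha> using M by (simp add: gmodule_def)
  have "\<exists>c :: ((('g \<Rightarrow> int set) + 'm) list \<Rightarrow> ('g \<Rightarrow> int set)) \<Rightarrow> (('g \<Rightarrow> int set) + 'm) list.
      inj_on c {f. finite {x. f x \<noteq> \<one>\<^bsub>RG G n\<^esub>}}" by (rule ex_inj_fin_supp)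
  then obtain c :: "((('g \<Rightarrow> int set) + 'm) list \<Rightarrow> ('g \<Rightarrow> int set)) \<Rightarrow> (('g \<Rightarrow> int set) + 'm) list"
    where c: "inj_on c {f. finite {x. f x \<noteq> \<one>\<^bsub>RG G n\<^esub>}}" ..
  have cF: "inj_on c (carrier (FR G n B))" for B
    by (rule inj_on_subset[OF c]) (auto simp: FR_def fsg_def)
  let ?F = "\<lambda>B :: (('g \<Rightarrow> int set) + 'm) list set. FR G n B"
  \<comment> \<open>The elements of \<open>M\<close> enter the basis type as lists of length one;
    all later bases are coded by \<open>c\<close>.\<close>
  define B0 :: "(('g \<Rightarrow> int set) + 'm) list set" where "B0 = (\<lambda>m. [Inr m]) ` carrier (amon M)"
  have "\<exists>e\<in>ehom (carrier G) (?F B0) (fsh G n) (amon M) \<alpha>. e ` carrier (?F B0) = carrier (amon M)"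
    unfolding B0_def
    by (rule ex_free_cover[OF M.gact_axioms]) (auto simp: M.A.subgroup_self inj_on_def simp del: amon_simps)
  then obtain e where e: "e \<in> ehom (carrier G) (?F B0) (fsh G n) (amon M) \<alpha>" "e ` carrier (?F B0) = carrier (amon M)" by blast
  define good where "good s \<longleftrightarrow> subgroup (snd s) (?F (fst s)) \<and> (\<forall>g\<in>carrier G. \<forall>x\<in>snd s. fsh G n g x \<in> snd s)" for s
  define step where "step s s' \<longleftrightarrow> (\<exists>d\<in>ehom (carrier G) (?F (fst s')) (fsh G n) (?F (fst s)) (fsh G n).
      d ` carrier (?F (fst s')) = snd s \<and> snd s' = {x \<in> carrier (?F (fst s')). d x = \<one>\<^bsub>?F (fst s)\<^esub>})" for s s'
  define s0 where "s0 = (B0, {x \<in> carrier (?F B0). e x = \<one>\<^bsub>amon M\<^esub>})"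
  have F: "gact G n (?F B) (fsh G n)" for B by (rule gact_FR[OF G])
  \<comment> \<open>A state of the recursion is a basis together with the submodule of its free
    module that the next map has to cover.\<close>
  have "\<exists>s. \<forall>k. ((k = 0 \<longrightarrow> s k = s0) \<and> good (s k)) \<and> step (s k) (s (Suc k))"
  proof (rule dependent_nat_choice[where P="\<lambda>(k::nat) x. (k = 0 \<longrightarrow> x = s0) \<and> good x" and Q="\<lambda>_. step"])
      have "good s0" using ehom_kernel[OF F M.gact_axioms e(1)] unfolding good_def s0_def by simp
      then show "\<exists>x. (0 = (0::nat) \<longrightarrow> x = s0) \<and> good x" by simp
      fix s and k :: nat assume "(k = 0 \<longrightarrow> s = s0) \<and> good s"
      then have K: "subgroup (snd s) (?F (fst s))" "\<And>g x. g \<in> carrier G \<Longrightarrow> x \<in> snd s \<Longrightarrow> fsh G n g x \<in> snd s"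
        by (auto simp: good_def)
      have "inj_on c (snd s)" by (rule inj_on_subset[OF cF subgroup.subset[OF K(1)]])
      from ex_free_cover[OF F K this] obtain d where
        d: "d \<in> ehom (carrier G) (?F (c ` snd s)) (fsh G n) (?F (fst s)) (fsh G n)" "d ` carrier (?F (c ` snd s)) = snd s" by blast
      define s' where "s' = (c ` snd s, {x \<in> carrier (?F (c ` snd s)). d x = \<one>\<^bsub>?F (fst s)\<^esub>})"
      have "good s'" using ehom_kernel[OF F F d(1)] unfolding good_def s'_def by simp
      moreover have "step s s'" unfolding step_def s'_def fst_conv snd_conv using d(2) by (intro bexI[OF _ d(1)]) simp
      ultimately show "\<exists>y. ((Suc k = 0 \<longrightarrow> y = s0) \<and> good y) \<and> step s y" by (intro exI[of _ s']) simp
  qed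
  then obtain s where s: "\<forall>k. ((k = 0 \<longrightarrow> s k = s0) \<and> good (s k)) \<and> step (s k) (s (Suc k))" ..
  then have s0: "s 0 = s0" and st: "\<And>k. step (s k) (s (Suc k))" by simp_all
  define B where "B k = fst (s k)" for k
  have "\<forall>k. \<exists>d. d \<in> ehom (carrier G) (?F (B (Suc k))) (fsh G n) (?F (B k)) (fsh G n) \<and>
      d ` carrier (?F (B (Suc k))) = snd (s k) \<and> snd (s (Suc k)) = {x \<in> carrier (?F (B (Suc k))). d x = \<one>\<^bsub>?F (B k)\<^esub>}"
  proof
    fix k
    from st[of k] show "\<exists>d. d \<in> ehom (carrier G) (?F (B (Suc k))) (fsh G n) (?F (B k)) (fsh G n) \<and>
      d ` carrier (?F (B (Suc k))) = snd (s k) \<and> snd (s (Suc k)) = {x \<in> carrier (?F (B (Suc k))). d x = \<one>\<^bsub>?F (B k)\<^esub>}"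
      unfolding step_def B_def by (elim bexE conjE) (intro exI conjI)
  qed
  from choice[OF this] obtain d where d: "\<forall>k. d k \<in> ehom (carrier G) (?F (B (Suc k))) (fsh G n) (?F (B k)) (fsh G n) \<and>
      d k ` carrier (?F (B (Suc k))) = snd (s k) \<and> snd (s (Suc k)) = {x \<in> carrier (?F (B (Suc k))). d k x = \<one>\<^bsub>?F (B k)\<^esub>}" ..
  have B0: "B 0 = B0" by (simp add: B_def s0 s0_def)
  have "free_resolution (group_ring (Zmod n) G) M (B, d, e)"
    unfolding free_resolution_iff[OF G M]
  proof (intro conjI allI)
    show "d 0 ` carrier (?F (B 1)) = {x \<in> carrier (?F (B 0)). e x = \<one>\<^bsub>amon M\<^esub>}"
      using d[rule_format, of 0] unfolding s0 B0 by (simp add: s0_def)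
    show "d (Suc k) ` carrier (?F (B (Suc (Suc k)))) = {x \<in> carrier (?F (B (Suc k))). d k x = \<one>\<^bsub>?F (B k)\<^esub>}" for k
      using d[rule_format, of k] d[rule_format, of "Suc k"] by simp
  qed (use e d in \<open>simp_all add: B0\<close>)
  then show ?thesis by blast
qed

text \<open>The hypothesis \<open>prim\<close> ranges over all resolutions because the one chosen in
  \<open>Ext\<close> is known only to be a resolution. Once every cocycle is a coboundary, all
  cosets coincide with the group of coboundaries, which is the zero of the quotient.\<close>

lemma Ext_trivial:
  fixes M :: "('g \<Rightarrow> int set, 'm) module"
  assumes G: "comm_group G" and M: "gmodule G n M \<alpha>"
    and prim: "\<And>(B :: nat \<Rightarrow> (('g \<Rightarrow> int set) + 'm) list set) d e f. free_resolution (group_ring (Zmod n) G) M (B, d, e) \<Longrightarrow>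
      f \<in> ehom (carrier G) (FR G n (B (Suc k))) (fsh G n) (RG G n) (rsh G n) \<Longrightarrow>
      (\<And>x. x \<in> carrier (FR G n (B (Suc (Suc k)))) \<Longrightarrow> f (d (Suc k) x) = \<one>\<^bsub>RG G n\<^esub>) \<Longrightarrow>
      \<exists>g\<in>ehom (carrier G) (FR G n (B k)) (fsh G n) (RG G n) (rsh G n). \<forall>x\<in>carrier (FR G n (B (Suc k))). f x = g (d k x)"
  defines "E \<equiv> Ext (group_ring (Zmod n) G) (Suc k) M (ring_module (group_ring (Zmod n) G))"
  shows "carrier E = {\<zero>\<^bsub>E\<^esub>}"
proof -
  let ?R = "group_ring (Zmod n) G"
  let ?N = "ring_module ?R"
  obtain B :: "nat \<Rightarrow> (('g \<Rightarrow> int set) + 'm) list set" and d e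
    where F: "(SOME F. free_resolution ?R M F) = (B, d, e)" and res: "free_resolution ?R M (B, d, e)"
    using someI_ex[OF ex_free_resolution[OF G M]] by (metis prod_cases3)
  interpret N: gact G n "RG G n" "rsh G n" by (rule gact_RG[OF G])
  let ?F = "\<lambda>k. FR G n (B k)"
  have dk: "d k \<in> ehom (carrier G) (?F (Suc k)) (fsh G n) (?F k) (fsh G n)" for k
    using res unfolding free_resolution_iff[OF G M] by blast
  have dd: "d j (d (Suc j) x) = \<one>\<^bsub>?F j\<^esub>" if "x \<in> carrier (?F (Suc (Suc j)))" for j x
    using res that unfolding free_resolution_iff[OF G M] by blast
  note c = carrier_free_module
  have aN: "amon ?N = RG G n" by (simp add: amon_ring_module amon_group_ring)
  have addN: "add ?N = monoid.mult (RG G n)" using aN by (metis amon_simps(2))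
  have zN: "\<zero>\<^bsub>?N\<^esub> = \<one>\<^bsub>RG G n\<^esub>" using aN by (metis amon_simps(3))
  have H: "carrier (Hom_module ?R (free_module ?R C) ?N) =
      ehom (carrier G) (FR G n C) (fsh G n) (RG G n) (rsh G n) \<inter> extensional (carrier (FR G n C))"
    for C :: "(('g \<Rightarrow> int set) + 'm) list set"
    by (simp add: Hom_module_def c module_hom_eq_ehom[OF gmodule_free[OF G] gmodule_ring[OF G]] amon_free_module aN)
  let ?Z = "cocycles ?R ?N B d (Suc k)" and ?B = "coboundaries ?R ?N B d (Suc k)"
  let ?H = "Hom_module ?R (free_module ?R (B (Suc k))) ?N"
  let ?Hk = "ehom (carrier G) (?F k) (fsh G n) (RG G n) (rsh G n)"
  have B: "?B = (\<lambda>g. \<lambda>x\<in>carrier (?F (Suc k)). g (d k x)) ` (?Hk \<inter> extensional (carrier (?F k)))"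
    by (simp add: coboundaries_def c H)
  \<comment> \<open>Elements of \<open>Hom_module\<close> are extensional, while \<open>ehom\<close>
    leaves values off the carrier free; restricting \<open>g\<close> does not change its
    coboundary.\<close>
  have Bi: "(\<lambda>x\<in>carrier (?F (Suc k)). g (d k x)) \<in> ?B" if g: "g \<in> ?Hk" for g
  proof -
    let ?g = "restrict g (carrier (?F k))"
    interpret F: gact G n "?F k" "fsh G n" by (rule gact_FR[OF G])
    have "?g \<in> ?Hk" using g unfolding ehom_def by (auto simp: hom_def Pi_iff)
    then have g1: "?g \<in> ?Hk \<inter> extensional (carrier (?F k))" by simp
    have g2: "(\<lambda>x\<in>carrier (?F (Suc k)). ?g (d k x)) = (\<lambda>x\<in>carrier (?F (Suc k)). g (d k x))"
      using ehom_closed[OF dk] by (auto simp: fun_eq_iff restrict_def)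
    from imageI[OF g1, of "\<lambda>g. \<lambda>x\<in>carrier (?F (Suc k)). g (d k x)"] show ?thesis unfolding B g2 .
  qed
  have addH: "f \<oplus>\<^bsub>?H\<^esub> g = (\<lambda>x\<in>carrier (?F (Suc k)). f x \<otimes>\<^bsub>RG G n\<^esub> g x)" for f g
    by (simp add: Hom_module_def c addN)
  have ZB: "?Z \<subseteq> ?B"
  proof
    fix f assume "f \<in> ?Z"
    then have f: "f \<in> ehom (carrier G) (?F (Suc k)) (fsh G n) (RG G n) (rsh G n)" "f \<in> extensional (carrier (?F (Suc k)))"
      "\<And>x. x \<in> carrier (?F (Suc (Suc k))) \<Longrightarrow> f (d (Suc k) x) = \<one>\<^bsub>RG G n\<^esub>"
      by (auto simp: cocycles_def c H zN)
    obtain g where g: "g \<in> ?Hk" "\<forall>x\<in>carrier (?F (Suc k)). f x = g (d k x)" using prim[OF res f(1,3)] by blast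
    have "f = (\<lambda>x\<in>carrier (?F (Suc k)). g (d k x))" using g(2) f(2) by (auto simp: fun_eq_iff extensional_def restrict_def)
    then show "f \<in> ?B" using Bi[OF g(1)] by simp
  qed
  have coset: "(\<Union>h\<in>?B. {h \<oplus>\<^bsub>?H\<^esub> f}) = ?B" if f: "f \<in> ?B" for f
  proof -
    obtain g0 where g0: "g0 \<in> ?Hk" "f = (\<lambda>x\<in>carrier (?F (Suc k)). g0 (d k x))" using f unfolding B by blast
    have dc: "d k x \<in> carrier (?F k)" if "x \<in> carrier (?F (Suc k))" for x using ehom_closed[OF dk that] .
    have mult: "(\<lambda>x. g x \<otimes>\<^bsub>RG G n\<^esub> g' x) \<in> ?Hk" if "g \<in> ?Hk" "g' \<in> ?Hk" for g g'
      using hom_mult_fun[OF N.A.comm_group_axioms ehom_hom[OF that(1)] ehom_hom[OF that(2)]]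
        ehom_eq[OF that(1)] ehom_eq[OF that(2)] ehom_closed[OF that(1)] ehom_closed[OF that(2)]
      by (simp add: ehom_def N.act_m)
    have inv: "(\<lambda>x. inv\<^bsub>RG G n\<^esub> (g x)) \<in> ?Hk" if "g \<in> ?Hk" for g
      using hom_inv_fun[OF N.A.comm_group_axioms ehom_hom[OF that]] ehom_eq[OF that] ehom_closed[OF that]
      by (simp add: ehom_def N.act_inv)
    show ?thesis
    proof
      show "(\<Union>h\<in>?B. {h \<oplus>\<^bsub>?H\<^esub> f}) \<subseteq> ?B"
      proof
        fix y assume "y \<in> (\<Union>h\<in>?B. {h \<oplus>\<^bsub>?H\<^esub> f})"
        then obtain h where h: "h \<in> ?B" "y = h \<oplus>\<^bsub>?H\<^esub> f" by blast
        then obtain g where g: "g \<in> ?Hk" "h = (\<lambda>x\<in>carrier (?F (Suc k)). g (d k x))" unfolding B by blast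
        have "y = (\<lambda>x\<in>carrier (?F (Suc k)). (\<lambda>z. g z \<otimes>\<^bsub>RG G n\<^esub> g0 z) (d k x))"
          unfolding h(2) addH g(2) g0(2) by (auto simp: fun_eq_iff)
        then show "y \<in> ?B" using Bi[OF mult[OF g(1) g0(1)]] by simp
      qed
      show "?B \<subseteq> (\<Union>h\<in>?B. {h \<oplus>\<^bsub>?H\<^esub> f})"
      proof
        fix y assume "y \<in> ?B"
        then obtain g where g: "g \<in> ?Hk" "y = (\<lambda>x\<in>carrier (?F (Suc k)). g (d k x))" unfolding B by blast
        define h where "h = (\<lambda>x\<in>carrier (?F (Suc k)). (\<lambda>z. g z \<otimes>\<^bsub>RG G n\<^esub> inv\<^bsub>RG G n\<^esub> (g0 z)) (d k x))"
        have "h \<in> ?B" unfolding h_def by (rule Bi[OF mult[OF g(1) inv[OF g0(1)]]])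
        moreover have "h \<oplus>\<^bsub>?H\<^esub> f = y"
          unfolding addH g(2) g0(2) h_def using ehom_closed[OF g(1) dc] ehom_closed[OF g0(1) dc]
          by (auto simp: fun_eq_iff N.A.m_assoc)
        ultimately show "y \<in> (\<Union>h\<in>?B. {h \<oplus>\<^bsub>?H\<^esub> f})" by blast
      qed
    qed
  qed
  have one: "(\<lambda>x\<in>carrier (?F (Suc k)). \<one>\<^bsub>RG G n\<^esub>) \<in> ?Z"
  proof -
    have "(\<lambda>x\<in>carrier (?F (Suc k)). \<one>\<^bsub>RG G n\<^esub>) \<in> ehom (carrier G) (?F (Suc k)) (fsh G n) (RG G n) (rsh G n)"
    proof -
      interpret F: gact G n "?F (Suc k)" "fsh G n" by (rule gact_FR[OF G])
      show ?thesis by (auto simp: ehom_def hom_def)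
    qed
    then show ?thesis using ehom_closed[OF dk] by (simp add: cocycles_def c H zN)
  qed
  have Edef: "E = quotient_module (?H\<lparr>carrier := ?Z\<rparr>) ?B"
    by (simp add: E_def Ext_def F)
  have "carrier E = (\<lambda>f. \<Union>h\<in>?B. {h \<oplus>\<^bsub>?H\<^esub> f}) ` ?Z"
    unfolding Edef by (auto simp: quotient_module_def A_RCOSETS_def' a_r_coset_def')
  also have "\<dots> = {?B}" using coset ZB one by (auto intro!: image_eqI[OF _ one])
  also have "?B = \<zero>\<^bsub>E\<^esub>" by (simp add: Edef quotient_module_def)
  finally show ?thesis .
qed

section \<open>Stacked stabilizer modules\<close>

lemma fsg_hom_eq:
  assumes "comm_group A" "comm_group B" "f \<in> hom (fsg J A) B" "f' \<in> hom (fsg J A) B"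
    "\<And>x a. x \<in> J \<Longrightarrow> a \<in> carrier A \<Longrightarrow> f (sng A x a) = f' (sng A x a)"
    and "v \<in> carrier (fsg J A)"
  shows "f v = f' v"
proof -
  have "v \<in> {v \<in> carrier (fsg J A). f v = f' v}"
    by (rule fsg_induct[OF assms(1) hom_equalizer[OF fsg_comm_group[OF assms(1)] assms(2-4)] _ assms(6)])
      (use assms(1,5) in auto)
  then show ?thesis by simp
qed

lemma RG_hom_eq:
  assumes B: "comm_group B" and f: "f \<in> hom (RG G n) B" "f' \<in> hom (RG G n) B"
    and eq: "\<And>g. g \<in> carrier G \<Longrightarrow> f (sng (amon (Zmod n)) g (zc n 1)) = f' (sng (amon (Zmod n)) g (zc n 1))"
    and v: "v \<in> carrier (RG G n)"
  shows "f v = f' v"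
proof -
  let ?K = "amon (Zmod n)"
  have f': "f \<in> hom (fsg (carrier G) ?K) B" "f' \<in> hom (fsg (carrier G) ?K) B" using f by (simp_all add: RG_def)
  show ?thesis
  proof (rule fsg_hom_eq[OF comm_group_Zmod B f' _ v[unfolded RG_def]])
    fix g z assume g: "g \<in> carrier G" and z: "z \<in> carrier ?K"
    have s: "sng ?K g \<in> hom ?K (fsg (carrier G) ?K)" by (rule sng_hom[OF comm_group_Zmod g])
    have gh: "group_hom ?K B (\<lambda>z. h (sng ?K g z))" if "h \<in> hom (fsg (carrier G) ?K) B" for h
      using hom_comp_fun[OF s that] B comm_group_Zmod
      by (simp add: group_hom_def group_hom_axioms_def comm_group.axioms)
    have "zc n (zrep n z) = z" using z by (simp add: zc_zrep)
    then have zz: "z = zc n 1 [^]\<^bsub>?K\<^esub> zrep n z" by (simp add: zc_pow)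
    have hz: "h (sng ?K g z) = h (sng ?K g (zc n 1)) [^]\<^bsub>B\<^esub> zrep n z" if "h \<in> hom (fsg (carrier G) ?K) B" for h
      using group_hom.hom_int_pow[OF gh[OF that], of "zc n 1" "zrep n z"] zz by simp
    show "f (sng ?K g z) = f' (sng ?K g z)" using hz[OF f'(1)] hz[OF f'(2)] eq[OF g] by simp
  qed
qed

lemma gmodule_smult_hom:
  assumes M: "gmodule G n M \<alpha>"
  shows "r \<in> carrier (RG G n) \<Longrightarrow> (\<lambda>v. r \<odot>\<^bsub>M\<^esub> v) \<in> hom (amon M) (amon M)"
    and "v \<in> carrier M \<Longrightarrow> (\<lambda>r. r \<odot>\<^bsub>M\<^esub> v) \<in> hom (RG G n) (amon M)"
proof -
  interpret gact G n "amon M" \<alpha> using M by (simp add: gmodule_def)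
  let ?K = "amon (Zmod n)"
  have eq: "r \<odot>\<^bsub>M\<^esub> v = finprod (amon M) (\<lambda>h. \<alpha> h v [^]\<^bsub>amon M\<^esub> zrep n (r h)) {h. r h \<noteq> \<one>\<^bsub>?K\<^esub>}"
    if r: "r \<in> carrier (RG G n)" and v: "v \<in> carrier (amon M)" for r v
  proof -
    have "{h \<in> carrier G. r h \<noteq> zc n 0} = {h. r h \<noteq> \<one>\<^bsub>?K\<^esub>}"
      using fsg_out[OF r[unfolded RG_def]] by (auto simp: zc_zero)
    then show ?thesis using M r v by (simp add: gmodule_def)
  qed
  have c: "\<alpha> h v [^]\<^bsub>amon M\<^esub> (k::int) \<in> carrier (amon M)" if "h \<in> carrier G" "v \<in> carrier (amon M)" for h v k
    by (rule A.int_pow_closed[OF act_closed[OF that]])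
  { assume v: "v \<in> carrier M"
    then have v': "v \<in> carrier (amon M)" by simp
    have "(\<lambda>r. finprod (amon M) (\<lambda>h. \<alpha> h v [^]\<^bsub>amon M\<^esub> zrep n (r h)) {h. r h \<noteq> \<one>\<^bsub>?K\<^esub>}) \<in> hom (RG G n) (amon M)"
      unfolding RG_def
      by (rule fsg_ext_explicit(1)[OF comm_group_Zmod A.comm_group_axioms, where \<phi>="\<lambda>h z. \<alpha> h v [^]\<^bsub>amon M\<^esub> zrep n z"])
        (rule zmod_ext[OF A.comm_group_axioms act_closed[OF _ v'] torsion[OF act_closed[OF _ v']]])
    moreover have "monoid.mult (RG G n) r s \<in> carrier (RG G n)" if "r \<in> carrier (RG G n)" "s \<in> carrier (RG G n)" for r s
      using comm_groupE(1)[OF comm_group_RG] that by blast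
    ultimately show "(\<lambda>r. r \<odot>\<^bsub>M\<^esub> v) \<in> hom (RG G n) (amon M)"
      using eq[OF _ v'] unfolding hom_def by (simp add: Pi_iff) }
  { assume r: "r \<in> carrier (RG G n)"
    let ?S = "{h. r h \<noteq> \<one>\<^bsub>?K\<^esub>}"
    have SG: "?S \<subseteq> carrier G" using fsg_out[OF r[unfolded RG_def]] by blast
    show "(\<lambda>v. r \<odot>\<^bsub>M\<^esub> v) \<in> hom (amon M) (amon M)"
    proof (rule homI)
      fix v assume v: "v \<in> carrier (amon M)"
      show "r \<odot>\<^bsub>M\<^esub> v \<in> carrier (amon M)" unfolding eq[OF r v]
        by (rule A.finprod_closed) (use c[OF _ v] SG in blast)
      fix w assume w: "w \<in> carrier (amon M)"
      have "r \<odot>\<^bsub>M\<^esub> (v \<otimes>\<^bsub>amon M\<^esub> w) = finprod (amon M) (\<lambda>h. \<alpha> h v [^]\<^bsub>amon M\<^esub> zrep n (r h) \<otimes>\<^bsub>amon M\<^esub> \<alpha> h w [^]\<^bsub>amon M\<^esub> zrep n (r h)) ?S"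
        unfolding eq[OF r A.m_closed[OF v w]]
      proof (rule A.finprod_cong'[OF refl])
        show "(\<lambda>h. \<alpha> h v [^]\<^bsub>amon M\<^esub> zrep n (r h) \<otimes>\<^bsub>amon M\<^esub> \<alpha> h w [^]\<^bsub>amon M\<^esub> zrep n (r h)) \<in> ?S \<rightarrow> carrier (amon M)"
          using c[OF _ v] c[OF _ w] SG by (intro Pi_I A.m_closed) blast+
        fix h assume "h \<in> ?S"
        then have h: "h \<in> carrier G" using SG by blast
        show "\<alpha> h (v \<otimes>\<^bsub>amon M\<^esub> w) [^]\<^bsub>amon M\<^esub> zrep n (r h) = \<alpha> h v [^]\<^bsub>amon M\<^esub> zrep n (r h) \<otimes>\<^bsub>amon M\<^esub> \<alpha> h w [^]\<^bsub>amon M\<^esub> zrep n (r h)"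
          unfolding act_m[OF h v w] by (rule A.int_pow_distrib[OF act_closed[OF h v] act_closed[OF h w]])
      qed
      also have "\<dots> = (r \<odot>\<^bsub>M\<^esub> v) \<otimes>\<^bsub>amon M\<^esub> (r \<odot>\<^bsub>M\<^esub> w)"
        unfolding eq[OF r v] eq[OF r w]
        by (rule A.finprod_multf) (use c[OF _ v] c[OF _ w] SG in blast)+
      finally show "r \<odot>\<^bsub>M\<^esub> (v \<otimes>\<^bsub>amon M\<^esub> w) = (r \<odot>\<^bsub>M\<^esub> v) \<otimes>\<^bsub>amon M\<^esub> (r \<odot>\<^bsub>M\<^esub> w)" .
    qed }
qed

text \<open>By commutativity a monomial can be moved from the scalar to the vector. This is what the
  balancing relation of the tensor product needs for monomials.\<close>

lemma gmodule_smult_shift: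
  assumes M: "gmodule G n M \<alpha>" and g: "g \<in> carrier G" and r: "r \<in> carrier (RG G n)" and v: "v \<in> carrier M"
  shows "rsh G n g r \<odot>\<^bsub>M\<^esub> v = r \<odot>\<^bsub>M\<^esub> \<alpha> g v"
proof -
  interpret gact G n "amon M" \<alpha> using M by (simp add: gmodule_def)
  interpret R: gact G n "RG G n" "rsh G n" by (rule gact_RG[OF G.comm_group_axioms])
  have gv: "\<alpha> g v \<in> carrier M" using act_closed[OF g, of v] v by simp
  show ?thesis
  proof (rule RG_hom_eq[OF A.comm_group_axioms _ _ _ r])
    show "(\<lambda>r. rsh G n g r \<odot>\<^bsub>M\<^esub> v) \<in> hom (RG G n) (amon M)"
      by (rule hom_comp_fun[OF R.act_hom[OF g] gmodule_smult_hom(2)[OF M v]])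
    show "(\<lambda>r. r \<odot>\<^bsub>M\<^esub> \<alpha> g v) \<in> hom (RG G n) (amon M)" by (rule gmodule_smult_hom(2)[OF M gv])
    fix h assume h: "h \<in> carrier G"
    have "rsh G n g (sng (amon (Zmod n)) h (zc n 1)) = sng (amon (Zmod n)) (g \<otimes>\<^bsub>G\<^esub> h) (zc n 1)"
      unfolding rsh_def by (rule shift_sng[OF G.comm_group_axioms g h])
    then have "rsh G n g (sng (amon (Zmod n)) h (zc n 1)) \<odot>\<^bsub>M\<^esub> v = \<alpha> (h \<otimes>\<^bsub>G\<^esub> g) v"
      using gmodule_monomial(2)[OF M _ v, of "g \<otimes>\<^bsub>G\<^esub> h"] g h by (simp add: G.m_comm)
    also have "\<dots> = \<alpha> h (\<alpha> g v)" using act_mult[OF h g] v by simp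
    also have "\<dots> = sng (amon (Zmod n)) h (zc n 1) \<odot>\<^bsub>M\<^esub> \<alpha> g v" using gmodule_monomial(2)[OF M h gv] by simp
    finally show "rsh G n g (sng (amon (Zmod n)) h (zc n 1)) \<odot>\<^bsub>M\<^esub> v = sng (amon (Zmod n)) h (zc n 1) \<odot>\<^bsub>M\<^esub> \<alpha> g v" .
  qed
qed

lemma gmodule_submodule:
  assumes M: "gmodule G n M \<alpha>" and L: "submodule L (group_ring (Zmod n) G) M"
  shows "subgroup L (amon M)" and "g \<in> carrier G \<Longrightarrow> \<alpha> g ` L \<subseteq> L"
proof -
  show s: "subgroup L (amon M)" using submodule.axioms(1)[OF L] by (simp add: subgroup_amon)
  show "\<alpha> g ` L \<subseteq> L" if g: "g \<in> carrier G"
  proof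
    fix y assume "y \<in> \<alpha> g ` L"
    then obtain x where x: "x \<in> L" "y = \<alpha> g x" by blast
    have xM: "x \<in> carrier M" using subgroup.mem_carrier[OF s x(1)] by simp
    show "y \<in> L" using submodule.smult_closed[OF L, of "sng (amon (Zmod n)) g (zc n 1)" x] x gmodule_monomial[OF M g xM]
      by (simp add: carrier_group_ring)
  qed
qed

section \<open>Extension by zero along an injective group homomorphism\<close>

locale stacking = S: comm_group S + G: comm_group G for S :: "'l monoid" and G :: "'g monoid" +
  fixes \<iota> :: "'l \<Rightarrow> 'g"
  assumes hom: "\<iota> \<in> hom S G" and inj: "inj_on \<iota> (carrier S)"
begin

sublocale i: group_hom S G \<iota> using hom by unfold_locales

text \<open>\<open>push\<close> sums over the fibres of \<open>\<iota>\<close>; injectivity leaves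
  at most one term, so it is extension by zero.\<close>

lemma push_eq:
  assumes M: "comm_group (amon M)" and f: "f \<in> carrier (fsg (carrier S) (amon M))"
  shows "push M S \<iota> f h = (if h \<in> \<iota> ` carrier S then f (inv_into (carrier S) \<iota> h) else \<zero>\<^bsub>M\<^esub>)"
proof -
  interpret M: comm_group "amon M" by (rule M)
  show ?thesis
  proof (cases "h \<in> \<iota> ` carrier S")
    case True
    then obtain g where g: "g \<in> carrier S" "h = \<iota> g" by blast
    have gi: "inv_into (carrier S) \<iota> h = g" using g inj by simp
    have iff: "\<iota> k = h \<longleftrightarrow> k = g" if "k \<in> carrier S" for k using g inj that by (auto dest: inj_onD)
    show ?thesis
    proof (cases "f g = \<zero>\<^bsub>M\<^esub>")
      case z: True
      then have E: "{k \<in> carrier S. f k \<noteq> \<zero>\<^bsub>M\<^esub> \<and> \<iota> k = h} = {}" using iff by auto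
      have "push M S \<iota> f h = \<zero>\<^bsub>M\<^esub>" unfolding push_def finsum_amon E by simp
      then show ?thesis using True gi z by simp
    next
      case False
      then have E: "{k \<in> carrier S. f k \<noteq> \<zero>\<^bsub>M\<^esub> \<and> \<iota> k = h} = {g}" using iff g by auto
      have "push M S \<iota> f h = f g" unfolding push_def finsum_amon E
        by (rule finprod_single[where f=f, OF M.comm_monoid_axioms fsg_app[OF f]])
      then show ?thesis using True gi by simp
    qed
  next
    case False
    then have E: "{k \<in> carrier S. f k \<noteq> \<zero>\<^bsub>M\<^esub> \<and> \<iota> k = h} = {}" by auto
    have "push M S \<iota> f h = \<zero>\<^bsub>M\<^esub>" unfolding push_def finsum_amon E by simp
    then show ?thesis using False by simp
  qed
qed

lemma push_app:
  assumes "comm_group (amon M)" "f \<in> carrier (fsg (carrier S) (amon M))" "g \<in> carrier S"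
  shows "push M S \<iota> f (\<iota> g) = f g"
  using push_eq[OF assms(1,2)] assms(3) inj by simp

lemma push_out:
  assumes "comm_group (amon M)" "f \<in> carrier (fsg (carrier S) (amon M))" "h \<notin> \<iota> ` carrier S"
  shows "push M S \<iota> f h = \<zero>\<^bsub>M\<^esub>"
  using push_eq[OF assms(1,2)] assms(3) by simp

lemma push_hom:
  assumes M: "comm_group (amon M)"
  shows "push M S \<iota> \<in> hom (fsg (carrier S) (amon M)) (fsg (carrier G) (amon M))"
proof (rule homI)
  interpret M: comm_group "amon M" by (rule M)
  fix f assume f: "f \<in> carrier (fsg (carrier S) (amon M))"
  show "push M S \<iota> f \<in> carrier (fsg (carrier G) (amon M))"
  proof (rule fsgI[where S="\<iota> ` {x. f x \<noteq> \<one>\<^bsub>amon M\<^esub>}"])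
    fix h
    show "push M S \<iota> f h \<in> carrier (amon M)"
      unfolding push_eq[OF M f] using fsg_app[OF f] M.one_closed by simp
    assume nz: "push M S \<iota> f h \<noteq> \<one>\<^bsub>amon M\<^esub>"
    then have "h \<in> \<iota> ` carrier S" using push_out[OF M f, of h] by auto
    then obtain g where g: "g \<in> carrier S" "h = \<iota> g" by blast
    then show "h \<in> carrier G" by simp
    show "h \<in> \<iota> ` {x. f x \<noteq> \<one>\<^bsub>amon M\<^esub>}" using nz push_app[OF M f g(1)] g(2) by auto
  qed (use fsg_fin[OF f] in simp)
  fix f' assume f': "f' \<in> carrier (fsg (carrier S) (amon M))"
  have ff': "f \<otimes>\<^bsub>fsg (carrier S) (amon M)\<^esub> f' \<in> carrier (fsg (carrier S) (amon M))"
    using comm_groupE(1)[OF fsg_comm_group[OF M]] f f' by blast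
  show "push M S \<iota> (f \<otimes>\<^bsub>fsg (carrier S) (amon M)\<^esub> f') = push M S \<iota> f \<otimes>\<^bsub>fsg (carrier G) (amon M)\<^esub> push M S \<iota> f'"
  proof
    fix h
    show "push M S \<iota> (f \<otimes>\<^bsub>fsg (carrier S) (amon M)\<^esub> f') h = (push M S \<iota> f \<otimes>\<^bsub>fsg (carrier G) (amon M)\<^esub> push M S \<iota> f') h"
    proof -
      have "(push M S \<iota> f \<otimes>\<^bsub>fsg (carrier G) (amon M)\<^esub> push M S \<iota> f') h = push M S \<iota> f h \<otimes>\<^bsub>amon M\<^esub> push M S \<iota> f' h"
        by (simp add: fsg_mult)
      also have "\<dots> = (if h \<in> \<iota> ` carrier S then (f \<otimes>\<^bsub>fsg (carrier S) (amon M)\<^esub> f') (inv_into (carrier S) \<iota> h) else \<zero>\<^bsub>M\<^esub>)"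
        unfolding push_eq[OF M f] push_eq[OF M f'] using M.l_one[OF M.one_closed] by (simp add: fsg_mult)
      finally show ?thesis unfolding push_eq[OF M ff'] by (rule sym)
    qed
  qed
qed

lemma push_sng:
  assumes M: "comm_group (amon M)" and g: "g \<in> carrier S" and a: "a \<in> carrier M"
  shows "push M S \<iota> (sng (amon M) g a) = sng (amon M) (\<iota> g) a"
proof
  fix h
  have s: "sng (amon M) g a \<in> carrier (fsg (carrier S) (amon M))" using M g a by simp
  show "push M S \<iota> (sng (amon M) g a) h = sng (amon M) (\<iota> g) a h"
  proof (cases "h \<in> \<iota> ` carrier S")
    case True
    then obtain k where k: "k \<in> carrier S" "h = \<iota> k" by blast
    have "\<iota> k = \<iota> g \<longleftrightarrow> k = g" using inj k g by (auto dest: inj_onD)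
    then show ?thesis using push_app[OF M s k(1)] k by (simp add: sng_def)
  next
    case False
    then show ?thesis using push_out[OF M s False] g by (auto simp: sng_def)
  qed
qed

lemma push_shift:
  assumes M: "comm_group (amon M)" and g: "g \<in> carrier S" and f: "f \<in> carrier (fsg (carrier S) (amon M))"
    and sf: "shift S (amon M) g f \<in> carrier (fsg (carrier S) (amon M))"
  shows "push M S \<iota> (shift S (amon M) g f) = shift G (amon M) (\<iota> g) (push M S \<iota> f)"
proof
  fix h
  have iG: "\<iota> g \<in> carrier G" using g by simp
  show "push M S \<iota> (shift S (amon M) g f) h = shift G (amon M) (\<iota> g) (push M S \<iota> f) h"
  proof (cases "h \<in> \<iota> ` carrier S")
    case True
    then obtain k where k: "k \<in> carrier S" "h = \<iota> k" by blast
    have "inv\<^bsub>G\<^esub> (\<iota> g) \<otimes>\<^bsub>G\<^esub> h = \<iota> (inv\<^bsub>S\<^esub> g \<otimes>\<^bsub>S\<^esub> k)" using k g by simp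
    then have "shift G (amon M) (\<iota> g) (push M S \<iota> f) h = push M S \<iota> f (\<iota> (inv\<^bsub>S\<^esub> g \<otimes>\<^bsub>S\<^esub> k))"
      using k by (simp add: shift_def)
    also have "\<dots> = f (inv\<^bsub>S\<^esub> g \<otimes>\<^bsub>S\<^esub> k)" by (rule push_app[OF M f]) (use k g in simp)
    also have "\<dots> = push M S \<iota> (shift S (amon M) g f) h" unfolding k(2) push_app[OF M sf k(1)] using k by (simp add: shift_def)
    finally show ?thesis by simp
  next
    case False
    have "inv\<^bsub>G\<^esub> (\<iota> g) \<otimes>\<^bsub>G\<^esub> h \<notin> \<iota> ` carrier S" if h: "h \<in> carrier G"
    proof
      assume "inv\<^bsub>G\<^esub> (\<iota> g) \<otimes>\<^bsub>G\<^esub> h \<in> \<iota> ` carrier S"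
      then obtain k where k: "k \<in> carrier S" "inv\<^bsub>G\<^esub> (\<iota> g) \<otimes>\<^bsub>G\<^esub> h = \<iota> k" by blast
      have "h = \<iota> g \<otimes>\<^bsub>G\<^esub> (inv\<^bsub>G\<^esub> (\<iota> g) \<otimes>\<^bsub>G\<^esub> h)" using h iG by (simp add: G.m_assoc[symmetric])
      also have "\<dots> = \<iota> (g \<otimes>\<^bsub>S\<^esub> k)" unfolding k(2) using g k(1) by simp
      finally show False using False g k(1) by blast
    qed
    then show ?thesis unfolding push_out[OF M sf False] using push_out[OF M f] by (simp add: shift_def)
  qed
qed

lemma image_subgroup: "subgroup (\<iota> ` carrier S) G" by (rule i.img_is_subgroup)

text \<open>For \<open>p\<close> supported on the image of \<open>\<iota>\<close>, the translate of
  \<open>p\<close> by \<open>h\<close> is supported on the coset of \<open>h\<close>. Cutting the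
  product therefore keeps just the terms of \<open>s\<close> at those \<open>h\<close> that lie in
  the image.\<close>

lemma cut_smult:
  assumes M: "Module.module (Zmod n) M" and s: "s \<in> carrier (RG G n)" and p: "p \<in> carrier (fsg (carrier G) (amon M))"
    and sp: "\<And>h. h \<notin> \<iota> ` carrier S \<Longrightarrow> p h = \<zero>\<^bsub>M\<^esub>"
  defines "P \<equiv> group_module (Zmod n) M G"
  shows "cut (amon M) (\<iota> ` carrier S) (s \<odot>\<^bsub>P\<^esub> p) = cut (amon (Zmod n)) (\<iota> ` carrier S) s \<odot>\<^bsub>P\<^esub> p"
proof -
  interpret M: Module.module "Zmod n" M by (rule M)
  have cM: "comm_group (amon M)" using comm_group_amon M.abelian_group_axioms by blast
  have gm: "gmodule G n P (shift G (amon M))" unfolding P_def by (rule gmodule_group_module[OF G.comm_group_axioms M])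
  have aP: "amon P = fsg (carrier G) (amon M)" by (simp add: P_def amon_group_module)
  have pP: "p \<in> carrier P" using p aP by (metis amon_simps(1))
  let ?L = "\<iota> ` carrier S" and ?K = "amon (Zmod n)"
  interpret L: subgroup ?L G by (rule image_subgroup)
  have cP: "comm_group (amon P)" unfolding aP by (rule fsg_comm_group[OF cM])
  have cutP: "cut (amon M) ?L \<in> hom (amon P) (amon P)" unfolding aP by (rule cut_hom[OF cM])
  have cutR: "cut ?K ?L \<in> hom (RG G n) (RG G n)" unfolding RG_def by (rule cut_hom[OF comm_group_Zmod])
  have sm: "(\<lambda>s. s \<odot>\<^bsub>P\<^esub> p) \<in> hom (RG G n) (amon P)" by (rule gmodule_smult_hom(2)[OF gm pP])
  show ?thesis
  proof (rule RG_hom_eq[OF cP hom_comp_fun[OF sm cutP] hom_comp_fun[OF cutR sm] _ s])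
    fix h assume h: "h \<in> carrier G"
    let ?x = "sng ?K h (zc n 1)"
    have xp: "?x \<odot>\<^bsub>P\<^esub> p = shift G (amon M) h p" by (rule gmodule_monomial(2)[OF gm h pP])
    show "cut (amon M) ?L (?x \<odot>\<^bsub>P\<^esub> p) = cut ?K ?L ?x \<odot>\<^bsub>P\<^esub> p"
    proof (cases "h \<in> ?L")
      case True
      then have "cut ?K ?L ?x = ?x" by (auto simp: cut_def sng_def fun_eq_iff)
      moreover have "cut (amon M) ?L (shift G (amon M) h p) = shift G (amon M) h p"
      proof
        fix k
        show "cut (amon M) ?L (shift G (amon M) h p) k = shift G (amon M) h p k"
        proof (cases "k \<in> ?L \<or> k \<notin> carrier G")
          case True then show ?thesis by (auto simp: cut_def shift_def)
        next
          case False
          have "inv\<^bsub>G\<^esub> h \<otimes>\<^bsub>G\<^esub> k \<notin> ?L"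
          proof
            assume "inv\<^bsub>G\<^esub> h \<otimes>\<^bsub>G\<^esub> k \<in> ?L"
            then have "h \<otimes>\<^bsub>G\<^esub> (inv\<^bsub>G\<^esub> h \<otimes>\<^bsub>G\<^esub> k) \<in> ?L" by (rule L.m_closed[OF True])
            then show False using False h by (simp add: G.m_assoc[symmetric])
          qed
          then show ?thesis using False sp by (simp add: cut_def shift_def)
        qed
      qed
      ultimately show ?thesis using xp by simp
    next
      case False
      then have "cut ?K ?L ?x = \<one>\<^bsub>RG G n\<^esub>" by (auto simp: cut_def sng_def fun_eq_iff RG_def fsg_one)
      then have "cut ?K ?L ?x \<odot>\<^bsub>P\<^esub> p = \<one>\<^bsub>amon P\<^esub>"
        using hom_one[OF sm comm_group.axioms(2)[OF comm_group_RG] comm_group.axioms(2)[OF cP]] by simp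
      moreover have "cut (amon M) ?L (shift G (amon M) h p) = \<one>\<^bsub>amon P\<^esub>"
        unfolding aP fsg_one
      proof
        fix k
        show "cut (amon M) ?L (shift G (amon M) h p) k = \<one>\<^bsub>amon M\<^esub>"
        proof (cases "k \<in> ?L")
          case True
          have "inv\<^bsub>G\<^esub> h \<otimes>\<^bsub>G\<^esub> k \<notin> ?L"
          proof
            assume a: "inv\<^bsub>G\<^esub> h \<otimes>\<^bsub>G\<^esub> k \<in> ?L"
            have kG: "k \<in> carrier G" using True by (rule L.mem_carrier)
            have "k \<otimes>\<^bsub>G\<^esub> inv\<^bsub>G\<^esub> (inv\<^bsub>G\<^esub> h \<otimes>\<^bsub>G\<^esub> k) \<in> ?L" by (rule L.m_closed[OF True L.m_inv_closed[OF a]])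
            moreover have "k \<otimes>\<^bsub>G\<^esub> inv\<^bsub>G\<^esub> (inv\<^bsub>G\<^esub> h \<otimes>\<^bsub>G\<^esub> k) = h"
              using h kG by (simp add: G.inv_mult_group G.m_assoc[symmetric])
            ultimately show False using False by simp
          qed
          then show ?thesis using sp by (simp add: cut_def shift_def)
        qed (simp add: cut_def)
      qed
      ultimately show ?thesis using xp by simp
    qed
  qed
qed

end

section \<open>The stacked submodule as an image of the tensor product\<close>

lemma subgroup_finprod_closed:
  assumes "comm_group A" "subgroup V A" "finite S" "\<And>x. x \<in> S \<Longrightarrow> f x \<in> V"
  shows "finprod A f S \<in> V"
proof -
  interpret comm_group A by fact
  show ?thesis using assms(3,4)
  proof (induction S)
    case empty then show ?case using subgroup.one_closed[OF assms(2)] by simp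
  next
    case (insert x S)
    have "f \<in> S \<rightarrow> carrier A" "f x \<in> carrier A" using insert.prems subgroup.mem_carrier[OF assms(2)] by auto
    then show ?case using insert subgroup.m_closed[OF assms(2)] by simp
  qed
qed

text \<open>The universal property of the free abelian group, for the formula that
  \<open>stack_eval\<close> uses.\<close>

lemma frag_eval_hom:
  fixes f :: "'x \<Rightarrow> 'a"
  assumes A: "comm_group A" and f: "\<And>x. x \<in> J \<Longrightarrow> f x \<in> carrier A"
  defines "ev \<equiv> \<lambda>z :: 'x \<Rightarrow>\<^sub>0 int. finprod A (\<lambda>x. f x [^]\<^bsub>A\<^esub> Poly_Mapping.lookup z x) (Poly_Mapping.keys z)"
  shows "ev \<in> hom (free_Abelian_group J) A" and "x \<in> J \<Longrightarrow> ev (frag_of x) = f x"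
proof -
  interpret A: comm_group A by (rule A)
  have fp: "f x [^]\<^bsub>A\<^esub> (k::int) \<in> carrier A" if "x \<in> J" for x k by (rule A.int_pow_closed[OF f[OF that]])
  have eq: "ev z = finprod A (\<lambda>x. f x [^]\<^bsub>A\<^esub> Poly_Mapping.lookup z x) S"
    if "Poly_Mapping.keys z \<subseteq> S" "finite S" "S \<subseteq> J" for z S
    unfolding ev_def
  proof (rule A.finprod_mono_neutral_cong_left)
    show "f i [^]\<^bsub>A\<^esub> Poly_Mapping.lookup z i = \<one>\<^bsub>A\<^esub>" if "i \<in> S - Poly_Mapping.keys z" for i
      using that by (simp add: in_keys_iff)
  qed (use that fp in auto)
  show "ev \<in> hom (free_Abelian_group J) A"
  proof (rule homI)
    fix z assume "z \<in> carrier (free_Abelian_group J)"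
    then have z: "Poly_Mapping.keys z \<subseteq> J" by simp
    show "ev z \<in> carrier A" unfolding ev_def by (rule A.finprod_closed) (use fp z in blast)
    fix w assume "w \<in> carrier (free_Abelian_group J)"
    then have w: "Poly_Mapping.keys w \<subseteq> J" by simp
    let ?S = "Poly_Mapping.keys z \<union> Poly_Mapping.keys w"
    have S: "finite ?S" "?S \<subseteq> J" using z w by auto
    have zw: "Poly_Mapping.keys (z + w) \<subseteq> ?S" by (rule Poly_Mapping.keys_add)
    have "ev (z + w) = finprod A (\<lambda>x. f x [^]\<^bsub>A\<^esub> Poly_Mapping.lookup z x \<otimes>\<^bsub>A\<^esub> f x [^]\<^bsub>A\<^esub> Poly_Mapping.lookup w x) ?S"
      unfolding eq[OF zw S]
    proof (rule A.finprod_cong'[OF refl])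
      show "(\<lambda>x. f x [^]\<^bsub>A\<^esub> Poly_Mapping.lookup z x \<otimes>\<^bsub>A\<^esub> f x [^]\<^bsub>A\<^esub> Poly_Mapping.lookup w x) \<in> ?S \<rightarrow> carrier A"
        using fp S(2) by (intro Pi_I A.m_closed) blast+
      fix x assume "x \<in> ?S"
      then have "f x \<in> carrier A" using f S(2) by blast
      then show "f x [^]\<^bsub>A\<^esub> Poly_Mapping.lookup (z + w) x = f x [^]\<^bsub>A\<^esub> Poly_Mapping.lookup z x \<otimes>\<^bsub>A\<^esub> f x [^]\<^bsub>A\<^esub> Poly_Mapping.lookup w x"
        by (simp add: lookup_add A.int_pow_mult)
    qed
    also have "\<dots> = ev z \<otimes>\<^bsub>A\<^esub> ev w"
      unfolding eq[OF Un_upper1 S] eq[OF Un_upper2 S] by (rule A.finprod_multf) (use fp S(2) in blast)+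
    finally show "ev (z \<otimes>\<^bsub>free_Abelian_group J\<^esub> w) = ev z \<otimes>\<^bsub>A\<^esub> ev w" by simp
  qed
  show "ev (frag_of x) = f x" if x: "x \<in> J"
    unfolding ev_def using f[OF x] by simp
qed

lemma (in stacking) stack_submodule_eq:
  fixes D :: "('l, 'p) stab_code"
  assumes M: "Module.module (Zmod n) (local_module D)" and n: "modulus D = n" and SD: "site_group D = S"
    and N: "submodule N (stab_ring D) (stab_module D)"
  defines "P \<equiv> group_module (Zmod n) (local_module D) G"
  defines "f \<equiv> \<lambda>(l, s). s \<odot>\<^bsub>P\<^esub> push (local_module D) S \<iota> l"
  defines "ev \<equiv> \<lambda>z :: _ \<Rightarrow>\<^sub>0 int. finprod (amon P) (\<lambda>x. f x [^]\<^bsub>amon P\<^esub> Poly_Mapping.lookup z x) (Poly_Mapping.keys z)"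
  shows "stack_submodule \<iota> G D N = ev ` carrier (free_Abelian_group (N \<times> carrier (RG G n)))"
    and "ev \<in> hom (free_Abelian_group (N \<times> carrier (RG G n))) (amon P)"
    and "l \<in> N \<Longrightarrow> s \<in> carrier (RG G n) \<Longrightarrow> ev (frag_of (l, s)) = s \<odot>\<^bsub>P\<^esub> push (local_module D) S \<iota> l"
    and "l \<in> N \<Longrightarrow> s \<in> carrier (RG G n) \<Longrightarrow> s \<odot>\<^bsub>P\<^esub> push (local_module D) S \<iota> l \<in> carrier P"
proof -
  let ?M = "local_module D" and ?F = "free_Abelian_group (N \<times> carrier (RG G n))"
  interpret M: Module.module "Zmod n" ?M by (rule M)
  have cM: "comm_group (amon ?M)" using comm_group_amon M.abelian_group_axioms by blast
  have gP: "gmodule G n P (shift G (amon ?M))" unfolding P_def by (rule gmodule_group_module[OF G.comm_group_axioms M])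
  have gD: "gmodule S n (stab_module D) (shift S (amon ?M))"
    unfolding stab_module_def n SD by (rule gmodule_group_module[OF S.comm_group_axioms M])
  have aP: "amon P = fsg (carrier G) (amon ?M)" by (simp add: P_def amon_group_module)
  have aD: "amon (stab_module D) = fsg (carrier S) (amon ?M)" by (simp add: stab_module_def amon_group_module SD)
  have N': "submodule N (group_ring (Zmod n) S) (stab_module D)" using N by (simp add: stab_ring_def n SD)
  note Nsub = gmodule_submodule[OF gD N']
  have NS: "l \<in> carrier (fsg (carrier S) (amon ?M))" if "l \<in> N" for l
    using subgroup.mem_carrier[OF Nsub(1) that] unfolding aD .
  interpret P: gact G n "amon P" "shift G (amon ?M)" using gP by (simp add: gmodule_def)
  interpret D: gact S n "amon (stab_module D)" "shift S (amon ?M)" using gD by (simp add: gmodule_def)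
  interpret R: gact G n "RG G n" "rsh G n" by (rule gact_RG[OF G.comm_group_axioms])
  let ?push = "push ?M S \<iota>"
  have pP: "?push \<in> hom (amon (stab_module D)) (amon P)" unfolding aP aD by (rule push_hom[OF cM])
  have pl: "?push l \<in> carrier P" if "l \<in> N" for l
    using hom_in_carrier[OF push_hom[OF cM] NS[OF that]] unfolding aP[symmetric] by simp
  have smv: "(\<lambda>v. s \<odot>\<^bsub>P\<^esub> v) \<in> hom (amon P) (amon P)" if "s \<in> carrier (RG G n)" for s by (rule gmodule_smult_hom(1)[OF gP that])
  have smr: "(\<lambda>s. s \<odot>\<^bsub>P\<^esub> v) \<in> hom (RG G n) (amon P)" if "v \<in> carrier P" for v by (rule gmodule_smult_hom(2)[OF gP that])
  have fc: "f x \<in> carrier (amon P)" if "x \<in> N \<times> carrier (RG G n)" for x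
    using that hom_in_carrier[OF smr[OF pl]] by (auto simp: f_def)
  show evh: "ev \<in> hom ?F (amon P)" unfolding ev_def by (rule frag_eval_hom(1)[OF P.A.comm_group_axioms fc])
  have evf: "ev (frag_of x) = f x" if "x \<in> N \<times> carrier (RG G n)" for x
    unfolding ev_def by (rule frag_eval_hom(2)[OF P.A.comm_group_axioms fc that])
  show "ev (frag_of (l, s)) = s \<odot>\<^bsub>P\<^esub> ?push l" if "l \<in> N" "s \<in> carrier (RG G n)" for l s
    using evf[of "(l, s)"] that by (simp add: f_def)
  show "s \<odot>\<^bsub>P\<^esub> ?push l \<in> carrier P" if "l \<in> N" "s \<in> carrier (RG G n)" for l s
    using fc[of "(l, s)"] that by (simp add: f_def)
  interpret F: comm_group ?F by (rule abelian_free_Abelian_group)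
  interpret ev: group_hom ?F "amon P" ev using evh by (simp add: group_hom_def group_hom_axioms_def P.A.group_axioms)
  have se: "stack_eval \<iota> G D = ev"
    by (simp add: fun_eq_iff stack_eval_def Let_def n SD P_def[symmetric] finsum_amon add_pow_amon ev_def f_def split_def)
  let ?N = "(stab_module D)\<lparr>carrier := N\<rparr>" and ?S = "stack_scalars \<iota> G D"
  have cS: "carrier ?S = carrier (RG G n)" by (simp add: stack_scalars_def Let_def n carrier_group_ring)
  have addS: "add ?S = monoid.mult (RG G n)"
    using amon_simps(2)[of "group_ring (Zmod n) G"] by (simp add: stack_scalars_def Let_def n amon_group_ring)
  have pK: "push (Zmod n) S \<iota> \<in> hom (RG S n) (RG G n)" unfolding RG_def by (rule push_hom[OF comm_group_Zmod])
  have gR: "gmodule G n (ring_module (group_ring (Zmod n) G)) (rsh G n)" by (rule gmodule_ring[OF G.comm_group_axioms])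
  have smS: "r \<odot>\<^bsub>?S\<^esub> s = push (Zmod n) S \<iota> r \<odot>\<^bsub>ring_module (group_ring (Zmod n) G)\<^esub> s" for r s
    by (simp add: stack_scalars_def Let_def n SD ring_module_def)
  have cRM: "carrier (ring_module (group_ring (Zmod n) G)) = carrier (RG G n)"
    by (simp add: ring_module_def carrier_group_ring)
  have aRM: "amon (ring_module (group_ring (Zmod n) G)) = RG G n" by (simp add: amon_ring_module amon_group_ring)
  have smSc: "(\<lambda>r. r \<odot>\<^bsub>?S\<^esub> s) \<in> hom (RG S n) (RG G n)" if "s \<in> carrier (RG G n)" for s
    unfolding smS using hom_comp_fun[OF pK gmodule_smult_hom(2)[OF gR, of s]] that cRM aRM by simp
  let ?rel = "tensor_relators (stab_ring D) ?N ?S"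
  have gc: "carrier (stab_ring D) = carrier (RG S n)" by (simp add: stab_ring_def n SD carrier_group_ring)
  have addN: "x \<oplus>\<^bsub>stab_module D\<^esub> y = x \<otimes>\<^bsub>amon (stab_module D)\<^esub> y" for x y by simp
  \<comment> \<open>Both sides are additive in \<open>r\<close>, so the balancing relation is
    checked on monomials only, where \<open>push\<close> turns translation by \<open>g\<close> into
    translation by \<open>\<iota> g\<close>.\<close>
  have rel3: "s \<odot>\<^bsub>P\<^esub> ?push (r \<odot>\<^bsub>stab_module D\<^esub> l) = (r \<odot>\<^bsub>?S\<^esub> s) \<odot>\<^bsub>P\<^esub> ?push l"
    if r: "r \<in> carrier (RG S n)" and l: "l \<in> N" and s: "s \<in> carrier (RG G n)" for r l s
  proof (rule RG_hom_eq[OF P.A.comm_group_axioms _ _ _ r])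
    have lD: "l \<in> carrier (stab_module D)" using NS[OF l] unfolding aD[symmetric] by simp
    show "(\<lambda>r. s \<odot>\<^bsub>P\<^esub> ?push (r \<odot>\<^bsub>stab_module D\<^esub> l)) \<in> hom (RG S n) (amon P)"
      by (rule hom_comp_fun[OF hom_comp_fun[OF gmodule_smult_hom(2)[OF gD lD] pP] smv[OF s]])
    show "(\<lambda>r. (r \<odot>\<^bsub>?S\<^esub> s) \<odot>\<^bsub>P\<^esub> ?push l) \<in> hom (RG S n) (amon P)"
      by (rule hom_comp_fun[OF smSc[OF s] smr[OF pl[OF l]]])
    fix g assume g: "g \<in> carrier S"
    let ?x = "sng (amon (Zmod n)) g (zc n 1)"
    have ig: "\<iota> g \<in> carrier G" using g by simp
    have sl: "shift S (amon ?M) g l \<in> carrier (fsg (carrier S) (amon ?M))"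
      using D.act_closed[OF g] NS[OF l] unfolding aD by blast
    have "s \<odot>\<^bsub>P\<^esub> ?push (?x \<odot>\<^bsub>stab_module D\<^esub> l) = s \<odot>\<^bsub>P\<^esub> shift G (amon ?M) (\<iota> g) (?push l)"
      unfolding gmodule_monomial(2)[OF gD g lD] push_shift[OF cM g NS[OF l] sl] ..
    also have "\<dots> = rsh G n (\<iota> g) s \<odot>\<^bsub>P\<^esub> ?push l"
      by (rule gmodule_smult_shift[OF gP ig s pl[OF l], symmetric])
    also have "rsh G n (\<iota> g) s = ?x \<odot>\<^bsub>?S\<^esub> s"
    proof -
      have "push (Zmod n) S \<iota> ?x = sng (amon (Zmod n)) (\<iota> g) (zc n 1)"
        by (rule push_sng[OF comm_group_Zmod g zc_closed])
      then show ?thesis unfolding smS using gmodule_monomial(2)[OF gR ig, of s] s cRM by simp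
    qed
    finally show "s \<odot>\<^bsub>P\<^esub> ?push (?x \<odot>\<^bsub>stab_module D\<^esub> l) = (?x \<odot>\<^bsub>?S\<^esub> s) \<odot>\<^bsub>P\<^esub> ?push l" .
  qed
  let ?ker = "{z \<in> carrier ?F. ev z = \<one>\<^bsub>amon P\<^esub>}"
  have kersub: "subgroup ?ker ?F"
  proof (rule F.subgroupI)
    have "\<one>\<^bsub>?F\<^esub> \<in> ?ker" using F.one_closed ev.hom_one by blast
    then show "?ker \<noteq> {}" by blast
    show "inv\<^bsub>?F\<^esub> a \<in> ?ker" if "a \<in> ?ker" for a
    proof -
      have a: "a \<in> carrier ?F" "ev a = \<one>\<^bsub>amon P\<^esub>" using that by blast+
      have "ev (inv\<^bsub>?F\<^esub> a) = \<one>\<^bsub>amon P\<^esub>" unfolding ev.hom_inv[OF a(1)] a(2) by (rule P.A.inv_one)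
      then show ?thesis using F.inv_closed[OF a(1)] by blast
    qed
    show "a \<otimes>\<^bsub>?F\<^esub> b \<in> ?ker" if "a \<in> ?ker" "b \<in> ?ker" for a b
    proof -
      have a: "a \<in> carrier ?F" "ev a = \<one>\<^bsub>amon P\<^esub>" and b: "b \<in> carrier ?F" "ev b = \<one>\<^bsub>amon P\<^esub>" using that by blast+
      have "ev (a \<otimes>\<^bsub>?F\<^esub> b) = \<one>\<^bsub>amon P\<^esub>"
        unfolding ev.hom_mult[OF a(1) b(1)] a(2) b(2) by (rule P.A.l_one[OF P.A.one_closed])
      then show ?thesis using F.m_closed[OF a(1) b(1)] by blast
    qed
  qed blast
  have frc: "frag_of x \<in> carrier ?F" if "x \<in> N \<times> carrier (RG G n)" for x using that by simp
  have sub: "a - b \<in> carrier ?F \<and> ev (a - b) = ev a \<otimes>\<^bsub>amon P\<^esub> inv\<^bsub>amon P\<^esub> (ev b)"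
    if a: "a \<in> carrier ?F" and b: "b \<in> carrier ?F" for a b
  proof -
    have 1: "a - b = a \<otimes>\<^bsub>?F\<^esub> inv\<^bsub>?F\<^esub> b" using b by simp
    show ?thesis unfolding 1 ev.hom_mult[OF a F.inv_closed[OF b]] ev.hom_inv[OF b]
      by (rule conjI[OF F.m_closed[OF a F.inv_closed[OF b]] refl])
  qed
  have ker2: "frag_of x - frag_of y \<in> ?ker" if "x \<in> N \<times> carrier (RG G n)" "y \<in> N \<times> carrier (RG G n)" "f x = f y" for x y
  proof -
    note s = sub[OF frc[OF that(1)] frc[OF that(2)]]
    have "ev (frag_of x - frag_of y) = \<one>\<^bsub>amon P\<^esub>"
      unfolding conjunct2[OF s] evf[OF that(1)] evf[OF that(2)] that(3) by (rule P.A.r_inv[OF fc[OF that(2)]])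
    then show ?thesis using conjunct1[OF s] by blast
  qed
  have ker3: "frag_of x - frag_of y - frag_of z \<in> ?ker"
    if "x \<in> N \<times> carrier (RG G n)" "y \<in> N \<times> carrier (RG G n)" "z \<in> N \<times> carrier (RG G n)" "f x = f y \<otimes>\<^bsub>amon P\<^esub> f z" for x y z
  proof -
    note s1 = sub[OF frc[OF that(1)] frc[OF that(2)]]
    note s2 = sub[OF conjunct1[OF s1] frc[OF that(3)]]
    have c: "f y \<in> carrier (amon P)" "f z \<in> carrier (amon P)" using fc that by blast+
    have "ev (frag_of x - frag_of y - frag_of z) = ((f y \<otimes>\<^bsub>amon P\<^esub> f z) \<otimes>\<^bsub>amon P\<^esub> inv\<^bsub>amon P\<^esub> (f y)) \<otimes>\<^bsub>amon P\<^esub> inv\<^bsub>amon P\<^esub> (f z)"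
      unfolding conjunct2[OF s2] conjunct2[OF s1] evf[OF that(1)] evf[OF that(2)] evf[OF that(3)] that(4) ..
    also have "\<dots> = \<one>\<^bsub>amon P\<^esub>"
      using c by (metis P.A.inv_closed P.A.m_assoc P.A.m_closed P.A.m_comm P.A.r_inv P.A.r_one)
    finally show ?thesis using conjunct1[OF s2] by blast
  qed
  have relker: "?rel \<subseteq> ?ker"
    unfolding tensor_relators_def cS addS gc
  proof (intro Un_least subsetI)
    fix z assume "z \<in> {frag_of (x \<oplus>\<^bsub>?N\<^esub> x', y) - frag_of (x, y) - frag_of (x', y) |x x' y. x \<in> carrier ?N \<and> x' \<in> carrier ?N \<and> y \<in> carrier (RG G n)}"
    then obtain x x' y where z: "z = frag_of (x \<oplus>\<^bsub>stab_module D\<^esub> x', y) - frag_of (x, y) - frag_of (x', y)"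
      and m: "x \<in> N" "x' \<in> N" "y \<in> carrier (RG G n)" by auto
    have xx: "x \<oplus>\<^bsub>stab_module D\<^esub> x' \<in> N" using subgroup.m_closed[OF Nsub(1) m(1,2)] by simp
    have c: "x \<in> carrier (amon (stab_module D))" "x' \<in> carrier (amon (stab_module D))" using m subgroup.mem_carrier[OF Nsub(1)] by blast+
    have "f (x \<oplus>\<^bsub>stab_module D\<^esub> x', y) = f (x, y) \<otimes>\<^bsub>amon P\<^esub> f (x', y)"
      using hom_mult[OF hom_comp_fun[OF pP smv[OF m(3)]] c] by (simp add: f_def)
    then show "z \<in> ?ker" unfolding z using m xx by (intro ker3) auto
  next
    fix z assume "z \<in> {frag_of (x, y \<otimes>\<^bsub>RG G n\<^esub> y') - frag_of (x, y) - frag_of (x, y') |x y y'. x \<in> carrier ?N \<and> y \<in> carrier (RG G n) \<and> y' \<in> carrier (RG G n)}"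
    then obtain x y y' where z: "z = frag_of (x, y \<otimes>\<^bsub>RG G n\<^esub> y') - frag_of (x, y) - frag_of (x, y')"
      and m: "x \<in> N" "y \<in> carrier (RG G n)" "y' \<in> carrier (RG G n)" by auto
    have "f (x, y \<otimes>\<^bsub>RG G n\<^esub> y') = f (x, y) \<otimes>\<^bsub>amon P\<^esub> f (x, y')"
      using hom_mult[OF smr[OF pl[OF m(1)]] m(2,3)] by (simp add: f_def)
    then show "z \<in> ?ker" unfolding z using m by (intro ker3) auto
  next
    fix z assume "z \<in> {frag_of (r \<odot>\<^bsub>?N\<^esub> x, y) - frag_of (x, r \<odot>\<^bsub>?S\<^esub> y) |r x y. r \<in> carrier (RG S n) \<and> x \<in> carrier ?N \<and> y \<in> carrier (RG G n)}"
    then obtain r x y where z: "z = frag_of (r \<odot>\<^bsub>stab_module D\<^esub> x, y) - frag_of (x, r \<odot>\<^bsub>?S\<^esub> y)"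
      and m: "r \<in> carrier (RG S n)" "x \<in> N" "y \<in> carrier (RG G n)" by auto
    have rx: "r \<odot>\<^bsub>stab_module D\<^esub> x \<in> N" using submodule.smult_closed[OF N _ m(2), of r] m(1) gc by simp
    have ry: "r \<odot>\<^bsub>?S\<^esub> y \<in> carrier (RG G n)" using hom_in_carrier[OF smSc[OF m(3)] m(1)] .
    have "f (r \<odot>\<^bsub>stab_module D\<^esub> x, y) = f (x, r \<odot>\<^bsub>?S\<^esub> y)" using rel3[OF m] by (simp add: f_def)
    then show "z \<in> ?ker" unfolding z using m rx ry by (intro ker2) auto
  qed
  let ?H = "generate ?F ?rel"
  have Hker: "?H \<subseteq> ?ker" by (rule F.generate_subgroup_incl[OF relker kersub])
  have H1: "\<one>\<^bsub>?F\<^esub> \<in> ?H" by (rule generate.one)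
  have te: "the_elem (ev ` (?H #>\<^bsub>?F\<^esub> z)) = ev z" if z: "z \<in> carrier ?F" for z
  proof -
    have "ev (h \<otimes>\<^bsub>?F\<^esub> z) = ev z" if "h \<in> ?H" for h
      using Hker that ev.hom_mult[OF _ z, of h] P.A.l_one[OF ev.hom_closed[OF z]] by auto
    then have "ev ` (?H #>\<^bsub>?F\<^esub> z) = {ev z}" using H1 unfolding r_coset_def by auto
    then show ?thesis by simp
  qed
  have "carrier (tensor_product (stab_ring D) ?N ?S) = (\<lambda>z. ?H #>\<^bsub>?F\<^esub> z) ` carrier ?F"
    by (auto simp: tensor_product_def Let_def cS FactGroup_def RCOSETS_def)
  then show "stack_submodule \<iota> G D N = ev ` carrier ?F"
    unfolding stack_submodule_def se using te by (auto simp: image_image)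
qed

text \<open>This is where the stacked form of the stabilizers enters: the cut of a generator, the
  product of some \<open>s\<close> with a pushed \<open>l\<close>, is the product of the cut of
  \<open>s\<close> with the same pushed \<open>l\<close>, again a generator.\<close>

lemma (in stacking) stack_submodule_cut:
  fixes D :: "('l, 'p) stab_code"
  assumes M: "Module.module (Zmod n) (local_module D)" and n: "modulus D = n" and SD: "site_group D = S"
    and N: "submodule N (stab_ring D) (stab_module D)" and p: "p \<in> stack_submodule \<iota> G D N"
  shows "cut (amon (local_module D)) (\<iota> ` carrier S) p \<in> stack_submodule \<iota> G D N"
proof -
  let ?M = "local_module D"
  let ?P = "group_module (Zmod n) ?M G"
  let ?F = "free_Abelian_group (N \<times> carrier (RG G n))"
  define f where "f = (\<lambda>(l, s). s \<odot>\<^bsub>?P\<^esub> push ?M S \<iota> l)"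
  define ev where "ev z = finprod (amon ?P) (\<lambda>x. f x [^]\<^bsub>amon ?P\<^esub> Poly_Mapping.lookup z x) (Poly_Mapping.keys z)" for z :: "_ \<Rightarrow>\<^sub>0 int"
  note * = stack_submodule_eq[OF M n SD N, folded f_def, folded ev_def]
  interpret M: Module.module "Zmod n" ?M by (rule M)
  have cM: "comm_group (amon ?M)" using comm_group_amon M.abelian_group_axioms by blast
  have aP: "amon ?P = fsg (carrier G) (amon ?M)" by (simp add: amon_group_module)
  have cP: "comm_group (amon ?P)" unfolding aP by (rule fsg_comm_group[OF cM])
  interpret P: comm_group "amon ?P" by (rule cP)
  interpret ev: group_hom ?F "amon ?P" ev using *(2) by (simp add: group_hom_def group_hom_axioms_def P.group_axioms)
  let ?cut = "cut (amon ?M) (\<iota> ` carrier S)"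
  let ?L = "stack_submodule \<iota> G D N"
  have Lsub: "subgroup ?L (amon ?P)" unfolding *(1) by (rule ev.img_is_subgroup)
  have cuth: "?cut \<in> hom (amon ?P) (amon ?P)" unfolding aP by (rule cut_hom[OF cM])
  interpret cut: group_hom "amon ?P" "amon ?P" ?cut using cuth by unfold_locales
  \<comment> \<open>The elements whose cut stays in the stacked submodule form a subgroup, so
    generators suffice.\<close>
  let ?V = "{q \<in> carrier (amon ?P). ?cut q \<in> ?L}"
  have V: "subgroup ?V (amon ?P)"
  proof (rule P.subgroupI)
    show "?V \<noteq> {}" using subgroup.one_closed[OF Lsub] cut.hom_one P.one_closed by fastforce
    show "inv\<^bsub>amon ?P\<^esub> a \<in> ?V" if "a \<in> ?V" for a
      using that subgroup.m_inv_closed[OF Lsub] cut.hom_inv[of a] P.inv_closed[of a] by fastforce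
    show "a \<otimes>\<^bsub>amon ?P\<^esub> b \<in> ?V" if "a \<in> ?V" "b \<in> ?V" for a b
      using that subgroup.m_closed[OF Lsub] cut.hom_mult[of a b] P.m_closed[of a b] by fastforce
  qed blast
  have gD: "gmodule S n (stab_module D) (shift S (amon ?M))"
    unfolding stab_module_def n SD by (rule gmodule_group_module[OF S.comm_group_axioms M])
  have aD: "amon (stab_module D) = fsg (carrier S) (amon ?M)" by (simp add: stab_module_def amon_group_module SD)
  have N': "submodule N (group_ring (Zmod n) S) (stab_module D)" using N by (simp add: stab_ring_def n SD)
  have NS: "l \<in> carrier (fsg (carrier S) (amon ?M))" if "l \<in> N" for l
    using subgroup.mem_carrier[OF gmodule_submodule(1)[OF gD N'] that] unfolding aD .
  have fV: "f x \<in> ?V" if x: "x \<in> N \<times> carrier (RG G n)" for x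
  proof -
    obtain l s where ls: "x = (l, s)" "l \<in> N" "s \<in> carrier (RG G n)" using x by auto
    have pl: "push ?M S \<iota> l \<in> carrier (fsg (carrier G) (amon ?M))"
      by (rule hom_in_carrier[OF push_hom[OF cM] NS[OF ls(2)]])
    have cs: "cut (amon (Zmod n)) (\<iota> ` carrier S) s \<in> carrier (RG G n)"
      using hom_in_carrier[OF cut_hom[OF comm_group_Zmod]] ls(3) unfolding RG_def by blast
    have "?cut (f x) = cut (amon (Zmod n)) (\<iota> ` carrier S) s \<odot>\<^bsub>?P\<^esub> push ?M S \<iota> l"
      unfolding f_def ls(1) prod.case by (rule cut_smult[OF M ls(3) pl push_out[OF cM NS[OF ls(2)]]])
    also have "\<dots> = ev (frag_of (l, cut (amon (Zmod n)) (\<iota> ` carrier S) s))" by (rule *(3)[OF ls(2) cs, symmetric])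
    also have "\<dots> \<in> ?L" unfolding *(1) using ls(2) cs by (intro imageI) simp
    finally have "?cut (f x) \<in> ?L" .
    moreover have "f x \<in> carrier (amon ?P)" using *(4)[OF ls(2,3)] by (simp add: f_def ls(1))
    ultimately show ?thesis by blast
  qed
  obtain z where z: "z \<in> carrier ?F" "p = ev z" using p unfolding *(1) by blast
  have "ev z \<in> ?V"
    unfolding ev_def
  proof (rule subgroup_finprod_closed[OF cP V])
    fix x assume "x \<in> Poly_Mapping.keys z"
    then have "x \<in> N \<times> carrier (RG G n)" using z(1) by auto
    then show "f x [^]\<^bsub>amon ?P\<^esub> Poly_Mapping.lookup z x \<in> ?V" by (intro P.subgroup_int_pow_closed[OF V] fV)
  qed simp
  then show ?thesis using z by blast
qed

text \<open>Functions on the group decompose along the cosets of \<Lambda>. Under the inverted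
  action the conjugate of the cut by \<open>x\<close> is restriction to the coset of
  \<open>x^(-1)\<close>, and a finitely supported function meets only finitely many cosets.\<close>

lemma (in transversal) splitting_cut:
  assumes A: "comm_group A" and tors: "\<And>x. x \<in> carrier A \<Longrightarrow> x [^]\<^bsub>A\<^esub> int n = \<one>\<^bsub>A\<^esub>"
  shows "splitting n (fsg (carrier G) A) (\<lambda>g. shift G A (inv\<^bsub>G\<^esub> g)) (cut A \<Lambda>)"
proof -
  let ?P = "fsg (carrier G) A" and ?\<alpha> = "\<lambda>g. shift G A (inv\<^bsub>G\<^esub> g)"
  have g0: "gact G n ?P (shift G A)" by (rule gact_shift[OF G.comm_group_axioms A tors])
  have g: "gact G n ?P ?\<alpha>" by (rule gact_inverse[OF g0])
  interpret P: gact G n ?P ?\<alpha> by (rule g)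
  interpret P0: gact G n ?P "shift G A" by (rule g0)
  interpret A: comm_group A by (rule A)
  interpret L: subgroup \<Lambda> G by (rule sub)
  have e: "cut A \<Lambda> \<in> ehom \<Lambda> ?P ?\<alpha> ?P ?\<alpha>"
    unfolding ehom_def
  proof (intro CollectI conjI ballI)
    show "cut A \<Lambda> \<in> hom ?P ?P" by (rule cut_hom[OF A])
    fix h x assume h: "h \<in> \<Lambda>" and x: "x \<in> carrier ?P"
    show "cut A \<Lambda> (shift G A (inv\<^bsub>G\<^esub> h) x) = shift G A (inv\<^bsub>G\<^esub> h) (cut A \<Lambda> x)"
    proof (rule shift_cut)
      fix g assume g: "g \<in> carrier G"
      show "inv\<^bsub>G\<^esub> (inv\<^bsub>G\<^esub> h) \<otimes>\<^bsub>G\<^esub> g \<in> \<Lambda> \<longleftrightarrow> g \<in> \<Lambda>"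
      proof
        assume "inv\<^bsub>G\<^esub> (inv\<^bsub>G\<^esub> h) \<otimes>\<^bsub>G\<^esub> g \<in> \<Lambda>"
        then have "inv\<^bsub>G\<^esub> h \<otimes>\<^bsub>G\<^esub> (h \<otimes>\<^bsub>G\<^esub> g) \<in> \<Lambda>" using h by simp
        then show "g \<in> \<Lambda>" using h g by (simp add: G.m_assoc[symmetric])
      qed (use h in simp)
    qed (use h in auto)
  qed
  have tv: "trm ?\<alpha> ?\<alpha> (cut A \<Lambda>) x v k = (if k \<in> carrier G \<and> x = \<rho> (inv\<^bsub>G\<^esub> k) then v k else \<one>\<^bsub>A\<^esub>)"
    if x: "x \<in> T" and v: "v \<in> carrier ?P" for x v k
  proof (cases "k \<in> carrier G")
    case k: True
    have xG: "x \<in> carrier G" using T_closed[OF x] .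
    have "inv\<^bsub>G\<^esub> x \<otimes>\<^bsub>G\<^esub> (x \<otimes>\<^bsub>G\<^esub> k) = k" using xG k by (simp add: G.m_assoc[symmetric])
    then have 1: "trm ?\<alpha> ?\<alpha> (cut A \<Lambda>) x v k = (if x \<otimes>\<^bsub>G\<^esub> k \<in> \<Lambda> then v k else \<one>\<^bsub>A\<^esub>)"
      using xG k by (simp add: trm_def shift_def cut_def)
    have "x \<otimes>\<^bsub>G\<^esub> k \<in> \<Lambda> \<longleftrightarrow> x = \<rho> (inv\<^bsub>G\<^esub> k)"
    proof
      assume "x \<otimes>\<^bsub>G\<^esub> k \<in> \<Lambda>"
      then have "inv\<^bsub>G\<^esub> (inv\<^bsub>G\<^esub> k) \<otimes>\<^bsub>G\<^esub> x \<in> \<Lambda>" using k xG by (simp add: G.m_comm)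
      from rho_eqI[OF _ xG this] show "x = \<rho> (inv\<^bsub>G\<^esub> k)" using k rho_T[OF x] by simp
    next
      assume r: "x = \<rho> (inv\<^bsub>G\<^esub> k)"
      show "x \<otimes>\<^bsub>G\<^esub> k \<in> \<Lambda>" using rho_mem[of "inv\<^bsub>G\<^esub> k"] k xG unfolding r by (simp add: G.m_comm)
    qed
    then show ?thesis using 1 k by simp
  next
    case False
    then show ?thesis by (simp add: trm_def shift_def)
  qed
  have "finite (supp ?P ?\<alpha> ?\<alpha> (cut A \<Lambda>) v) \<and> avg ?P ?\<alpha> ?\<alpha> (cut A \<Lambda>) v = v" if v: "v \<in> carrier ?P" for v
  proof
    let ?s = "supp ?P ?\<alpha> ?\<alpha> (cut A \<Lambda>) v"
    have "?s \<subseteq> (\<lambda>k. \<rho> (inv\<^bsub>G\<^esub> k)) ` {k. v k \<noteq> \<one>\<^bsub>A\<^esub>}"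
    proof
      fix x assume x: "x \<in> ?s"
      then have xT: "x \<in> T" and "trm ?\<alpha> ?\<alpha> (cut A \<Lambda>) x v \<noteq> (\<lambda>_. \<one>\<^bsub>A\<^esub>)" by (auto simp: supp_def fsg_one)
      then obtain k where "trm ?\<alpha> ?\<alpha> (cut A \<Lambda>) x v k \<noteq> \<one>\<^bsub>A\<^esub>" by blast
      then show "x \<in> (\<lambda>k. \<rho> (inv\<^bsub>G\<^esub> k)) ` {k. v k \<noteq> \<one>\<^bsub>A\<^esub>}" unfolding tv[OF xT v] by (auto split: if_splits)
    qed
    then show fin: "finite ?s" using fsg_fin[OF v] finite_surj by blast
    have sT: "?s \<subseteq> T" by (auto simp: supp_def)
    have tc: "trm ?\<alpha> ?\<alpha> (cut A \<Lambda>) x v \<in> carrier ?P" if "x \<in> T" for x by (rule trm_closed[OF g g e T_closed[OF that] v])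
    show "avg ?P ?\<alpha> ?\<alpha> (cut A \<Lambda>) v = v"
    proof
      fix k
      have "avg ?P ?\<alpha> ?\<alpha> (cut A \<Lambda>) v k = finprod A (\<lambda>x. trm ?\<alpha> ?\<alpha> (cut A \<Lambda>) x v k) ?s"
        unfolding avg_def by (rule fsg_finprod[OF A]) (use tc sT in blast)
      also have "\<dots> = v k"
      proof (cases "v k = \<one>\<^bsub>A\<^esub>")
        case True
        have "finprod A (\<lambda>x. trm ?\<alpha> ?\<alpha> (cut A \<Lambda>) x v k) ?s = \<one>\<^bsub>A\<^esub>"
          by (rule A.finprod_one_eqI) (use tv[OF _ v] sT True in auto)
        then show ?thesis using True by simp
      next
        case False
        then have k: "k \<in> carrier G" using fsg_out[OF v] by blast
        let ?x = "\<rho> (inv\<^bsub>G\<^esub> k)"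
        have xT: "?x \<in> T" using k by simp
        have "trm ?\<alpha> ?\<alpha> (cut A \<Lambda>) ?x v k \<noteq> \<one>\<^bsub>A\<^esub>" using tv[OF xT v] False k by simp
        then have xs: "?x \<in> ?s" using xT by (auto simp: supp_def fsg_one)
        have "finprod A (\<lambda>x. trm ?\<alpha> ?\<alpha> (cut A \<Lambda>) x v k) ?s = finprod A (\<lambda>x. if ?x = x then v k else \<one>\<^bsub>A\<^esub>) ?s"
          by (rule A.finprod_cong'[OF refl]) (use tv[OF _ v] sT k fsg_app[OF v] in auto)
        also have "\<dots> = v k" by (rule A.finprod_singleton[OF xs fin]) (use fsg_app[OF v] in auto)
        finally show ?thesis .
      qed
      finally show "avg ?P ?\<alpha> ?\<alpha> (cut A \<Lambda>) v k = v k" .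
    qed
  qed
  then show ?thesis using e by (simp add: splitting_def)
qed

section \<open>The form of a stabilizer code\<close>

locale stab = fixes C :: "('g, 'p) stab_code" assumes code: "stabilizer_code C"
begin

abbreviation "n \<equiv> modulus C"
abbreviation "\<Gamma> \<equiv> site_group C"
abbreviation "M0 \<equiv> local_module C"
abbreviation "P \<equiv> stab_module C"
abbreviation "L \<equiv> stabilizers C"
abbreviation "K \<equiv> amon (Zmod n)"
abbreviation "sh \<equiv> shift \<Gamma> (amon M0)"

lemma n_pos: "n > 0" and Gam: "comm_group \<Gamma>" and fg: "fin_gen_group \<Gamma>" and modM: "Module.module (Zmod n) M0"
  and fgM: "fin_gen_module (Zmod n) M0" and Lsub: "submodule L (group_ring (Zmod n) \<Gamma>) P"
  and bil: "bilinear_form (Zmod n) M0 (local_form C)"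
  using code by (simp_all add: stabilizer_code_def Let_def stab_ring_def)

sublocale G: comm_group \<Gamma> by (rule Gam)

lemma cM: "comm_group (amon M0)"
proof -
  interpret Module.module "Zmod n" M0 by (rule modM)
  show ?thesis using comm_group_amon M.abelian_group_axioms by blast
qed

sublocale K: comm_group K by (rule comm_group_Zmod)

lemma aP: "amon P = fsg (carrier \<Gamma>) (amon M0)" by (simp add: stab_module_def amon_group_module)

lemma gP: "gmodule \<Gamma> n P sh"
  unfolding stab_module_def by (rule gmodule_group_module[OF Gam modM])

sublocale P: gact \<Gamma> n "amon P" sh using gP by (simp add: gmodule_def)

lemma w_right: "a \<in> carrier M0 \<Longrightarrow> (\<lambda>b. local_form C a b) \<in> hom (amon M0) K"
  and w_left: "b \<in> carrier M0 \<Longrightarrow> (\<lambda>a. local_form C a b) \<in> hom (amon M0) K"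
  using bil by (simp_all add: bilinear_form_def module_hom_def hom_amon amon_ring_module)

lemma form_app:
  assumes "m \<in> carrier (amon P)" "\<gamma> \<in> carrier \<Gamma>"
  shows "stab_form C m p \<gamma> = finprod K (\<lambda>l. local_form C (m l) (p (l \<otimes>\<^bsub>\<Gamma>\<^esub> \<gamma>))) {l. m l \<noteq> \<one>\<^bsub>amon M0\<^esub>}"
proof -
  have "{l \<in> carrier \<Gamma>. m l \<noteq> \<zero>\<^bsub>M0\<^esub>} = {l. m l \<noteq> \<one>\<^bsub>amon M0\<^esub>}"
    using fsg_out[OF assms(1)[unfolded aP]] by auto
  then show ?thesis using assms(2) by (simp add: stab_form_def finsum_amon)
qed

lemma form_out: "\<gamma> \<notin> carrier \<Gamma> \<Longrightarrow> stab_form C m p \<gamma> = \<one>\<^bsub>K\<^esub>"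
  by (simp add: stab_form_def)

lemma form_zero_iff: "stab_form C m p = \<zero>\<^bsub>stab_ring C\<^esub> \<longleftrightarrow> (\<forall>\<gamma>\<in>carrier \<Gamma>. stab_form C m p \<gamma> = \<one>\<^bsub>K\<^esub>)"
  using form_out by (auto simp: stab_ring_def group_ring_def fun_eq_iff)

lemma P_app: "p \<in> carrier (amon P) \<Longrightarrow> p l \<in> carrier M0"
  using fsg_app[of p "carrier \<Gamma>" "amon M0" l] by (simp add: aP)

lemma form_left:
  assumes p: "p \<in> carrier (amon P)" and \<gamma>: "\<gamma> \<in> carrier \<Gamma>"
  shows "(\<lambda>m. stab_form C m p \<gamma>) \<in> hom (amon P) K"
    and "\<And>l a. l \<in> carrier \<Gamma> \<Longrightarrow> a \<in> carrier M0 \<Longrightarrow> stab_form C (sng (amon M0) l a) p \<gamma> = local_form C a (p (l \<otimes>\<^bsub>\<Gamma>\<^esub> \<gamma>))"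
proof -
  let ?\<phi> = "\<lambda>l a. local_form C a (p (l \<otimes>\<^bsub>\<Gamma>\<^esub> \<gamma>))"
  have \<phi>: "?\<phi> l \<in> hom (amon M0) K" for l by (rule w_left[OF P_app[OF p]])
  note e = fsg_ext_explicit[OF cM comm_group_Zmod, of "carrier \<Gamma>" ?\<phi>, OF \<phi>]
  have eq: "stab_form C m p \<gamma> = finprod K (\<lambda>l. ?\<phi> l (m l)) {l. m l \<noteq> \<one>\<^bsub>amon M0\<^esub>}" if "m \<in> carrier (fsg (carrier \<Gamma>) (amon M0))" for m
    using form_app[of m \<gamma> p] that \<gamma> by (simp add: aP)
  have c: "m \<otimes>\<^bsub>fsg (carrier \<Gamma>) (amon M0)\<^esub> m' \<in> carrier (fsg (carrier \<Gamma>) (amon M0))"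
    if "m \<in> carrier (fsg (carrier \<Gamma>) (amon M0))" "m' \<in> carrier (fsg (carrier \<Gamma>) (amon M0))" for m m'
    using comm_groupE(1)[OF fsg_comm_group[OF cM]] that by blast
  show "(\<lambda>m. stab_form C m p \<gamma>) \<in> hom (amon P) K"
    unfolding aP
  proof (rule homI)
    fix m assume m: "m \<in> carrier (fsg (carrier \<Gamma>) (amon M0))"
    show "stab_form C m p \<gamma> \<in> carrier K" unfolding eq[OF m] by (rule hom_in_carrier[OF e(1) m])
    fix m' assume m': "m' \<in> carrier (fsg (carrier \<Gamma>) (amon M0))"
    show "stab_form C (m \<otimes>\<^bsub>fsg (carrier \<Gamma>) (amon M0)\<^esub> m') p \<gamma> = stab_form C m p \<gamma> \<otimes>\<^bsub>K\<^esub> stab_form C m' p \<gamma>"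
      unfolding eq[OF m] eq[OF m'] eq[OF c[OF m m']] by (rule hom_mult[OF e(1) m m'])
  qed
  fix l a assume l: "l \<in> carrier \<Gamma>" and a: "a \<in> carrier M0"
  have s: "sng (amon M0) l a \<in> carrier (fsg (carrier \<Gamma>) (amon M0))" using cM l a by simp
  have a': "a \<in> carrier (amon M0)" using a by simp
  show "stab_form C (sng (amon M0) l a) p \<gamma> = local_form C a (p (l \<otimes>\<^bsub>\<Gamma>\<^esub> \<gamma>))"
    unfolding eq[OF s] by (rule e(2)[OF l a'])
qed

lemma form_right:
  assumes m: "m \<in> carrier (amon P)" and \<gamma>: "\<gamma> \<in> carrier \<Gamma>"
  shows "(\<lambda>p. stab_form C m p \<gamma>) \<in> hom (amon P) K"
proof (rule homI)
  let ?S = "{l. m l \<noteq> \<one>\<^bsub>amon M0\<^esub>}"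
  have wc: "local_form C (m l) b \<in> carrier K" if "b \<in> carrier M0" for l b
    using hom_in_carrier[OF w_right[OF P_app[OF m]], of b] that by simp
  fix p assume p: "p \<in> carrier (amon P)"
  show "stab_form C m p \<gamma> \<in> carrier K" by (rule hom_in_carrier[OF form_left(1)[OF p \<gamma>] m])
  fix p' assume p': "p' \<in> carrier (amon P)"
  have "stab_form C m (p \<otimes>\<^bsub>amon P\<^esub> p') \<gamma> = finprod K (\<lambda>l. local_form C (m l) (p (l \<otimes>\<^bsub>\<Gamma>\<^esub> \<gamma>)) \<otimes>\<^bsub>K\<^esub> local_form C (m l) (p' (l \<otimes>\<^bsub>\<Gamma>\<^esub> \<gamma>))) ?S"
    unfolding form_app[OF m \<gamma>]
  proof (rule K.finprod_cong'[OF refl])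
    show "(\<lambda>l. local_form C (m l) (p (l \<otimes>\<^bsub>\<Gamma>\<^esub> \<gamma>)) \<otimes>\<^bsub>K\<^esub> local_form C (m l) (p' (l \<otimes>\<^bsub>\<Gamma>\<^esub> \<gamma>))) \<in> ?S \<rightarrow> carrier K"
      by (intro Pi_I K.m_closed wc P_app p p')
    fix l
    have c: "p (l \<otimes>\<^bsub>\<Gamma>\<^esub> \<gamma>) \<in> carrier (amon M0)" "p' (l \<otimes>\<^bsub>\<Gamma>\<^esub> \<gamma>) \<in> carrier (amon M0)" using P_app[OF p] P_app[OF p'] by simp_all
    have "(p \<otimes>\<^bsub>amon P\<^esub> p') (l \<otimes>\<^bsub>\<Gamma>\<^esub> \<gamma>) = p (l \<otimes>\<^bsub>\<Gamma>\<^esub> \<gamma>) \<otimes>\<^bsub>amon M0\<^esub> p' (l \<otimes>\<^bsub>\<Gamma>\<^esub> \<gamma>)" unfolding aP fsg_mult ..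
    then show "local_form C (m l) ((p \<otimes>\<^bsub>amon P\<^esub> p') (l \<otimes>\<^bsub>\<Gamma>\<^esub> \<gamma>)) = local_form C (m l) (p (l \<otimes>\<^bsub>\<Gamma>\<^esub> \<gamma>)) \<otimes>\<^bsub>K\<^esub> local_form C (m l) (p' (l \<otimes>\<^bsub>\<Gamma>\<^esub> \<gamma>))"
      using hom_mult[OF w_right[OF P_app[OF m]] c] by (simp only:)
  qed
  also have "\<dots> = stab_form C m p \<gamma> \<otimes>\<^bsub>K\<^esub> stab_form C m p' \<gamma>"
    unfolding form_app[OF m \<gamma>] by (rule K.finprod_multf) (intro Pi_I wc P_app p p')+
  finally show "stab_form C m (p \<otimes>\<^bsub>amon P\<^esub> p') \<gamma> = stab_form C m p \<gamma> \<otimes>\<^bsub>K\<^esub> stab_form C m p' \<gamma>" .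
qed

text \<open>The form is linear in its second argument and, by \<open>form_shift_left\<close>,
  antilinear in its first; both are stated on coefficients for the action of monomials.\<close>

lemma form_shift_right:
  assumes m: "m \<in> carrier (amon P)" and p: "p \<in> carrier (amon P)" and g: "g \<in> carrier \<Gamma>" and \<gamma>: "\<gamma> \<in> carrier \<Gamma>"
  shows "stab_form C m (sh g p) \<gamma> = stab_form C m p (inv\<^bsub>\<Gamma>\<^esub> g \<otimes>\<^bsub>\<Gamma>\<^esub> \<gamma>)"
proof -
  have ig: "inv\<^bsub>\<Gamma>\<^esub> g \<otimes>\<^bsub>\<Gamma>\<^esub> \<gamma> \<in> carrier \<Gamma>" using g \<gamma> by simp
  show ?thesis
    unfolding form_app[OF m \<gamma>] form_app[OF m ig]
  proof (rule K.finprod_cong'[OF refl])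
    have wc: "local_form C (m l) b \<in> carrier K" if "b \<in> carrier M0" for l b
      using hom_in_carrier[OF w_right[OF P_app[OF m]], of b] that by simp
    show "(\<lambda>l. local_form C (m l) (p (l \<otimes>\<^bsub>\<Gamma>\<^esub> (inv\<^bsub>\<Gamma>\<^esub> g \<otimes>\<^bsub>\<Gamma>\<^esub> \<gamma>)))) \<in> {l. m l \<noteq> \<one>\<^bsub>amon M0\<^esub>} \<rightarrow> carrier K"
      by (intro Pi_I wc P_app p)
    fix l assume "l \<in> {l. m l \<noteq> \<one>\<^bsub>amon M0\<^esub>}"
    then have l: "l \<in> carrier \<Gamma>" using fsg_out[OF m[unfolded aP]] by blast
    then show "local_form C (m l) (sh g p (l \<otimes>\<^bsub>\<Gamma>\<^esub> \<gamma>)) = local_form C (m l) (p (l \<otimes>\<^bsub>\<Gamma>\<^esub> (inv\<^bsub>\<Gamma>\<^esub> g \<otimes>\<^bsub>\<Gamma>\<^esub> \<gamma>)))"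
      using g \<gamma> by (simp add: shift_def G.m_lcomm)
  qed
qed

lemma form_shift_left:
  assumes m: "m \<in> carrier (amon P)" and p: "p \<in> carrier (amon P)" and g: "g \<in> carrier \<Gamma>" and \<gamma>: "\<gamma> \<in> carrier \<Gamma>"
  shows "stab_form C (sh g m) p \<gamma> = stab_form C m p (g \<otimes>\<^bsub>\<Gamma>\<^esub> \<gamma>)"
proof -
  have gg: "g \<otimes>\<^bsub>\<Gamma>\<^esub> \<gamma> \<in> carrier \<Gamma>" using g \<gamma> by simp
  show ?thesis
  proof (rule fsg_hom_eq[OF cM comm_group_Zmod _ _ _ m[unfolded aP]])
    show "(\<lambda>m. stab_form C (sh g m) p \<gamma>) \<in> hom (fsg (carrier \<Gamma>) (amon M0)) K"
      unfolding aP[symmetric] by (rule hom_comp_fun[OF P.act_hom[OF g] form_left(1)[OF p \<gamma>]])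
    show "(\<lambda>m. stab_form C m p (g \<otimes>\<^bsub>\<Gamma>\<^esub> \<gamma>)) \<in> hom (fsg (carrier \<Gamma>) (amon M0)) K"
      unfolding aP[symmetric] by (rule form_left(1)[OF p gg])
    fix l a assume l: "l \<in> carrier \<Gamma>" and "a \<in> carrier (amon M0)"
    then have a: "a \<in> carrier M0" by simp
    have gl: "g \<otimes>\<^bsub>\<Gamma>\<^esub> l \<in> carrier \<Gamma>" using g l by simp
    show "stab_form C (sh g (sng (amon M0) l a)) p \<gamma> = stab_form C (sng (amon M0) l a) p (g \<otimes>\<^bsub>\<Gamma>\<^esub> \<gamma>)"
      unfolding shift_sng[OF Gam g l] form_left(2)[OF p \<gamma> gl a] form_left(2)[OF p gg l a]
      using g l \<gamma> by (simp add: G.m_assoc G.m_lcomm)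
  qed
qed

text \<open>The coefficient at \<open>\<gamma>\<close> can be nonzero only if
  \<open>\<gamma>\<close> is a quotient of a point in the support of \<open>p\<close> by a point in
  the support of \<open>m\<close>.\<close>

lemma form_RG:
  assumes m: "m \<in> carrier (amon P)" and p: "p \<in> carrier (amon P)"
  shows "stab_form C m p \<in> carrier (RG \<Gamma> n)"
  unfolding RG_def
proof (rule fsgI)
  let ?S = "(\<lambda>(l, k). inv\<^bsub>\<Gamma>\<^esub> l \<otimes>\<^bsub>\<Gamma>\<^esub> k) ` ({l. m l \<noteq> \<one>\<^bsub>amon M0\<^esub>} \<times> {k. p k \<noteq> \<one>\<^bsub>amon M0\<^esub>})"
  show "finite ?S" using fsg_fin[OF m[unfolded aP]] fsg_fin[OF p[unfolded aP]] by simp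
  fix \<gamma>
  show "stab_form C m p \<gamma> \<in> carrier K"
    using hom_in_carrier[OF form_left(1)[OF p] m] form_out[of \<gamma> m p] K.one_closed by (cases "\<gamma> \<in> carrier \<Gamma>") auto
  assume nz: "stab_form C m p \<gamma> \<noteq> \<one>\<^bsub>K\<^esub>"
  show \<gamma>: "\<gamma> \<in> carrier \<Gamma>" using nz form_out by blast
  have "\<exists>l. m l \<noteq> \<one>\<^bsub>amon M0\<^esub> \<and> local_form C (m l) (p (l \<otimes>\<^bsub>\<Gamma>\<^esub> \<gamma>)) \<noteq> \<one>\<^bsub>K\<^esub>"
  proof (rule ccontr)
    assume "\<nexists>l. m l \<noteq> \<one>\<^bsub>amon M0\<^esub> \<and> local_form C (m l) (p (l \<otimes>\<^bsub>\<Gamma>\<^esub> \<gamma>)) \<noteq> \<one>\<^bsub>K\<^esub>"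
    then have "stab_form C m p \<gamma> = \<one>\<^bsub>K\<^esub>"
      unfolding form_app[OF m \<gamma>] by (intro K.finprod_one_eqI) blast
    then show False using nz by simp
  qed
  then obtain l where l: "m l \<noteq> \<one>\<^bsub>amon M0\<^esub>" "local_form C (m l) (p (l \<otimes>\<^bsub>\<Gamma>\<^esub> \<gamma>)) \<noteq> \<one>\<^bsub>K\<^esub>" by blast
  have lG: "l \<in> carrier \<Gamma>" using l fsg_out[OF m[unfolded aP]] by blast
  have "local_form C (m l) \<one>\<^bsub>amon M0\<^esub> = \<one>\<^bsub>K\<^esub>"
    by (rule hom_one[OF w_right[OF P_app[OF m]] comm_group.axioms(2)[OF cM] comm_group.axioms(2)[OF comm_group_Zmod]])
  then have "p (l \<otimes>\<^bsub>\<Gamma>\<^esub> \<gamma>) \<noteq> \<one>\<^bsub>amon M0\<^esub>" using l(2) by metis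
  moreover have "\<gamma> = inv\<^bsub>\<Gamma>\<^esub> l \<otimes>\<^bsub>\<Gamma>\<^esub> (l \<otimes>\<^bsub>\<Gamma>\<^esub> \<gamma>)" using lG \<gamma> by (simp add: G.m_assoc[symmetric])
  ultimately show "\<gamma> \<in> ?S" using l(1) by (intro image_eqI[where x="(l, l \<otimes>\<^bsub>\<Gamma>\<^esub> \<gamma>)"]) auto
qed

text \<open>By Noetherianity finitely many elements \<open>m\<close> of \<open>L\<^sup>\<omega>\<close> already cut out \<open>L = L\<^sup>\<omega>\<^sup>\<omega>\<close>, so that \<open>P/L\<close> embeds into a
  finitely generated free module via the \<open>\<omega>(m, \<cdot>)\<close>.\<close>

lemma ex_embedding:
  fixes \<kappa> :: "nat \<Rightarrow> 'u"
  assumes sat: "saturated C" and \<kappa>: "inj \<kappa>"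
  shows "\<exists>(B :: 'u set) E. E \<in> ehom (carrier \<Gamma>) (amon P) (\<lambda>g. sh (inv\<^bsub>\<Gamma>\<^esub> g)) (FR \<Gamma> n B) (fsh \<Gamma> n) \<and>
    (\<forall>p\<in>carrier P. E p = \<one>\<^bsub>FR \<Gamma> n B\<^esub> \<longleftrightarrow> p \<in> L)"
proof -
  let ?PA = "fsg (carrier \<Gamma>) (amon M0)"
  have cPA: "carrier P = carrier (amon P)" by simp
  define W where "W = form_orthogonal C L"
  have LP: "L \<subseteq> carrier (amon P)" using subgroup.subset[OF gmodule_submodule(1)[OF gP Lsub]] .
  have W: "p \<in> W \<longleftrightarrow> p \<in> carrier (amon P) \<and> (\<forall>m\<in>L. \<forall>\<gamma>\<in>carrier \<Gamma>. stab_form C m p \<gamma> = \<one>\<^bsub>K\<^esub>)" for p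
    unfolding W_def form_orthogonal_def form_zero_iff cPA by simp
  have LW: "p \<in> L \<longleftrightarrow> p \<in> carrier (amon P) \<and> (\<forall>m\<in>W. \<forall>\<gamma>\<in>carrier \<Gamma>. stab_form C m p \<gamma> = \<one>\<^bsub>K\<^esub>)" for p
    using sat unfolding saturated_def W_def[symmetric] form_orthogonal_def[of C W] form_zero_iff cPA by blast
  have WP: "W \<subseteq> carrier (amon P)" using W by blast
  have gh_right: "group_hom (amon P) K (\<lambda>p. stab_form C m p \<gamma>)" if "m \<in> carrier (amon P)" "\<gamma> \<in> carrier \<Gamma>" for m \<gamma>
    using form_right[OF that] by (simp add: group_hom_def group_hom_axioms_def P.A.group_axioms K.group_axioms)
  have gh_left: "group_hom (amon P) K (\<lambda>m. stab_form C m p \<gamma>)" if "p \<in> carrier (amon P)" "\<gamma> \<in> carrier \<Gamma>" for p \<gamma>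
    using form_left(1)[OF that] by (simp add: group_hom_def group_hom_axioms_def P.A.group_axioms K.group_axioms)
  have Wsub: "subgroup W (amon P)"
  proof (rule P.A.subgroupI)
    have "\<one>\<^bsub>amon P\<^esub> \<in> W" unfolding W using group_hom.hom_one[OF gh_right] LP P.A.one_closed by blast
    then show "W \<noteq> {}" by blast
    show "inv\<^bsub>amon P\<^esub> a \<in> W" if a: "a \<in> W" for a
      unfolding W
    proof (intro conjI ballI)
      have aP: "a \<in> carrier (amon P)" using a WP by blast
      show "inv\<^bsub>amon P\<^esub> a \<in> carrier (amon P)" by (rule P.A.inv_closed[OF aP])
      fix m \<gamma> assume m: "m \<in> L" and \<gamma>: "\<gamma> \<in> carrier \<Gamma>"
      have "stab_form C m a \<gamma> = \<one>\<^bsub>K\<^esub>" using a m \<gamma> W by blast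
      then show "stab_form C m (inv\<^bsub>amon P\<^esub> a) \<gamma> = \<one>\<^bsub>K\<^esub>"
        using group_hom.hom_inv[OF gh_right[OF subsetD[OF LP m] \<gamma>] aP] K.inv_one by metis
    qed
    show "a \<otimes>\<^bsub>amon P\<^esub> b \<in> W" if a: "a \<in> W" and b: "b \<in> W" for a b
      unfolding W
    proof (intro conjI ballI)
      have c: "a \<in> carrier (amon P)" "b \<in> carrier (amon P)" using a b WP by blast+
      show "a \<otimes>\<^bsub>amon P\<^esub> b \<in> carrier (amon P)" by (rule P.A.m_closed[OF c])
      fix m \<gamma> assume m: "m \<in> L" and \<gamma>: "\<gamma> \<in> carrier \<Gamma>"
      have "stab_form C m a \<gamma> = \<one>\<^bsub>K\<^esub>" "stab_form C m b \<gamma> = \<one>\<^bsub>K\<^esub>" using a b m \<gamma> W by blast+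
      then show "stab_form C m (a \<otimes>\<^bsub>amon P\<^esub> b) \<gamma> = \<one>\<^bsub>K\<^esub>"
        using group_hom.hom_mult[OF gh_right[OF subsetD[OF LP m] \<gamma>] c] K.l_one[OF K.one_closed] by metis
    qed
  qed (rule WP)
  have Wsh: "sh g ` W \<subseteq> W" if g: "g \<in> carrier \<Gamma>" for g
  proof
    fix y assume "y \<in> sh g ` W"
    then obtain p where p: "p \<in> W" "y = sh g p" by blast
    have pP: "p \<in> carrier (amon P)" using p WP by blast
    show "y \<in> W" unfolding W p(2)
    proof (intro conjI ballI)
      show "sh g p \<in> carrier (amon P)" by (rule P.act_closed[OF g pP])
      fix m \<gamma> assume m: "m \<in> L" and \<gamma>: "\<gamma> \<in> carrier \<Gamma>"
      have "inv\<^bsub>\<Gamma>\<^esub> g \<otimes>\<^bsub>\<Gamma>\<^esub> \<gamma> \<in> carrier \<Gamma>" using g \<gamma> by simp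
      then show "stab_form C m (sh g p) \<gamma> = \<one>\<^bsub>K\<^esub>"
        unfolding form_shift_right[OF subsetD[OF LP m] pP g \<gamma>] using p(1) m W by blast
    qed
  qed
  have finM: "finite (carrier (amon M0))"
    using finite_fin_gen_module[OF modM finite_Zmod[OF n_pos] fgM] by simp
  obtain S where S: "finite S" "S \<subseteq> W"
    and Sgen: "\<And>U. subgroup U (amon P) \<Longrightarrow> (\<And>g. g \<in> carrier \<Gamma> \<Longrightarrow> sh g ` U \<subseteq> U) \<Longrightarrow> S \<subseteq> U \<Longrightarrow> W \<subseteq> U"
  proof (rule fsg_noetherian[OF Gam fg cM finM Wsub[unfolded aP]])
    show "sh g ` W \<subseteq> W" if "g \<in> carrier \<Gamma>" for g by (rule Wsh[OF that])
  next
    fix S assume fin: "finite S" and sub: "S \<subseteq> W"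
      and gen: "\<And>U. subgroup U (fsg (carrier \<Gamma>) (amon M0)) \<Longrightarrow> (\<And>g. g \<in> carrier \<Gamma> \<Longrightarrow> sh g ` U \<subseteq> U) \<Longrightarrow> S \<subseteq> U \<Longrightarrow> W \<subseteq> U"
    show thesis by (rule that) (fact fin, fact sub, fact gen[folded aP])
  qed
  have SP: "S \<subseteq> carrier (amon P)" using S WP by blast
  obtain c0 :: "('g \<Rightarrow> 'p) \<Rightarrow> nat" where c0: "inj_on c0 S" using finite_imp_inj_to_nat_seg[OF S(1)] by blast
  \<comment> \<open>The set \<open>S\<close> is renamed through the natural numbers into a
    prescribed basis type, so that the embedding can be attached to a resolution. Finiteness of
    \<open>S\<close> matters because elements of a free module have almost all components
    trivial.\<close>
  define B where "B = (\<kappa> \<circ> c0) ` S"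
  define mm where "mm = inv_into S (\<kappa> \<circ> c0)"
  have inj: "inj_on (\<kappa> \<circ> c0) S" using c0 \<kappa> by (simp add: comp_inj_on inj_on_subset)
  have mmS: "mm b \<in> S" if "b \<in> B" for b using that inv_into_into[of b "\<kappa> \<circ> c0" S] by (simp add: B_def mm_def)
  have mmsurj: "\<exists>b\<in>B. mm b = m" if "m \<in> S" for m
    using that inv_into_f_f[OF inj that] unfolding B_def mm_def by blast
  have mmP: "mm b \<in> carrier (amon P)" if "b \<in> B" for b using mmS[OF that] SP by blast
  have finB: "finite B" using S(1) by (simp add: B_def)
  \<comment> \<open>The functional \<open>\<omega>(m, \<cdot>)\<close> is linear for the original
    action on \<open>P\<close>; the antipode makes it equivariant for the inverted action, the one
    that belongs to the twisted quotient.\<close>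
  define \<theta> where "\<theta> m p = antipode (Zmod n) \<Gamma> (stab_form C m p)" for m p
  have \<theta>: "\<theta> m p k = (if k \<in> carrier \<Gamma> then stab_form C m p (inv\<^bsub>\<Gamma>\<^esub> k) else \<one>\<^bsub>K\<^esub>)" for m p k
    by (simp add: \<theta>_def antipode_def)
  have \<theta>c: "\<theta> m p \<in> carrier (RG \<Gamma> n)" if "m \<in> carrier (amon P)" "p \<in> carrier (amon P)" for m p
    unfolding RG_def
  proof (rule fsgI)
    note r = form_RG[OF that, unfolded RG_def]
    show "finite ((\<lambda>k. inv\<^bsub>\<Gamma>\<^esub> k) ` {k. stab_form C m p k \<noteq> \<one>\<^bsub>K\<^esub>})" using fsg_fin[OF r] by simp
    fix k
    show "\<theta> m p k \<in> carrier K" unfolding \<theta> using fsg_app[OF r] K.one_closed by auto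
    assume nz: "\<theta> m p k \<noteq> \<one>\<^bsub>K\<^esub>"
    then show k: "k \<in> carrier \<Gamma>" unfolding \<theta> by presburger
    show "k \<in> (\<lambda>k. inv\<^bsub>\<Gamma>\<^esub> k) ` {k. stab_form C m p k \<noteq> \<one>\<^bsub>K\<^esub>}"
    proof (rule image_eqI)
      show "k = inv\<^bsub>\<Gamma>\<^esub> (inv\<^bsub>\<Gamma>\<^esub> k)" using k by simp
      show "inv\<^bsub>\<Gamma>\<^esub> k \<in> {k. stab_form C m p k \<noteq> \<one>\<^bsub>K\<^esub>}" using nz k unfolding \<theta> by simp
    qed
  qed
  interpret N: gact \<Gamma> n "RG \<Gamma> n" "rsh \<Gamma> n" by (rule gact_RG[OF Gam])
  define E where "E p = (\<lambda>b. if b \<in> B then \<theta> (mm b) p else \<one>\<^bsub>RG \<Gamma> n\<^esub>)" for p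
  have Ec: "E p \<in> carrier (FR \<Gamma> n B)" if p: "p \<in> carrier (amon P)" for p
    unfolding FR_def
  proof (rule fsgI[where S=B])
    show "E p b \<in> carrier (RG \<Gamma> n)" for b
      unfolding E_def using \<theta>c[OF mmP p, of b] N.A.one_closed by presburger
    show "b \<in> B" if "E p b \<noteq> \<one>\<^bsub>RG \<Gamma> n\<^esub>" for b using that unfolding E_def by presburger
    show "b \<in> B" if "E p b \<noteq> \<one>\<^bsub>RG \<Gamma> n\<^esub>" for b using that unfolding E_def by presburger
  qed (rule finB)
  have Ehom: "E \<in> hom (amon P) (FR \<Gamma> n B)"
  proof (rule homI)
    fix p p' assume p: "p \<in> carrier (amon P)" and p': "p' \<in> carrier (amon P)"
    show "E (p \<otimes>\<^bsub>amon P\<^esub> p') = E p \<otimes>\<^bsub>FR \<Gamma> n B\<^esub> E p'"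
    proof
      fix b
      have "\<theta> (mm b) (p \<otimes>\<^bsub>amon P\<^esub> p') = \<theta> (mm b) p \<otimes>\<^bsub>RG \<Gamma> n\<^esub> \<theta> (mm b) p'" if b: "b \<in> B"
      proof
        fix k
        have e: "(\<theta> (mm b) p \<otimes>\<^bsub>RG \<Gamma> n\<^esub> \<theta> (mm b) p') k = \<theta> (mm b) p k \<otimes>\<^bsub>K\<^esub> \<theta> (mm b) p' k" by (simp add: RG_def fsg_mult)
        show "\<theta> (mm b) (p \<otimes>\<^bsub>amon P\<^esub> p') k = (\<theta> (mm b) p \<otimes>\<^bsub>RG \<Gamma> n\<^esub> \<theta> (mm b) p') k"
        proof (cases "k \<in> carrier \<Gamma>")
          case True
          then show ?thesis unfolding e \<theta> if_P[OF True] by (intro hom_mult[OF form_right[OF mmP[OF b]] p p']) simp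
        next
          case False
          show ?thesis unfolding e \<theta> if_not_P[OF False] by (rule K.l_one[OF K.one_closed, symmetric])
        qed
      qed
      moreover have "\<one>\<^bsub>RG \<Gamma> n\<^esub> = \<one>\<^bsub>RG \<Gamma> n\<^esub> \<otimes>\<^bsub>RG \<Gamma> n\<^esub> \<one>\<^bsub>RG \<Gamma> n\<^esub>" by simp
      ultimately show "E (p \<otimes>\<^bsub>amon P\<^esub> p') b = (E p \<otimes>\<^bsub>FR \<Gamma> n B\<^esub> E p') b" by (simp add: E_def FR_def fsg_mult)
    qed
  qed (rule Ec)
  have Eeq: "E (sh (inv\<^bsub>\<Gamma>\<^esub> g) p) = fsh \<Gamma> n g (E p)" if g: "g \<in> carrier \<Gamma>" and p: "p \<in> carrier (amon P)" for g p
  proof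
    fix b
    have "\<theta> (mm b) (sh (inv\<^bsub>\<Gamma>\<^esub> g) p) = rsh \<Gamma> n g (\<theta> (mm b) p)" if b: "b \<in> B"
    proof
      fix k
      show "\<theta> (mm b) (sh (inv\<^bsub>\<Gamma>\<^esub> g) p) k = rsh \<Gamma> n g (\<theta> (mm b) p) k"
      proof (cases "k \<in> carrier \<Gamma>")
        case True
        have i: "inv\<^bsub>\<Gamma>\<^esub> g \<in> carrier \<Gamma>" "inv\<^bsub>\<Gamma>\<^esub> k \<in> carrier \<Gamma>" using g True by simp_all
        have gk: "inv\<^bsub>\<Gamma>\<^esub> g \<otimes>\<^bsub>\<Gamma>\<^esub> k \<in> carrier \<Gamma>" using g True by simp
        have "inv\<^bsub>\<Gamma>\<^esub> (inv\<^bsub>\<Gamma>\<^esub> g) \<otimes>\<^bsub>\<Gamma>\<^esub> inv\<^bsub>\<Gamma>\<^esub> k = inv\<^bsub>\<Gamma>\<^esub> (inv\<^bsub>\<Gamma>\<^esub> g \<otimes>\<^bsub>\<Gamma>\<^esub> k)" using G.inv_mult[OF i(1) True] by simp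
        then have "\<theta> (mm b) (sh (inv\<^bsub>\<Gamma>\<^esub> g) p) k = \<theta> (mm b) p (inv\<^bsub>\<Gamma>\<^esub> g \<otimes>\<^bsub>\<Gamma>\<^esub> k)"
          unfolding \<theta> if_P[OF True] if_P[OF gk] form_shift_right[OF mmP[OF b] p i] by simp
        then show ?thesis unfolding rsh_def shift_def if_P[OF True] .
      qed (simp add: \<theta> rsh_def shift_def)
    qed
    moreover have "rsh \<Gamma> n g \<one>\<^bsub>RG \<Gamma> n\<^esub> = \<one>\<^bsub>RG \<Gamma> n\<^esub>" by (rule N.act_unit[OF g])
    ultimately show "E (sh (inv\<^bsub>\<Gamma>\<^esub> g) p) b = fsh \<Gamma> n g (E p) b" by (simp add: E_def fsh_def)
  qed
  have ker: "E p = \<one>\<^bsub>FR \<Gamma> n B\<^esub> \<longleftrightarrow> p \<in> L" if p: "p \<in> carrier (amon P)" for p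
  proof
    assume E1: "E p = \<one>\<^bsub>FR \<Gamma> n B\<^esub>"
    \<comment> \<open>The elements that annihilate \<open>p\<close> form an invariant subgroup.
      Containing the generators \<open>S\<close> it contains \<open>W\<close>, which puts
      \<open>p\<close> into the double orthogonal of \<open>L\<close>, that is into
      \<open>L\<close>.\<close>
    let ?U = "{m \<in> carrier (amon P). \<forall>\<gamma>\<in>carrier \<Gamma>. stab_form C m p \<gamma> = \<one>\<^bsub>K\<^esub>}"
    have SU: "S \<subseteq> ?U"
    proof
      fix m assume m: "m \<in> S"
      then obtain b where b: "b \<in> B" "mm b = m" using mmsurj by blast
      have "\<theta> m p = \<one>\<^bsub>RG \<Gamma> n\<^esub>" using fun_cong[OF E1, of b] b by (simp add: E_def FR_def fsg_one)
      then have t1: "\<theta> m p k = \<one>\<^bsub>K\<^esub>" for k by (simp add: RG_def fsg_one)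
      have "stab_form C m p \<gamma> = \<one>\<^bsub>K\<^esub>" if \<gamma>: "\<gamma> \<in> carrier \<Gamma>" for \<gamma>
      proof -
        have "inv\<^bsub>\<Gamma>\<^esub> \<gamma> \<in> carrier \<Gamma>" using \<gamma> by simp
        then show ?thesis using t1[of "inv\<^bsub>\<Gamma>\<^esub> \<gamma>"] \<gamma> unfolding \<theta> by simp
      qed
      then show "m \<in> ?U" using m SP by blast
    qed
    have U: "subgroup ?U (amon P)"
    proof (rule P.A.subgroupI)
      have "\<one>\<^bsub>amon P\<^esub> \<in> ?U" using group_hom.hom_one[OF gh_left[OF p]] P.A.one_closed by blast
      then show "?U \<noteq> {}" by blast
      show "inv\<^bsub>amon P\<^esub> a \<in> ?U" if "a \<in> ?U" for a
      proof -
        have a: "a \<in> carrier (amon P)" "\<And>\<gamma>. \<gamma> \<in> carrier \<Gamma> \<Longrightarrow> stab_form C a p \<gamma> = \<one>\<^bsub>K\<^esub>" using that by blast+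
        have "stab_form C (inv\<^bsub>amon P\<^esub> a) p \<gamma> = \<one>\<^bsub>K\<^esub>" if \<gamma>: "\<gamma> \<in> carrier \<Gamma>" for \<gamma>
          using group_hom.hom_inv[OF gh_left[OF p \<gamma>] a(1)] a(2)[OF \<gamma>] K.inv_one by metis
        then show ?thesis using P.A.inv_closed[OF a(1)] by blast
      qed
      show "a \<otimes>\<^bsub>amon P\<^esub> b \<in> ?U" if "a \<in> ?U" "b \<in> ?U" for a b
      proof -
        have a: "a \<in> carrier (amon P)" "\<And>\<gamma>. \<gamma> \<in> carrier \<Gamma> \<Longrightarrow> stab_form C a p \<gamma> = \<one>\<^bsub>K\<^esub>"
          and b: "b \<in> carrier (amon P)" "\<And>\<gamma>. \<gamma> \<in> carrier \<Gamma> \<Longrightarrow> stab_form C b p \<gamma> = \<one>\<^bsub>K\<^esub>" using that by blast+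
        have "stab_form C (a \<otimes>\<^bsub>amon P\<^esub> b) p \<gamma> = \<one>\<^bsub>K\<^esub>" if \<gamma>: "\<gamma> \<in> carrier \<Gamma>" for \<gamma>
          using group_hom.hom_mult[OF gh_left[OF p \<gamma>] a(1) b(1)] a(2)[OF \<gamma>] b(2)[OF \<gamma>] K.l_one[OF K.one_closed] by metis
        then show ?thesis using P.A.m_closed[OF a(1) b(1)] by blast
      qed
    qed blast
    have Ush: "sh g ` ?U \<subseteq> ?U" if g: "g \<in> carrier \<Gamma>" for g
    proof
      fix y assume "y \<in> sh g ` ?U"
      then obtain m where m: "m \<in> carrier (amon P)" "\<And>\<gamma>. \<gamma> \<in> carrier \<Gamma> \<Longrightarrow> stab_form C m p \<gamma> = \<one>\<^bsub>K\<^esub>" "y = sh g m" by blast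
      have "stab_form C y p \<gamma> = \<one>\<^bsub>K\<^esub>" if \<gamma>: "\<gamma> \<in> carrier \<Gamma>" for \<gamma>
        unfolding m(3) form_shift_left[OF m(1) p g \<gamma>] by (rule m(2)) (use g \<gamma> in simp)
      moreover have "y \<in> carrier (amon P)" unfolding m(3) by (rule P.act_closed[OF g m(1)])
      ultimately show "y \<in> ?U" by blast
    qed
    have "W \<subseteq> ?U" by (rule Sgen[OF U Ush SU])
    then show "p \<in> L" unfolding LW using p by blast
  next
    assume pL: "p \<in> L"
    show "E p = \<one>\<^bsub>FR \<Gamma> n B\<^esub>"
    proof
      fix b
      have "\<theta> (mm b) p = \<one>\<^bsub>RG \<Gamma> n\<^esub>" if b: "b \<in> B"
      proof
        fix k
        have "mm b \<in> W" using mmS[OF b] S(2) by blast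
        then have z: "stab_form C (mm b) p \<gamma> = \<one>\<^bsub>K\<^esub>" if "\<gamma> \<in> carrier \<Gamma>" for \<gamma> using pL that LW by blast
        have "\<theta> (mm b) p k = \<one>\<^bsub>K\<^esub>"
        proof (cases "k \<in> carrier \<Gamma>")
          case True
          then show ?thesis unfolding \<theta> if_P[OF True] by (intro z) simp
        qed (simp add: \<theta>)
        then show "\<theta> (mm b) p k = \<one>\<^bsub>RG \<Gamma> n\<^esub> k" by (simp add: RG_def fsg_one)
      qed
      then show "E p b = \<one>\<^bsub>FR \<Gamma> n B\<^esub> b" by (simp add: E_def FR_def fsg_one)
    qed
  qed
  have "E \<in> ehom (carrier \<Gamma>) (amon P) (\<lambda>g. sh (inv\<^bsub>\<Gamma>\<^esub> g)) (FR \<Gamma> n B) (fsh \<Gamma> n)"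
    unfolding ehom_def using Ehom Eeq by blast
  then show ?thesis
  proof (intro exI[where x=B] exI[where x=E] conjI ballI)
    show "E p = \<one>\<^bsub>FR \<Gamma> n B\<^esub> \<longleftrightarrow> p \<in> L" if "p \<in> carrier P" for p by (rule ker) (use that in simp)
  qed
qed

end

section \<open>Vanishing of the charge modules\<close>

text \<open>Because \<open>\<tau>\<close> covers \<open>\<sigma>\<close>, it maps the kernel of
  \<open>e\<close> to itself. By exactness this kernel is the image of \<open>d\<close>, as
  \<open>splitting_lift\<close> requires.\<close>

lemma (in transversal) splitting_lift_next:
  assumes A: "gact G n A \<alpha>" and \<sigma>: "splitting n A \<alpha> \<sigma>" and e: "e \<in> ehom (carrier G) (FR G n B) (fsh G n) A \<alpha>"
    and \<tau>: "splitting n (FR G n B) (fsh G n) \<tau>" and comm: "\<And>v. v \<in> carrier (FR G n B) \<Longrightarrow> e (\<tau> v) = \<sigma> (e v)"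
    and d: "d \<in> ehom (carrier G) (FR G n B') (fsh G n) (FR G n B) (fsh G n)"
    and ker: "d ` carrier (FR G n B') = {x \<in> carrier (FR G n B). e x = \<one>\<^bsub>A\<^esub>}"
  shows "\<exists>\<tau>'. splitting n (FR G n B') (fsh G n) \<tau>' \<and> (\<forall>v\<in>carrier (FR G n B'). d (\<tau>' v) = \<tau> (d v))"
proof -
  interpret A: gact G n A \<alpha> by (rule A)
  have F: "gact G n (FR G n B) (fsh G n)" by (rule gact_FR[OF G.comm_group_axioms])
  have \<tau>e: "\<tau> \<in> ehom \<Lambda> (FR G n B) (fsh G n) (FR G n B) (fsh G n)" using \<tau> by (simp add: splitting_def)
  have \<sigma>e: "\<sigma> \<in> ehom \<Lambda> A \<alpha> A \<alpha>" using \<sigma> by (simp add: splitting_def)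
  have im: "\<tau> (d v) \<in> d ` carrier (FR G n B')" if v: "v \<in> carrier (FR G n B')" for v
  proof -
    have dv: "d v \<in> carrier (FR G n B)" by (rule ehom_closed[OF d v])
    have "e (d v) = \<one>\<^bsub>A\<^esub>" using ker v by blast
    then have "e (\<tau> (d v)) = \<one>\<^bsub>A\<^esub>"
      using comm[OF dv] hom_one[OF ehom_hom[OF \<sigma>e] A.A.group_axioms A.A.group_axioms] by simp
    then show ?thesis unfolding ker using ehom_closed[OF \<tau>e dv] by blast
  qed
  show ?thesis
  proof (rule splitting_lift[OF F \<tau> d im])
    fix \<tau>' assume "splitting n (FR G n B') (fsh G n) \<tau>'" and "\<And>v. v \<in> carrier (FR G n B') \<Longrightarrow> d (\<tau>' v) = \<tau> (d v)"
    then show ?thesis by (intro exI[where x=\<tau>']) simp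
  qed
qed

text \<open>The induction carries two adjacent splittings and their compatibility, since the next
  lift needs the lower one to see that a kernel is preserved.\<close>

lemma (in transversal) splitting_resolution:
  assumes M: "gact G n M \<alpha>" and sp: "splitting n M \<alpha> \<pi>"
    and e: "e \<in> ehom (carrier G) (FR G n (B 0)) (fsh G n) M \<alpha>" and surj: "e ` carrier (FR G n (B 0)) = carrier M"
    and d: "\<And>k. d k \<in> ehom (carrier G) (FR G n (B (Suc k))) (fsh G n) (FR G n (B k)) (fsh G n)"
    and ex0: "d 0 ` carrier (FR G n (B 1)) = {x \<in> carrier (FR G n (B 0)). e x = \<one>\<^bsub>M\<^esub>}"
    and ex: "\<And>k. d (Suc k) ` carrier (FR G n (B (Suc (Suc k)))) = {x \<in> carrier (FR G n (B (Suc k))). d k x = \<one>\<^bsub>FR G n (B k)\<^esub>}"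
  shows "\<exists>\<sigma> \<tau>. splitting n (FR G n (B k)) (fsh G n) \<sigma> \<and> splitting n (FR G n (B (Suc k))) (fsh G n) \<tau> \<and>
    (\<forall>v\<in>carrier (FR G n (B (Suc k))). d k (\<tau> v) = \<sigma> (d k v))"
proof (induction k)
  case 0
  have \<pi>: "\<pi> \<in> ehom \<Lambda> M \<alpha> M \<alpha>" using sp by (simp add: splitting_def)
  have im: "\<pi> (e v) \<in> e ` carrier (FR G n (B 0))" if "v \<in> carrier (FR G n (B 0))" for v
    unfolding surj by (rule ehom_closed[OF \<pi> ehom_closed[OF e that]])
  show ?case
  proof (rule splitting_lift[OF M sp e im])
    fix \<sigma> assume \<sigma>: "splitting n (FR G n (B 0)) (fsh G n) \<sigma>" and c: "\<And>v. v \<in> carrier (FR G n (B 0)) \<Longrightarrow> e (\<sigma> v) = \<pi> (e v)"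
    show ?thesis using splitting_lift_next[OF M sp e \<sigma> c d[of 0, folded One_nat_def] ex0] \<sigma> by auto
  qed
next
  case (Suc k)
  then obtain \<sigma> \<tau> where \<sigma>: "splitting n (FR G n (B k)) (fsh G n) \<sigma>" and \<tau>: "splitting n (FR G n (B (Suc k))) (fsh G n) \<tau>"
    and c: "\<And>v. v \<in> carrier (FR G n (B (Suc k))) \<Longrightarrow> d k (\<tau> v) = \<sigma> (d k v)" by auto
  show ?case using splitting_lift_next[OF gact_FR[OF G.comm_group_axioms] \<sigma> d[of k] \<tau> c d[of "Suc k"] ex] \<tau> by auto
qed

lemma (in exact_seq) vanish_free_rank:
  assumes S: "comm_group S" "fin_gen_group S" and \<iota>: "\<iota> \<in> hom S G" "inj_on \<iota> (carrier S)"
  shows "\<exists>m\<le>free_rank S. vanish (\<iota> ` carrier S) m"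
proof -
  interpret S: comm_group S by (rule S(1))
  interpret i: group_hom S G \<iota> using \<iota>(1) by unfold_locales
  obtain S0 where S0: "finite S0" "S0 \<subseteq> carrier S" "generate S S0 = carrier S" using S(2) by (auto simp: fin_gen_group_def)
  have sub: "\<iota> ` S0 \<subseteq> carrier G" using S0(2) by auto
  have gen: "generate G (\<iota> ` S0) = \<iota> ` carrier S" using i.generate_img[OF S0(2)] S0(3) by simp
  obtain I where I: "I \<subseteq> \<iota> ` S0" "int_independent G I" "vanish (\<iota> ` carrier S) (card I)"
    using vanish_rank[OF finite_imageI[OF S0(1)] sub] unfolding gen by blast
  obtain J where J: "J \<subseteq> S0" "I = \<iota> ` J" using I(1) by (rule subset_imageE)
  have JS: "J \<subseteq> carrier S" using J(1) S0(2) by blast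
  have "int_independent S J" by (rule int_independent_image[OF S(1) G.comm_group_axioms \<iota> JS I(2)[unfolded J(2)]])
  then have "card J \<le> free_rank S" by (rule card_le_free_rank[OF S])
  moreover have "card I = card J" unfolding J(2) by (rule card_image[OF inj_on_subset[OF \<iota>(2) JS]])
  ultimately show ?thesis using I(3) by auto
qed

text \<open>Injectivity of \<open>E\<close> gives \<open>E \<circ> e\<close> the same kernel as
  \<open>e\<close>, so exactness at the old first term is that of the resolution, and at the new
  first term none is demanded. Every old index moves up by one, which is the gain of a
  degree.\<close>

lemma exact_seq_prepend:
  assumes n: "n > 0" and G: "comm_group G"
    and M: "gact G n M \<alpha>" and E: "E \<in> ehom (carrier G) M \<alpha> (FR G n B') (fsh G n)"
    and inj: "\<And>x. x \<in> carrier M \<Longrightarrow> E x = \<one>\<^bsub>FR G n B'\<^esub> \<Longrightarrow> x = \<one>\<^bsub>M\<^esub>"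
    and e: "e \<in> ehom (carrier G) (FR G n (B 0)) (fsh G n) M \<alpha>"
    and d: "\<And>k. d k \<in> ehom (carrier G) (FR G n (B (Suc k))) (fsh G n) (FR G n (B k)) (fsh G n)"
    and ex0: "d 0 ` carrier (FR G n (B 1)) = {x \<in> carrier (FR G n (B 0)). e x = \<one>\<^bsub>M\<^esub>}"
    and ex: "\<And>k. d (Suc k) ` carrier (FR G n (B (Suc (Suc k)))) = {x \<in> carrier (FR G n (B (Suc k))). d k x = \<one>\<^bsub>FR G n (B k)\<^esub>}"
  shows "exact_seq G n (case_nat B' B) (case_nat (\<lambda>x. E (e x)) d)"
proof (intro exact_seq.intro exact_seq_axioms.intro)
  show "comm_group G" by (rule G)
  show "n > 0" by (rule n)
  interpret M: gact G n M \<alpha> by (rule M)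
  have F: "gact G n (FR G n B') (fsh G n)" by (rule gact_FR[OF G])
  interpret F: gact G n "FR G n B'" "fsh G n" by (rule F)
  have E1: "E \<one>\<^bsub>M\<^esub> = \<one>\<^bsub>FR G n B'\<^esub>" by (rule hom_one[OF ehom_hom[OF E] M.A.group_axioms F.A.group_axioms])
  have E_iff: "E (e x) = \<one>\<^bsub>FR G n B'\<^esub> \<longleftrightarrow> e x = \<one>\<^bsub>M\<^esub>" if "x \<in> carrier (FR G n (B 0))" for x
    using inj[OF ehom_closed[OF e that]] E1 by auto
  fix k
  show "case_nat (\<lambda>x. E (e x)) d k \<in> ehom (carrier G) (FR G n (case_nat B' B (Suc k))) (fsh G n) (FR G n (case_nat B' B k)) (fsh G n)"
    by (cases k) (simp_all add: ehom_comp[OF e E] d)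
  show "{x \<in> carrier (FR G n (case_nat B' B (Suc k))). case_nat (\<lambda>x. E (e x)) d k x = \<one>\<^bsub>FR G n (case_nat B' B k)\<^esub>} =
    case_nat (\<lambda>x. E (e x)) d (Suc k) ` carrier (FR G n (case_nat B' B (Suc (Suc k))))"
  proof (cases k)
    case 0
    show ?thesis unfolding 0 nat.case using ex0 E_iff by auto
  next
    case (Suc j)
    show ?thesis unfolding Suc nat.case by (rule ex[symmetric])
  qed
qed

lemma (in stab) ex_quotient:
  defines "M \<equiv> antipode_twist (Zmod n) \<Gamma> (quotient_module P L)"
  shows "\<exists>\<alpha> q. gmodule \<Gamma> n M \<alpha> \<and> q \<in> ehom (carrier \<Gamma>) (amon P) (\<lambda>g. sh (inv\<^bsub>\<Gamma>\<^esub> g)) (amon M) \<alpha> \<and>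
    q ` carrier P = carrier M \<and> (\<forall>p\<in>carrier P. q p = \<one>\<^bsub>amon M\<^esub> \<longleftrightarrow> p \<in> L)"
  unfolding M_def
proof (rule quotient_twist[OF gP gmodule_submodule(1)[OF gP Lsub]])
  let ?M = "antipode_twist (Zmod n) \<Gamma> (quotient_module P L)"
  show "sh g ` L \<subseteq> L" if "g \<in> carrier \<Gamma>" for g by (rule gmodule_submodule(2)[OF gP Lsub that])
  fix \<alpha> assume "gmodule \<Gamma> n ?M \<alpha>" "(\<lambda>p. L +>\<^bsub>P\<^esub> p) \<in> ehom (carrier \<Gamma>) (amon P) (\<lambda>g. sh (inv\<^bsub>\<Gamma>\<^esub> g)) (amon ?M) \<alpha>"
    "(\<lambda>p. L +>\<^bsub>P\<^esub> p) ` carrier P = carrier ?M" and k: "\<And>p. p \<in> carrier P \<Longrightarrow> L +>\<^bsub>P\<^esub> p = \<one>\<^bsub>amon ?M\<^esub> \<longleftrightarrow> p \<in> L"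
  then show "\<exists>\<alpha> q. gmodule \<Gamma> n ?M \<alpha> \<and> q \<in> ehom (carrier \<Gamma>) (amon P) (\<lambda>g. sh (inv\<^bsub>\<Gamma>\<^esub> g)) (amon ?M) \<alpha> \<and>
    q ` carrier P = carrier ?M \<and> (\<forall>p\<in>carrier P. q p = \<one>\<^bsub>amon ?M\<^esub> \<longleftrightarrow> p \<in> L)"
    by (intro exI[where x=\<alpha>] exI[where x="\<lambda>p. L +>\<^bsub>P\<^esub> p"] conjI ballI) (assumption | rule k)+
qed

text \<open>The map of \<open>ex_embedding\<close> has kernel \<open>L\<close>, the same as
  \<open>q\<close>, so it factors through \<open>q\<close> and becomes injective.\<close>

lemma (in stab) ex_quotient_embedding:
  fixes \<kappa> :: "nat \<Rightarrow> 'u"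
  assumes sat: "saturated C" and \<kappa>: "inj \<kappa>" and M: "gact \<Gamma> n M \<alpha>"
    and q: "q \<in> ehom (carrier \<Gamma>) (amon P) (\<lambda>g. sh (inv\<^bsub>\<Gamma>\<^esub> g)) M \<alpha>" and surj: "q ` carrier P = carrier M"
    and ker: "\<forall>p\<in>carrier P. q p = \<one>\<^bsub>M\<^esub> \<longleftrightarrow> p \<in> L"
  shows "\<exists>(B :: 'u set) E. E \<in> ehom (carrier \<Gamma>) M \<alpha> (FR \<Gamma> n B) (fsh \<Gamma> n) \<and>
    (\<forall>x\<in>carrier M. E x = \<one>\<^bsub>FR \<Gamma> n B\<^esub> \<longrightarrow> x = \<one>\<^bsub>M\<^esub>)"
proof -
  interpret M: gact \<Gamma> n M \<alpha> by (rule M)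
  obtain B :: "'u set" and E where E: "E \<in> ehom (carrier \<Gamma>) (amon P) (\<lambda>g. sh (inv\<^bsub>\<Gamma>\<^esub> g)) (FR \<Gamma> n B) (fsh \<Gamma> n)"
    and Ek: "\<forall>p\<in>carrier P. E p = \<one>\<^bsub>FR \<Gamma> n B\<^esub> \<longleftrightarrow> p \<in> L"
    using ex_embedding[OF sat \<kappa>] by (elim exE conjE) (rule that; assumption)
  interpret F: gact \<Gamma> n "FR \<Gamma> n B" "fsh \<Gamma> n" by (rule gact_FR[OF Gam])
  have surj': "q ` carrier (amon P) = carrier M" using surj by simp
  have ker': "E p = \<one>\<^bsub>FR \<Gamma> n B\<^esub>" if "p \<in> carrier (amon P)" "q p = \<one>\<^bsub>M\<^esub>" for p
    using that ker Ek by simp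
  have "\<exists>E'. E' \<in> hom (M\<lparr>carrier := q ` carrier (amon P)\<rparr>) (FR \<Gamma> n B) \<and> (\<forall>p\<in>carrier (amon P). E' (q p) = E p)"
    by (rule hom_factor[OF P.A.comm_group_axioms M.A.comm_group_axioms F.A.comm_group_axioms ehom_hom[OF q] ehom_hom[OF E]])
      (rule ker')
  then obtain E' where E': "E' \<in> hom (M\<lparr>carrier := q ` carrier (amon P)\<rparr>) (FR \<Gamma> n B)"
    and E'q: "\<forall>p\<in>carrier (amon P). E' (q p) = E p"
    by (elim exE conjE)
  have E'h: "E' \<in> hom M (FR \<Gamma> n B)" using E' unfolding surj' by simp
  have ex: "\<exists>p. p \<in> carrier (amon P) \<and> x = q p" if "x \<in> carrier M" for x using that unfolding surj'[symmetric] by blast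
  have eq: "E' (\<alpha> g x) = fsh \<Gamma> n g (E' x)" if g: "g \<in> carrier \<Gamma>" and x: "x \<in> carrier M" for g x
  proof -
    obtain p where p: "p \<in> carrier (amon P)" "x = q p" using ex[OF x] by blast
    have ig: "inv\<^bsub>\<Gamma>\<^esub> g \<in> carrier \<Gamma>" using g by simp
    have "E' (\<alpha> g x) = E' (q (sh (inv\<^bsub>\<Gamma>\<^esub> g) p))" unfolding p(2) ehom_eq[OF q g p(1)] ..
    also have "\<dots> = E (sh (inv\<^bsub>\<Gamma>\<^esub> g) p)" by (rule bspec[OF E'q P.act_closed[OF ig p(1)]])
    also have "\<dots> = fsh \<Gamma> n g (E p)" by (rule ehom_eq[OF E g p(1)])
    also have "E p = E' x" unfolding p(2) by (rule bspec[OF E'q p(1), symmetric])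
    finally show ?thesis .
  qed
  have inj: "x = \<one>\<^bsub>M\<^esub>" if x: "x \<in> carrier M" and "E' x = \<one>\<^bsub>FR \<Gamma> n B\<^esub>" for x
  proof -
    obtain p where p: "p \<in> carrier (amon P)" "x = q p" using ex[OF x] by blast
    have "E p = \<one>\<^bsub>FR \<Gamma> n B\<^esub>" using that(2) bspec[OF E'q p(1)] unfolding p(2) by simp
    then show ?thesis using Ek ker p by simp
  qed
  have "E' \<in> ehom (carrier \<Gamma>) M \<alpha> (FR \<Gamma> n B) (fsh \<Gamma> n)" unfolding ehom_def using E'h eq by blast
  then show ?thesis using inj by (intro exI[where x=B] exI[where x=E']) simp
qed

text \<open>The cut splits the module of the stacked code. The inverse of the code isomorphism
  followed by \<open>q\<close> maps this module onto \<open>M\<close>; its kernel is the stacked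
  submodule, which is stable under the cut, so the splitting descends to \<open>M\<close>.\<close>

lemma splitting_charge:
  fixes C :: "('g, 'p) stab_code" and D :: "('l, 'q) stab_code" and M :: "'m monoid"
  assumes C: "stab C" and D: "stab D" and mod: "modulus D = modulus C"
    and \<iota>: "\<iota> \<in> hom (site_group D) (site_group C)" "inj_on \<iota> (carrier (site_group D))"
    and iso: "stab_isomorphic C (stack \<iota> (site_group C) D)"
    and T: "transversal (site_group C) (\<iota> ` carrier (site_group D)) \<rho>"
    and M: "gact (site_group C) (modulus C) M \<alpha>"
    and q: "q \<in> ehom (carrier (site_group C)) (amon (stab_module C))
      (\<lambda>g. shift (site_group C) (amon (local_module C)) (inv\<^bsub>site_group C\<^esub> g)) M \<alpha>"
    and surj: "q ` carrier (stab_module C) = carrier M"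
    and ker: "\<And>p. p \<in> carrier (stab_module C) \<Longrightarrow> q p = \<one>\<^bsub>M\<^esub> \<longleftrightarrow> p \<in> stabilizers C"
  shows "\<exists>\<pi>. transversal.splitting (site_group C) (\<iota> ` carrier (site_group D)) \<rho> (modulus C) M \<alpha> \<pi>"
proof -
  interpret C: stab C by (rule C)
  interpret D: stab D by (rule D)
  define G where "G = site_group C"
  define n where "n = modulus C"
  define A where "A = amon (local_module D)"
  define Q where "Q = fsg (carrier G) A"
  define P where "P = amon (stab_module C)"
  define N where "N = stack_submodule \<iota> G D (stabilizers D)"
  have Gam: "comm_group G" unfolding G_def by (rule C.Gam)
  interpret stacking "site_group D" G \<iota>
    unfolding stacking_def stacking_axioms_def using Gam D.Gam \<iota> by (simp add: G_def)
  interpret T: transversal G "\<iota> ` carrier (site_group D)" \<rho> unfolding G_def by (rule T)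
  have modD: "Module.module (Zmod n) (local_module D)" using D.modM unfolding mod n_def .
  have cA: "comm_group A" unfolding A_def by (rule D.cM)
  have tA: "x [^]\<^bsub>A\<^esub> int n = \<one>\<^bsub>A\<^esub>" if "x \<in> carrier A" for x
    unfolding A_def by (rule Zmod_smult(2)[OF modD]) (use that in \<open>simp add: A_def\<close>)
  let ?sP = "shift G (amon (local_module C))" and ?sQ = "shift G A"
  have gQ: "gmodule G n (group_module (Zmod n) (local_module D) G) ?sQ"
    unfolding A_def by (rule gmodule_group_module[OF Gam modD])
  have gP: "gmodule G n (stab_module C) ?sP" unfolding G_def n_def by (rule C.gP)
  have aQ: "amon (group_module (Zmod n) (local_module D) G) = Q" unfolding Q_def A_def by (rule amon_group_module)
  have cQ: "carrier (group_module (Zmod n) (local_module D) G) = carrier Q" using aQ by (metis amon_simps(1))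
  have aP: "carrier (stab_module C) = carrier P" by (simp add: P_def)
  have gQ': "gact G n Q ?sQ" using gQ aQ by (simp add: gmodule_def)
  interpret Q: gact G n Q ?sQ by (rule gQ')
  interpret P: gact G n P ?sP using gP by (simp add: gmodule_def P_def)
  have sm: "stab_module (stack \<iota> (site_group C) D) = group_module (Zmod n) (local_module D) G"
    by (simp add: stab_module_def stack_def mod G_def n_def)
  have sr: "stab_ring C = group_ring (Zmod n) G" by (simp add: stab_ring_def G_def n_def)
  have sN: "stabilizers (stack \<iota> (site_group C) D) = N" by (simp add: stack_def N_def G_def)
  obtain \<phi> where \<phi>m: "\<phi> \<in> module_hom (group_ring (Zmod n) G) (stab_module C) (group_module (Zmod n) (local_module D) G)"
    and \<phi>b: "bij_betw \<phi> (carrier P) (carrier Q)" and \<phi>L: "\<phi> ` stabilizers C = N"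
    using iso unfolding stab_isomorphic_def sm sr sN aP cQ by blast
  have \<phi>: "\<phi> \<in> ehom (carrier G) P ?sP Q ?sQ"
    using \<phi>m unfolding module_hom_eq_ehom[OF gP gQ] aQ P_def .
  define \<psi> where "\<psi> = inv_into (carrier P) \<phi>"
  have "\<phi> \<in> iso P Q" using ehom_hom[OF \<phi>] \<phi>b by (simp add: iso_def)
  then have \<psi>iso: "\<psi> \<in> iso Q P" unfolding \<psi>_def by (rule group.iso_set_sym[OF P.A.group_axioms])
  then have \<psi>h: "\<psi> \<in> hom Q P" and \<psi>b: "bij_betw \<psi> (carrier Q) (carrier P)" by (auto simp: iso_def)
  have \<psi>\<phi>: "\<psi> (\<phi> x) = x" if "x \<in> carrier P" for x
    unfolding \<psi>_def by (rule inv_into_f_f[OF bij_betw_imp_inj_on[OF \<phi>b] that])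
  have \<phi>\<psi>: "\<phi> (\<psi> y) = y" if "y \<in> carrier Q" for y
    using f_inv_into_f[of y \<phi> "carrier P"] that unfolding \<psi>_def bij_betw_imp_surj_on[OF \<phi>b] by blast
  have \<psi>e: "\<psi> \<in> ehom (carrier G) Q (\<lambda>g. ?sQ (inv\<^bsub>G\<^esub> g)) P (\<lambda>g. ?sP (inv\<^bsub>G\<^esub> g))"
    unfolding ehom_def
  proof (intro CollectI conjI ballI)
    fix g y assume g: "g \<in> carrier G" and y: "y \<in> carrier Q"
    have ig: "inv\<^bsub>G\<^esub> g \<in> carrier G" using g by simp
    have \<psi>y: "\<psi> y \<in> carrier P" by (rule hom_in_carrier[OF \<psi>h y])
    have "?sQ (inv\<^bsub>G\<^esub> g) y = \<phi> (?sP (inv\<^bsub>G\<^esub> g) (\<psi> y))" unfolding ehom_eq[OF \<phi> ig \<psi>y] \<phi>\<psi>[OF y] ..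
    then show "\<psi> (?sQ (inv\<^bsub>G\<^esub> g) y) = ?sP (inv\<^bsub>G\<^esub> g) (\<psi> y)" using \<psi>\<phi>[OF P.act_closed[OF ig \<psi>y]] by simp
  qed (rule \<psi>h)
  have q': "q \<in> ehom (carrier G) P (\<lambda>g. ?sP (inv\<^bsub>G\<^esub> g)) M \<alpha>" unfolding G_def P_def by (rule q)
  have M': "gact G n M \<alpha>" unfolding G_def n_def by (rule M)
  have r: "(\<lambda>y. q (\<psi> y)) \<in> ehom (carrier G) Q (\<lambda>g. ?sQ (inv\<^bsub>G\<^esub> g)) M \<alpha>" by (rule ehom_comp[OF \<psi>e q'])
  have "(\<lambda>y. q (\<psi> y)) ` carrier Q = q ` (\<psi> ` carrier Q)" by (simp add: image_image)
  also have "\<dots> = carrier M" using surj unfolding aP bij_betw_imp_surj_on[OF \<psi>b] .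
  finally have rs: "(\<lambda>y. q (\<psi> y)) ` carrier Q = carrier M" .
  have LP: "\<psi> y \<in> stabilizers C" if "y \<in> N" for y
  proof -
    obtain x where x: "x \<in> stabilizers C" "y = \<phi> x" using \<open>y \<in> N\<close> \<phi>L by blast
    have "x \<in> carrier P" using subgroup.mem_carrier[OF gmodule_submodule(1)[OF C.gP C.Lsub] x(1)] unfolding P_def .
    then show ?thesis using x \<psi>\<phi> by simp
  qed
  have rker: "q (\<psi> (cut A (\<iota> ` carrier (site_group D)) y)) = \<one>\<^bsub>M\<^esub>" if y: "y \<in> carrier Q" and "q (\<psi> y) = \<one>\<^bsub>M\<^esub>" for y
  proof -
    have "\<psi> y \<in> stabilizers C" using ker[of "\<psi> y"] hom_in_carrier[OF \<psi>h y] that(2) unfolding aP by simp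
    then have "\<phi> (\<psi> y) \<in> \<phi> ` stabilizers C" by (rule imageI)
    then have "y \<in> N" unfolding \<phi>L \<phi>\<psi>[OF y] .
    then have "cut A (\<iota> ` carrier (site_group D)) y \<in> N"
      unfolding N_def A_def by (rule stack_submodule_cut[OF modD _ refl, unfolded n_def, OF mod D.Lsub[folded stab_ring_def]])
    then have L: "\<psi> (cut A (\<iota> ` carrier (site_group D)) y) \<in> stabilizers C" by (rule LP)
    then have "\<psi> (cut A (\<iota> ` carrier (site_group D)) y) \<in> carrier (stab_module C)"
      using subgroup.mem_carrier[OF gmodule_submodule(1)[OF C.gP C.Lsub]] by simp
    then show ?thesis using ker L by simp
  qed
  have "\<exists>\<pi>. T.splitting n M \<alpha> \<pi>"
    by (rule T.splitting_transfer[OF gact_inverse[OF gQ'] M' T.splitting_cut[OF cA, folded Q_def] r rs]) (erule tA, rule rker)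
  then show ?thesis unfolding n_def G_def .
qed

text \<open>The charge module is Ext in degree \<open>i + 1\<close>, so a primitive is sought on the
  term with index \<open>i\<close>; \<open>vanish\<close> provides it as soon as \<open>i\<close> is
  at least the rank. In the saturated case the prolonged sequence has this term at index
  \<open>Suc i\<close>, whence the weaker bound.\<close>

lemma charge_module_trivial:
  fixes C :: "('g, 'p) stab_code" and D :: "('l, 'q) stab_code"
  assumes C: "stabilizer_code C" and D: "stabilizer_code D" and mod: "modulus D = modulus C"
    and \<iota>: "\<iota> \<in> hom (site_group D) (site_group C)" "inj_on \<iota> (carrier (site_group D))"
    and iso: "stab_isomorphic C (stack \<iota> (site_group C) D)"
    and rank: "free_rank (site_group D) \<le> i \<or> saturated C \<and> free_rank (site_group D) \<le> Suc i"
  shows "carrier (charge_module i C) = {\<zero>\<^bsub>charge_module i C\<^esub>}"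
proof -
  interpret C: stab C by unfold_locales (rule C)
  interpret D: stab D by unfold_locales (rule D)
  let ?G = "site_group C" and ?n = "modulus C" and ?\<Lambda> = "\<iota> ` carrier (site_group D)"
  let ?M = "antipode_twist (Zmod ?n) ?G (quotient_module (stab_module C) (stabilizers C))"
  interpret stacking "site_group D" ?G \<iota>
    unfolding stacking_def stacking_axioms_def using C.Gam D.Gam \<iota> by simp
  obtain \<rho> where "transversal ?G ?\<Lambda> \<rho>" using ex_transversal[OF C.Gam image_subgroup] by blast
  then interpret T: transversal ?G ?\<Lambda> \<rho> .
  obtain \<alpha> q where gM: "gmodule ?G ?n ?M \<alpha>"
    and q: "q \<in> ehom (carrier ?G) (amon (stab_module C)) (\<lambda>g. C.sh (inv\<^bsub>?G\<^esub> g)) (amon ?M) \<alpha>"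
    and surj: "q ` carrier (stab_module C) = carrier ?M"
    and ker: "\<forall>p\<in>carrier (stab_module C). q p = \<one>\<^bsub>amon ?M\<^esub> \<longleftrightarrow> p \<in> stabilizers C"
    using C.ex_quotient by (elim exE conjE)
  have gM': "gact ?G ?n (amon ?M) \<alpha>" using gM by (simp add: gmodule_def)
  have surj': "q ` carrier (stab_module C) = carrier (amon ?M)" using surj by simp
  have "\<exists>\<pi>. T.splitting ?n (amon ?M) \<alpha> \<pi>"
    by (rule splitting_charge[OF C.stab_axioms D.stab_axioms mod \<iota> iso T.transversal_axioms gM' q surj' bspec[OF ker]])
  then obtain \<pi> where \<pi>: "T.splitting ?n (amon ?M) \<alpha> \<pi>" by (elim exE)
  have \<Lambda>G: "?\<Lambda> \<subseteq> carrier ?G" by (rule subgroup.subset[OF image_subgroup])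
  show ?thesis
    unfolding charge_module_def stab_ring_def Suc_eq_plus1[symmetric]
  proof (rule Ext_trivial[OF C.Gam gM])
    fix B :: "nat \<Rightarrow> (('g \<Rightarrow> int set) + ('g \<Rightarrow> 'p) set) list set" and d e f
    assume res: "free_resolution (group_ring (Zmod ?n) ?G) ?M (B, d, e)"
      and f: "f \<in> ehom (carrier ?G) (FR ?G ?n (B (Suc i))) (fsh ?G ?n) (RG ?G ?n) (rsh ?G ?n)"
      and fz: "\<And>x. x \<in> carrier (FR ?G ?n (B (Suc (Suc i)))) \<Longrightarrow> f (d (Suc i) x) = \<one>\<^bsub>RG ?G ?n\<^esub>"
    note R = res[unfolded free_resolution_iff[OF C.Gam gM]]
    have e: "e \<in> ehom (carrier ?G) (FR ?G ?n (B 0)) (fsh ?G ?n) (amon ?M) \<alpha>"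
      and es: "e ` carrier (FR ?G ?n (B 0)) = carrier (amon ?M)"
      and ex0: "d 0 ` carrier (FR ?G ?n (B 1)) = {x \<in> carrier (FR ?G ?n (B 0)). e x = \<one>\<^bsub>amon ?M\<^esub>}"
      using R by simp_all
    have d: "d k \<in> ehom (carrier ?G) (FR ?G ?n (B (Suc k))) (fsh ?G ?n) (FR ?G ?n (B k)) (fsh ?G ?n)"
      and ex: "d (Suc k) ` carrier (FR ?G ?n (B (Suc (Suc k)))) = {x \<in> carrier (FR ?G ?n (B (Suc k))). d k x = \<one>\<^bsub>FR ?G ?n (B k)\<^esub>}" for k
      using R by blast+
    note f\<Lambda> = ehom_mono[OF f \<Lambda>G]
    have "\<exists>g. g \<in> ehom ?\<Lambda> (FR ?G ?n (B i)) (fsh ?G ?n) (RG ?G ?n) (rsh ?G ?n) \<and> (\<forall>x\<in>carrier (FR ?G ?n (B (Suc i))). f x = g (d i x))"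
      using rank
    proof (elim disjE conjE)
      assume le: "free_rank (site_group D) \<le> i"
      interpret F: exact_seq ?G ?n B d
        by (intro exact_seq.intro exact_seq_axioms.intro C.Gam C.n_pos d ex[symmetric])
      obtain m where m: "m \<le> free_rank (site_group D)" "F.vanish ?\<Lambda> m"
        using F.vanish_free_rank[OF D.Gam D.fg \<iota>] by blast
      show ?thesis
        by (rule F.vanishD[OF m(2) order.trans[OF m(1) le] f\<Lambda>]) (erule fz, intro exI conjI ballI, assumption+)
    next
      assume sat: "saturated C" and le: "free_rank (site_group D) \<le> Suc i"
      \<comment> \<open>Lists of different lengths suffice as names of basis elements; their entries
        are immaterial.\<close>
      have \<kappa>: "inj (\<lambda>m. replicate m undefined :: (('g \<Rightarrow> int set) + ('g \<Rightarrow> 'p) set) list)"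
        by (rule injI) (metis length_replicate)
      obtain B' :: "(('g \<Rightarrow> int set) + ('g \<Rightarrow> 'p) set) list set" and E
        where E: "E \<in> ehom (carrier ?G) (amon ?M) \<alpha> (FR ?G ?n B') (fsh ?G ?n)"
        and Ek: "\<forall>x\<in>carrier (amon ?M). E x = \<one>\<^bsub>FR ?G ?n B'\<^esub> \<longrightarrow> x = \<one>\<^bsub>amon ?M\<^esub>"
        using C.ex_quotient_embedding[OF sat \<kappa> gM' q surj' ker] by (elim exE conjE)
      interpret F: exact_seq ?G ?n "case_nat B' B" "case_nat (\<lambda>x. E (e x)) d"
        by (rule exact_seq_prepend[OF C.n_pos C.Gam gM' E _ e d ex0 ex]) (use Ek in blast)
      obtain m where m: "m \<le> free_rank (site_group D)" "F.vanish ?\<Lambda> m"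
        using F.vanish_free_rank[OF D.Gam D.fg \<iota>] by blast
      show ?thesis
        by (rule F.vanishD[OF m(2) order.trans[OF m(1) le], unfolded nat.case, OF f\<Lambda>]) (erule fz, intro exI conjI ballI, assumption+)
    qed
    then obtain g where g: "g \<in> ehom ?\<Lambda> (FR ?G ?n (B i)) (fsh ?G ?n) (RG ?G ?n) (rsh ?G ?n)"
      and fg: "\<forall>x\<in>carrier (FR ?G ?n (B (Suc i))). f x = g (d i x)" by (elim exE conjE)
    obtain \<sigma> \<tau> where \<sigma>: "T.splitting ?n (FR ?G ?n (B i)) (fsh ?G ?n) \<sigma>"
      and \<tau>: "T.splitting ?n (FR ?G ?n (B (Suc i))) (fsh ?G ?n) \<tau>"
      and c: "\<forall>v\<in>carrier (FR ?G ?n (B (Suc i))). d i (\<tau> v) = \<sigma> (d i v)"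
      using T.splitting_resolution[OF gM' \<pi> e es d ex0 ex, of i] by (elim exE conjE)
    \<comment> \<open>In both cases the averaging takes place on the original resolution, with
      compatible splittings at the two ends of \<open>d i\<close>.\<close>
    show "\<exists>g\<in>ehom (carrier ?G) (FR ?G ?n (B i)) (fsh ?G ?n) (RG ?G ?n) (rsh ?G ?n). \<forall>x\<in>carrier (FR ?G ?n (B (Suc i))). f x = g (d i x)"
    proof (rule T.equivariant_primitive[OF gact_FR[OF C.Gam] gact_FR[OF C.Gam] gact_RG[OF C.Gam] d \<tau> \<sigma> _ f g])
      show "d i (\<tau> v) = \<sigma> (d i v)" if "v \<in> carrier (FR ?G ?n (B (Suc i)))" for v using c that by blast
      show "f v = g (d i v)" if "v \<in> carrier (FR ?G ?n (B (Suc i)))" for v using fg that by blast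
    qed
  qed
qed

theorem proposition31:
  fixes C :: "('g, 'p) stab_code" and i :: nat
  assumes "stabilizer_code C"
    and "carrier (charge_module i C) \<noteq> {\<zero>\<^bsub>charge_module i C\<^esub>}"
  shows "(\<forall>(D :: ('l, 'q) stab_code) \<iota>.
            stabilizer_code D \<and> modulus D = modulus C \<and>
            \<iota> \<in> hom (site_group D) (site_group C) \<and> inj_on \<iota> (carrier (site_group D)) \<and>
            free_rank (site_group D) < i + 1
            \<longrightarrow> \<not> stab_isomorphic C (stack \<iota> (site_group C) D)) \<and>
         (saturated C \<longrightarrow>
           (\<forall>(D :: ('l, 'q) stab_code) \<iota>.
              stabilizer_code D \<and> modulus D = modulus C \<and>
              \<iota> \<in> hom (site_group D) (site_group C) \<and> inj_on \<iota> (carrier (site_group D)) \<and>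
              free_rank (site_group D) = i + 1
              \<longrightarrow> \<not> stab_isomorphic C (stack \<iota> (site_group C) D)))"
proof (intro conjI impI allI; elim conjE; rule notI)
  fix D :: "('l, 'q) stab_code" and \<iota>
  assume D: "stabilizer_code D" "modulus D = modulus C" "\<iota> \<in> hom (site_group D) (site_group C)"
    "inj_on \<iota> (carrier (site_group D))" and iso: "stab_isomorphic C (stack \<iota> (site_group C) D)"
  note trivial = charge_module_trivial[OF assms(1) D iso, of i]
  {
    assume "free_rank (site_group D) < i + 1"
    then show False using trivial assms(2) by simp
  next
    assume "saturated C" "free_rank (site_group D) = i + 1"
    then show False using trivial assms(2) by simp
  }
qed

end
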